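(* Let $\{(X_i,Y_i,Z_i)\}_{i\ge 1}$ be an i.i.d. sequence of $\mathbb{R}^{3d}$-valued random variables on a sublinear expectation space $(\Omega,\mathcal{H},\hat{\mathbb{E}})$ satisfying assumptions (A1)-(A3) of the context, and let $\phi\in C_{b,\mathrm{Lip}}(\mathbb{R}^{3d})$. Let $u$ be the viscosity solution of the PIDE (P) of the context with initial datum $\phi$, and for $h\in(0,1)$ let $u_h$ be the function defined by the recursive scheme in the context. Let $E_1,E_2:\mathbb{R}_+^5\to\mathbb{R}_+$ be the error functions of the scheme, i.e. functions for which properties (C2) and (C3) of the context hold. Then, for all sufficiently small $h>0$: (i) (Lower bound) $$u-u_h\le 4C_0h^{1/2}+\inf_{\varepsilon>0}\Big(8C_0\varepsilon+E_1(\varepsilon,h,\|\phi\|_\infty,C_0,K_\rho)\Big)\quad\text{in }[0,1]\times\mathbb{R}^{3d};$$ (ii) (Upper bound) $$u_h-u\le 2C_0h^{1/2}+\inf_{\varepsilon>0}\Big(8C_0\varepsilon+E_2(\varepsilon,h,\|\phi\|_\infty,C_0,K_\rho)\Big)\quad\text{in }[0,1]\times\mathbb{R}^{3d}.$$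
   Context: Notation. $|\cdot|$ is the Euclidean norm (for matrices $|A|^2=\mathrm{tr}[AA^{\intercal}]$), $\langle\cdot,\cdot\rangle$ the Euclidean inner product, $a\vee b=\max(a,b)$, $\mathbb{S}(d)$ the symmetric $d\times d$ matrices, $\mathbb{S}_+(d)$ the positive semidefinite ones. $C_{b,\mathrm{Lip}}$ denotes bounded Lipschitz functions, $C_b$ bounded continuous functions, $C_b^k$ functions with uniformly bounded derivatives up to order $k$. Sublinear expectations. $\mathcal{H}$ is a linear space of real random variables on $\Omega$, stable under composition of finitely many of its elements with a Lipschitz function. $\hat{\mathbb{E}}:\mathcal{H}\to\mathbb{R}$ is a sublinear expectation: monotone, $\hat{\mathbb{E}}[c]=c$ for constants, sub-additive, and positively homogeneous. Random variables to which $\hat{\mathbb{E}}$ is applied are understood to lie in $\mathcal{H}$; for vectors $\hat{\mathbb{E}}$ acts componentwise. $X\overset{d}{=}X'$ (possibly on different spaces) means that the sublinear expectations of $\varphi(X)$ and $\varphi(X')$ agree for all $\varphi\in C_{b,\mathrm{Lip}}$. $Y$ is independent from $X$ if $\hat{\mathbb{E}}[\varphi(X,Y)]=\hat{\mathbb{E}}\big[\hat{\mathbb{E}}[\varphi(x,Y)]_{x=X}\big]$ for all $\varphi\in C_{b,\mathrm{Lip}}$. A sequence $\{\chi_i\}$ is i.i.d. if $\chi_{i+1}\overset{d}{=}\chi_i$ and $\chi_{i+1}$ is independent from $(\chi_1,\dots,\chi_i)$ for all $i$. Uncertainty set and PIDE. Fix $\alpha\in(1,2)$ and $0<\underline\Lambda<\overline\Lambda$.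 For a finite measure $\mu$ on the unit sphere $S\subset\mathbb{R}^d$ let $F_\mu(B)=\int_S\mu(dx)\int_0^\infty \mathbf 1_B(rx)\frac{dr}{r^{1+\alpha}}$. Let $\mathcal{L}_0=\{F_\mu:\mu(S)\in(\underline\Lambda,\overline\Lambda)\}$ and let $\mathcal{L}\subset\mathcal{L}_0$ be non-empty, compact and convex (compact for weak convergence of the spectral measures $\mu$). Let $\Theta\subset\mathcal{L}\times\mathbb{R}^d\times\mathbb{S}_+(d)$ be the (non-empty) uncertainty set, with $\sup_{(F_\mu,q,Q)\in\Theta}\{\int|z|\wedge|z|^2F_\mu(dz)+|q|+|Q|\}<\infty$; it need not be a Cartesian product. Put $\delta_\lambda\varphi(z)=\varphi(z+\lambda)-\varphi(z)-\langle D\varphi(z),\lambda\rangle$ and $$G(p,A,\varphi(\cdot))=\sup_{(F_\mu,q,Q)\in\Theta}\Big\{\int_{\mathbb{R}^d}\delta_\lambda\varphi(0)F_\mu(d\lambda)+\langle p,q\rangle+\tfrac12\mathrm{tr}[AQ]\Big\}.$$ The PIDE (P) is $$\partial_tu-G\big(D_yu(t,x,y,z),D_x^2u(t,x,y,z),u(t,x,y,z+\cdot)\big)=0\ \text{on }(0,1]\times\mathbb{R}^{3d},\qquad u(0,\cdot)=\phi .$$ A bounded upper (resp. lower) semicontinuous $u$ is a viscosity subsolution (resp. supersolution) if $u(0,\cdot)\le\phi$ (resp. $\ge\phi$) and for each $(t,x,y,z)\in(0,1]\times\mathbb{R}^{3d}$ and each $\psi\in C_b^{2,3}((0,1]\times\mathbb{R}^{3d})$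 (bounded derivatives up to order 2 in $t$ and 3 in space) with $\psi\ge u$ (resp. $\psi\le u$) and equality at $(t,x,y,z)$, one has $\partial_t\psi-G(D_y\psi,D_x^2\psi,\psi(t,x,y,z+\cdot))\le0$ (resp. $\ge0$) at that point. A bounded continuous function is a viscosity solution if it is both. Under the assumptions below it is known that (P) has a unique viscosity solution $u$, that $\|u\|_\infty\le\|\phi\|_\infty$, and that $|u(t,x,y,z)-u(t',x',y',z')|\le C_0(|t-t'|^{1/2}+|x-x'|+|y-y'|+|z-z'|)$, with $C_0$ as below. Assumptions. Write $M_\xi^p=\hat{\mathbb{E}}[|\xi|^p]$ and $S_n^3=\sum_{i=1}^nZ_i$. (A1) $\hat{\mathbb{E}}[X_1]=\hat{\mathbb{E}}[-X_1]=0$, $M_{X_1}^3<\infty$, $M_{Y_1}^2<\infty$. (A2) $\hat{\mathbb{E}}[Z_1]=\hat{\mathbb{E}}[-Z_1]=0$, $M_*:=\sup_{n\ge1}\hat{\mathbb{E}}[n^{-1/\alpha}|S_n^3|]<\infty$, and $M_{Z_1}^\delta<\infty$ for some $\delta\in(\frac34\alpha\vee1,\alpha)$. (A3) For each $(p,A)\in\mathbb{R}^d\times\mathbb{S}(d)$ and $\varphi\in C_b^3(\mathbb{R}^d)$, $$\frac1s\Big|\hat{\mathbb{E}}\Big[\varphi(z+s^{1/\alpha}Z_1)-\varphi(z)+\langle p,sY_1\rangle+\tfrac12\langle As^{1/2}X_1,s^{1/2}X_1\rangle\Big]-sG(p,A,\varphi(z+\cdot))\Big|\le\hat l(s,L_0),$$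 where $\hat l$ is a function of $s\in[0,1]$ and $L_0:=|p|+|A|+\|\varphi\|_\infty+\sum_{i=1}^3\|D^i\varphi\|_\infty$ such that, for each constant $C>0$, $\hat l(s,L_0)\to0$ as $s\to0$, uniformly in $z\in\mathbb{R}^d$ and $L_0\le C$. Scheme. With $(X,Y,Z)\overset{d}{=}(X_1,Y_1,Z_1)$ on $(\Omega,\mathcal{H},\hat{\mathbb{E}})$ and $h\in(0,1)$, define $u_h:[0,1]\times\mathbb{R}^{3d}\to\mathbb{R}$ by $u_h(t,x,y,z)=\phi(x,y,z)$ for $t\in[0,h)$ and $u_h(t,x,y,z)=\hat{\mathbb{E}}[u_h(t-h,x+h^{1/2}X,y+hY,z+h^{1/\alpha}Z)]$ for $t\in[h,1]$. Set $$S(h,x,y,z,p,v)=\frac1h\Big(p-\hat{\mathbb{E}}[v(x+h^{1/2}X,y+hY,z+h^{1/\alpha}Z)]\Big).$$ Let $C_\phi$ be the Lipschitz constant of $\phi$ (i.e. $|\phi(x,y,z)-\phi(x',y',z')|\le C_\phi(|x-x'|+|y-y'|+|z-z'|)$) and $C_0:=C_\phi\big((M_{X_1}^2)^{1/2}+M_{Y_1}^1+M_*\big)\vee C_\phi$. Mollification. Fix a nonnegative $\rho\in C_c^\infty(\mathbb{R}\times\mathbb{R}^{3d})$ with unit integral and support in $[-1,0]\times B_1$; $\rho_\varepsilon(\tau,e)=\varepsilon^{-(2+3d)}\rho(\tau/\varepsilon^2,e/\varepsilon)$. A function $v$ on $[0,1]\times\mathbb{R}^{3d}$ is extended by $v(t,\chi)=v(1,\chi)$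 for $t\in[1,1+\varepsilon^2]$, and $(v*\rho_\varepsilon)(t,\chi)=\int_{-\varepsilon^2}^0\int_{|e|<\varepsilon}v(t-\tau,\chi-e)\rho_\varepsilon(\tau,e)\,de\,d\tau$. Put $K_\rho=\max_{i+j\le3}\max_{|\gamma|=j}\int_{-1}^0\int_{|e|<1}|\partial_t^iD^\gamma\rho(\tau,e)|\,de\,d\tau$. Let $u^\varepsilon=u*\rho_\varepsilon$ and $u_h^\varepsilon=u_h*\rho_\varepsilon$. Error functions. $E_1,E_2:\mathbb{R}_+^5\to\mathbb{R}_+$ are functions such that for all $\varepsilon\in(0,1)$, $h\in(0,1)$, $(t,x,y,z)\in[h,1]\times\mathbb{R}^{3d}$: (C2) $S(h,x,y,z,u_h^\varepsilon(t,x,y,z),u_h^\varepsilon(t-h,\cdot))\le\partial_tu_h^\varepsilon-G(D_yu_h^\varepsilon,D_x^2u_h^\varepsilon,u_h^\varepsilon(t,x,y,z+\cdot))+E_1(\varepsilon,h,\|\phi\|_\infty,C_0,K_\rho)$; (C3) $S(h,x,y,z,u^\varepsilon(t,x,y,z),u^\varepsilon(t-h,\cdot))\ge\partial_tu^\varepsilon-G(D_yu^\varepsilon,D_x^2u^\varepsilon,u^\varepsilon(t,x,y,z+\cdot))-E_2(\varepsilon,h,\|\phi\|_\infty,C_0,K_\rho)$. *)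

theory Defs
  imports "HOL-Analysis.Analysis"
begin

section \<open>Sublinear expectations\<close>

text \<open>
  Random variables on a sublinear expectation space are functions on the type \<^typ>\<open>'w\<close>.
  The expectation is a total function, but its values matter only on \<open>H\<close>; hence
  ``the moment of order \<open>p\<close> is finite'' means that the corresponding power belongs to \<open>H\<close>.

  A function of \<open>n\<close> variables is represented by a function on sequences. The Lipschitz condition
  below involves the variables in \<open>I\<close> only, so it forces the function to depend on
  these variables alone.
\<close>

definition family_lipschitz ::
    "'i set \<Rightarrow> (('i \<Rightarrow> 'a::real_normed_vector) \<Rightarrow> real) \<Rightarrow> bool" where
  "family_lipschitz I f \<longleftrightarrow>
     (\<exists>C. \<forall>a b. \<bar>f a - f b\<bar> \<le> C * L2_set (\<lambda>i. norm (a i - b i)) I)"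

locale sublinear_expectation =
  fixes H :: "('w \<Rightarrow> real) set" and E :: "('w \<Rightarrow> real) \<Rightarrow> real"
  assumes zero_in: "(\<lambda>\<omega>. 0) \<in> H"
    and add_in: "\<xi> \<in> H \<Longrightarrow> \<eta> \<in> H \<Longrightarrow> (\<lambda>\<omega>. \<xi> \<omega> + \<eta> \<omega>) \<in> H"
    and scale_in: "\<xi> \<in> H \<Longrightarrow> (\<lambda>\<omega>. c * \<xi> \<omega>) \<in> H"
    and lipschitz_in:
      "(\<And>i. i < (n::nat) \<Longrightarrow> \<Xi> i \<in> H) \<Longrightarrow> family_lipschitz {..<n} f
        \<Longrightarrow> (\<lambda>\<omega>. f (\<lambda>i. \<Xi> i \<omega>)) \<in> H"
    and mono: "\<xi> \<in> H \<Longrightarrow> \<eta> \<in> H \<Longrightarrow> (\<And>\<omega>. \<xi> \<omega> \<le> \<eta> \<omega>) \<Longrightarrow> E \<xi> \<le> E \<eta>"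
    and const: "E (\<lambda>\<omega>. c) = c"
    and subadd: "\<xi> \<in> H \<Longrightarrow> \<eta> \<in> H \<Longrightarrow> E (\<lambda>\<omega>. \<xi> \<omega> + \<eta> \<omega>) \<le> E \<xi> + E \<eta>"
    and pos_hom: "\<xi> \<in> H \<Longrightarrow> 0 \<le> c \<Longrightarrow> E (\<lambda>\<omega>. c * \<xi> \<omega>) = c * E \<xi>"

definition random_vector :: "('w \<Rightarrow> real) set \<Rightarrow> ('w \<Rightarrow> 'a::euclidean_space) \<Rightarrow> bool" where
  "random_vector H \<xi> \<longleftrightarrow> (\<forall>b\<in>Basis. (\<lambda>\<omega>. \<xi> \<omega> \<bullet> b) \<in> H)"

definition Cb_Lip :: "('a::metric_space \<Rightarrow> real) set" where
  "Cb_Lip = {f. bounded (range f) \<and> (\<exists>C. C-lipschitz_on UNIV f)}"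

definition eq_distr ::
    "(('w \<Rightarrow> real) \<Rightarrow> real) \<Rightarrow> ('w \<Rightarrow> 'a::metric_space) \<Rightarrow>
     (('v \<Rightarrow> real) \<Rightarrow> real) \<Rightarrow> ('v \<Rightarrow> 'a) \<Rightarrow> bool" where
  "eq_distr E \<xi> E' \<xi>' \<longleftrightarrow> (\<forall>f\<in>Cb_Lip. E (\<lambda>\<omega>. f (\<xi> \<omega>)) = E' (\<lambda>\<omega>. f (\<xi>' \<omega>)))"

text \<open>
  \<open>\<eta>\<close> is independent from the vector \<open>(\<Xi> i)\<close>, \<open>i \<in> I\<close>. The test function takes the family
  as its first argument; it is bounded and jointly Lipschitz.
\<close>

definition indep_from ::
    "(('w \<Rightarrow> real) \<Rightarrow> real) \<Rightarrow> ('w \<Rightarrow> 'b::real_normed_vector) \<Rightarrow>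
     'i set \<Rightarrow> ('i \<Rightarrow> 'w \<Rightarrow> 'a::real_normed_vector) \<Rightarrow> bool" where
  "indep_from E \<eta> I \<Xi> \<longleftrightarrow>
     (\<forall>f. (\<exists>B. \<forall>a y. \<bar>f a y\<bar> \<le> B) \<and>
          (\<exists>C. \<forall>a a' y y'. \<bar>f a y - f a' y'\<bar> \<le>
             C * (L2_set (\<lambda>i. norm (a i - a' i)) I + norm (y - y'))) \<longrightarrow>
        E (\<lambda>\<omega>. f (\<lambda>i. \<Xi> i \<omega>) (\<eta> \<omega>)) =
        E (\<lambda>\<omega>. E (\<lambda>\<omega>'. f (\<lambda>i. \<Xi> i \<omega>) (\<eta> \<omega>'))))"

text \<open>Sequences are indexed by \<open>i \<ge> 1\<close>; the entry at 0 is irrelevant.\<close>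

definition iid ::
    "('w \<Rightarrow> real) set \<Rightarrow> (('w \<Rightarrow> real) \<Rightarrow> real) \<Rightarrow> (nat \<Rightarrow> 'w \<Rightarrow> 'a::euclidean_space) \<Rightarrow> bool" where
  "iid H E \<Xi> \<longleftrightarrow>
     (\<forall>i\<ge>1. random_vector H (\<Xi> i)) \<and>
     (\<forall>i\<ge>1. eq_distr E (\<Xi> (i + 1)) E (\<Xi> i) \<and> indep_from E (\<Xi> (i + 1)) {1..i} \<Xi>)"

definition moment :: "(('w \<Rightarrow> real) \<Rightarrow> real) \<Rightarrow> ('w \<Rightarrow> 'a::real_normed_vector) \<Rightarrow> real \<Rightarrow> real" where
  "moment E \<xi> p = E (\<lambda>\<omega>. norm (\<xi> \<omega>) powr p)"

definition has_moment :: "('w \<Rightarrow> real) set \<Rightarrow> ('w \<Rightarrow> 'a::real_normed_vector) \<Rightarrow> real \<Rightarrow> bool" where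
  "has_moment H \<xi> p \<longleftrightarrow> (\<lambda>\<omega>. norm (\<xi> \<omega>) powr p) \<in> H"

definition mean_zero :: "(('w \<Rightarrow> real) \<Rightarrow> real) \<Rightarrow> ('w \<Rightarrow> real^'n) \<Rightarrow> bool" where
  "mean_zero E \<xi> \<longleftrightarrow> (\<forall>j. E (\<lambda>\<omega>. \<xi> \<omega> $ j) = 0 \<and> E (\<lambda>\<omega>. - (\<xi> \<omega> $ j)) = 0)"


section \<open>Spaces of differentiable functions\<close>

text \<open>
  Partial derivatives are taken within the domain \<open>S\<close>, so that on \<open>(0,1] \<times> \<real>\<^sup>3\<^sup>d\<close>
  the time derivative at \<open>t = 1\<close> is one-sided. The list \<open>vs\<close> of coordinate directions plays the
  role of a multi-index.
\<close>

definition partial_deriv ::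
    "'a::euclidean_space set \<Rightarrow> 'a \<Rightarrow> ('a \<Rightarrow> real) \<Rightarrow> 'a \<Rightarrow> real" where
  "partial_deriv S v f p =
     vector_derivative (\<lambda>s. f (p + s *\<^sub>R v)) (at 0 within {s. p + s *\<^sub>R v \<in> S})"

fun iter_partial ::
    "'a::euclidean_space set \<Rightarrow> 'a list \<Rightarrow> ('a \<Rightarrow> real) \<Rightarrow> 'a \<Rightarrow> real" where
  "iter_partial S [] f = f"
| "iter_partial S (v # vs) f = partial_deriv S v (iter_partial S vs f)"

text \<open>
  The derivatives indexed by \<open>A\<close>, a set of multi-indices closed under taking suffixes, exist and
  are continuous.
\<close>

definition cont_diff ::
    "'a::euclidean_space set \<Rightarrow> 'a list set \<Rightarrow> ('a \<Rightarrow> real) \<Rightarrow> bool" where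
  "cont_diff S A f \<longleftrightarrow>
     (\<forall>vs\<in>A. continuous_on S (iter_partial S vs f)) \<and>
     (\<forall>v vs. v # vs \<in> A \<longrightarrow> (\<forall>p\<in>S.
        (\<lambda>s. iter_partial S vs f (p + s *\<^sub>R v)) differentiable
          (at 0 within {s. p + s *\<^sub>R v \<in> S})))"

definition Cb_diff ::
    "'a::euclidean_space set \<Rightarrow> 'a list set \<Rightarrow> ('a \<Rightarrow> real) set" where
  "Cb_diff S A = {f. cont_diff S A f \<and> (\<forall>vs\<in>A. bounded (iter_partial S vs f ` S))}"

definition Cb :: "nat \<Rightarrow> ('a::euclidean_space \<Rightarrow> real) set" where
  "Cb k = Cb_diff UNIV {vs. set vs \<subseteq> Basis \<and> length vs \<le> k}"

definition sup_norm :: "('a \<Rightarrow> real) \<Rightarrow> real" where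
  "sup_norm f = (SUP x. \<bar>f x\<bar>)"

text \<open>The Euclidean norm of the tensor of all partial derivatives of order \<open>k\<close>.\<close>

definition deriv_norm :: "nat \<Rightarrow> ('a::euclidean_space \<Rightarrow> real) \<Rightarrow> 'a \<Rightarrow> real" where
  "deriv_norm k f x =
     L2_set (\<lambda>vs. iter_partial UNIV vs f x) {vs. set vs \<subseteq> Basis \<and> length vs = k}"

definition gradient :: "(real^'n \<Rightarrow> real) \<Rightarrow> real^'n \<Rightarrow> real^'n" where
  "gradient f z = (\<chi> i. partial_deriv UNIV (axis i 1) f z)"


section \<open>The uncertainty set\<close>

definition spectral_measures :: "(real^'n) measure set" where
  "spectral_measures =
     {\<mu>. sets \<mu> = sets (restrict_space borel (sphere 0 1)) \<and> finite_measure \<mu>}"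

definition levy_measure :: "real \<Rightarrow> (real^'n) measure \<Rightarrow> (real^'n) measure" where
  "levy_measure \<alpha> \<mu> = measure_of UNIV (sets borel)
     (\<lambda>B. \<integral>\<^sup>+x. (\<integral>\<^sup>+r\<in>{0<..}. indicator B (r *\<^sub>R x) * ennreal (1 / r powr (1 + \<alpha>)) \<partial>lborel) \<partial>\<mu>)"

lemma emeasure_levy_measure:
  fixes \<mu> :: "(real^'n) measure"
  assumes \<mu>: "\<mu> \<in> spectral_measures" and B: "B \<in> sets borel"
  shows "emeasure (levy_measure \<alpha> \<mu>) B =
    (\<integral>\<^sup>+x. (\<integral>\<^sup>+r\<in>{0<..}. indicator B (r *\<^sub>R x) * ennreal (1 / r powr (1 + \<alpha>)) \<partial>lborel) \<partial>\<mu>)"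
proof -
  have [measurable_cong]: "sets \<mu> = sets (restrict_space borel (sphere 0 1))"
    using \<mu> by (simp add: spectral_measures_def)
  have id [measurable]: "(\<lambda>x. x) \<in> borel_measurable \<mu>"
    using measurable_restrict_space1[OF measurable_ident, of borel "sphere 0 1"]
    by (simp add: measurable_cong_sets[OF \<open>sets \<mu> = _\<close> refl] id_def)
  have meas [measurable]: "(\<lambda>(x, r). indicator B (r *\<^sub>R x) * ennreal (1 / r powr (1 + \<alpha>)) *
      indicator {0<..} r) \<in> borel_measurable (\<mu> \<Otimes>\<^sub>M lborel)" if "B \<in> sets borel" for B
    using that by measurable
  show ?thesis
    unfolding levy_measure_def
  proof (rule emeasure_measure_of_sigma[OF _ _ _ B])
    show "sigma_algebra UNIV (sets (borel :: (real^'n) measure))"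
      by (metis sets.sigma_algebra_axioms space_borel)
    show "positive (sets borel) (\<lambda>B. \<integral>\<^sup>+x. (\<integral>\<^sup>+r\<in>{0<..}. indicator B (r *\<^sub>R x) *
        ennreal (1 / r powr (1 + \<alpha>)) \<partial>lborel) \<partial>\<mu>)"
      by (simp add: positive_def)
    show "countably_additive (sets borel) (\<lambda>B. \<integral>\<^sup>+x. (\<integral>\<^sup>+r\<in>{0<..}. indicator B (r *\<^sub>R x) *
        ennreal (1 / r powr (1 + \<alpha>)) \<partial>lborel) \<partial>\<mu>)"
    proof (rule countably_additiveI)
      fix A :: "nat \<Rightarrow> (real^'n) set"
      assume A: "range A \<subseteq> sets borel" "disjoint_family A"
      have [measurable]: "A i \<in> sets borel" for i
        using A by auto
      have m1: "(\<lambda>r. indicator (A i) (r *\<^sub>R x) * ennreal (1 / r powr (1 + \<alpha>)) *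
          indicator {0<..} r) \<in> borel_measurable lborel" for i x
        by measurable
      have m2: "(\<lambda>x. \<integral>\<^sup>+r\<in>{0<..}. indicator (A i) (r *\<^sub>R x) *
          ennreal (1 / r powr (1 + \<alpha>)) \<partial>lborel) \<in> borel_measurable \<mu>" for i
        using lborel.borel_measurable_nn_integral[OF meas[of "A i"]] by simp
      have "(\<integral>\<^sup>+r\<in>{0<..}. indicator (\<Union> (range A)) (r *\<^sub>R x) * ennreal (1 / r powr (1 + \<alpha>)) \<partial>lborel)
          = (\<Sum>i. \<integral>\<^sup>+r\<in>{0<..}. indicator (A i) (r *\<^sub>R x) * ennreal (1 / r powr (1 + \<alpha>)) \<partial>lborel)"
        for x
        by (subst nn_integral_suminf[symmetric, OF m1])
           (simp add: suminf_indicator[OF A(2), symmetric] ennreal_suminf_multc)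
      then show "(\<Sum>i. \<integral>\<^sup>+x. (\<integral>\<^sup>+r\<in>{0<..}. indicator (A i) (r *\<^sub>R x) *
            ennreal (1 / r powr (1 + \<alpha>)) \<partial>lborel) \<partial>\<mu>) =
          (\<integral>\<^sup>+x. (\<integral>\<^sup>+r\<in>{0<..}. indicator (\<Union> (range A)) (r *\<^sub>R x) *
            ennreal (1 / r powr (1 + \<alpha>)) \<partial>lborel) \<partial>\<mu>)"
        by (simp add: nn_integral_suminf[OF m2])
    qed
  qed
qed

definition levy_family :: "real \<Rightarrow> real \<Rightarrow> real \<Rightarrow> (real^'n) measure set" where
  "levy_family \<alpha> \<Lambda>1 \<Lambda>2 =
     {levy_measure \<alpha> \<mu> | \<mu>. \<mu> \<in> spectral_measures \<and>
        \<Lambda>1 < measure \<mu> (sphere 0 1) \<and> measure \<mu> (sphere 0 1) < \<Lambda>2}"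

text \<open>The coarsest topology for which all integrals of continuous functions are continuous.\<close>

definition weak_topology :: "(real^'n) measure topology" where
  "weak_topology =
     (let C = {f :: real^'n \<Rightarrow> real. continuous_on (sphere 0 1) f}
      in pullback_topology spectral_measures (\<lambda>\<mu>. \<lambda>f\<in>C. \<integral>x. f x \<partial>\<mu>)
           (product_topology (\<lambda>_. euclideanreal) C))"

definition convex_measures :: "'a measure set \<Rightarrow> bool" where
  "convex_measures L \<longleftrightarrow>
     (\<forall>F1\<in>L. \<forall>F2\<in>L. \<forall>c\<in>{0..1}. \<exists>F\<in>L. \<forall>B\<in>sets F.
        emeasure F B = ennreal c * emeasure F1 B + ennreal (1 - c) * emeasure F2 B)"

definition admissible_levy_set :: "real \<Rightarrow> real \<Rightarrow> real \<Rightarrow> (real^'n) measure set \<Rightarrow> bool" where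
  "admissible_levy_set \<alpha> \<Lambda>1 \<Lambda>2 L \<longleftrightarrow>
     L \<noteq> {} \<and> L \<subseteq> levy_family \<alpha> \<Lambda>1 \<Lambda>2 \<and> convex_measures L \<and>
     compactin weak_topology {\<mu> \<in> spectral_measures. levy_measure \<alpha> \<mu> \<in> L}"

definition psd :: "(real^'n^'n) set" where
  "psd = {Q. transpose Q = Q \<and> (\<forall>x. 0 \<le> x \<bullet> (Q *v x))}"

type_synonym 'n levy_triplet = "(real^'n) measure \<times> (real^'n) \<times> (real^'n^'n)"

definition uncertainty_set :: "(real^'n) measure set \<Rightarrow> 'n::finite levy_triplet set \<Rightarrow> bool" where
  "uncertainty_set L \<Theta> \<longleftrightarrow>
     \<Theta> \<noteq> {} \<and> \<Theta> \<subseteq> L \<times> UNIV \<times> psd \<and>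
     (SUP (F, q, Q)\<in>\<Theta>. (\<integral>\<^sup>+z. ennreal (min (norm z) ((norm z)\<^sup>2)) \<partial>F)
        + ennreal (norm q) + ennreal (norm Q)) < \<infinity>"


section \<open>The integro-differential equation\<close>

definition increment :: "(real^'n \<Rightarrow> real) \<Rightarrow> real^'n \<Rightarrow> real^'n \<Rightarrow> real" where
  "increment f z l = f (z + l) - f z - gradient f z \<bullet> l"

definition G ::
    "'n::finite levy_triplet set \<Rightarrow> real^'n \<Rightarrow> real^'n^'n \<Rightarrow> (real^'n \<Rightarrow> real) \<Rightarrow> real" where
  "G \<Theta> p A f =
     (SUP (F, q, Q)\<in>\<Theta>. (\<integral>l. increment f 0 l \<partial>F) + p \<bullet> q + 1 / 2 * trace (A ** Q))"

type_synonym 'n space = "(real^'n) \<times> (real^'n) \<times> (real^'n)"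

definition cyl :: "(real \<times> 'n::finite space) set" where
  "cyl = {0<..1} \<times> UNIV"

definition dt :: "real \<times> 'n::finite space" where "dt = (1, 0, 0, 0)"
definition dx :: "'n \<Rightarrow> real \<times> 'n::finite space" where "dx i = (0, axis i 1, 0, 0)"
definition dy :: "'n \<Rightarrow> real \<times> 'n::finite space" where "dy i = (0, 0, axis i 1, 0)"

text \<open>The left-hand side of the equation, i.e. the time derivative minus \<open>G\<close>.\<close>

fun pide_op :: "'n::finite levy_triplet set \<Rightarrow> (real \<times> 'n space \<Rightarrow> real) \<Rightarrow>
    real \<times> 'n space \<Rightarrow> real" where
  "pide_op \<Theta> w (t, x, y, z) =
     partial_deriv cyl dt w (t, x, y, z) -
     G \<Theta> (\<chi> i. partial_deriv cyl (dy i) w (t, x, y, z))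
          (\<chi> i j. iter_partial cyl [dx i, dx j] w (t, x, y, z))
          (\<lambda>l. w (t, x, y, z + l))"

text \<open>
  Test functions: all derivatives, including the mixed ones, of order at most 2 in time and at
  most 3 in space are continuous and bounded.
\<close>

definition Cb23 :: "(real \<times> 'n::finite space \<Rightarrow> real) set" where
  "Cb23 = Cb_diff cyl {vs. set vs \<subseteq> Basis \<and>
     length (filter (\<lambda>v. v = dt) vs) \<le> 2 \<and> length (filter (\<lambda>v. v \<noteq> dt) vs) \<le> 3}"

definition usc_on :: "'a::topological_space set \<Rightarrow> ('a \<Rightarrow> real) \<Rightarrow> bool" where
  "usc_on S f \<longleftrightarrow> (\<forall>p\<in>S. \<forall>c. f p < c \<longrightarrow> (\<forall>\<^sub>F q in at p within S. f q < c))"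

definition viscosity_subsolution ::
    "'n::finite levy_triplet set \<Rightarrow> ('n space \<Rightarrow> real) \<Rightarrow> (real \<times> 'n space \<Rightarrow> real) \<Rightarrow> bool" where
  "viscosity_subsolution \<Theta> \<phi> u \<longleftrightarrow>
     bounded (u ` ({0..1} \<times> UNIV)) \<and> usc_on ({0..1} \<times> UNIV) u \<and>
     (\<forall>e. u (0, e) \<le> \<phi> e) \<and>
     (\<forall>p\<in>cyl. \<forall>\<psi>\<in>Cb23. (\<forall>q\<in>cyl. u q \<le> \<psi> q) \<and> \<psi> p = u p \<longrightarrow> pide_op \<Theta> \<psi> p \<le> 0)"

definition viscosity_supersolution ::
    "'n::finite levy_triplet set \<Rightarrow> ('n space \<Rightarrow> real) \<Rightarrow> (real \<times> 'n space \<Rightarrow> real) \<Rightarrow> bool" where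
  "viscosity_supersolution \<Theta> \<phi> u \<longleftrightarrow>
     bounded (u ` ({0..1} \<times> UNIV)) \<and> usc_on ({0..1} \<times> UNIV) (\<lambda>p. - u p) \<and>
     (\<forall>e. \<phi> e \<le> u (0, e)) \<and>
     (\<forall>p\<in>cyl. \<forall>\<psi>\<in>Cb23. (\<forall>q\<in>cyl. \<psi> q \<le> u q) \<and> \<psi> p = u p \<longrightarrow> 0 \<le> pide_op \<Theta> \<psi> p)"

definition viscosity_solution ::
    "'n::finite levy_triplet set \<Rightarrow> ('n space \<Rightarrow> real) \<Rightarrow> (real \<times> 'n space \<Rightarrow> real) \<Rightarrow> bool" where
  "viscosity_solution \<Theta> \<phi> u \<longleftrightarrow>
     bounded (u ` ({0..1} \<times> UNIV)) \<and> continuous_on ({0..1} \<times> UNIV) u \<and>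
     viscosity_subsolution \<Theta> \<phi> u \<and> viscosity_supersolution \<Theta> \<phi> u"


section \<open>Assumptions on the random variables\<close>

definition assumption_A1 ::
    "('w \<Rightarrow> real) set \<Rightarrow> (('w \<Rightarrow> real) \<Rightarrow> real) \<Rightarrow> ('w \<Rightarrow> real^'n) \<Rightarrow> ('w \<Rightarrow> real^'n) \<Rightarrow> bool" where
  "assumption_A1 H E X1 Y1 \<longleftrightarrow> mean_zero E X1 \<and> has_moment H X1 3 \<and> has_moment H Y1 2"

definition stable_mean ::
    "(('w \<Rightarrow> real) \<Rightarrow> real) \<Rightarrow> real \<Rightarrow> (nat \<Rightarrow> 'w \<Rightarrow> real^'n) \<Rightarrow> nat \<Rightarrow> real" where
  "stable_mean E \<alpha> Z n = E (\<lambda>\<omega>. real n powr (- 1 / \<alpha>) * norm (\<Sum>i=1..n. Z i \<omega>))"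

definition M_star :: "(('w \<Rightarrow> real) \<Rightarrow> real) \<Rightarrow> real \<Rightarrow> (nat \<Rightarrow> 'w \<Rightarrow> real^'n) \<Rightarrow> real" where
  "M_star E \<alpha> Z = (SUP n\<in>{1..}. stable_mean E \<alpha> Z n)"

definition assumption_A2 ::
    "('w \<Rightarrow> real) set \<Rightarrow> (('w \<Rightarrow> real) \<Rightarrow> real) \<Rightarrow> real \<Rightarrow> (nat \<Rightarrow> 'w \<Rightarrow> real^'n) \<Rightarrow> bool" where
  "assumption_A2 H E \<alpha> Z \<longleftrightarrow>
     mean_zero E (Z 1) \<and> bdd_above (stable_mean E \<alpha> Z ` {1..}) \<and>
     (\<exists>\<delta>. max (3 / 4 * \<alpha>) 1 < \<delta> \<and> \<delta> < \<alpha> \<and> has_moment H (Z 1) \<delta>)"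

text \<open>
  The membership in \<open>H\<close> makes the expectation meaningful; it amounts to the integrability of the
  quadratic forms in \<open>X1\<close>, which does not follow from that of the third moment.
\<close>

definition assumption_A3 ::
    "('w \<Rightarrow> real) set \<Rightarrow> (('w \<Rightarrow> real) \<Rightarrow> real) \<Rightarrow> real \<Rightarrow> 'n::finite levy_triplet set \<Rightarrow>
     ('w \<Rightarrow> real^'n) \<Rightarrow> ('w \<Rightarrow> real^'n) \<Rightarrow> ('w \<Rightarrow> real^'n) \<Rightarrow> bool" where
  "assumption_A3 H E \<alpha> \<Theta> X1 Y1 Z1 \<longleftrightarrow>
     (\<exists>l :: real \<Rightarrow> real \<Rightarrow> real.
        (\<forall>C>0. uniform_limit {0..C} l (\<lambda>_. 0) (at_right 0)) \<and>
        (\<forall>p A f z s. transpose A = A \<and> f \<in> Cb 3 \<and> 0 < s \<and> s \<le> 1 \<longrightarrow>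
           (let \<zeta> = (\<lambda>\<omega>. f (z + s powr (1 / \<alpha>) *\<^sub>R Z1 \<omega>) - f z + p \<bullet> (s *\<^sub>R Y1 \<omega>)
                      + 1 / 2 * ((A *v (sqrt s *\<^sub>R X1 \<omega>)) \<bullet> (sqrt s *\<^sub>R X1 \<omega>)));
                L0 = norm p + norm A + sup_norm f + (\<Sum>i=1..3. sup_norm (deriv_norm i f))
            in \<zeta> \<in> H \<and>
               1 / s * \<bar>E \<zeta> - s * G \<Theta> p A (\<lambda>l. f (z + l))\<bar> \<le> l s L0)))"


section \<open>The approximation scheme\<close>

function scheme ::
    "(('w \<Rightarrow> real) \<Rightarrow> real) \<Rightarrow> real \<Rightarrow> ('w \<Rightarrow> real^'n) \<Rightarrow> ('w \<Rightarrow> real^'n) \<Rightarrow> ('w \<Rightarrow> real^'n) \<Rightarrow>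
     ('n::finite space \<Rightarrow> real) \<Rightarrow> real \<Rightarrow> real \<times> 'n space \<Rightarrow> real" where
  "scheme E \<alpha> X Y Z \<phi> h (t, x, y, z) =
     (if h \<le> 0 \<or> t < h then \<phi> (x, y, z)
      else E (\<lambda>\<omega>. scheme E \<alpha> X Y Z \<phi> h
             (t - h, x + sqrt h *\<^sub>R X \<omega>, y + h *\<^sub>R Y \<omega>, z + h powr (1 / \<alpha>) *\<^sub>R Z \<omega>)))"
  by pat_completeness auto
termination
proof (relation "Wellfounded.measure (\<lambda>(E, \<alpha>, X, Y, Z, \<phi>, h, t, e). nat \<lfloor>t / h\<rfloor>)", goal_cases)
  case 1
  show ?case by simp
next
  case (2 E \<alpha> X Y Z \<phi> h t x y z \<omega>)
  then have "(t - h) / h = t / h - 1" "1 \<le> t / h"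
    by (simp_all add: field_simps)
  then show ?case
    by (simp add: le_floor_iff zless_nat_eq_int_zless)
qed

definition S_op ::
    "(('w \<Rightarrow> real) \<Rightarrow> real) \<Rightarrow> real \<Rightarrow> ('w \<Rightarrow> real^'n) \<Rightarrow> ('w \<Rightarrow> real^'n) \<Rightarrow> ('w \<Rightarrow> real^'n) \<Rightarrow>
     real \<Rightarrow> real^'n \<Rightarrow> real^'n \<Rightarrow> real^'n \<Rightarrow> real \<Rightarrow> ('n::finite space \<Rightarrow> real) \<Rightarrow> real" where
  "S_op E \<alpha> X Y Z h x y z p v =
     1 / h * (p - E (\<lambda>\<omega>. v (x + sqrt h *\<^sub>R X \<omega>, y + h *\<^sub>R Y \<omega>, z + h powr (1 / \<alpha>) *\<^sub>R Z \<omega>)))"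


section \<open>Mollification\<close>

text \<open>The support may touch the unit sphere of \<open>\<real>\<^sup>3\<^sup>d\<close>.\<close>

definition mollifier :: "(real \<times> 'n::finite space \<Rightarrow> real) \<Rightarrow> bool" where
  "mollifier \<rho> \<longleftrightarrow>
     cont_diff UNIV (lists Basis) \<rho> \<and> (\<forall>p. 0 \<le> \<rho> p) \<and>
     closure {p. \<rho> p \<noteq> 0} \<subseteq> {-1..0} \<times> cball 0 1 \<and> (\<integral>p. \<rho> p \<partial>lborel) = 1"

text \<open>The exponent is the parabolic scaling dimension, with \<open>d = CARD('n)\<close>.\<close>

definition rescaled ::
    "(real \<times> 'n::finite space \<Rightarrow> real) \<Rightarrow> real \<Rightarrow> real \<times> 'n space \<Rightarrow> real" where
  "rescaled \<rho> \<epsilon> = (\<lambda>(\<tau>, e). 1 / \<epsilon> ^ (2 + 3 * CARD('n)) * \<rho> (\<tau> / \<epsilon>\<^sup>2, e /\<^sub>R \<epsilon>))"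

text \<open>The truncation \<open>min 1\<close> extends \<open>v\<close> constantly in time beyond \<open>t = 1\<close>.\<close>

definition mollify ::
    "(real \<times> 'n::finite space \<Rightarrow> real) \<Rightarrow> real \<Rightarrow> (real \<times> 'n space \<Rightarrow> real) \<Rightarrow>
     real \<times> 'n space \<Rightarrow> real" where
  "mollify \<rho> \<epsilon> v = (\<lambda>(t, c).
     LINT \<tau>:{- \<epsilon>\<^sup>2..0}|lborel. LINT e:ball 0 \<epsilon>|lborel.
       v (min 1 (t - \<tau>), c - e) * rescaled \<rho> \<epsilon> (\<tau>, e))"

definition K_const :: "(real \<times> 'n::finite space \<Rightarrow> real) \<Rightarrow> real" where
  "K_const \<rho> = Max ((\<lambda>vs. LINT \<tau>:{-1..0}|lborel. LINT e:ball 0 1|lborel.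
     \<bar>iter_partial UNIV vs \<rho> (\<tau>, e)\<bar>) ` {vs. set vs \<subseteq> Basis \<and> length vs \<le> 3})"


section \<open>Error functions\<close>

definition nonneg5 :: "(real \<Rightarrow> real \<Rightarrow> real \<Rightarrow> real \<Rightarrow> real \<Rightarrow> real) \<Rightarrow> bool" where
  "nonneg5 f \<longleftrightarrow> (\<forall>a\<ge>0. \<forall>b\<ge>0. \<forall>c\<ge>0. \<forall>d\<ge>0. \<forall>e\<ge>0. 0 \<le> f a b c d e)"

text \<open>
  In both conditions \<open>u h\<close> is the function whose mollification is tested; it may depend on \<open>h\<close>.
\<close>

definition upper_consistency ::
    "(('w \<Rightarrow> real) \<Rightarrow> real) \<Rightarrow> real \<Rightarrow> ('w \<Rightarrow> real^'n) \<Rightarrow> ('w \<Rightarrow> real^'n) \<Rightarrow> ('w \<Rightarrow> real^'n) \<Rightarrow>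
     'n::finite levy_triplet set \<Rightarrow> (real \<times> 'n space \<Rightarrow> real) \<Rightarrow>
     (real \<Rightarrow> real \<times> 'n space \<Rightarrow> real) \<Rightarrow> (real \<Rightarrow> real \<Rightarrow> real) \<Rightarrow> bool" where
  "upper_consistency E \<alpha> X Y Z \<Theta> \<rho> u err \<longleftrightarrow>
     (\<forall>\<epsilon>\<in>{0<..<1}. \<forall>h\<in>{0<..<1}. \<forall>t\<in>{h..1}. \<forall>x y z.
        let w = mollify \<rho> \<epsilon> (u h) in
        S_op E \<alpha> X Y Z h x y z (w (t, x, y, z)) (\<lambda>e. w (t - h, e))
          \<le> pide_op \<Theta> w (t, x, y, z) + err \<epsilon> h)"

definition lower_consistency ::
    "(('w \<Rightarrow> real) \<Rightarrow> real) \<Rightarrow> real \<Rightarrow> ('w \<Rightarrow> real^'n) \<Rightarrow> ('w \<Rightarrow> real^'n) \<Rightarrow> ('w \<Rightarrow> real^'n) \<Rightarrow>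
     'n::finite levy_triplet set \<Rightarrow> (real \<times> 'n space \<Rightarrow> real) \<Rightarrow>
     (real \<Rightarrow> real \<times> 'n space \<Rightarrow> real) \<Rightarrow> (real \<Rightarrow> real \<Rightarrow> real) \<Rightarrow> bool" where
  "lower_consistency E \<alpha> X Y Z \<Theta> \<rho> u err \<longleftrightarrow>
     (\<forall>\<epsilon>\<in>{0<..<1}. \<forall>h\<in>{0<..<1}. \<forall>t\<in>{h..1}. \<forall>x y z.
        let w = mollify \<rho> \<epsilon> (u h) in
        S_op E \<alpha> X Y Z h x y z (w (t, x, y, z)) (\<lambda>e. w (t - h, e))
          \<ge> pide_op \<Theta> w (t, x, y, z) - err \<epsilon> h)"

end

theory Submission
  imports Defs
begin

text \<open>
  Let \<open>T h\<close> be the operator of one time step, so that the scheme at time \<open>t\<close> is the iterate of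
  order \<open>\<lfloor>t / h\<rfloor>\<close> of \<open>T h\<close>, applied to the initial datum. The error functions control the scheme
  on mollified functions only. Both bounds therefore compare one of the two functions with the
  mollification of the other one, and the mollification is smooth.

  \<^emph>\<open>Lower bound.\<close> The operator \<open>T h\<close> is sublinear and commutes with translations. Jensen's inequality
  (\<open>sch_jensen\<close>) shows that a step from the mollified scheme ends below the mollified scheme, and the
  first error function turns this into a differential inequality: up to a drift of size \<open>E1\<close> the
  mollified scheme is a smooth supersolution. Such a function dominates the viscosity solution by the maximum
  principle (\<open>comparison_sub\<close>); no comparison of two nonsmooth functions is involved.

  \<^emph>\<open>Upper bound.\<close> The mollification of the viscosity solution is a classical supersolution
  (\<open>mollified_super\<close>). The second error function makes it a supersolution of the scheme, and the
  monotonicity of \<open>T h\<close> gives the bound by induction on the number of steps. A mollified viscosity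
  supersolution is a supersolution for the following reason. The operator \<open>G\<close> is a supremum of
  linear operators, one for each triplet. A viscosity supersolution lies above the linear flow of
  each of them (\<open>linear_flow_below\<close>). That flow is approximated by iterated averages over finitely
  many translates, and these commute with convolution, so that the inequality passes to the
  mollification, which can be differentiated.

  \<^emph>\<open>The cost of mollifying\<close> is governed by the Lipschitz constant in space and by the modulus
  \<open>C0 * sqrt\<close> in time. For the scheme both follow from translation invariance and from the
  moments (\<open>Tk_growth\<close>). For the viscosity solution they are derived as well.
  In time, it is compared with smooth barriers (\<open>barrier\<close>): mollified iterates of the
  scheme itself, started from truncated cones in one of the three blocks of coordinates. Assumption A3
  treats the three blocks separately, so the scheme is consistent on functions of a single block
  (\<open>consistency\<close>), and sublinearity allows adding the three. In space, the inf-convolution of the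
  solution is a Lipschitz supersolution; being Lipschitz, it can be mollified, and comparison
  shows that it is not smaller than the solution (\<open>le_inf_conv\<close>).
\<close>

section \<open>Functions with bounded partial derivatives of all orders\<close>

text \<open>The relation names the derivative, so that the rules below need neither \<^const>\<open>vector_derivative\<close>
 nor differentiability side conditions.\<close>

definition has_partial ::
  "'a::euclidean_space set => ('a => real) => 'a => ('a => real) => bool" where
 "has_partial S f v g \<longleftrightarrow>
   (\<forall>p\<in>S. ((\<lambda>s. f (p + s *\<^sub>R v)) has_vector_derivative g p) (at 0 within {s. p + s *\<^sub>R v \<in> S}))"

text \<open>On such a domain partial derivatives, possibly one-sided, are unique.\<close>

definition thick :: "'a::euclidean_space set => bool" where
 "thick S \<longleftrightarrow> (\<forall>p\<in>S. \<forall>v\<in>Basis. at 0 within {s. p + s *\<^sub>R v \<in> S} \<noteq> bot)"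

definition Cb_inf :: "'a::euclidean_space set => ('a => real) set" where
 "Cb_inf S = Cb_diff S (lists Basis)"

lemma thick_UNIV [simp]: "thick UNIV"
 by (simp add: thick_def)

lemma thick_cyl [simp]: "thick (cyl :: (real \<times> 'n::finite space) set)"
 unfolding thick_def
proof (intro ballI)
 fix p v :: "real \<times> 'n space" assume p: "p \<in> cyl" and "v \<in> Basis"
 then have t: "0 < fst p" "fst p \<le> 1"
  by (auto simp: cyl_def)
 define c where "c = fst v"
 have "\<bar>c\<bar> \<le> 1" "0 \<le> c"
  using \<open>v \<in> Basis\<close> by (auto simp: c_def Basis_prod_def)
 have "{- (fst p / 2)..0} \<subseteq> {s. p + s *\<^sub>R v \<in> cyl}"
 proof
  fix s assume s: "s \<in> {- (fst p / 2)..0}"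
  have "s * c \<le> 0"
   using s \<open>0 \<le> c\<close> by (simp add: mult_nonpos_nonneg)
  moreover have "\<bar>s * c\<bar> \<le> (fst p / 2) * 1"
   unfolding abs_mult using s \<open>\<bar>c\<bar> \<le> 1\<close> by (intro mult_mono) auto
  ultimately show "s \<in> {s. p + s *\<^sub>R v \<in> cyl}"
   using t by (auto simp: cyl_def c_def mem_Times_iff)
 qed
 moreover have "at 0 within {- (fst p / 2)..0} \<noteq> bot"
  using t by (simp add: trivial_limit_within islimpt_Icc)
 ultimately show "at 0 within {s. p + s *\<^sub>R v \<in> cyl} \<noteq> bot"
  by (metis at_le bot.extremum_uniqueI)
qed

lemma has_partial_unique:
 assumes "thick S" "v \<in> Basis" "has_partial S f v g" "p \<in> S"
 shows "partial_deriv S v f p = g p"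
 using assms unfolding partial_deriv_def has_partial_def thick_def
 by (intro vector_derivative_within) auto

lemma has_vector_derivative_cong_on:
 assumes "(f has_vector_derivative d) (at x within A)" "\<And>y. y \<in> A ==> f y = g y" "x \<in> A"
 shows "(g has_vector_derivative d) (at x within A)"
 using has_vector_derivative_transform[of x A g f d] assms by auto

lemma has_partial_cong:
 assumes "has_partial S f v g" "\<And>p. p \<in> S ==> f p = f' p" "\<And>p. p \<in> S ==> g p = g' p"
 shows "has_partial S f' v g'"
 unfolding has_partial_def
proof
 fix p assume p: "p \<in> S"
 show "((\<lambda>s. f' (p + s *\<^sub>R v)) has_vector_derivative g' p) (at 0 within {s. p + s *\<^sub>R v \<in> S})"
  by (rule has_vector_derivative_cong_on[of "\<lambda>s. f (p + s *\<^sub>R v)"]) (use assms p in \<open>auto simp: has_partial_def\<close>)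
qed

lemma iter_partial_family:
 assumes "thick S" "f \<in> F"
  and "\<And>f b. f \<in> F ==> b \<in> Basis ==> \<exists>g\<in>F. has_partial S f b g"
  and "vs \<in> lists Basis"
 shows "\<exists>g\<in>F. \<forall>p\<in>S. iter_partial S vs f p = g p"
 using assms(4)
proof (induction vs)
 case Nil
 then show ?case using assms(2) by auto
next
 case (Cons v vs)
 obtain g where g: "g \<in> F" "\<forall>p\<in>S. iter_partial S vs f p = g p" using Cons.IH by blast
 obtain g' where g': "g' \<in> F" "has_partial S g v g'" using assms(3)[OF g(1) Cons.hyps(1)] by blast
 have h: "has_partial S (iter_partial S vs f) v g'"
  by (rule has_partial_cong[OF g'(2)]) (use g(2) in simp_all)
 have "\<forall>p\<in>S. iter_partial S (v # vs) f p = g' p"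
  using has_partial_unique[OF assms(1) Cons.hyps(1) h] by simp
 then show ?case
  by (rule bexI[OF _ g'(1)])
qed

text \<open>A coinduction rule: smoothness follows from membership in a family of bounded continuous
 functions that is closed under differentiation.\<close>

lemma Cb_infI:
 assumes "thick S" "f \<in> F"
  and cont: "\<And>f. f \<in> F ==> continuous_on S f"
  and bdd: "\<And>f. f \<in> F ==> bounded (f ` S)"
  and der: "\<And>f b. f \<in> F ==> b \<in> Basis ==> \<exists>g\<in>F. has_partial S f b g"
 shows "f \<in> Cb_inf S"
proof -
 have fam: "\<exists>g\<in>F. \<forall>p\<in>S. iter_partial S vs f p = g p" if "vs \<in> lists Basis" for vs
  by (rule iter_partial_family[OF assms(1,2) der that])
 have "continuous_on S (iter_partial S vs f)" if vs: "vs \<in> lists Basis" for vs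
 proof -
  obtain g where g: "g \<in> F" "\<forall>p\<in>S. iter_partial S vs f p = g p" using fam[OF vs] by blast
  show ?thesis
   using continuous_on_cong[OF refl, of S "iter_partial S vs f" g] g(2) cont[OF g(1)] by simp
 qed
 moreover have "bounded (iter_partial S vs f ` S)" if vs: "vs \<in> lists Basis" for vs
 proof -
  obtain g where g: "g \<in> F" "\<forall>p\<in>S. iter_partial S vs f p = g p" using fam[OF vs] by blast
  then show ?thesis using bdd[OF g(1)] image_cong[OF refl, of S "iter_partial S vs f" g] by simp
 qed
 moreover have "(\<lambda>s. iter_partial S vs f (p + s *\<^sub>R v)) differentiable
   (at 0 within {s. p + s *\<^sub>R v \<in> S})" if "v # vs \<in> lists Basis" "p \<in> S" for v vs p
 proof -
  have v: "v \<in> Basis" "vs \<in> lists Basis" using that by auto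
  obtain g where g: "g \<in> F" "\<forall>p\<in>S. iter_partial S vs f p = g p" using fam[OF v(2)] by blast
  obtain g' where "has_partial S g v g'" using der[OF g(1) v(1)] by blast
  then have "((\<lambda>s. g (p + s *\<^sub>R v)) has_vector_derivative g' p) (at 0 within {s. p + s *\<^sub>R v \<in> S})"
   using that unfolding has_partial_def by blast
  then have "((\<lambda>s. iter_partial S vs f (p + s *\<^sub>R v)) has_vector_derivative g' p)
    (at 0 within {s. p + s *\<^sub>R v \<in> S})"
   by (rule has_vector_derivative_cong_on) (use g that in auto)
  then show ?thesis by (rule differentiableI_vector)
 qed
 ultimately show ?thesis
  unfolding Cb_inf_def Cb_diff_def cont_diff_def by (simp del: lists.simps)
qed

lemma iter_partial_append:
 "iter_partial S (us @ vs) f = iter_partial S us (iter_partial S vs f)"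
 by (induction us) auto

lemma Cb_inf_iter_partial:
 assumes "f \<in> Cb_inf S" "vs \<in> lists Basis"
 shows "iter_partial S vs f \<in> Cb_inf S"
 using assms unfolding Cb_inf_def Cb_diff_def cont_diff_def
 by (simp flip: iter_partial_append append_Cons)

lemma Cb_inf_partial:
 assumes "f \<in> Cb_inf S" "b \<in> Basis"
 shows "partial_deriv S b f \<in> Cb_inf S"
 using Cb_inf_iter_partial[OF assms(1), of "[b]"] assms(2) by simp

lemma Cb_inf_has_partial:
 assumes "f \<in> Cb_inf S" "b \<in> Basis"
 shows "has_partial S f b (partial_deriv S b f)"
proof -
 have "(\<lambda>s. f (p + s *\<^sub>R b)) differentiable (at 0 within {s. p + s *\<^sub>R b \<in> S})" if "p \<in> S" for p
 proof -
  have "\<forall>v vs. v # vs \<in> lists Basis --> (\<forall>p\<in>S. (\<lambda>s. iter_partial S vs f (p + s *\<^sub>R v)) differentiable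
    (at 0 within {s. p + s *\<^sub>R v \<in> S}))"
   using assms(1) by (simp add: Cb_inf_def Cb_diff_def cont_diff_def)
  from this[rule_format, of b "[]" p] show ?thesis using assms(2) that by simp
 qed
 then show ?thesis
  unfolding has_partial_def partial_deriv_def by (simp add: vector_derivative_works)
qed

lemma Cb_inf_cont: "f \<in> Cb_inf S ==> continuous_on S f"
 unfolding Cb_inf_def Cb_diff_def cont_diff_def by (drule CollectD) (auto dest: bspec[where x = "[]"])

lemma Cb_inf_bdd: "f \<in> Cb_inf S ==> bounded (f ` S)"
 unfolding Cb_inf_def Cb_diff_def by (drule CollectD) (auto dest: bspec[where x = "[]"])

lemma Cb_inf_subset_Cb23: "Cb_inf (cyl :: (real \<times> 'n::finite space) set) \<subseteq> Cb23"
proof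
 fix f :: "real \<times> 'n space => real" assume f: "f \<in> Cb_inf cyl"
 have mono: "g \<in> Cb_diff S A" if "A \<subseteq> B" "g \<in> Cb_diff S B" for g S A B
  using that unfolding Cb_diff_def cont_diff_def by blast
 show "f \<in> Cb23"
  unfolding Cb23_def
  by (rule mono[OF _ f[unfolded Cb_inf_def]]) (auto simp: in_lists_conv_set)
qed

lemma has_partial_const: "has_partial S (\<lambda>_. c) b (\<lambda>_. 0)"
 by (simp add: has_partial_def has_vector_derivative_const)

lemma has_partial_add:
 "has_partial S f b f' ==> has_partial S g b g' ==> has_partial S (\<lambda>p. f p + g p) b (\<lambda>p. f' p + g' p)"
 by (auto simp: has_partial_def intro!: derivative_intros)

lemma has_partial_cmult:
 "has_partial S f b f' ==> has_partial S (\<lambda>p. c * f p) b (\<lambda>p. c * f' p)"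
 by (auto simp: has_partial_def intro!: derivative_eq_intros)

lemma has_partial_mult:
 assumes "has_partial S f b f'" "has_partial S g b g'"
 shows "has_partial S (\<lambda>p. f p * g p) b (\<lambda>p. f p * g' p + f' p * g p)"
 unfolding has_partial_def
proof
 fix p assume p: "p \<in> S"
 show "((\<lambda>s. f (p + s *\<^sub>R b) * g (p + s *\<^sub>R b)) has_vector_derivative f p * g' p + f' p * g p)
   (at 0 within {s. p + s *\<^sub>R b \<in> S})"
  using has_vector_derivative_mult[of "\<lambda>s. f (p + s *\<^sub>R b)" "f' p" 0 "{s. p + s *\<^sub>R b \<in> S}"
    "\<lambda>s. g (p + s *\<^sub>R b)" "g' p"] assms p
  by (simp add: has_partial_def)
qed

lemma Cb_inf_const: "thick S ==> (\<lambda>_. c) \<in> Cb_inf S"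
 by (rule Cb_infI[where F = "range (\<lambda>c _. c)"]) (auto intro: has_partial_const simp: image_constant_conv)

lemma bounded_plus_image:
 fixes f g :: "'a => real"
 assumes "bounded (f ` S)" "bounded (g ` S)"
 shows "bounded ((\<lambda>p. f p + g p) ` S)" "bounded ((\<lambda>p. f p * g p) ` S)"
proof -
 obtain A B where "\<forall>p\<in>S. \<bar>f p\<bar> \<le> A" "\<forall>p\<in>S. \<bar>g p\<bar> \<le> B"
  using assms by (auto simp: bounded_iff)
 then have "\<forall>p\<in>S. \<bar>f p + g p\<bar> \<le> A + B" "\<forall>p\<in>S. \<bar>f p * g p\<bar> \<le> A * B"
  by (fastforce, auto simp: abs_mult intro!: mult_mono order_trans[OF abs_ge_zero])
 then show "bounded ((\<lambda>p. f p + g p) ` S)" "bounded ((\<lambda>p. f p * g p) ` S)"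
  unfolding bounded_iff by (auto simp del: abs_mult)
qed

lemma Cb_inf_add:
 assumes S: "thick S" and "f \<in> Cb_inf S" "g \<in> Cb_inf S"
 shows "(\<lambda>p. f p + g p) \<in> Cb_inf S"
proof (rule Cb_infI[OF S, where F = "{(\<lambda>p. f p + g p) |f g. f \<in> Cb_inf S \<and> g \<in> Cb_inf S}"])
 fix h b assume "h \<in> {(\<lambda>p. f p + g p) |f g. f \<in> Cb_inf S \<and> g \<in> Cb_inf S}" and b: "b \<in> (Basis :: 'a set)"
 then obtain f g where h: "h = (\<lambda>p. f p + g p)" and fg: "f \<in> Cb_inf S" "g \<in> Cb_inf S" by blast
 have "has_partial S h b (\<lambda>p. partial_deriv S b f p + partial_deriv S b g p)"
  unfolding h by (intro has_partial_add Cb_inf_has_partial fg b)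
 then show "\<exists>k\<in>{(\<lambda>p. f p + g p) |f g. f \<in> Cb_inf S \<and> g \<in> Cb_inf S}. has_partial S h b k"
  using Cb_inf_partial[OF fg(1) b] Cb_inf_partial[OF fg(2) b] by (intro bexI[of _ "\<lambda>p. partial_deriv S b f p + partial_deriv S b g p"]) auto
next
 fix h assume "h \<in> {(\<lambda>p. f p + g p) |f g. f \<in> Cb_inf S \<and> g \<in> Cb_inf S}"
 then obtain f g where h: "h = (\<lambda>p. f p + g p)" and fg: "f \<in> Cb_inf S" "g \<in> Cb_inf S" by blast
 show "continuous_on S h" "bounded (h ` S)"
  unfolding h by (intro continuous_on_add bounded_plus_image Cb_inf_cont Cb_inf_bdd fg)+
qed (use assms in blast)

text \<open>A product is not closed under differentiation, but a sum of products is.\<close>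

lemma Cb_inf_mult:
 assumes S: "thick S" and f: "f \<in> Cb_inf S" and g: "g \<in> Cb_inf S"
 shows "(\<lambda>p. f p * g p) \<in> Cb_inf S"
proof -
 define F where "F = {(\<lambda>p. \<Sum>i<n. f i p * g i p) |(n::nat) f g.
   (\<forall>i<n. f i \<in> Cb_inf S) \<and> (\<forall>i<n. g i \<in> Cb_inf S)}"
 have "(\<lambda>p. f p * g p) \<in> F"
  unfolding F_def using f g
  by (intro CollectI exI[of _ "1::nat"] exI[of _ "\<lambda>_. f"] exI[of _ "\<lambda>_. g"]) auto
 then show ?thesis
 proof (rule Cb_infI[OF S])
  fix h assume "h \<in> F"
  then obtain n f g where h: "h = (\<lambda>p. \<Sum>i<(n::nat). f i p * g i p)"
    "\<forall>i<n. f i \<in> Cb_inf S" "\<forall>i<n. g i \<in> Cb_inf S"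
   by (auto simp: F_def)
  show "continuous_on S h"
   unfolding h(1) using h(2,3) by (intro continuous_on_sum continuous_on_mult Cb_inf_cont) auto
  show "bounded (h ` S)"
   unfolding h(1) using h(2,3)
  proof (induction n)
   case 0
   then show ?case by (simp add: image_constant_conv)
  next
   case (Suc n)
   then show ?case
    by simp (rule bounded_plus_image(1), simp, rule bounded_plus_image(2); simp add: Cb_inf_bdd)
  qed
 next
  fix h b assume "h \<in> F" and b: "b \<in> (Basis :: 'a set)"
  then obtain n f g where h: "h = (\<lambda>p. \<Sum>i<(n::nat). f i p * g i p)"
    "\<forall>i<n. f i \<in> Cb_inf S" "\<forall>i<n. g i \<in> Cb_inf S"
   by (auto simp: F_def)
  define f2 where "f2 i = (if i < n then f i else partial_deriv S b (f (i - n)))" for i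
  define g2 where "g2 i = (if i < n then partial_deriv S b (g i) else g (i - n))" for i
  have "has_partial S h b (\<lambda>p. \<Sum>i<n. f i p * partial_deriv S b (g i) p + partial_deriv S b (f i) p * g i p)"
   unfolding h(1) has_partial_def
  proof (intro ballI has_vector_derivative_sum)
   fix p i assume "p \<in> S" "i \<in> {..<n}"
   then show "((\<lambda>s. f i (p + s *\<^sub>R b) * g i (p + s *\<^sub>R b)) has_vector_derivative
     f i p * partial_deriv S b (g i) p + partial_deriv S b (f i) p * g i p)
     (at 0 within {s. p + s *\<^sub>R b \<in> S})"
    using has_partial_mult[OF Cb_inf_has_partial[OF _ b] Cb_inf_has_partial[OF _ b], of "f i" S "g i"] h(2,3)
    by (simp add: has_partial_def)
  qed
  also have "(\<lambda>p. \<Sum>i<n. f i p * partial_deriv S b (g i) p + partial_deriv S b (f i) p * g i p) =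
    (\<lambda>p. \<Sum>i<n + n. f2 i p * g2 i p)"
  proof
   fix p
   have "(\<Sum>i<n + n. f2 i p * g2 i p) = (\<Sum>i<n. f2 i p * g2 i p) + (\<Sum>i<n. f2 (i + n) p * g2 (i + n) p)"
    using sum.shift_bounds_nat_ivl[of "\<lambda>i. f2 i p * g2 i p" 0 n n]
     sum.atLeastLessThan_concat[of 0 n "n + n" "\<lambda>i. f2 i p * g2 i p"]
    by (simp add: lessThan_atLeast0)
   then show "(\<Sum>i<n. f i p * partial_deriv S b (g i) p + partial_deriv S b (f i) p * g i p) =
     (\<Sum>i<n + n. f2 i p * g2 i p)"
    by (simp add: f2_def g2_def sum.distrib)
  qed
  finally have "has_partial S h b (\<lambda>p. \<Sum>i<n + n. f2 i p * g2 i p)" .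
  moreover have "(\<lambda>p. \<Sum>i<n + n. f2 i p * g2 i p) \<in> F"
  proof -
   have "\<forall>i<n+n. f2 i \<in> Cb_inf S" "\<forall>i<n+n. g2 i \<in> Cb_inf S"
    using h(2,3) b by (auto simp: f2_def g2_def intro!: Cb_inf_partial)
   then show ?thesis unfolding F_def by blast
  qed
  ultimately show "\<exists>g\<in>F. has_partial S h b g" by (rule bexI)
 qed
qed

lemma Cb_inf_cmult:
 assumes "thick S" "f \<in> Cb_inf S"
 shows "(\<lambda>p. c * f p) \<in> Cb_inf S"
 using Cb_inf_mult[OF assms(1) Cb_inf_const[OF assms(1)] assms(2)] .

lemma Cb_inf_uminus: "thick S ==> f \<in> Cb_inf S ==> (\<lambda>p. - f p) \<in> Cb_inf S"
 using Cb_inf_cmult[of S f "-1"] by simp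

lemma Cb_inf_diff:
 "thick S ==> f \<in> Cb_inf S ==> g \<in> Cb_inf S ==> (\<lambda>p. f p - g p) \<in> Cb_inf S"
 using Cb_inf_add[OF _ _ Cb_inf_uminus, of S f g] by simp

lemma Cb_inf_power:
 assumes "thick S" "f \<in> Cb_inf S"
 shows "(\<lambda>p. f p ^ n) \<in> Cb_inf S"
 by (induction n) (simp_all add: assms Cb_inf_const Cb_inf_mult)

lemma Cb_inf_UNIV_restrict:
 fixes f :: "'a::euclidean_space => real"
 assumes S: "thick S" and f: "f \<in> Cb_inf UNIV"
 shows "f \<in> Cb_inf S"
proof (rule Cb_infI[OF S f])
 fix g :: "'a => real" and b assume g: "g \<in> Cb_inf UNIV" and b: "b \<in> (Basis :: 'a set)"
 have "has_partial S g b (partial_deriv UNIV b g)"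
  using Cb_inf_has_partial[OF g b] unfolding has_partial_def
  by (auto intro: has_vector_derivative_within_subset)
 then show "\<exists>h\<in>Cb_inf UNIV. has_partial S g b h"
  by (rule bexI[OF _ Cb_inf_partial[OF g b]])
next
 fix g :: "'a => real" assume g: "g \<in> Cb_inf UNIV"
 show "continuous_on S g" "bounded (g ` S)"
  using continuous_on_subset[OF Cb_inf_cont[OF g]] bounded_subset[OF Cb_inf_bdd[OF g], of "g ` S"] by auto
qed

lemma partial_deriv_restrict:
 fixes f :: "'a::euclidean_space => real"
 assumes S: "thick S" and f: "f \<in> Cb_inf UNIV" and b: "b \<in> Basis" and p: "p \<in> S"
 shows "partial_deriv S b f p = partial_deriv UNIV b f p"
proof (rule has_partial_unique[OF S b _ p])
 show "has_partial S f b (partial_deriv UNIV b f)"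
  using Cb_inf_has_partial[OF f b] unfolding has_partial_def
  by (auto intro: has_vector_derivative_within_subset)
qed

lemma iter_partial_add:
 assumes S: "thick S" and "f \<in> Cb_inf S" "g \<in> Cb_inf S" "vs \<in> lists Basis" "p \<in> S"
 shows "iter_partial S vs (\<lambda>p. f p + g p) p = iter_partial S vs f p + iter_partial S vs g p"
 using assms(4,5)
proof (induction vs arbitrary: p)
 case (Cons v vs)
 have "has_partial S (\<lambda>p. iter_partial S vs f p + iter_partial S vs g p) v
   (\<lambda>p. iter_partial S (v # vs) f p + iter_partial S (v # vs) g p)"
  using Cons(1,2) assms by (auto intro!: has_partial_add Cb_inf_has_partial Cb_inf_iter_partial)
 then have h: "has_partial S (iter_partial S vs (\<lambda>p. f p + g p)) v
   (\<lambda>p. iter_partial S (v # vs) f p + iter_partial S (v # vs) g p)"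
  by (rule has_partial_cong) (use Cons.IH in simp_all)
 show ?case
  using has_partial_unique[OF S Cons(1) h Cons.prems(1)] by simp
qed simp

lemma iter_partial_cmult:
 assumes S: "thick S" and "f \<in> Cb_inf S" "vs \<in> lists Basis" "p \<in> S"
 shows "iter_partial S vs (\<lambda>p. c * f p) p = c * iter_partial S vs f p"
 using assms(3,4)
proof (induction vs arbitrary: p)
 case (Cons v vs)
 have "has_partial S (\<lambda>p. c * iter_partial S vs f p) v (\<lambda>p. c * iter_partial S (v # vs) f p)"
  using Cons(1,2) assms by (auto intro!: has_partial_cmult Cb_inf_has_partial Cb_inf_iter_partial)
 then have h: "has_partial S (iter_partial S vs (\<lambda>p. c * f p)) v (\<lambda>p. c * iter_partial S (v # vs) f p)"
  by (rule has_partial_cong) (use Cons.IH in simp_all)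
 show ?case
  using has_partial_unique[OF S Cons(1) h Cons.prems(1)] by simp
qed simp

lemma iter_partial_const:
 assumes S: "thick S" "vs \<in> lists Basis" "p \<in> S" "vs \<noteq> []"
 shows "iter_partial S vs (\<lambda>p. c) p = 0"
proof -
 have "\<forall>p\<in>S. iter_partial S vs (\<lambda>p. c) p = (if vs = [] then c else 0)"
  using assms(2)
 proof (induction vs)
  case (Cons v vs)
  have "has_partial S (iter_partial S vs (\<lambda>p. c)) v (\<lambda>_. 0)"
   by (rule has_partial_cong[OF has_partial_const[of S "if vs = [] then c else 0"]])
    (use Cons.IH in simp_all)
  then show ?case
   using has_partial_unique[OF S(1) Cons(1), of "iter_partial S vs (\<lambda>p. c)" "\<lambda>_. 0"] by simp
 qed simp
 then show ?thesis using assms by simp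
qed

lemma partial_deriv_shift: "partial_deriv UNIV v (\<lambda>p. f (p + a)) p = partial_deriv UNIV v f (p + a)"
 by (simp add: partial_deriv_def algebra_simps)

lemma iter_partial_shift: "iter_partial UNIV vs (\<lambda>p. f (p + a)) p = iter_partial UNIV vs f (p + a)"
proof (induction vs arbitrary: p)
 case (Cons v vs)
 then have "iter_partial UNIV vs (\<lambda>p. f (p + a)) = (\<lambda>p. iter_partial UNIV vs f (p + a))" by blast
 then show ?case by (simp add: partial_deriv_shift)
qed simp

lemma Cb_inf_shift:
 fixes f :: "'a::euclidean_space => real"
 assumes f: "f \<in> Cb_inf UNIV"
 shows "(\<lambda>p. f (p + a)) \<in> Cb_inf UNIV"
proof (rule Cb_infI[OF thick_UNIV, where F = "{(\<lambda>p. f (p + a)) |f. f \<in> Cb_inf UNIV}"])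
 fix h b assume "h \<in> {(\<lambda>p. f (p + a)) |f. f \<in> Cb_inf UNIV}" and b: "b \<in> (Basis :: 'a set)"
 then obtain f where f: "h = (\<lambda>p. f (p + a))" "f \<in> Cb_inf UNIV" by blast
 have "has_partial UNIV h b (\<lambda>p. partial_deriv UNIV b f (p + a))"
  unfolding has_partial_def f(1)
 proof
  fix p
  show "((\<lambda>s. f (p + s *\<^sub>R b + a)) has_vector_derivative partial_deriv UNIV b f (p + a))
    (at 0 within {s. p + s *\<^sub>R b \<in> UNIV})"
   using Cb_inf_has_partial[OF f(2) b, unfolded has_partial_def, rule_format, of "p + a"]
   by (simp add: add_ac)
 qed
 then show "\<exists>g\<in>{(\<lambda>p. f (p + a)) |f. f \<in> Cb_inf UNIV}. has_partial UNIV h b g"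
  using Cb_inf_partial[OF f(2) b] by (intro bexI[of _ "\<lambda>p. partial_deriv UNIV b f (p + a)"]) auto
next
 fix h assume "h \<in> {(\<lambda>p. f (p + a)) |f. f \<in> Cb_inf UNIV}"
 then obtain f where f: "h = (\<lambda>p. f (p + a))" "f \<in> Cb_inf UNIV" by blast
 show "continuous_on UNIV h"
  unfolding f(1) by (rule continuous_on_compose2[OF Cb_inf_cont[OF f(2)]]) (auto intro!: continuous_intros)
 show "bounded (range h)"
  unfolding f(1) by (rule bounded_subset[OF Cb_inf_bdd[OF f(2)]]) auto
qed (use f in auto)

subsection \<open>Taylor expansions\<close>

text \<open>The increments along a path that follows the coordinate axes add up to this norm.\<close>

definition norm1 :: "'a::euclidean_space => real" where
 "norm1 h = (\<Sum>b\<in>Basis. \<bar>h \<bullet> b\<bar>)"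

lemma norm1_le: "norm1 (h :: 'a::euclidean_space) \<le> DIM('a) * norm h"
 unfolding norm1_def using sum_mono[of Basis "\<lambda>b. \<bar>h \<bullet> b\<bar>" "\<lambda>_. norm h"] by (simp add: Basis_le_norm)

lemma norm1_nonneg [simp]: "0 \<le> norm1 h"
 by (simp add: norm1_def sum_nonneg)

lemma norm1_scaleR: "norm1 (s *\<^sub>R h) = \<bar>s\<bar> * norm1 h"
 by (simp add: norm1_def abs_mult sum_distrib_left)

lemma has_partial_line:
 assumes "has_partial UNIV f b g"
 shows "((\<lambda>s. f (p + s *\<^sub>R b)) has_real_derivative g (p + s *\<^sub>R b)) (at s)"
proof -
 have "((\<lambda>r. f ((p + s *\<^sub>R b) + r *\<^sub>R b)) has_real_derivative g (p + s *\<^sub>R b)) (at 0)"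
  using assms by (simp add: has_partial_def has_real_derivative_iff_has_vector_derivative)
 then have "((\<lambda>r. f (p + (s + r) *\<^sub>R b)) has_real_derivative g (p + s *\<^sub>R b)) (at 0)"
  by (simp add: algebra_simps)
 then show ?thesis
  using DERIV_shift[of "\<lambda>r. f (p + r *\<^sub>R b)" "g (p + s *\<^sub>R b)" 0 s] by (simp add: add.commute)
qed

text \<open>The path from \<open>p\<close> to \<open>p + h\<close> runs along the coordinate axes, one after the other.\<close>

lemma coordinate_path:
 fixes f :: "'a::euclidean_space => real"
 assumes f: "\<And>b. b \<in> Basis ==> has_partial UNIV f b (g b)"
  and g: "\<And>b q. b \<in> Basis ==> norm1 (q - p) \<le> norm1 h ==> \<bar>g b q - c b\<bar> \<le> e"
 shows "\<bar>f (p + h) - f p - (\<Sum>b\<in>Basis. (h \<bullet> b) * c b)\<bar> \<le> e * norm1 h"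
proof -
 have "\<bar>f (p + (\<Sum>b\<in>A. (h \<bullet> b) *\<^sub>R b)) - f p - (\<Sum>b\<in>A. (h \<bullet> b) * c b)\<bar> \<le> e * (\<Sum>b\<in>A. \<bar>h \<bullet> b\<bar>)"
  if "A \<subseteq> Basis" for A
  using finite_subset[OF that finite_Basis] that
 proof (induction A rule: finite_induct)
  case (insert b A)
  define q where "q = p + (\<Sum>b\<in>A. (h \<bullet> b) *\<^sub>R b)"
  define k where "k s = f (q + s *\<^sub>R b) - s * c b" for s
  have b: "b \<in> Basis" and A: "A \<subseteq> Basis" using insert by auto
  have comp: "(q - p) \<bullet> a = (if a \<in> A then h \<bullet> a else 0)" if "a \<in> Basis" for a
  proof -
   have "(q - p) \<bullet> a = (\<Sum>b\<in>A. (h \<bullet> b) * (b \<bullet> a))"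
    by (simp add: q_def inner_sum_left)
   also have "\<dots> = (\<Sum>b\<in>A. if b = a then h \<bullet> a else 0)"
    using that A by (intro sum.cong) (auto simp: inner_Basis)
   also have "\<dots> = (if a \<in> A then h \<bullet> a else 0)"
    by (rule sum.delta[OF insert(1)])
   finally show ?thesis .
  qed
  have "\<bar>k (h \<bullet> b) - k 0\<bar> \<le> e * \<bar>h \<bullet> b - 0\<bar>"
  proof -
   have dk: "(k has_real_derivative g b (q + s *\<^sub>R b) - c b) (at s)" for s
    unfolding k_def by (auto intro!: derivative_eq_intros has_partial_line[OF f[OF b]])
   have "\<bar>g b (q + s *\<^sub>R b) - c b\<bar> \<le> e" if s: "s \<in> closed_segment 0 (h \<bullet> b)" for s
   proof (rule g[OF b])
    have "\<bar>s\<bar> \<le> \<bar>h \<bullet> b\<bar>"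
     using s by (auto simp: closed_segment_eq_real_ivl split: if_splits)
    then have "\<bar>(q + s *\<^sub>R b - p) \<bullet> a\<bar> \<le> \<bar>h \<bullet> a\<bar>" if "a \<in> Basis" for a
     using comp[OF that] insert(2) b that
     by (auto simp: algebra_simps inner_Basis split: if_splits)
    then show "norm1 (q + s *\<^sub>R b - p) \<le> norm1 h"
     unfolding norm1_def by (intro sum_mono) auto
   qed
   then show ?thesis
    using field_differentiable_bound[of "closed_segment 0 (h \<bullet> b)" k "\<lambda>s. g b (q + s *\<^sub>R b) - c b" e "h \<bullet> b" 0]
     dk by (auto simp: has_field_derivative_at_within)
  qed
  then have "\<bar>f (q + (h \<bullet> b) *\<^sub>R b) - f q - (h \<bullet> b) * c b\<bar> \<le> e * \<bar>h \<bullet> b\<bar>"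
   by (simp add: k_def)
  moreover have eq: "p + (\<Sum>a\<in>insert b A. (h \<bullet> a) *\<^sub>R a) = q + (h \<bullet> b) *\<^sub>R b"
   using insert by (simp add: q_def)
  moreover have "\<bar>f q - f p - (\<Sum>b\<in>A. (h \<bullet> b) * c b)\<bar> \<le> e * (\<Sum>b\<in>A. \<bar>h \<bullet> b\<bar>)"
   using insert A by (simp add: q_def)
  ultimately show ?case
   unfolding eq using insert(1,2) by (simp add: distrib_left)
 qed simp
 from this[of Basis] show ?thesis
  by (simp add: euclidean_representation norm1_def)
qed

text \<open>The order zero is left out, because the operators of the equation do not see constants.\<close>

definition deriv_bound :: "nat => real => ('a::euclidean_space => real) => bool" where
 "deriv_bound k B f \<longleftrightarrow> f \<in> Cb_inf UNIV \<and>
   (\<forall>vs\<in>lists Basis. vs \<noteq> [] --> length vs \<le> k --> (\<forall>p. \<bar>iter_partial UNIV vs f p\<bar> \<le> B))"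

lemma deriv_boundD:
 assumes "deriv_bound k B f" "vs \<in> lists Basis" "vs \<noteq> []" "length vs \<le> k"
 shows "\<bar>iter_partial UNIV vs f p\<bar> \<le> B"
 using assms by (simp add: deriv_bound_def)

lemma deriv_bound_smooth: "deriv_bound k B f ==> f \<in> Cb_inf UNIV"
 by (simp add: deriv_bound_def)

lemma deriv_bound_mono: "deriv_bound k B f ==> j \<le> k ==> B \<le> B' ==> deriv_bound j B' f"
 unfolding deriv_bound_def by (meson order_trans)

lemma deriv_bound_nonneg:
 fixes f :: "'a::euclidean_space => real"
 assumes "deriv_bound k B f" "1 \<le> k"
 shows "0 \<le> B"
proof -
 obtain b :: 'a where "b \<in> Basis" by fastforce
 then show ?thesis
  using deriv_boundD[OF assms(1), of "[b]" 0] assms(2) by (simp add: order_trans[OF abs_ge_zero])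
qed

lemma deriv_bound_partial:
 assumes "deriv_bound (Suc k) B f" "vs \<in> lists Basis" "length vs = m" "m \<le> j" "j \<le> Suc k"
 shows "deriv_bound (Suc k - j) B (iter_partial UNIV vs f)"
 using assms unfolding deriv_bound_def
 by (auto intro: Cb_inf_iter_partial simp flip: iter_partial_append)

lemma Lipschitz_norm1:
 assumes "deriv_bound 1 B f"
 shows "\<bar>f (p + h) - f p\<bar> \<le> B * norm1 h"
proof -
 have "\<bar>f (p + h) - f p - (\<Sum>b\<in>Basis. (h \<bullet> b) * 0)\<bar> \<le> B * norm1 h"
 proof (rule coordinate_path[where g = "\<lambda>b. partial_deriv UNIV b f"])
  fix b q assume "b \<in> (Basis :: 'a set)"
  then show "\<bar>partial_deriv UNIV b f q - 0\<bar> \<le> B"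
   using deriv_boundD[OF assms, of "[b]" q] by simp
 qed (use assms in \<open>auto simp: deriv_bound_def intro: Cb_inf_has_partial\<close>)
 then show ?thesis by simp
qed

lemma Taylor2_norm1:
 assumes f: "deriv_bound 2 B f"
 shows "\<bar>f (p + h) - f p - (\<Sum>b\<in>Basis. (h \<bullet> b) * partial_deriv UNIV b f p)\<bar> \<le> B * (norm1 h)\<^sup>2"
proof -
 have B: "0 \<le> B" using deriv_bound_nonneg[OF f] by simp
 have "\<bar>f (p + h) - f p - (\<Sum>b\<in>Basis. (h \<bullet> b) * partial_deriv UNIV b f p)\<bar> \<le> (B * norm1 h) * norm1 h"
 proof (rule coordinate_path[where g = "\<lambda>b. partial_deriv UNIV b f"])
  fix b q assume b: "b \<in> (Basis :: 'a set)" and q: "norm1 (q - p) \<le> norm1 h"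
  have "deriv_bound 1 B (iter_partial UNIV [b] f)"
   using deriv_bound_partial[of 1 B f "[b]" 1 1] f b by (simp add: numeral_2_eq_2)
  from Lipschitz_norm1[OF this, of p "q - p"]
  show "\<bar>partial_deriv UNIV b f q - partial_deriv UNIV b f p\<bar> \<le> B * norm1 h"
   using q B by (auto intro: order_trans mult_left_mono)
 qed (use f in \<open>auto simp: deriv_bound_def intro: Cb_inf_has_partial\<close>)
 then show ?thesis by (simp add: power2_eq_square mult.assoc)
qed

lemma line_deriv:
 assumes f: "deriv_bound 2 B f"
 shows "((\<lambda>s. f (p + s *\<^sub>R h)) has_real_derivative
  (\<Sum>b\<in>Basis. (h \<bullet> b) * partial_deriv UNIV b f (p + s *\<^sub>R h))) (at s)"
proof -
 define D where "D = (\<Sum>b\<in>Basis. (h \<bullet> b) * partial_deriv UNIV b f (p + s *\<^sub>R h))"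
 have est: "\<bar>(f (p + (s + r) *\<^sub>R h) - f (p + s *\<^sub>R h)) / r - D\<bar> \<le> B * (norm1 h)\<^sup>2 * \<bar>r\<bar>" if "r \<noteq> 0" for r
 proof -
  have "\<bar>f (p + (s + r) *\<^sub>R h) - f (p + s *\<^sub>R h) - r * D\<bar> \<le> B * (norm1 h)\<^sup>2 * r\<^sup>2"
   using Taylor2_norm1[OF f, of "p + s *\<^sub>R h" "r *\<^sub>R h"]
   by (simp add: D_def norm1_scaleR power_mult_distrib sum_distrib_left mult.assoc mult.left_commute
     scaleR_left_distrib add.assoc mult.commute)
  then have "\<bar>f (p + (s + r) *\<^sub>R h) - f (p + s *\<^sub>R h) - r * D\<bar> / \<bar>r\<bar> \<le> B * (norm1 h)\<^sup>2 * r\<^sup>2 / \<bar>r\<bar>"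
   by (rule divide_right_mono) auto
  also have "B * (norm1 h)\<^sup>2 * r\<^sup>2 / \<bar>r\<bar> = B * (norm1 h)\<^sup>2 * \<bar>r\<bar>"
   using that by (simp add: field_simps power2_eq_square flip: abs_mult)
  finally show ?thesis
   using that by (simp add: divide_diff_eq_iff flip: abs_divide) (simp add: diff_divide_distrib)
 qed
 have "((\<lambda>r. (f (p + (s + r) *\<^sub>R h) - f (p + s *\<^sub>R h)) / r) \<longlongrightarrow> D) (at 0)"
 proof (rule Lim_transform_bound[where g = "\<lambda>r. B * (norm1 h)\<^sup>2 * \<bar>r\<bar>", THEN LIM_zero_cancel])
  show "\<forall>\<^sub>F r in at 0. norm ((f (p + (s + r) *\<^sub>R h) - f (p + s *\<^sub>R h)) / r - D)
    \<le> norm (B * (norm1 h)\<^sup>2 * \<bar>r\<bar>)"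
   using est by (auto simp: eventually_at_filter intro!: always_eventually order_trans[OF _ abs_ge_self])
  show "((\<lambda>r. B * (norm1 h)\<^sup>2 * \<bar>r\<bar>) \<longlongrightarrow> 0) (at 0)"
   by (auto intro!: tendsto_eq_intros)
 qed
 then show ?thesis
  by (simp add: DERIV_def D_def)
qed

lemma Taylor3_norm1:
 assumes f: "deriv_bound 3 B f"
 shows "\<bar>f (p + h) - f p - (\<Sum>b\<in>Basis. (h \<bullet> b) * partial_deriv UNIV b f p)
   - 1 / 2 * (\<Sum>a\<in>Basis. \<Sum>b\<in>Basis. (h \<bullet> a) * (h \<bullet> b) * iter_partial UNIV [a, b] f p)\<bar> \<le> B * (norm1 h) ^ 3"
proof -
 have f2: "deriv_bound 2 B f" using deriv_bound_mono[OF f] by simp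
 have B: "0 \<le> B" using deriv_bound_nonneg[OF f] by simp
 define D where "D b q = partial_deriv UNIV b f q" for b q
 define H where "H = (\<Sum>a\<in>Basis. \<Sum>b\<in>Basis. (h \<bullet> a) * (h \<bullet> b) * iter_partial UNIV [a, b] f p)"
 define k where "k s = f (p + s *\<^sub>R h) - s * (\<Sum>b\<in>Basis. (h \<bullet> b) * D b p) - s\<^sup>2 / 2 * H" for s
 define k' where "k' s = (\<Sum>b\<in>Basis. (h \<bullet> b) * D b (p + s *\<^sub>R h)) - (\<Sum>b\<in>Basis. (h \<bullet> b) * D b p) - s * H" for s
 have dk: "(k has_real_derivative k' s) (at s)" for s
 proof -
  have *: "((\<lambda>s. f (p + s *\<^sub>R h)) has_real_derivative (\<Sum>b\<in>Basis. (h \<bullet> b) * D b (p + s *\<^sub>R h))) (at s)"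
   unfolding D_def by (rule line_deriv[OF f2])
  show ?thesis
   unfolding k_def[abs_def] k'_def by (rule derivative_eq_intros * refl | simp)+
 qed
 have "\<bar>k' s\<bar> \<le> B * (norm1 h) ^ 3" if s: "0 \<le> s" "s \<le> 1" for s
 proof -
  have H: "H = (\<Sum>b\<in>Basis. (h \<bullet> b) * (\<Sum>a\<in>Basis. (h \<bullet> a) * iter_partial UNIV [a, b] f p))"
   unfolding H_def by (subst sum.swap) (simp add: sum_distrib_left mult_ac)
  have "k' s = (\<Sum>b\<in>Basis. (h \<bullet> b) *
    (D b (p + s *\<^sub>R h) - D b p - (\<Sum>a\<in>Basis. ((s *\<^sub>R h) \<bullet> a) * partial_deriv UNIV a (D b) p)))"
   unfolding k'_def H D_def
   by (simp add: sum_subtractf[symmetric] sum_distrib_left right_diff_distrib mult_ac)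
  also have "\<bar>\<dots>\<bar> \<le> (\<Sum>b\<in>Basis. \<bar>h \<bullet> b\<bar> * (B * (norm1 h)\<^sup>2))"
  proof (rule order_trans[OF sum_abs], rule sum_mono)
   fix b assume b: "b \<in> (Basis :: 'a set)"
   have "deriv_bound 2 B (iter_partial UNIV [b] f)"
    using deriv_bound_partial[of 2 B f "[b]" 1 1] f b by (simp add: eval_nat_numeral)
   then have "deriv_bound 2 B (D b)" by (simp add: D_def[abs_def])
   from Taylor2_norm1[OF this, of p "s *\<^sub>R h"]
   have "\<bar>D b (p + s *\<^sub>R h) - D b p - (\<Sum>a\<in>Basis. ((s *\<^sub>R h) \<bullet> a) * partial_deriv UNIV a (D b) p)\<bar>
     \<le> B * (s * norm1 h)\<^sup>2"
    using s by (simp add: norm1_scaleR)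
   also have "\<dots> \<le> B * (norm1 h)\<^sup>2"
    using s B by (intro mult_left_mono power_mono) (auto simp: mult_left_le_one_le)
   finally show "\<bar>(h \<bullet> b) * (D b (p + s *\<^sub>R h) - D b p -
     (\<Sum>a\<in>Basis. ((s *\<^sub>R h) \<bullet> a) * partial_deriv UNIV a (D b) p))\<bar> \<le> \<bar>h \<bullet> b\<bar> * (B * (norm1 h)\<^sup>2)"
    unfolding abs_mult by (rule mult_left_mono) auto
  qed
  also have "\<dots> = B * (norm1 h) ^ 3"
   by (simp add: norm1_def sum_distrib_right[symmetric] power2_eq_square power3_eq_cube)
  finally show ?thesis .
 qed
 then have "\<bar>k 1 - k 0\<bar> \<le> B * (norm1 h) ^ 3 * \<bar>1 - 0\<bar>"
  using field_differentiable_bound[of "{0..1}" k k' "B * (norm1 h) ^ 3" 1 0] dk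
  by (auto simp: has_field_derivative_at_within)
 then show ?thesis
  by (simp add: k_def D_def H_def algebra_simps)
qed

section \<open>Convolution and mollification\<close>

definition conv :: "('a::euclidean_space => real) => ('a => real) => 'a => real" where
 "conv v k p = (LINT q|lborel. v q * k (p - q))"

definition smooth_kernel :: "('a::euclidean_space => real) => bool" where
 "smooth_kernel k \<longleftrightarrow> k \<in> Cb_inf UNIV \<and> (\<exists>R. \<forall>p. R < norm p --> k p = 0)"

definition bounded_borel :: "real => ('a::euclidean_space => real) => bool" where
 "bounded_borel M v \<longleftrightarrow> v \<in> borel_measurable borel \<and> (\<forall>q. \<bar>v q\<bar> \<le> M)"

lemma bounded_borel_nonneg: "bounded_borel M v ==> 0 \<le> M"
 unfolding bounded_borel_def by (meson abs_ge_zero order_trans)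

lemma bounded_borel_meas [measurable_dest]: "bounded_borel M v ==> v \<in> borel_measurable borel"
 by (simp add: bounded_borel_def)

lemma bounded_borelD: "bounded_borel M v ==> \<bar>v q\<bar> \<le> M"
 by (simp add: bounded_borel_def)

lemma Cb_inf_measurable: "f \<in> Cb_inf UNIV ==> f \<in> borel_measurable borel"
 by (intro borel_measurable_continuous_onI Cb_inf_cont)

lemma kernel_smooth: "smooth_kernel k ==> k \<in> Cb_inf UNIV"
 by (simp add: smooth_kernel_def)

lemma kernel_meas [measurable_dest]: "smooth_kernel k ==> k \<in> borel_measurable borel"
 by (simp add: smooth_kernel_def Cb_inf_measurable)

lemma kernel_support:
 assumes "smooth_kernel k"
 shows "\<exists>R>0. \<forall>p. R < norm p --> k p = 0"
proof -
 obtain R where "\<forall>p. R < norm p --> k p = 0"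
  using assms by (auto simp: smooth_kernel_def)
 then show ?thesis
  by (intro exI[of _ "max R 1"]) auto
qed

lemma partial_deriv_zero_open:
 assumes "open U" "\<And>q. q \<in> U ==> f q = 0" "p \<in> U"
 shows "partial_deriv UNIV b f p = 0"
proof -
 obtain e where e: "0 < e" "ball p e \<subseteq> U"
  using assms by (auto simp: open_contains_ball)
 have "((\<lambda>s. f (p + s *\<^sub>R b)) has_vector_derivative 0) (at 0)"
 proof (rule has_vector_derivative_transform_within[where f = "\<lambda>_. 0" and d = "e / (norm b + 1)"])
  show "0 < e / (norm b + 1)" using e by (auto simp: add_nonneg_pos)
  fix s :: real assume "dist s 0 < e / (norm b + 1)"
  then have "\<bar>s\<bar> * (norm b + 1) < e"
   by (simp add: pos_less_divide_eq add_nonneg_pos)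
  then have "\<bar>s\<bar> * norm b < e"
   by (simp add: distrib_left)
  then have "p + s *\<^sub>R b \<in> ball p e"
   by (simp add: dist_norm)
  then show "0 = f (p + s *\<^sub>R b)" using e assms(2) by auto
 qed auto
 then show ?thesis
  by (simp add: partial_deriv_def vector_derivative_at)
qed

lemma kernel_partial:
 assumes k: "smooth_kernel k" and b: "b \<in> Basis"
 shows "smooth_kernel (partial_deriv UNIV b k)"
proof -
 obtain R where R: "\<And>p. R < norm p ==> k p = 0"
  using k by (auto simp: smooth_kernel_def)
 have "open {p. R < norm p}"
  by (intro open_Collect_less continuous_intros)
 from partial_deriv_zero_open[OF this, of k] R
 show ?thesis
  using Cb_inf_partial[OF kernel_smooth[OF k] b] by (auto simp: smooth_kernel_def)
qed

lemma kernel_iter_partial: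
 assumes "smooth_kernel k" "vs \<in> lists Basis"
 shows "smooth_kernel (iter_partial UNIV vs k)"
 using assms(2) by (induction vs) (auto intro: kernel_partial assms(1))

lemma deriv_bound_exists:
 fixes f :: "'a::euclidean_space => real"
 assumes "f \<in> Cb_inf UNIV"
 obtains B where "0 \<le> B" "deriv_bound n B f" "\<And>p. \<bar>f p\<bar> \<le> B"
proof -
 define A :: "'a list set" where "A = {vs. set vs \<subseteq> Basis \<and> length vs \<le> n}"
 have fin: "finite A" unfolding A_def by (rule finite_lists_length_le) auto
 have "\<exists>B. \<forall>p. \<bar>iter_partial UNIV vs f p\<bar> \<le> B" if "vs \<in> A" for vs
  using Cb_inf_bdd[OF Cb_inf_iter_partial[OF assms]] that
  by (fastforce simp: A_def bounded_iff in_lists_conv_set)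
 then obtain C where C: "\<And>vs p. vs \<in> A ==> \<bar>iter_partial UNIV vs f p\<bar> \<le> C vs"
  by metis
 define B where "B = (\<Sum>vs\<in>A. \<bar>C vs\<bar>)"
 have B: "\<bar>iter_partial UNIV vs f p\<bar> \<le> B" if "vs \<in> A" for vs p
  using C[OF that, of p] member_le_sum[OF that _ fin, of "\<lambda>vs. \<bar>C vs\<bar>"] by (simp add: B_def)
 show thesis
 proof
  show "0 \<le> B" by (simp add: B_def sum_nonneg)
  show "deriv_bound n B f"
   unfolding deriv_bound_def using assms B by (auto simp: A_def in_lists_conv_set subset_iff)
  show "\<bar>f p\<bar> \<le> B" for p
   using B[of "[]" p] by (simp add: A_def)
 qed
qed

lemma integral_cball_bound:
 fixes g :: "'a::euclidean_space => real"
 assumes [measurable]: "g \<in> borel_measurable borel"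
  and B: "\<And>q. \<bar>g q\<bar> \<le> B" and supp: "\<And>q. q \<notin> cball p R ==> g q = 0" and R: "0 \<le> R"
 shows "integrable lborel g" "\<bar>LINT q|lborel. g q\<bar> \<le> B * (unit_ball_vol (DIM('a)) * R ^ DIM('a))"
proof -
 have fin: "integrable lborel (\<lambda>q. B * indicator (cball p R) q)"
  using emeasure_lborel_cball_finite[of p R] by (intro integrable_mult_right integrable_real_indicator) auto
 have le: "norm (g q) \<le> B * indicator (cball p R) q" for q
  using B[of q] supp[of q] by (auto simp: indicator_def)
 show int: "integrable lborel g"
  by (rule Bochner_Integration.integrable_bound[OF fin])
   (auto intro!: AE_I2 order_trans[OF le[unfolded real_norm_def] abs_ge_self])
 have "\<bar>LINT q|lborel. g q\<bar> \<le> (LINT q|lborel. B * indicator (cball p R) q)"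
  by (rule integral_abs_bound_integral[OF int fin]) (use le in auto)
 then show "\<bar>LINT q|lborel. g q\<bar> \<le> B * (unit_ball_vol (DIM('a)) * R ^ DIM('a))"
  using R by (simp add: content_cball)
qed

lemma kernel_reflect_integrable:
 assumes k: "smooth_kernel k"
 shows "integrable lborel (\<lambda>q. k (p - q))" "integrable lborel k"
proof -
 have [measurable]: "k \<in> borel_measurable borel" using k by (rule kernel_meas)
 obtain R where R: "0 < R" "\<And>p. R < norm p ==> k p = 0" using kernel_support[OF k] by blast
 obtain B where B: "\<And>p. \<bar>k p\<bar> \<le> B" using deriv_bound_exists[OF kernel_smooth[OF k]] by metis
 show "integrable lborel (\<lambda>q. k (p - q))"
  by (rule integral_cball_bound(1)[where B = B and p = p and R = R])
   (use R B in \<open>auto simp: dist_norm\<close>)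
 show "integrable lborel k"
  by (rule integral_cball_bound(1)[where B = B and p = 0 and R = R])
   (use R B in \<open>auto simp: dist_norm\<close>)
qed

lemma conv_integrable:
 assumes k: "smooth_kernel k" and v: "bounded_borel M v"
 shows "integrable lborel (\<lambda>q. v q * k (p - q))" "integrable lborel (\<lambda>q. v (p - q) * k q)"
proof -
 have [measurable]: "k \<in> borel_measurable borel" "v \<in> borel_measurable borel"
  using kernel_meas[OF k] bounded_borel_meas[OF v] by auto
 have M: "0 \<le> M" using v by (rule bounded_borel_nonneg)
 have le: "norm (v q * x) \<le> norm (M * x)" for q x
  using bounded_borelD[OF v, of q] M by (auto simp: abs_mult intro!: mult_right_mono)
 have "integrable lborel (\<lambda>q. M * k (p - q))" "integrable lborel (\<lambda>q. M * k q)"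
  using kernel_reflect_integrable[OF k] by auto
 then show "integrable lborel (\<lambda>q. v q * k (p - q))" "integrable lborel (\<lambda>q. v (p - q) * k q)"
  by (auto intro!: Bochner_Integration.integrable_bound[OF _ _ AE_I2[OF le]])
qed

lemma conv_bound_exists:
 fixes k :: "'a::euclidean_space => real"
 assumes k: "smooth_kernel k"
 obtains C where "0 \<le> C" "\<And>v M p. bounded_borel M v ==> \<bar>conv v k p\<bar> \<le> C * M"
proof -
 have [measurable]: "k \<in> borel_measurable borel" using k by (rule kernel_meas)
 obtain R where R: "0 < R" "\<And>p. R < norm p ==> k p = 0" using kernel_support[OF k] by blast
 obtain B where B: "0 \<le> B" "\<And>p. \<bar>k p\<bar> \<le> B" using deriv_bound_exists[OF kernel_smooth[OF k]] by metis
 define V where "V = unit_ball_vol (DIM('a)) * R ^ DIM('a)"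
 have V: "0 \<le> V" using R by (simp add: V_def)
 show thesis
 proof
  show "0 \<le> B * V" using B V by simp
  fix v :: "'a => real" and M p assume v: "bounded_borel M v"
  have [measurable]: "v \<in> borel_measurable borel" using v by (rule bounded_borel_meas)
  have "\<bar>LINT q|lborel. v q * k (p - q)\<bar> \<le> (M * B) * V"
   unfolding V_def
   by (rule integral_cball_bound(2)[where p = p])
    (use R B bounded_borelD[OF v] bounded_borel_nonneg[OF v] in
     \<open>auto simp: dist_norm abs_mult intro!: mult_mono\<close>)
  then show "\<bar>conv v k p\<bar> \<le> B * V * M" by (simp add: conv_def mult_ac)
 qed
qed

lemma conv_lincomb_bound:
 fixes v :: "'a::euclidean_space => real"
 assumes v: "bounded_borel M v" and R: "0 \<le> R"
  and g: "g \<in> borel_measurable borel" "\<And>q. \<bar>g q\<bar> \<le> B" "\<And>q. R < norm q ==> g q = 0"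
 shows "\<bar>LINT q|lborel. v q * g (p - q)\<bar> \<le> M * B * (unit_ball_vol (DIM('a)) * R ^ DIM('a))"
proof -
 have [measurable]: "v \<in> borel_measurable borel" "g \<in> borel_measurable borel"
  using bounded_borel_meas[OF v] g by auto
 show ?thesis
  by (rule integral_cball_bound(2)[where p = p and B = "M * B"])
   (use R g(2,3) bounded_borelD[OF v] bounded_borel_nonneg[OF v] in
    \<open>auto simp: dist_norm abs_mult intro!: mult_mono\<close>)
qed

lemma conv_continuous:
 fixes k :: "'a::euclidean_space => real"
 assumes k: "smooth_kernel k" and v: "bounded_borel M v"
 shows "continuous_on UNIV (conv v k)"
proof -
 have [measurable]: "k \<in> borel_measurable borel" using k by (rule kernel_meas)
 obtain R where R: "0 < R" "\<And>p. R < norm p ==> k p = 0" using kernel_support[OF k] by blast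
 obtain B where B: "0 \<le> B" "deriv_bound 1 B k" using deriv_bound_exists[OF kernel_smooth[OF k]] by metis
 define V where "V = unit_ball_vol (DIM('a)) * (R + 1) ^ DIM('a)"
 have V: "0 \<le> V" using R by (simp add: V_def)
 have est: "\<bar>conv v k (p + h) - conv v k p\<bar> \<le> M * (B * norm1 h) * V" if h: "norm h \<le> 1" for p h
 proof -
  have "conv v k (p + h) - conv v k p = (LINT q|lborel. v q * (k (p - q + h) - k (p - q)))"
   unfolding conv_def right_diff_distrib
   using conv_integrable(1)[OF k v, of "p + h"] conv_integrable(1)[OF k v, of p]
   by (subst Bochner_Integration.integral_diff) (auto simp: algebra_simps)
  also have "\<bar>\<dots>\<bar> \<le> M * (B * norm1 h) * V"
   unfolding V_def
  proof (rule conv_lincomb_bound[OF v, where g = "\<lambda>q. k (q + h) - k q"])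
   fix q :: 'a assume "R + 1 < norm q"
   moreover have "norm q \<le> norm (q + h) + norm h" by (metis norm_triangle_sub add_diff_cancel norm_minus_commute add.commute)
   ultimately show "k (q + h) - k q = 0" using R h by simp
  qed (use Lipschitz_norm1[OF B(2)] R in auto)
  finally show ?thesis .
 qed
 show ?thesis
  unfolding continuous_on_def
 proof
  fix p :: 'a
  have lim: "((\<lambda>q. M * (B * (DIM('a) * norm (q - p))) * V) \<longlongrightarrow> 0) (at p)"
   by (auto intro!: tendsto_eq_intros)
  show "(conv v k \<longlongrightarrow> conv v k p) (at p within UNIV)"
  proof (rule LIM_zero_cancel, rule Lim_null_comparison[OF _ lim])
   have "\<forall>\<^sub>F q in at p. dist q p < 1"
    by (simp add: eventually_at) (use zero_less_one in blast)
   then show "\<forall>\<^sub>F q in at p. norm (conv v k q - conv v k p) \<le> M * (B * (DIM('a) * norm (q - p))) * V"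
   proof eventually_elim
    fix q assume "dist q p < 1"
    then have "\<bar>conv v k (p + (q - p)) - conv v k p\<bar> \<le> M * (B * norm1 (q - p)) * V"
     by (intro est) (simp add: dist_norm)
    also have "\<dots> \<le> M * (B * (DIM('a) * norm (q - p))) * V"
     using B V bounded_borel_nonneg[OF v]
     by (intro mult_right_mono mult_left_mono norm1_le) auto
    finally show "norm (conv v k q - conv v k p) \<le> M * (B * (DIM('a) * norm (q - p))) * V" by simp
   qed
  qed
 qed
qed

lemma conv_has_partial:
 fixes k :: "'a::euclidean_space => real"
 assumes k: "smooth_kernel k" and v: "bounded_borel M v" and b: "b \<in> Basis"
 shows "has_partial UNIV (conv v k) b (conv v (partial_deriv UNIV b k))"
proof -
 define k' where "k' = partial_deriv UNIV b k"
 have k': "smooth_kernel k'" using kernel_partial[OF k b] by (simp add: k'_def)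
 have [measurable]: "k \<in> borel_measurable borel" "k' \<in> borel_measurable borel"
  using k k' by (auto intro: kernel_meas)
 obtain R1 where R1: "0 < R1" "\<And>p. R1 < norm p ==> k p = 0" using kernel_support[OF k] by blast
 obtain R2 where R2: "0 < R2" "\<And>p. R2 < norm p ==> k' p = 0" using kernel_support[OF k'] by blast
 define R where "R = max R1 R2"
 obtain B where B: "0 \<le> B" "deriv_bound 2 B k" using deriv_bound_exists[OF kernel_smooth[OF k]] by metis
 define V where "V = unit_ball_vol (DIM('a)) * (R + 1) ^ DIM('a)"
 have est: "\<bar>conv v k (p + s *\<^sub>R b) - conv v k p - s * conv v k' p\<bar> \<le> M * (B * s\<^sup>2) * V" if s: "\<bar>s\<bar> \<le> 1" for p s
 proof -
  have "conv v k (p + s *\<^sub>R b) - conv v k p - s * conv v k' p =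
    (LINT q|lborel. v q * (k (p - q + s *\<^sub>R b) - k (p - q) - s * k' (p - q)))"
  proof -
   have "(LINT q|lborel. v q * (k (p - q + s *\<^sub>R b) - k (p - q) - s * k' (p - q))) =
     (LINT q|lborel. v q * k (p + s *\<^sub>R b - q) - v q * k (p - q) - s * (v q * k' (p - q)))"
    by (rule Bochner_Integration.integral_cong) (auto simp: algebra_simps)
   then show ?thesis
    unfolding conv_def
    using conv_integrable(1)[OF k v, of "p + s *\<^sub>R b"] conv_integrable(1)[OF k v, of p]
     conv_integrable(1)[OF k' v, of p] by simp
  qed
  also have "\<bar>\<dots>\<bar> \<le> M * (B * s\<^sup>2) * V"
   unfolding V_def
  proof (rule conv_lincomb_bound[OF v, where g = "\<lambda>q. k (q + s *\<^sub>R b) - k q - s * k' q"])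
   fix q :: 'a assume q: "R + 1 < norm q"
   have "norm q \<le> norm (q + s *\<^sub>R b) + norm (s *\<^sub>R b)"
    by (metis norm_triangle_sub add_diff_cancel norm_minus_commute add.commute)
   moreover have "norm (s *\<^sub>R b) \<le> 1" using s b by simp
   ultimately have "R < norm (q + s *\<^sub>R b)" "R < norm q" using q by linarith+
   then show "k (q + s *\<^sub>R b) - k q - s * k' q = 0"
    using R1 R2 by (simp add: R_def)
  next
   fix q
   have n1: "norm1 (s *\<^sub>R b) = \<bar>s\<bar>"
    using b by (simp add: norm1_def inner_Basis if_distrib abs_mult sum.delta cong: if_cong)
   have "(\<Sum>a\<in>Basis. ((s *\<^sub>R b) \<bullet> a) * partial_deriv UNIV a k q) =
     (\<Sum>a\<in>Basis. if a = b then s * k' q else 0)"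
    using b by (intro sum.cong) (auto simp: inner_Basis k'_def)
   then have "(\<Sum>a\<in>Basis. ((s *\<^sub>R b) \<bullet> a) * partial_deriv UNIV a k q) = s * k' q"
    using b by simp
   with Taylor2_norm1[OF B(2), of q "s *\<^sub>R b"] n1
   show "\<bar>k (q + s *\<^sub>R b) - k q - s * k' q\<bar> \<le> B * s\<^sup>2" by simp
  qed (use R1 in \<open>auto simp: R_def\<close>)
  finally show ?thesis .
 qed
 show ?thesis
  unfolding has_partial_def k'_def[symmetric]
 proof
  fix p
  have "((\<lambda>s. (conv v k (p + s *\<^sub>R b) - conv v k p) / s) \<longlongrightarrow> conv v k' p) (at 0)"
  proof (rule LIM_zero_cancel, rule Lim_null_comparison)
   show "((\<lambda>s. M * B * V * \<bar>s\<bar>) \<longlongrightarrow> 0) (at 0)"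
    by (auto intro!: tendsto_eq_intros)
   have "\<forall>\<^sub>F s in at (0::real). s \<noteq> 0 \<and> \<bar>s\<bar> \<le> 1"
    unfolding eventually_at by (rule exI[of _ 1]) (auto simp: dist_norm)
   then show "\<forall>\<^sub>F s in at 0. norm ((conv v k (p + s *\<^sub>R b) - conv v k p) / s - conv v k' p) \<le> M * B * V * \<bar>s\<bar>"
   proof eventually_elim
    fix s :: real assume s: "s \<noteq> 0 \<and> \<bar>s\<bar> \<le> 1"
    have "\<bar>(conv v k (p + s *\<^sub>R b) - conv v k p) / s - conv v k' p\<bar> =
      \<bar>conv v k (p + s *\<^sub>R b) - conv v k p - s * conv v k' p\<bar> / \<bar>s\<bar>"
     using s by (simp add: diff_divide_distrib flip: abs_divide)
    also have "\<dots> \<le> M * (B * s\<^sup>2) * V / \<bar>s\<bar>"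
     using est[of s p] s by (intro divide_right_mono) auto
    also have "\<dots> = M * B * V * \<bar>s\<bar>"
     using s by (simp add: field_simps power2_eq_square flip: abs_mult)
    finally show "norm ((conv v k (p + s *\<^sub>R b) - conv v k p) / s - conv v k' p) \<le> M * B * V * \<bar>s\<bar>"
     by simp
   qed
  qed
  then have "((\<lambda>s. conv v k (p + s *\<^sub>R b)) has_real_derivative conv v k' p) (at 0)"
   by (simp add: DERIV_def)
  then show "((\<lambda>s. conv v k (p + s *\<^sub>R b)) has_vector_derivative conv v k' p)
    (at 0 within {s. p + s *\<^sub>R b \<in> UNIV})"
   by (simp add: has_real_derivative_iff_has_vector_derivative)
 qed
qed

text \<open>The derivatives of a convolution are convolutions with the derivatives of the kernel, so the
 coinduction rule applies to the family of all convolutions of \<open>v\<close>.\<close>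

lemma conv_smooth:
 assumes k: "smooth_kernel k" and v: "bounded_borel M v"
 shows "conv v k \<in> Cb_inf UNIV"
proof (rule Cb_infI[OF thick_UNIV, where F = "conv v ` {k. smooth_kernel k}"])
 fix h b assume "h \<in> conv v ` {k. smooth_kernel k}" and b: "b \<in> (Basis :: 'a set)"
 then obtain k where h: "h = conv v k" and k: "smooth_kernel k" by blast
 show "\<exists>g\<in>conv v ` {k. smooth_kernel k}. has_partial UNIV h b g"
  unfolding h using conv_has_partial[OF k v b] kernel_partial[OF k b] by blast
next
 fix h assume "h \<in> conv v ` {k. smooth_kernel k}"
 then obtain k where h: "h = conv v k" and k: "smooth_kernel k" by blast
 show "continuous_on UNIV h" unfolding h by (rule conv_continuous[OF k v])
 obtain C where "\<And>p. \<bar>conv v k p\<bar> \<le> C * M" using conv_bound_exists[OF k] v by metis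
 then show "bounded (range h)" unfolding h by (auto simp: bounded_iff)
qed (use k in auto)

lemma conv_iter_partial:
 assumes k: "smooth_kernel k" and v: "bounded_borel M v" and vs: "vs \<in> lists Basis"
 shows "iter_partial UNIV vs (conv v k) = conv v (iter_partial UNIV vs k)"
 using vs
proof (induction vs)
 case (Cons b vs)
 then show ?case
  using has_partial_unique[OF thick_UNIV _ conv_has_partial[OF kernel_iter_partial[OF k] v]] by auto
qed simp

text \<open>The constant depends on the kernel alone. The barriers rely on this: they need bounds that do
 not deteriorate with the step of the scheme.\<close>

lemma conv_deriv_bound_exists:
 fixes k :: "'a::euclidean_space => real"
 assumes k: "smooth_kernel k"
 obtains C where "0 \<le> C" "\<And>v M. bounded_borel M v ==> deriv_bound n (C * M) (conv v k)"
  "\<And>v M p. bounded_borel M v ==> \<bar>conv v k p\<bar> \<le> C * M"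
proof -
 define A :: "'a list set" where "A = {vs. set vs \<subseteq> Basis \<and> length vs \<le> n}"
 have fin: "finite A" unfolding A_def by (rule finite_lists_length_le) auto
 have A: "vs \<in> A \<longleftrightarrow> vs \<in> lists Basis \<and> length vs \<le> n" for vs
  by (auto simp: A_def in_lists_conv_set)
 have "\<exists>C\<ge>0. \<forall>v M p. bounded_borel M v --> \<bar>conv v (iter_partial UNIV vs k) p\<bar> \<le> C * M"
  if "vs \<in> A" for vs
  using conv_bound_exists[OF kernel_iter_partial[OF k]] that A by metis
 then obtain C where C: "\<And>vs. vs \<in> A ==> 0 \<le> C vs"
   "\<And>vs v M p. vs \<in> A ==> bounded_borel M v ==> \<bar>conv v (iter_partial UNIV vs k) p\<bar> \<le> C vs * M"
  by metis
 have *: "\<bar>iter_partial UNIV vs (conv v k) p\<bar> \<le> sum C A * M" if "vs \<in> A" "bounded_borel M v" for vs v M p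
 proof -
  have "C vs \<le> sum C A" using that C by (intro member_le_sum fin) auto
  then show ?thesis
   using C(2)[OF that, of p] conv_iter_partial[OF k that(2), of vs] that(1) A
    bounded_borel_nonneg[OF that(2)] mult_right_mono[of "C vs" "sum C A" M] by fastforce
 qed
 show thesis
 proof
  show "0 \<le> sum C A" using C by (simp add: sum_nonneg)
  show "deriv_bound n (sum C A * M) (conv v k)" if "bounded_borel M v" for v M
   unfolding deriv_bound_def using conv_smooth[OF k that] * that A by blast
  show "\<bar>conv v k p\<bar> \<le> sum C A * M" if "bounded_borel M v" for v M p
   using *[of "[]", OF _ that] A by simp
 qed
qed

lemma lborel_integral_reflect:
 fixes f :: "'a::euclidean_space => real"
 assumes [measurable]: "f \<in> borel_measurable borel"
 shows "(LINT q|lborel. f (p - q)) = (LINT q|lborel. f q)"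
proof -
 have "lborel = density (distr lborel borel (\<lambda>x::'a. p - x)) (\<lambda>_. 1)"
  using lborel_affine[of "- 1" p] by simp
 then have "(LINT q|lborel. f q) = (LINT q|density (distr lborel borel (\<lambda>x. p - x)) (\<lambda>_. 1). f q)"
  by simp
 also have "\<dots> = (LINT q|lborel. f (p - q))"
  by (simp add: density_1 integral_distr)
 finally show ?thesis by simp
qed

lemma conv_alt:
 assumes "smooth_kernel k" "bounded_borel M v"
 shows "conv v k p = (LINT q|lborel. v (p - q) * k q)"
proof -
 have [measurable]: "k \<in> borel_measurable borel" "v \<in> borel_measurable borel"
  using assms by (auto intro: kernel_meas bounded_borel_meas)
 show ?thesis
  unfolding conv_def using lborel_integral_reflect[of "\<lambda>q. v q * k (p - q)" p] by simp
qed

lemma bounded_borel_shift: "bounded_borel M v ==> bounded_borel M (\<lambda>q. v (q + a))"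
 unfolding bounded_borel_def by (auto intro: measurable_compose[OF _ _, of "\<lambda>q. q + a" borel borel v borel])

lemma conv_shift:
 assumes "smooth_kernel k" "bounded_borel M v"
 shows "conv (\<lambda>q. v (q + a)) k p = conv v k (p + a)"
 by (simp add: conv_alt[OF assms(1) bounded_borel_shift[OF assms(2)]] conv_alt[OF assms] algebra_simps)

lemma bounded_borel_add:
 "bounded_borel M v ==> bounded_borel N w ==> bounded_borel (M + N) (\<lambda>q. v q + w q)"
 "bounded_borel M v ==> bounded_borel (\<bar>c\<bar> * M) (\<lambda>q. c * v q)"
 "bounded_borel M v ==> bounded_borel N w ==> bounded_borel (M + N) (\<lambda>q. v q - w q)"
 unfolding bounded_borel_def
 by (auto intro: order_trans[OF abs_triangle_ineq] order_trans[OF abs_triangle_ineq4] add_mono mult_left_mono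
   simp: abs_mult)

lemma conv_linear:
 assumes k: "smooth_kernel k" and v: "bounded_borel M v" and w: "bounded_borel N w"
 shows "conv (\<lambda>q. v q + w q) k p = conv v k p + conv w k p"
  "conv (\<lambda>q. c * v q) k p = c * conv v k p"
  "conv (\<lambda>q. v q - w q) k p = conv v k p - conv w k p"
 unfolding conv_def using conv_integrable(1)[OF k v, of p] conv_integrable(1)[OF k w, of p]
 by (simp_all add: distrib_right left_diff_distrib mult.assoc)

subsection \<open>Averaging kernels\<close>

text \<open>Convolution with such a kernel averages the values at the points \<open>(t + \<sigma>, c + e)\<close> with
 \<open>0 \<le> \<sigma> \<le> \<epsilon>\<^sup>2\<close> and \<open>\<bar>e\<bar> < \<epsilon>\<close>: the future is seen, the past is not.\<close>

definition averaging :: "real => (real \<times> 'b::euclidean_space => real) => bool" where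
 "averaging \<epsilon> k \<longleftrightarrow> smooth_kernel k \<and> (\<forall>p. 0 \<le> k p) \<and> (LINT p|lborel. k p) = 1 \<and>
   (\<forall>\<tau> e. k (\<tau>, e) \<noteq> 0 --> - \<epsilon>\<^sup>2 \<le> \<tau> \<and> \<tau> \<le> 0 \<and> norm e < \<epsilon>)"

lemma averaging_kernel: "averaging \<epsilon> k ==> smooth_kernel k"
 by (simp add: averaging_def)

lemma conv_mono_avg:
 assumes k: "averaging \<epsilon> k" and v: "bounded_borel M v" and w: "bounded_borel N w"
  and le: "\<And>\<sigma> e. 0 \<le> \<sigma> ==> \<sigma> \<le> \<epsilon>\<^sup>2 ==> norm e < \<epsilon> ==> v (t + \<sigma>, c + e) \<le> w (t' + \<sigma>, c' + e)"
 shows "conv v k (t, c) \<le> conv w k (t', c')"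
 unfolding conv_alt[OF averaging_kernel[OF k] v] conv_alt[OF averaging_kernel[OF k] w]
proof (rule integral_mono)
 fix q :: "real \<times> 'a" obtain \<tau> e where q: "q = (\<tau>, e)" by fastforce
 have "v ((t, c) - (\<tau>, e)) \<le> w ((t', c') - (\<tau>, e))" if "k (\<tau>, e) \<noteq> 0"
 proof -
  have "- \<epsilon>\<^sup>2 \<le> \<tau> \<and> \<tau> \<le> 0 \<and> norm e < \<epsilon>" using k that unfolding averaging_def by blast
  then show ?thesis using le[of "- \<tau>" "- e"] by simp
 qed
 moreover have "0 \<le> k (\<tau>, e)" using k unfolding averaging_def by blast
 ultimately show "v ((t, c) - q) * k q \<le> w ((t', c') - q) * k q"
  unfolding q by (cases "k (\<tau>, e) = 0") (simp_all add: mult_right_mono)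
qed (use conv_integrable(2) averaging_kernel[OF k] v w in blast)+

lemma conv_const:
 assumes k: "averaging \<epsilon> k"
 shows "conv (\<lambda>_. c) k p = c"
proof -
 have "smooth_kernel k" using k by (rule averaging_kernel)
 then have [measurable]: "k \<in> borel_measurable borel" by (rule kernel_meas)
 show ?thesis
  using lborel_integral_reflect[of k p] k by (simp add: conv_def averaging_def)
qed

lemma bounded_borel_const: "bounded_borel \<bar>c\<bar> (\<lambda>_. c)"
 by (simp add: bounded_borel_def)

lemma conv_le_avg:
 assumes k: "averaging \<epsilon> k" and v: "bounded_borel M v"
  and le: "\<And>\<sigma> e. 0 \<le> \<sigma> ==> \<sigma> \<le> \<epsilon>\<^sup>2 ==> norm e < \<epsilon> ==> v (t + \<sigma>, c + e) \<le> a"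
 shows "conv v k (t, c) \<le> a"
 using conv_mono_avg[OF k v bounded_borel_const, of t c a t c] le conv_const[OF k] by simp

lemma conv_ge_avg:
 assumes k: "averaging \<epsilon> k" and v: "bounded_borel M v"
  and le: "\<And>\<sigma> e. 0 \<le> \<sigma> ==> \<sigma> \<le> \<epsilon>\<^sup>2 ==> norm e < \<epsilon> ==> a \<le> v (t + \<sigma>, c + e)"
 shows "a \<le> conv v k (t, c)"
 using conv_mono_avg[OF k bounded_borel_const v, of a t c t c] le conv_const[OF k] by simp

lemma Cb_inf_compose_diag:
 fixes f :: "'a::euclidean_space => real"
 assumes f: "f \<in> Cb_inf UNIV" and D: "linear D" "\<And>b. b \<in> Basis ==> D b = r b *\<^sub>R b"
 shows "(\<lambda>p. c * f (D p)) \<in> Cb_inf UNIV"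
proof (rule Cb_infI[OF thick_UNIV, where F = "{(\<lambda>p. c * f (D p)) |c f. f \<in> Cb_inf UNIV}"])
 fix h b assume "h \<in> {(\<lambda>p. c * f (D p)) |c f. f \<in> Cb_inf UNIV}" and b: "b \<in> (Basis :: 'a set)"
 then obtain c f where h: "h = (\<lambda>p. c * f (D p))" and f: "f \<in> Cb_inf UNIV" by blast
 have "has_partial UNIV h b (\<lambda>p. (c * r b) * partial_deriv UNIV b f (D p))"
  unfolding has_partial_def
 proof
  fix p
  have "((\<lambda>s. f (D p + s *\<^sub>R b)) has_real_derivative partial_deriv UNIV b f (D p)) (at (r b * 0))"
   using has_partial_line[OF Cb_inf_has_partial[OF f b], of "D p" 0] by simp
  from DERIV_chain2[OF this DERIV_cmult_Id[of "r b" 0]]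
  have "((\<lambda>s. c * f (D p + (r b * s) *\<^sub>R b)) has_real_derivative c * (partial_deriv UNIV b f (D p) * r b)) (at 0)"
   by (rule DERIV_cmult)
  moreover have "D p + (r b * s) *\<^sub>R b = D (p + s *\<^sub>R b)" for s
   by (simp add: linear_add[OF D(1)] linear_scale[OF D(1)] D(2)[OF b] mult.commute)
  ultimately show "((\<lambda>s. h (p + s *\<^sub>R b)) has_vector_derivative c * r b * partial_deriv UNIV b f (D p))
    (at 0 within {s. p + s *\<^sub>R b \<in> UNIV})"
   by (simp add: h has_real_derivative_iff_has_vector_derivative mult_ac)
 qed
 then show "\<exists>g\<in>{(\<lambda>p. c * f (D p)) |c f. f \<in> Cb_inf UNIV}. has_partial UNIV h b g"
  by (intro bexI[of _ "\<lambda>p. (c * r b) * partial_deriv UNIV b f (D p)"]) (use Cb_inf_partial[OF f b] in blast)+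
next
 fix h assume "h \<in> {(\<lambda>p. c * f (D p)) |c f. f \<in> Cb_inf UNIV}"
 then obtain c f where h: "h = (\<lambda>p. c * f (D p))" and f: "f \<in> Cb_inf UNIV" by blast
 show "continuous_on UNIV h"
  unfolding h
  by (intro continuous_intros continuous_on_compose2[OF Cb_inf_cont[OF f] linear_continuous_on])
   (use D(1) in \<open>auto simp: linear_conv_bounded_linear\<close>)
 obtain B where B: "\<And>p. \<bar>f p\<bar> \<le> B" using Cb_inf_bdd[OF f] by (auto simp: bounded_iff)
 have "\<bar>c * f (D p)\<bar> \<le> \<bar>c\<bar> * B" for p
  using B by (auto simp: abs_mult intro: mult_left_mono)
 then show "bounded (range h)" unfolding h by (auto simp: bounded_iff)
qed (use f in blast)

lemma iter_partial_zero_open: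
 assumes "open U" "\<And>q. q \<in> U ==> f q = 0" "p \<in> U"
 shows "iter_partial UNIV vs f p = 0"
 using assms(3)
proof (induction vs arbitrary: p)
 case (Cons v vs)
 then show ?case using partial_deriv_zero_open[OF assms(1)] by simp
qed (use assms in simp)

lemma mollifier_kernel:
 fixes \<rho> :: "real \<times> 'n::finite space => real"
 assumes \<rho>: "mollifier \<rho>"
 shows "smooth_kernel \<rho>" "\<rho> (\<tau>, e) \<noteq> 0 ==> -1 \<le> \<tau> \<and> \<tau> \<le> 0 \<and> norm e < 1"
proof -
 define K where "K = closure {p. \<rho> p \<noteq> 0}"
 have KS: "K \<subseteq> {-1..0} \<times> cball 0 1" using \<rho> by (simp add: mollifier_def K_def)
 have "compact ({-1..0::real} \<times> cball (0 :: 'n space) 1)" by (intro compact_Times) auto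
 then have K: "compact K" using KS unfolding K_def by (metis closed_closure compact_Int_closed inf.absorb_iff2)
 have zero: "\<rho> p = 0" if "p \<notin> K" for p
 proof (rule ccontr)
  assume "\<rho> p \<noteq> 0"
  then have "p \<in> closure {p. \<rho> p \<noteq> 0}" by (intro subsetD[OF closure_subset]) simp
  with that show False by (simp add: K_def)
 qed
 have it0: "iter_partial UNIV vs \<rho> p = 0" if "p \<notin> K" for p vs
 proof (rule iter_partial_zero_open[of "- K"])
  show "open (- K)" by (simp add: K_def open_Compl)
  show "\<rho> q = 0" if "q \<in> - K" for q using zero that by simp
  show "p \<in> - K" using that by simp
 qed
 have cont: "continuous_on UNIV (iter_partial UNIV vs \<rho>)" if "vs \<in> lists Basis" for vs
  using \<rho> that unfolding mollifier_def cont_diff_def by blast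
 have "bounded (range (iter_partial UNIV vs \<rho>))" if vs: "vs \<in> lists Basis" for vs
 proof -
  have "compact (iter_partial UNIV vs \<rho> ` K)"
   by (rule compact_continuous_image[OF continuous_on_subset[OF cont[OF vs]] K]) auto
  then have "bounded (insert 0 (iter_partial UNIV vs \<rho> ` K))"
   by (simp add: compact_imp_bounded)
  then show ?thesis
   by (rule bounded_subset) (use it0 in blast)
 qed
 then have sm: "\<rho> \<in> Cb_inf UNIV"
  using \<rho> unfolding Cb_inf_def Cb_diff_def mollifier_def by blast
 obtain R where "\<forall>p\<in>K. norm p \<le> R" using compact_imp_bounded[OF K] by (auto simp: bounded_iff)
 then have "\<forall>p. R < norm p --> \<rho> p = 0" using zero by (meson not_le)
 with sm show "smooth_kernel \<rho>" by (auto simp: smooth_kernel_def)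
 assume ne: "\<rho> (\<tau>, e) \<noteq> 0"
 then have "(\<tau>, e) \<in> K" using zero by blast
 then have 1: "-1 \<le> \<tau>" "\<tau> \<le> 0" "norm e \<le> 1" using KS by auto
 have "norm e \<noteq> 1"
 proof
  assume e: "norm e = 1"
  have "(\<lambda>n. (\<tau>, (1 + 1 / real (Suc n)) *\<^sub>R e)) \<longlonglongrightarrow> (\<tau>, (1 + 0) *\<^sub>R e)"
   by (intro tendsto_intros LIMSEQ_Suc[OF lim_1_over_n])
  then have "(\<lambda>n. \<rho> (\<tau>, (1 + 1 / real (Suc n)) *\<^sub>R e)) \<longlonglongrightarrow> \<rho> (\<tau>, (1 + 0) *\<^sub>R e)"
   using Cb_inf_cont[OF sm] by (intro continuous_on_tendsto_compose[of UNIV \<rho>]) auto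
  moreover have "\<rho> (\<tau>, (1 + 1 / real (Suc n)) *\<^sub>R e) = 0" for n
  proof -
   have "norm ((1 + 1 / real (Suc n)) *\<^sub>R e) = 1 + 1 / real (Suc n)"
    using e by (simp add: abs_of_pos add_pos_pos)
   moreover have "0 < 1 / real (Suc n)" by simp
   ultimately have "1 < norm ((1 + 1 / real (Suc n)) *\<^sub>R e)" by linarith
   then have "(\<tau>, (1 + 1 / real (Suc n)) *\<^sub>R e) \<notin> {-1..0} \<times> cball 0 1"
    by (metis mem_Sigma_iff mem_cball_0 not_less)
   then have "(\<tau>, (1 + 1 / real (Suc n)) *\<^sub>R e) \<notin> K" using KS by blast
   then show ?thesis by (rule zero)
  qed
  ultimately have "\<rho> (\<tau>, e) = 0" by (simp add: LIMSEQ_const_iff)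
  with ne show False by blast
 qed
 with 1 show "-1 \<le> \<tau> \<and> \<tau> \<le> 0 \<and> norm e < 1" by auto
qed

lemma DIM_space: "DIM('n::finite space) = 3 * CARD('n)"
 by simp

lemma rescaled_averaging:
 fixes \<rho> :: "real \<times> 'n::finite space => real"
 assumes \<rho>: "mollifier \<rho>" and \<epsilon>: "0 < \<epsilon>"
 shows "averaging \<epsilon> (rescaled \<rho> \<epsilon>)"
proof -
 define N where "N = 2 + 3 * CARD('n)"
 define c where "c = 1 / \<epsilon> ^ N"
 define D :: "real \<times> 'n space => real \<times> 'n space" where "D p = (fst p / \<epsilon>\<^sup>2, snd p /\<^sub>R \<epsilon>)" for p
 define r :: "real \<times> 'n space => real" where "r b = (if b = (1, 0) then 1 / \<epsilon>\<^sup>2 else 1 / \<epsilon>)" for b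
 have resc: "rescaled \<rho> \<epsilon> = (\<lambda>p. c * \<rho> (D p))"
  by (auto simp: rescaled_def c_def D_def N_def fun_eq_iff)
 have lin: "linear D"
  by (auto simp: D_def linear_iff add_divide_distrib scaleR_add_right mult_ac)
 have Db: "D b = r b *\<^sub>R b" if "b \<in> Basis" for b
  using that \<epsilon> by (auto simp: D_def r_def Basis_prod_def zero_prod_def divide_inverse)
 note k = mollifier_kernel[OF \<rho>]
 have sm: "rescaled \<rho> \<epsilon> \<in> Cb_inf UNIV"
  unfolding resc by (rule Cb_inf_compose_diag[OF kernel_smooth[OF k(1)] lin Db])
 have supp: "- \<epsilon>\<^sup>2 \<le> \<tau> \<and> \<tau> \<le> 0 \<and> norm e < \<epsilon>" if "rescaled \<rho> \<epsilon> (\<tau>, e) \<noteq> 0" for \<tau> e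
 proof -
  have "\<rho> (\<tau> / \<epsilon>\<^sup>2, e /\<^sub>R \<epsilon>) \<noteq> 0" using that by (auto simp: resc D_def)
  from k(2)[OF this] have "-1 \<le> \<tau> / \<epsilon>\<^sup>2" "\<tau> / \<epsilon>\<^sup>2 \<le> 0" "norm (e /\<^sub>R \<epsilon>) < 1" by auto
  then show ?thesis
   using \<epsilon> by (auto simp: field_simps)
 qed
 have ker: "smooth_kernel (rescaled \<rho> \<epsilon>)"
  unfolding smooth_kernel_def
 proof (intro conjI sm exI allI impI)
  fix p :: "real \<times> 'n space" assume R: "\<epsilon>\<^sup>2 + \<epsilon> < norm p"
  have "norm p \<le> norm (fst p) + norm (snd p)"
   by (metis norm_Pair_le prod.collapse)
  then show "rescaled \<rho> \<epsilon> p = 0"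
   using R supp[of "fst p" "snd p"] by fastforce
 qed
 have [measurable]: "\<rho> \<in> borel_measurable borel" using kernel_meas[OF k(1)] .
 have T: "0 + (\<Sum>j\<in>Basis. (r j * (x \<bullet> j)) *\<^sub>R j) = D x" for x
 proof -
  have "D x = D (\<Sum>j\<in>Basis. (x \<bullet> j) *\<^sub>R j)" by (simp add: euclidean_representation)
  also have "\<dots> = (\<Sum>j\<in>Basis. (r j * (x \<bullet> j)) *\<^sub>R j)"
   by (simp add: linear_sum[OF lin] linear_scale[OF lin] Db mult.commute)
  finally show ?thesis by simp
 qed
 have rprod: "(\<Prod>j\<in>Basis. \<bar>r j\<bar>) = c"
 proof -
  have "(\<Prod>j\<in>Basis. \<bar>r j\<bar>) = \<bar>r (1, 0)\<bar> * (\<Prod>v\<in>(Basis :: 'n space set). \<bar>r (0, v)\<bar>)"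
   unfolding Basis_prod_def
   by (subst prod.union_disjoint) (auto simp: prod.reindex inj_on_def)
  also have "\<dots> = 1 / \<epsilon>\<^sup>2 * (1 / \<epsilon>) ^ DIM('n space)"
   using \<epsilon> by (simp add: r_def del: DIM_prod)
  also have "\<dots> = c"
   by (simp add: c_def N_def DIM_space power_add power_one_over power2_eq_square del: DIM_prod)
  finally show ?thesis .
 qed
 have cpos: "0 < c" using \<epsilon> by (simp add: c_def)
 have [measurable]: "D \<in> borel_measurable borel"
  using lin by (intro borel_measurable_continuous_onI linear_continuous_on) (simp add: linear_conv_bounded_linear)
 have "(lborel :: (real \<times> 'n space) measure) = density (distr lborel borel (\<lambda>x. 0 + (\<Sum>j\<in>Basis. (r j * (x \<bullet> j)) *\<^sub>R j)))
   (\<lambda>_. (\<Prod>j\<in>Basis. \<bar>r j\<bar>))"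
  using \<epsilon> by (intro lborel_affine_euclidean) (auto simp: r_def)
 then have lb: "(lborel :: (real \<times> 'n space) measure) = density (distr lborel borel D) (\<lambda>_. ennreal c)"
  unfolding T rprod by simp
 have "1 = (LINT p|lborel. \<rho> p)" using \<rho> by (simp add: mollifier_def)
 also have "\<dots> = (LINT p|density (distr lborel borel D) (\<lambda>_. ennreal c). \<rho> p)"
  using lb by simp
 also have "\<dots> = (LINT p|lborel. c * \<rho> (D p))"
  using cpos by (simp add: integral_density integral_distr)
 finally have one: "(LINT p|lborel. rescaled \<rho> \<epsilon> p) = 1" by (simp add: resc)
 have "0 \<le> rescaled \<rho> \<epsilon> p" for p
 proof -
  have "0 \<le> \<rho> q" for q using \<rho> unfolding mollifier_def by blast
  then show ?thesis using cpos by (simp add: resc)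
 qed
 with ker one supp show ?thesis by (auto simp: averaging_def)
qed

text \<open>A mollification at a time \<open>t \<ge> 0\<close> does not see the extension to negative times; it makes the
 function bounded and measurable on the whole space.\<close>

definition clamp_time :: "(real \<times> 'b => real) => real \<times> 'b => real" where
 "clamp_time v = (\<lambda>(t, e). v (max 0 (min 1 t), e))"

lemma mollify_eq_conv:
 fixes \<rho> :: "real \<times> 'n::finite space => real"
 assumes \<rho>: "mollifier \<rho>" and \<epsilon>: "0 < \<epsilon>" and v: "bounded_borel M (clamp_time v)" and t: "0 \<le> t"
 shows "mollify \<rho> \<epsilon> v (t, c) = conv (clamp_time v) (rescaled \<rho> \<epsilon>) (t, c)"
proof -
 define k where "k = rescaled \<rho> \<epsilon>"
 have k: "averaging \<epsilon> k" unfolding k_def by (rule rescaled_averaging[OF \<rho> \<epsilon>])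
 have supp: "- \<epsilon>\<^sup>2 \<le> \<tau> \<and> \<tau> \<le> 0 \<and> norm e < \<epsilon>" if "k (\<tau>, e) \<noteq> 0" for \<tau> e
  using k that unfolding averaging_def by blast
 have "conv (clamp_time v) k (t, c) = (LINT q|lborel. clamp_time v ((t, c) - q) * k q)"
  by (rule conv_alt[OF averaging_kernel[OF k] v])
 also have "\<dots> = (LINT \<tau>|lborel. LINT e|lborel. clamp_time v ((t, c) - (\<tau>, e)) * k (\<tau>, e))"
 proof -
  have lb: "(lborel :: (real \<times> 'n space) measure) = lborel \<Otimes>\<^sub>M lborel" by (rule lborel_prod[symmetric])
  have "integrable (lborel \<Otimes>\<^sub>M lborel) (\<lambda>q. clamp_time v ((t, c) - q) * k q)"
   using conv_integrable(2)[OF averaging_kernel[OF k] v, of "(t, c)"] unfolding lb .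
  from lborel_pair.integral_fst'[OF this] show ?thesis unfolding lb by simp
 qed
 also have "\<dots> = (LINT \<tau>:{- \<epsilon>\<^sup>2..0}|lborel. LINT e:ball 0 \<epsilon>|lborel. v (min 1 (t - \<tau>), c - e) * k (\<tau>, e))"
  unfolding set_lebesgue_integral_def
 proof (rule Bochner_Integration.integral_cong[OF refl])
  fix \<tau> :: real
  have eq: "indicator {- \<epsilon>\<^sup>2..0} \<tau> *\<^sub>R (indicator (ball 0 \<epsilon>) e *\<^sub>R (v (min 1 (t - \<tau>), c - e) * k (\<tau>, e))) =
    clamp_time v ((t, c) - (\<tau>, e)) * k (\<tau>, e)" for e
  proof (cases "k (\<tau>, e) = 0")
   case False
   with supp have s: "- \<epsilon>\<^sup>2 \<le> \<tau>" "\<tau> \<le> 0" "norm e < \<epsilon>" by blast+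
   then have "max 0 (min 1 (t - \<tau>)) = min 1 (t - \<tau>)" using t by auto
   with s show ?thesis by (simp add: clamp_time_def)
  qed simp
  show "(LINT e|lborel. clamp_time v ((t, c) - (\<tau>, e)) * k (\<tau>, e)) = indicat_real {- \<epsilon>\<^sup>2..0} \<tau> *\<^sub>R
    (LINT e|lborel. indicat_real (ball 0 \<epsilon>) e *\<^sub>R (v (min 1 (t - \<tau>), c - e) * k (\<tau>, e)))"
   by (subst integral_scaleR_right[symmetric]) (simp only: eq)
 qed
 finally show ?thesis by (simp add: mollify_def k_def)
qed

section \<open>The operator on functions of the space variables\<close>

lemma iter_partial_embed:
 fixes f :: "'a::euclidean_space => real" and J :: "'b::euclidean_space => 'a"
 assumes J: "linear J" and S: "\<And>z. p + J z \<in> S"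
 shows "iter_partial UNIV vs (\<lambda>z. f (p + J z)) z = iter_partial S (map J vs) f (p + J z)"
proof (induction vs arbitrary: z)
 case (Cons v vs)
 have 1: "iter_partial UNIV vs (\<lambda>z. f (p + J z)) = (\<lambda>z. iter_partial S (map J vs) f (p + J z))"
  using Cons by blast
 have 2: "p + J (z + s *\<^sub>R v) = p + J z + s *\<^sub>R J v" for s
  by (simp add: linear_add[OF J] linear_scale[OF J] add.assoc)
 have "{s. p + J z + s *\<^sub>R J v \<in> S} = UNIV"
  using S[of "z + _ *\<^sub>R v"] by (simp add: 2)
 then show ?case
  by (simp add: 1 partial_deriv_def 2)
qed simp

lemma Cb_inf_embed:
 fixes f :: "'a::euclidean_space => real" and J :: "'b::euclidean_space => 'a"
 assumes f: "f \<in> Cb_inf S" and J: "linear J" and S: "\<And>z. p + J z \<in> S" and B: "\<And>b. b \<in> Basis ==> J b \<in> Basis"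
 shows "(\<lambda>z. f (p + J z)) \<in> Cb_inf UNIV"
proof (rule Cb_infI[OF thick_UNIV, where F = "{(\<lambda>z. f (p + J z)) |f. f \<in> Cb_inf S}"])
 fix h b assume "h \<in> {(\<lambda>z. f (p + J z)) |f. f \<in> Cb_inf S}" and b: "b \<in> (Basis :: 'b set)"
 then obtain f where h: "h = (\<lambda>z. f (p + J z))" and f: "f \<in> Cb_inf S" by blast
 have "has_partial UNIV h b (\<lambda>z. partial_deriv S (J b) f (p + J z))"
  unfolding has_partial_def
 proof
  fix z
  have 2: "p + J (z + s *\<^sub>R b) = p + J z + s *\<^sub>R J b" for s
   by (simp add: linear_add[OF J] linear_scale[OF J] add.assoc)
  have "{s. p + J z + s *\<^sub>R J b \<in> S} = UNIV"
   using S[of "z + _ *\<^sub>R b"] by (simp add: 2)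
  with Cb_inf_has_partial[OF f B[OF b], unfolded has_partial_def, rule_format, OF S[of z]]
  show "((\<lambda>s. h (z + s *\<^sub>R b)) has_vector_derivative partial_deriv S (J b) f (p + J z))
    (at 0 within {s. z + s *\<^sub>R b \<in> UNIV})"
   by (simp add: h 2)
 qed
 then show "\<exists>g\<in>{(\<lambda>z. f (p + J z)) |f. f \<in> Cb_inf S}. has_partial UNIV h b g"
  by (intro bexI[of _ "\<lambda>z. partial_deriv S (J b) f (p + J z)"]) (use Cb_inf_partial[OF f B[OF b]] in blast)+
next
 fix h assume "h \<in> {(\<lambda>z. f (p + J z)) |f. f \<in> Cb_inf S}"
 then obtain f where h: "h = (\<lambda>z. f (p + J z))" and f: "f \<in> Cb_inf S" by blast
 show "continuous_on UNIV h"
  unfolding h using J S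
  by (intro continuous_on_compose2[OF Cb_inf_cont[OF f]] continuous_intros linear_continuous_on)
   (auto simp: linear_conv_bounded_linear)
 show "bounded (range h)"
  unfolding h by (rule bounded_subset[OF Cb_inf_bdd[OF f]]) (use S in auto)
qed (use f in blast)

lemma deriv_bound_embed:
 fixes f :: "'a::euclidean_space => real" and J :: "'b::euclidean_space => 'a"
 assumes f: "deriv_bound k K f" and J: "linear J" and B: "\<And>b. b \<in> Basis ==> J b \<in> Basis"
 shows "deriv_bound k K (\<lambda>z. f (p + J z))"
proof -
 have "\<bar>iter_partial UNIV vs (\<lambda>z. f (p + J z)) z\<bar> \<le> K"
  if "vs \<in> lists Basis" "vs \<noteq> []" "length vs \<le> k" for vs z
 proof -
  have "map J vs \<in> lists Basis" using that B by (auto simp: in_lists_conv_set)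
  then have "\<bar>iter_partial UNIV (map J vs) f (p + J z)\<bar> \<le> K"
   using that by (intro deriv_boundD[OF f]) auto
  then show ?thesis using iter_partial_embed[OF J, of p UNIV vs f z] by simp
 qed
 then show ?thesis
  using Cb_inf_embed[OF deriv_bound_smooth[OF f] J _ B, of p] by (simp add: deriv_bound_def)
qed

lemma deriv_bound_add:
 assumes f: "deriv_bound k A f" and g: "deriv_bound k B g"
 shows "deriv_bound k (A + B) (\<lambda>p. f p + g p)"
proof -
 note s = deriv_bound_smooth[OF f] deriv_bound_smooth[OF g]
 have "\<bar>iter_partial UNIV vs (\<lambda>p. f p + g p) p\<bar> \<le> A + B"
  if "vs \<in> lists Basis" "vs \<noteq> []" "length vs \<le> k" for vs p
  using deriv_boundD[OF f that, of p] deriv_boundD[OF g that, of p]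
   iter_partial_add[OF thick_UNIV s that(1), of p] by simp
 then show ?thesis using Cb_inf_add[OF thick_UNIV s] by (simp add: deriv_bound_def)
qed

lemma deriv_bound_cmult:
 assumes f: "deriv_bound k A f"
 shows "deriv_bound k (\<bar>c\<bar> * A) (\<lambda>p. c * f p)"
proof -
 note s = deriv_bound_smooth[OF f]
 have "\<bar>iter_partial UNIV vs (\<lambda>p. c * f p) p\<bar> \<le> \<bar>c\<bar> * A"
  if "vs \<in> lists Basis" "vs \<noteq> []" "length vs \<le> k" for vs p
  using deriv_boundD[OF f that, of p] iter_partial_cmult[OF thick_UNIV s that(1), of p c]
  by (simp add: abs_mult mult_left_mono)
 then show ?thesis using Cb_inf_cmult[OF thick_UNIV s] by (simp add: deriv_bound_def)
qed

lemma deriv_bound_const: "0 \<le> A ==> deriv_bound k A (\<lambda>_. c)"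
 unfolding deriv_bound_def by (auto simp: Cb_inf_const iter_partial_const simp del: iter_partial.simps)

definition ex :: "'n => 'n::finite space" where "ex i = (axis i 1, 0, 0)"
definition ey :: "'n => 'n::finite space" where "ey i = (0, axis i 1, 0)"
definition ez :: "'n => 'n::finite space" where "ez i = (0, 0, axis i 1)"

lemma e_Basis [simp]: "ex i \<in> Basis" "ey i \<in> Basis" "ez i \<in> Basis"
 by (auto simp: ex_def ey_def ez_def Basis_prod_def zero_prod_def axis_in_Basis_iff)

lemma Basis_vec_real: "(Basis :: (real^'n) set) = range (\<lambda>i. axis i 1)"
 by (auto simp: Basis_vec_def)

lemma sum_Basis_vec: "(\<Sum>b\<in>(Basis :: (real^'n) set). g b) = (\<Sum>i\<in>UNIV. g (axis i 1))"
 unfolding Basis_vec_real by (simp add: sum.reindex inj_on_def axis_eq_axis)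

lemma sum_Basis_prod:
 "(\<Sum>b\<in>(Basis :: ('a::euclidean_space \<times> 'b::euclidean_space) set). g b) =
  (\<Sum>b\<in>Basis. g (b, 0)) + (\<Sum>b\<in>Basis. g (0, b))"
 unfolding Basis_prod_def by (subst sum.union_disjoint) (auto simp: sum.reindex inj_on_def)

lemma sum_Basis_space:
 "(\<Sum>b\<in>(Basis :: 'n::finite space set). g b) = (\<Sum>i\<in>UNIV. g (ex i)) + ((\<Sum>i\<in>UNIV. g (ey i)) + (\<Sum>i\<in>UNIV. g (ez i)))"
 by (simp add: sum_Basis_prod sum_Basis_vec ex_def ey_def ez_def zero_prod_def)

lemma inner_e [simp]: "(hx, hy, hz) \<bullet> ex i = hx $ i" "(hx, hy, hz) \<bullet> ey i = hy $ i" "(hx, hy, hz) \<bullet> ez i = hz $ i"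
 by (simp_all add: ex_def ey_def ez_def inner_axis)

definition grad_y :: "('n::finite space => real) => 'n space => real^'n" where
 "grad_y f p = (\<chi> i. partial_deriv UNIV (ey i) f p)"
definition grad_z :: "('n::finite space => real) => 'n space => real^'n" where
 "grad_z f p = (\<chi> i. partial_deriv UNIV (ez i) f p)"
definition hess_x :: "('n::finite space => real) => 'n space => real^'n^'n" where
 "hess_x f p = (\<chi> i j. iter_partial UNIV [ex i, ex j] f p)"

definition jump :: "('n::finite space => real) => 'n space => real^'n => real" where
 "jump f p l = f (p + (0, 0, l)) - f p - grad_z f p \<bullet> l"

text \<open>The linear operator of a single triplet, written as an operator on functions of all the space
 variables.\<close>

definition Lop :: "'n levy_triplet => ('n::finite space => real) => 'n space => real" where
 "Lop = (\<lambda>(F, q, Q) f p. (\<integral>l. jump f p l \<partial>F) + grad_y f p \<bullet> q + 1 / 2 * trace (hess_x f p ** Q))"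

definition Gop :: "'n::finite levy_triplet set => ('n space => real) => 'n space => real" where
 "Gop \<Theta> f p = (SUP \<theta>\<in>\<Theta>. Lop \<theta> f p)"

lemma pide_op_eq:
 fixes w :: "real \<times> 'n::finite space => real"
 assumes t: "0 < t" "t \<le> 1"
 shows "pide_op \<Theta> w (t, e) = partial_deriv cyl dt w (t, e) - Gop \<Theta> (\<lambda>e. w (t, e)) e"
proof -
 obtain x y z where e: "e = (x, y, z)" by (cases e) auto
 have J: "linear (\<lambda>e::'n space. (0::real, e))" by (auto simp: linear_iff)
 have S: "(t, 0) + (0, e) \<in> cyl" for e :: "'n space" using t by (auto simp: cyl_def)
 note emb = iter_partial_embed[OF J S, where f = w, simplified]
 have J3: "linear (\<lambda>z::real^'n. (0::real, (0 :: real^'n), (0 :: real^'n), z))" by (auto simp: linear_iff)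
 have S3: "(t, x, y, z) + (0, 0, 0, l) \<in> cyl" for l :: "real^'n" using t by (auto simp: cyl_def)
 note emb3 = iter_partial_embed[OF J3 S3, where f = w, simplified]
 have dy: "partial_deriv cyl (dy i) w (t, x, y, z) = partial_deriv UNIV (ey i) (\<lambda>e. w (t, e)) e" for i
  using emb[of "[ey i]" e] by (simp add: dy_def ey_def e)
 have dx: "iter_partial cyl [dx i, dx j] w (t, x, y, z) = iter_partial UNIV [ex i, ex j] (\<lambda>e. w (t, e)) e" for i j
  using emb[of "[ex i, ex j]" e] by (simp add: dx_def ex_def e)
 have dz: "partial_deriv UNIV (axis i 1) (\<lambda>l. w (t, x, y, z + l)) 0 = partial_deriv UNIV (ez i) (\<lambda>e. w (t, e)) e" for i
  using emb[of "[ez i]" e] emb3[of "[axis i 1]" 0] by (simp add: ez_def e)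
 have "increment (\<lambda>l. w (t, x, y, z + l)) 0 = jump (\<lambda>e. w (t, e)) e"
  by (rule ext, simp add: increment_def jump_def gradient_def grad_z_def dz) (simp add: e)
 then show ?thesis
  unfolding e pide_op.simps Gop_def G_def dy dx
  by (simp add: Lop_def grad_y_def hess_x_def case_prod_unfold e)
qed

lemma dt_Basis [simp]: "dt \<in> Basis"
 by (simp add: dt_def Basis_prod_def zero_prod_def)

lemma slice_smooth:
 fixes w :: "real \<times> 'n::finite space => real"
 assumes w: "w \<in> Cb_inf S" and S: "\<And>e. (t, e) \<in> S"
 shows "(\<lambda>e. w (t, e)) \<in> Cb_inf UNIV"
proof -
 have "linear (\<lambda>e::'n space. (0::real, e))" by (auto simp: linear_iff)
 from Cb_inf_embed[OF w this, of "(t, 0)"] S show ?thesis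
  by (simp add: Basis_prod_def)
qed

lemma slice_deriv_bound:
 fixes w :: "real \<times> 'n::finite space => real"
 assumes w: "deriv_bound k K w"
 shows "deriv_bound k K (\<lambda>e. w (t, e))"
proof -
 have "linear (\<lambda>e::'n space. (0::real, e))" by (auto simp: linear_iff)
 from deriv_bound_embed[OF w this, of "(t, 0)"] show ?thesis
  by (simp add: Basis_prod_def)
qed

lemma partial_linear:
 assumes f: "f \<in> Cb_inf UNIV" and g: "g \<in> Cb_inf UNIV" and b: "b \<in> Basis"
 shows "partial_deriv UNIV b (\<lambda>p. f p + g p) p = partial_deriv UNIV b f p + partial_deriv UNIV b g p"
  "partial_deriv UNIV b (\<lambda>p. c * f p) p = c * partial_deriv UNIV b f p"
 using iter_partial_add[OF thick_UNIV f g, of "[b]" p] iter_partial_cmult[OF thick_UNIV f, of "[b]" p c] b by auto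

text \<open>The bounds on jumps, drift and diffusion are uniform over the set, so that \<open>G\<close> is controlled by two
 derivatives, see \<open>Gop_bound\<close>.\<close>

locale triplets =
 fixes \<Theta> :: "'n::finite levy_triplet set" and C\<Theta> :: real
 assumes nonempty: "\<Theta> \<noteq> {}"
  and triplet: "(F, q, Q) \<in> \<Theta> ==> sets F = sets borel \<and>
   integrable F (\<lambda>l. min (norm l) ((norm l)\<^sup>2)) \<and>
   (\<integral>l. min (norm l) ((norm l)\<^sup>2) \<partial>F) + norm q + norm Q \<le> C\<Theta> \<and> Q \<in> psd"

lemma uncertainty_set_triplets:
 fixes \<Theta> :: "'n::finite levy_triplet set"
 assumes L: "L \<subseteq> levy_family \<alpha> \<Lambda>1 \<Lambda>2" and \<Theta>: "uncertainty_set L \<Theta>"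
 shows "\<exists>C. triplets \<Theta> C"
proof -
 define g :: "'n levy_triplet => ennreal" where
  "g = (\<lambda>(F, q, Q). (\<integral>\<^sup>+z. ennreal (min (norm z) ((norm z)\<^sup>2)) \<partial>F) + ennreal (norm q) + ennreal (norm Q))"
 define s where "s = (SUP \<theta>\<in>\<Theta>. g \<theta>)"
 have s: "s < \<infinity>" using \<Theta> unfolding uncertainty_set_def s_def g_def by auto
 have "triplets \<Theta> (enn2real s)"
 proof
  show "\<Theta> \<noteq> {}" using \<Theta> by (simp add: uncertainty_set_def)
  fix F q Q assume th: "(F, q, Q) \<in> \<Theta>"
  then have "F \<in> L" "Q \<in> psd" using \<Theta> by (auto simp: uncertainty_set_def)
  then obtain \<mu> where F: "F = levy_measure \<alpha> \<mu>" using L by (auto simp: levy_family_def)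
  have setsF: "sets F = sets borel"
   unfolding F levy_measure_def by (simp add: sigma_algebra.sigma_sets_eq sets.sigma_algebra_axioms flip: space_borel)
  have spF: "space F = UNIV" using sets_eq_imp_space_eq[OF setsF] by simp
  have le: "g (F, q, Q) \<le> s" unfolding s_def using th by (rule SUP_upper)
  have I: "(\<integral>\<^sup>+z. ennreal (min (norm z) ((norm z)\<^sup>2)) \<partial>F) < \<infinity>"
  proof -
   have "(\<integral>\<^sup>+z. ennreal (min (norm z) ((norm z)\<^sup>2)) \<partial>F) \<le> g (F, q, Q)"
    unfolding g_def prod.case add.assoc by (rule add_increasing2) auto
   from order_le_less_trans[OF order_trans[OF this le] s] show ?thesis .
  qed
  have meas: "(\<lambda>z::real^'n. min (norm z) ((norm z)\<^sup>2)) \<in> borel_measurable F"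
   by (subst measurable_cong_sets[OF setsF refl]) measurable
  have int: "integrable F (\<lambda>l. min (norm l) ((norm l)\<^sup>2))"
   using I meas by (intro integrableI_bounded) simp_all
  have eq: "(\<integral>\<^sup>+z. ennreal (min (norm z) ((norm z)\<^sup>2)) \<partial>F) = ennreal (\<integral>l. min (norm l) ((norm l)\<^sup>2) \<partial>F)"
   by (rule nn_integral_eq_integral[OF int]) auto
  have nn: "0 \<le> (\<integral>l. min (norm l) ((norm l)\<^sup>2) \<partial>F)" by (rule Bochner_Integration.integral_nonneg) auto
  have "ennreal ((\<integral>l. min (norm l) ((norm l)\<^sup>2) \<partial>F) + norm q + norm Q) = g (F, q, Q)"
   using nn by (simp add: g_def eq ennreal_plus[symmetric] del: ennreal_plus)
  also have "\<dots> \<le> s" by (rule le)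
  also have "s = ennreal (enn2real s)" using s by simp
  finally have "(\<integral>l. min (norm l) ((norm l)\<^sup>2) \<partial>F) + norm q + norm Q \<le> enn2real s"
   by (subst (asm) ennreal_le_iff) auto
  with setsF int \<open>Q \<in> psd\<close> show "sets F = sets borel \<and>
   integrable F (\<lambda>l. min (norm l) ((norm l)\<^sup>2)) \<and>
   (\<integral>l. min (norm l) ((norm l)\<^sup>2) \<partial>F) + norm q + norm Q \<le> enn2real s \<and> Q \<in> psd" by blast
 qed
 then show ?thesis by blast
qed

lemma norm1_z: "norm1 ((0, 0, l) :: 'n::finite space) \<le> real CARD('n) * norm l"
proof -
 have "norm1 ((0, 0, l) :: 'n space) = (\<Sum>i\<in>UNIV. \<bar>l $ i\<bar>)"
  by (simp add: norm1_def sum_Basis_space)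
 also have "\<dots> \<le> (\<Sum>i\<in>(UNIV :: 'n set). norm l)"
  by (intro sum_mono component_le_norm_cart)
 finally show ?thesis by simp
qed

lemma grad_z_inner: "grad_z f p \<bullet> l = (\<Sum>b\<in>Basis. ((0, 0, l) \<bullet> b) * partial_deriv UNIV b f p)"
 by (simp add: sum_Basis_space grad_z_def inner_vec_def mult.commute)

lemma grad_y_inner: "grad_y f p \<bullet> l = (\<Sum>b\<in>Basis. ((0, l, 0) \<bullet> b) * partial_deriv UNIV b f p)"
 by (simp add: sum_Basis_space grad_y_def inner_vec_def mult.commute)

text \<open>Taylor's formula of the second order is used for small jumps, of the first order for large ones.\<close>

lemma jump_bound:
 fixes f :: "'n::finite space => real"
 assumes f: "deriv_bound 2 K f"
 shows "\<bar>jump f p l\<bar> \<le> 2 * (real CARD('n))\<^sup>2 * K * min (norm l) ((norm l)\<^sup>2)"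
proof -
 define n where "n = real CARD('n)"
 have n: "1 \<le> n" "n \<le> n\<^sup>2" by (simp_all add: n_def Suc_le_eq self_le_power)
 have K: "0 \<le> K" using deriv_bound_nonneg[OF f] by simp
 have n1: "norm1 ((0, 0, l) :: 'n space) \<le> n * norm l" using norm1_z[of l] by (simp add: n_def)
 have f1: "deriv_bound 1 K f" using deriv_bound_mono[OF f] by simp
 have pd: "\<bar>partial_deriv UNIV b f p\<bar> \<le> K" if "b \<in> Basis" for b
  using deriv_boundD[OF f1, of "[b]" p] that by simp
 have "\<bar>grad_z f p \<bullet> l\<bar> \<le> (\<Sum>b\<in>Basis. \<bar>((0, 0, l) :: 'n space) \<bullet> b\<bar> * K)"
  unfolding grad_z_inner
 proof (rule order_trans[OF sum_abs], rule sum_mono)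
  fix b :: "'n space" assume "b \<in> Basis"
  from mult_left_mono[OF pd[OF this], of "\<bar>(0, 0, l) \<bullet> b\<bar>"]
  show "\<bar>((0, 0, l) \<bullet> b) * partial_deriv UNIV b f p\<bar> \<le> \<bar>((0, 0, l) :: 'n space) \<bullet> b\<bar> * K"
   by (simp add: abs_mult)
 qed
 also have "\<dots> = K * norm1 ((0, 0, l) :: 'n space)"
  by (simp add: norm1_def sum_distrib_left mult.commute)
 finally have "\<bar>jump f p l\<bar> \<le> K * norm1 ((0, 0, l) :: 'n space) + K * norm1 ((0, 0, l) :: 'n space)"
  using Lipschitz_norm1[OF f1, of p "(0, 0, l)"] unfolding jump_def by linarith
 also have "\<dots> \<le> 2 * (K * (n * norm l))"
  using mult_left_mono[OF n1 K] by simp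
 also have "\<dots> \<le> 2 * (K * (n\<^sup>2 * norm l))"
  using n K by (intro mult_left_mono mult_right_mono) auto
 finally have 1: "\<bar>jump f p l\<bar> \<le> 2 * n\<^sup>2 * K * norm l" by (simp add: mult_ac)
 have "\<bar>jump f p l\<bar> \<le> K * (norm1 ((0, 0, l) :: 'n space))\<^sup>2"
  using Taylor2_norm1[OF f, of p "(0, 0, l)"] by (simp add: jump_def grad_z_inner)
 also have "\<dots> \<le> K * (n * norm l)\<^sup>2"
  using n1 K by (intro mult_left_mono power_mono) auto
 also have "\<dots> \<le> 2 * n\<^sup>2 * K * (norm l)\<^sup>2"
  using K by (simp add: power_mult_distrib mult_ac mult_left_mono)
 finally have 2: "\<bar>jump f p l\<bar> \<le> 2 * n\<^sup>2 * K * (norm l)\<^sup>2" .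
 show ?thesis using 1 2 by (auto simp: n_def min_def)
qed

lemma trace_prod_bound:
 fixes A Q :: "real^'n^'n"
 assumes "\<And>i j. \<bar>A $ i $ j\<bar> \<le> K" "0 \<le> K"
 shows "\<bar>trace (A ** Q)\<bar> \<le> (real CARD('n))\<^sup>2 * K * norm Q"
proof -
 have "\<bar>trace (A ** Q)\<bar> \<le> (\<Sum>i\<in>UNIV. \<Sum>j\<in>UNIV. \<bar>A $ i $ j * Q $ j $ i\<bar>)"
  unfolding trace_def matrix_matrix_mult_def
  by (simp, rule order_trans[OF sum_abs], rule sum_mono, rule sum_abs)
 also have "\<dots> \<le> (\<Sum>i\<in>(UNIV :: 'n set). \<Sum>j\<in>(UNIV :: 'n set). K * norm Q)"
 proof (intro sum_mono)
  fix i j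
  have "\<bar>Q $ j $ i\<bar> \<le> norm Q"
   by (rule order_trans[OF component_le_norm_cart Finite_Cartesian_Product.norm_nth_le])
  then show "\<bar>A $ i $ j * Q $ j $ i\<bar> \<le> K * norm Q"
   using assms by (auto simp: abs_mult intro!: mult_mono)
 qed
 also have "\<dots> = (real CARD('n))\<^sup>2 * K * norm Q" by (simp add: power2_eq_square)
 finally show ?thesis .
qed

context triplets
begin

definition CL :: real where "CL = 4 * (real CARD('n))\<^sup>2 * C\<Theta>"

lemma F_facts:
 assumes "(F, q, Q) \<in> \<Theta>"
 shows "sets F = sets borel" "integrable F (\<lambda>l. min (norm l) ((norm l)\<^sup>2))"
  "0 \<le> (\<integral>l. min (norm l) ((norm l)\<^sup>2) \<partial>F)"
  "(\<integral>l. min (norm l) ((norm l)\<^sup>2) \<partial>F) + norm q + norm Q \<le> C\<Theta>" "Q \<in> psd"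
 using triplet[OF assms] by (auto intro!: Bochner_Integration.integral_nonneg)

lemma C\<Theta>_nonneg: "0 \<le> C\<Theta>"
proof -
 obtain F q Q where "(F, q, Q) \<in> \<Theta>" using nonempty by (metis ex_in_conv prod_cases3)
 then show ?thesis using F_facts(3,4)[of F q Q] norm_ge_zero[of q] norm_ge_zero[of Q] by linarith
qed

lemma CL_nonneg: "0 \<le> CL"
 using C\<Theta>_nonneg by (simp add: CL_def)

lemma jump_integrable:
 assumes th: "(F, q, Q) \<in> \<Theta>" and f: "f \<in> Cb_inf UNIV"
 shows "integrable F (jump f p)"
proof -
 obtain K where K: "deriv_bound 2 K f" using deriv_bound_exists[OF f] by metis
 have [measurable]: "f \<in> borel_measurable borel" using Cb_inf_measurable[OF f] .
 have "jump f p \<in> borel_measurable F"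
  unfolding jump_def[abs_def] by (subst measurable_cong_sets[OF F_facts(1)[OF th] refl]) measurable
 moreover have "integrable F (\<lambda>l. 2 * (real CARD('n))\<^sup>2 * K * min (norm l) ((norm l)\<^sup>2))"
  using F_facts(2)[OF th] by (intro integrable_mult_right)
 moreover have "norm (jump f p l) \<le> norm (2 * (real CARD('n))\<^sup>2 * K * min (norm l) ((norm l)\<^sup>2))" for l
  using order_trans[OF jump_bound[OF K] abs_ge_self] by simp
 ultimately show ?thesis
  by (metis (mono_tags) AE_I2 Bochner_Integration.integrable_bound)
qed

lemma Lop_bound:
 assumes th: "\<theta> \<in> \<Theta>" and f: "deriv_bound 2 K f"
 shows "\<bar>Lop \<theta> f p\<bar> \<le> CL * K"
proof -
 obtain F q Q where \<theta>: "\<theta> = (F, q, Q)" by (cases \<theta>) auto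
 note F = F_facts[OF th[unfolded \<theta>]]
 note fs = deriv_bound_smooth[OF f]
 define n where "n = real CARD('n)"
 define I where "I = (\<integral>l. min (norm l) ((norm l)\<^sup>2) \<partial>F)"
 have n: "1 \<le> n" "n \<le> n\<^sup>2" by (simp_all add: n_def Suc_le_eq self_le_power)
 have K: "0 \<le> K" using deriv_bound_nonneg[OF f] by simp
 have "\<bar>\<integral>l. jump f p l \<partial>F\<bar> \<le> (\<integral>l. 2 * n\<^sup>2 * K * min (norm l) ((norm l)\<^sup>2) \<partial>F)"
  using jump_integrable[OF th[unfolded \<theta>] fs] F(2) jump_bound[OF f]
  by (intro integral_abs_bound_integral integrable_mult_right) (auto simp: n_def)
 then have 1: "\<bar>\<integral>l. jump f p l \<partial>F\<bar> \<le> 2 * n\<^sup>2 * K * I" by (simp add: I_def)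
 have pd: "\<bar>partial_deriv UNIV b f p\<bar> \<le> K" if "b \<in> Basis" for b
  using deriv_boundD[OF f, of "[b]" p] that by simp
 have pde: "\<bar>partial_deriv UNIV (ey i) f p\<bar> \<le> K" for i by (rule pd) simp
 have "\<bar>grad_y f p \<bullet> q\<bar> \<le> (\<Sum>i\<in>(UNIV :: 'n set). K * norm q)"
  unfolding inner_vec_def
  by (rule order_trans[OF sum_abs], rule sum_mono)
   (use pde component_le_norm_cart[of q] K in \<open>auto simp: grad_y_def abs_mult intro!: mult_mono\<close>)
 then have "\<bar>grad_y f p \<bullet> q\<bar> \<le> n * (K * norm q)" by (simp add: n_def)
 also have "\<dots> \<le> 2 * n\<^sup>2 * (K * norm q)"
  using n K by (intro mult_right_mono) auto
 finally have 2: "\<bar>grad_y f p \<bullet> q\<bar> \<le> 2 * n\<^sup>2 * K * norm q" by simp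
 have "\<bar>hess_x f p $ i $ j\<bar> \<le> K" for i j
  using deriv_boundD[OF f, of "[ex i, ex j]" p] by (simp add: hess_x_def)
 then have "\<bar>trace (hess_x f p ** Q)\<bar> \<le> n\<^sup>2 * K * norm Q"
  unfolding n_def by (rule trace_prod_bound) (rule K)
 then have 3: "\<bar>1 / 2 * trace (hess_x f p ** Q)\<bar> \<le> 2 * n\<^sup>2 * K * norm Q"
  by (simp add: abs_mult)
 have "\<bar>Lop \<theta> f p\<bar> \<le> 2 * n\<^sup>2 * K * I + 2 * n\<^sup>2 * K * norm q + 2 * n\<^sup>2 * K * norm Q"
  using 1 2 3 unfolding Lop_def \<theta> by (simp only: prod.case)
 also have "\<dots> = 2 * n\<^sup>2 * K * (I + norm q + norm Q)" by (simp add: distrib_left)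
 also have "\<dots> \<le> 2 * n\<^sup>2 * K * C\<Theta>"
  using F(4) K by (intro mult_left_mono) (auto simp: I_def)
 also have "\<dots> \<le> CL * K"
  using K C\<Theta>_nonneg by (simp add: CL_def n_def mult_ac mult_left_mono)
 finally show ?thesis .
qed

lemma Lop_linear:
 assumes th: "\<theta> \<in> \<Theta>" and f: "f \<in> Cb_inf UNIV" and g: "g \<in> Cb_inf UNIV"
 shows "Lop \<theta> (\<lambda>p. f p + g p) p = Lop \<theta> f p + Lop \<theta> g p"
  "Lop \<theta> (\<lambda>p. c * f p) p = c * Lop \<theta> f p"
proof -
 obtain F q Q where \<theta>: "\<theta> = (F, q, Q)" by (cases \<theta>) auto
 have gy: "grad_y (\<lambda>p. f p + g p) p = grad_y f p + grad_y g p" "grad_y (\<lambda>p. c * f p) p = c *\<^sub>R grad_y f p"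
  by (simp_all add: grad_y_def vec_eq_iff partial_linear[OF f g])
 have gz: "grad_z (\<lambda>p. f p + g p) p = grad_z f p + grad_z g p" "grad_z (\<lambda>p. c * f p) p = c *\<^sub>R grad_z f p"
  by (simp_all add: grad_z_def vec_eq_iff partial_linear[OF f g])
 have hx: "hess_x (\<lambda>p. f p + g p) p = hess_x f p + hess_x g p" "hess_x (\<lambda>p. c * f p) p = c *\<^sub>R hess_x f p"
  using iter_partial_add[OF thick_UNIV f g, of "[ex _, ex _]" p] iter_partial_cmult[OF thick_UNIV f, of "[ex _, ex _]" p c]
  by (simp_all add: hess_x_def vec_eq_iff)
 have j: "jump (\<lambda>p. f p + g p) p = (\<lambda>l. jump f p l + jump g p l)" "jump (\<lambda>p. c * f p) p = (\<lambda>l. c * jump f p l)"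
  by (simp_all add: jump_def gz inner_add_left algebra_simps fun_eq_iff)
 note i = jump_integrable[OF th[unfolded \<theta>] f, of p] jump_integrable[OF th[unfolded \<theta>] g, of p]
 have tr: "trace ((A + B) ** Q) = trace (A ** Q) + trace (B ** Q)" "trace ((c *\<^sub>R A) ** Q) = c * trace (A ** Q)" for A B :: "real^'n^'n"
  by (simp_all add: trace_def matrix_matrix_mult_def sum_distrib_left sum.distrib[symmetric] distrib_right mult.assoc)
 show "Lop \<theta> (\<lambda>p. f p + g p) p = Lop \<theta> f p + Lop \<theta> g p"
  using i by (simp add: Lop_def \<theta> gy hx j tr inner_add_left distrib_left)
 show "Lop \<theta> (\<lambda>p. c * f p) p = c * Lop \<theta> f p"
  using i by (simp add: Lop_def \<theta> gy hx j tr distrib_left)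
qed

lemma Gop_ge:
 assumes "\<theta> \<in> \<Theta>" "f \<in> Cb_inf UNIV"
 shows "Lop \<theta> f p \<le> Gop \<Theta> f p"
proof -
 obtain K where K: "deriv_bound 2 K f" using deriv_bound_exists[OF assms(2)] by metis
 have "bdd_above ((\<lambda>\<theta>. Lop \<theta> f p) ` \<Theta>)"
  by (rule bdd_aboveI2[of _ _ "CL * K"]) (rule abs_le_D1[OF Lop_bound[OF _ K]])
 then show ?thesis unfolding Gop_def using assms(1) by (rule cSUP_upper2) simp
qed

lemma Gop_le: "(\<And>\<theta>. \<theta> \<in> \<Theta> ==> Lop \<theta> f p \<le> c) ==> Gop \<Theta> f p \<le> c"
 unfolding Gop_def using nonempty by (rule cSUP_least)

lemma Gop_add_le:
 assumes f: "f \<in> Cb_inf UNIV" and g: "g \<in> Cb_inf UNIV"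
 shows "Gop \<Theta> (\<lambda>p. f p + g p) p \<le> Gop \<Theta> f p + Gop \<Theta> g p"
proof (rule Gop_le)
 fix \<theta> assume \<theta>: "\<theta> \<in> \<Theta>"
 show "Lop \<theta> (\<lambda>p. f p + g p) p \<le> Gop \<Theta> f p + Gop \<Theta> g p"
  using Gop_ge[OF \<theta> f, of p] Gop_ge[OF \<theta> g, of p] Lop_linear(1)[OF \<theta> f g, of p] by linarith
qed

lemma Gop_bound:
 assumes "deriv_bound 2 K f"
 shows "\<bar>Gop \<Theta> f p\<bar> \<le> CL * K"
proof -
 obtain \<theta> where \<theta>: "\<theta> \<in> \<Theta>" using nonempty by blast
 have "Gop \<Theta> f p \<le> CL * K"
  by (rule Gop_le) (rule abs_le_D1[OF Lop_bound[OF _ assms]])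
 moreover have "- (CL * K) \<le> Gop \<Theta> f p"
  using Gop_ge[OF \<theta> deriv_bound_smooth[OF assms], of p] Lop_bound[OF \<theta> assms, of p] by linarith
 ultimately show ?thesis by linarith
qed

text \<open>Sublinearity, applied to \<open>f\<close> and \<open>- f\<close>.\<close>

lemma Gop_neg:
 assumes f: "f \<in> Cb_inf UNIV"
 shows "- Gop \<Theta> f p \<le> Gop \<Theta> (\<lambda>p. - f p) p"
proof -
 obtain \<theta> where \<theta>: "\<theta> \<in> \<Theta>" using nonempty by blast
 have "Lop \<theta> (\<lambda>p. - f p) p = - Lop \<theta> f p"
  using Lop_linear(2)[OF \<theta> f f, of "-1" p] by simp
 then show ?thesis
  using Gop_ge[OF \<theta> f, of p] Gop_ge[OF \<theta> Cb_inf_uminus[OF thick_UNIV f], of p] by linarith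
qed

end

section \<open>Comparison with smooth functions\<close>

definition sub_test :: "'n::finite levy_triplet set => (real \<times> 'n space => real) => bool" where
 "sub_test \<Theta> u \<longleftrightarrow>
   (\<forall>p\<in>cyl. \<forall>\<psi>\<in>Cb23. (\<forall>q\<in>cyl. u q \<le> \<psi> q) \<and> \<psi> p = u p --> pide_op \<Theta> \<psi> p \<le> 0)"

definition super_test :: "'n::finite levy_triplet set => (real \<times> 'n space => real) => bool" where
 "super_test \<Theta> u \<longleftrightarrow>
   (\<forall>p\<in>cyl. \<forall>\<psi>\<in>Cb23. (\<forall>q\<in>cyl. \<psi> q \<le> u q) \<and> \<psi> p = u p --> 0 \<le> pide_op \<Theta> \<psi> p)"

abbreviation strip :: "(real \<times> 'n::finite space) set" where
 "strip \<equiv> {0..1} \<times> UNIV"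

lemma fst_smooth: "(\<lambda>p. fst p) \<in> Cb_inf (cyl :: (real \<times> 'n::finite space) set)"
proof (rule Cb_infI[OF thick_cyl, where F = "insert fst (range (\<lambda>c _. c))"])
 fix f b assume "f \<in> insert fst (range (\<lambda>c (_ :: real \<times> 'n space). c :: real))" and b: "b \<in> (Basis :: (real \<times> 'n space) set)"
 then consider "f = fst" | c where "f = (\<lambda>_. c)" by auto
 then show "\<exists>g\<in>insert fst (range (\<lambda>c _. c)). has_partial cyl f b g"
 proof cases
  case 1
  have "has_partial cyl f b (\<lambda>_. fst b)"
   unfolding has_partial_def 1 by (auto intro!: derivative_eq_intros)
  then show ?thesis by (intro bexI[of _ "\<lambda>_. fst b"]) auto
 next
  case 2
  have "has_partial cyl f b (\<lambda>_. 0)" unfolding 2 by (rule has_partial_const)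
  then show ?thesis by (intro bexI[of _ "\<lambda>_. 0"]) auto
 qed
next
 fix f assume "f \<in> insert fst (range (\<lambda>c (_ :: real \<times> 'n space). c :: real))"
 then consider "f = fst" | c where "f = (\<lambda>_. c)" by auto
 note cs = this
 show "continuous_on cyl f"
  using cs by cases (auto intro: continuous_intros)
 show "bounded (f ` (cyl :: (real \<times> 'n space) set))"
  using cs
 proof cases
  case 1
  then show ?thesis by (auto simp: bounded_iff cyl_def intro!: exI[of _ 1])
 next
  case (2 c)
  then show ?thesis by (auto simp: bounded_iff intro!: exI[of _ "\<bar>c\<bar>"])
 qed
qed simp

lemma snd_smooth:
 fixes f :: "'n::finite space => real"
 assumes f: "f \<in> Cb_inf UNIV"
 shows "(\<lambda>p. f (snd p)) \<in> Cb_inf (cyl :: (real \<times> 'n space) set)"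
proof (rule Cb_infI[OF thick_cyl, where F = "{(\<lambda>p. f (snd p)) |f. f \<in> Cb_inf UNIV}"])
 fix h b assume "h \<in> {(\<lambda>p :: real \<times> 'n space. f (snd p)) |f. f \<in> Cb_inf UNIV}" and b: "b \<in> (Basis :: (real \<times> 'n space) set)"
 then obtain f where h: "h = (\<lambda>p. f (snd p))" and f: "f \<in> Cb_inf UNIV" by blast
 consider "snd b = 0" | "snd b \<in> Basis" using b by (auto simp: Basis_prod_def)
 then show "\<exists>g\<in>{(\<lambda>p. f (snd p)) |f. f \<in> Cb_inf UNIV}. has_partial cyl h b g"
 proof cases
  case 1
  have "has_partial cyl h b (\<lambda>_. 0)"
   unfolding has_partial_def h using 1 by simp
  moreover have "(\<lambda>_. 0) \<in> {(\<lambda>p :: real \<times> 'n space. f (snd p)) |f. f \<in> Cb_inf UNIV}"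
   using Cb_inf_const[OF thick_UNIV, of 0] by (intro CollectI exI[of _ "\<lambda>_. 0"]) simp
  ultimately show ?thesis by (rule bexI)
 next
  case 2
  have "has_partial cyl h b (\<lambda>p. partial_deriv UNIV (snd b) f (snd p))"
   unfolding has_partial_def
  proof
   fix p :: "real \<times> 'n space"
   have "((\<lambda>s. f (snd p + s *\<^sub>R snd b)) has_vector_derivative partial_deriv UNIV (snd b) f (snd p)) (at 0)"
    using Cb_inf_has_partial[OF f 2, unfolded has_partial_def, rule_format, of "snd p"] by simp
   then show "((\<lambda>s. h (p + s *\<^sub>R b)) has_vector_derivative partial_deriv UNIV (snd b) f (snd p))
     (at 0 within {s. p + s *\<^sub>R b \<in> cyl})"
    unfolding h by (auto intro: has_vector_derivative_at_within)
  qed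
  then show ?thesis
   by (intro bexI[of _ "\<lambda>p. partial_deriv UNIV (snd b) f (snd p)"]) (use Cb_inf_partial[OF f 2] in blast)+
 qed
next
 fix h assume "h \<in> {(\<lambda>p :: real \<times> 'n space. f (snd p)) |f. f \<in> Cb_inf UNIV}"
 then obtain f where h: "h = (\<lambda>p. f (snd p))" and f: "f \<in> Cb_inf UNIV" by blast
 show "continuous_on cyl h"
  unfolding h by (intro continuous_on_compose2[OF Cb_inf_cont[OF f]] continuous_intros) auto
 show "bounded (h ` cyl)"
  unfolding h by (rule bounded_subset[OF Cb_inf_bdd[OF f]]) auto
qed (use f in blast)

lemma partial_bound_Lipschitz:
 assumes f: "has_partial UNIV f b g" and L: "\<And>s. \<bar>f (p + s *\<^sub>R b) - f p\<bar> \<le> c * \<bar>s\<bar>"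
 shows "\<bar>g p\<bar> \<le> c"
proof -
 have "((\<lambda>s. f (p + s *\<^sub>R b)) has_real_derivative g p) (at 0)"
  using has_partial_line[OF f, of p 0] by simp
 then have "((\<lambda>s. \<bar>(f (p + s *\<^sub>R b) - f p) / s\<bar>) \<longlongrightarrow> \<bar>g p\<bar>) (at 0)"
  by (intro tendsto_rabs) (simp add: DERIV_def)
 then show ?thesis
 proof (rule tendsto_upperbound)
  show "\<forall>\<^sub>F s in at 0. \<bar>(f (p + s *\<^sub>R b) - f p) / s\<bar> \<le> c"
   using L by (auto simp: eventually_at_filter abs_divide pos_divide_le_eq)
 qed simp
qed

text \<open>Mollify \<open>min 1 (\<bar>e\<bar> / R)\<close> with a fixed kernel. Since this function is Lipschitz with the constant
 \<open>1 / R\<close>, all derivatives of the mollification are of order \<open>1 / R\<close>.\<close>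

lemma flat_penalty:
 fixes \<rho> :: "real \<times> 'n::finite space => real" and e0 :: "'n space"
 assumes \<rho>: "mollifier \<rho>" and \<delta>: "0 < \<delta>"
 obtains \<beta> :: "'n space => real" and R where "deriv_bound 2 \<delta> \<beta>" "\<And>e. 0 \<le> \<beta> e" "\<beta> e0 \<le> \<delta>"
  "\<And>e. R \<le> norm e ==> 1 \<le> \<beta> e"
proof -
 define k where "k = rescaled \<rho> 1"
 have k: "averaging 1 k" unfolding k_def by (rule rescaled_averaging[OF \<rho>]) simp
 note ker = averaging_kernel[OF k]
 define A :: "(real \<times> 'n space) list set" where "A = {vs. set vs \<subseteq> Basis \<and> length vs \<le> 1}"
 have fin: "finite A" unfolding A_def by (rule finite_lists_length_le) auto
 have A: "vs \<in> A \<longleftrightarrow> vs \<in> lists Basis \<and> length vs \<le> 1" for vs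
  by (auto simp: A_def in_lists_conv_set)
 have "\<exists>C\<ge>0. \<forall>v M p. bounded_borel M v --> \<bar>conv v (iter_partial UNIV vs k) p\<bar> \<le> C * M"
  if "vs \<in> A" for vs
  using conv_bound_exists[OF kernel_iter_partial[OF ker]] that A by metis
 then obtain C0 where C0: "\<And>vs. vs \<in> A ==> 0 \<le> C0 vs"
   "\<And>vs v M p. vs \<in> A ==> bounded_borel M v ==> \<bar>conv v (iter_partial UNIV vs k) p\<bar> \<le> C0 vs * M"
  by metis
 define C where "C = sum C0 A"
 have C: "0 \<le> C" "\<And>vs. vs \<in> A ==> C0 vs \<le> C"
  unfolding C_def using C0 fin by (auto intro: sum_nonneg member_le_sum)
 define R where "R = max (C / \<delta>) ((norm e0 + 1) / \<delta>) + 1"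
 have Rge: "C / \<delta> \<le> R" "(norm e0 + 1) / \<delta> \<le> R" "1 \<le> R"
  using C \<delta> by (auto simp: R_def intro!: max.coboundedI1 divide_nonneg_pos)
 have R: "0 < R" "C / R \<le> \<delta>" "(norm e0 + 1) / R \<le> \<delta>"
  using Rge \<delta> by (auto simp: field_simps)
 define v :: "real \<times> 'n space => real" where "v p = min 1 (norm (snd p) / R)" for p
 have v: "bounded_borel 1 v"
  unfolding bounded_borel_def v_def[abs_def]
 proof (intro conjI allI)
  show "(\<lambda>p :: real \<times> 'n space. min 1 (norm (snd p) / R)) \<in> borel_measurable borel"
   by (intro borel_measurable_continuous_onI continuous_intros) (use R in auto)
  show "\<bar>min 1 (norm (snd q) / R)\<bar> \<le> 1" for q :: "real \<times> 'n space" using R by auto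
 qed
 have vL: "\<bar>v (q + h) - v q\<bar> \<le> norm (snd h) / R" for q h
 proof -
  have "\<bar>norm (snd q + snd h) / R - norm (snd q) / R\<bar> \<le> norm (snd h) / R"
   using norm_triangle_ineq3[of "snd q + snd h" "snd q"] R by (simp add: divide_right_mono flip: diff_divide_distrib)
  then show ?thesis by (auto simp: v_def min_def abs_if split: if_splits)
 qed
 define w where "w = conv v k"
 have db: "deriv_bound 2 \<delta> w"
  unfolding deriv_bound_def w_def
 proof (intro conjI ballI impI allI)
  show "conv v k \<in> Cb_inf UNIV" by (rule conv_smooth[OF ker v])
  fix vs :: "(real \<times> 'n space) list" and p
  assume vs: "vs \<in> lists Basis" "vs \<noteq> []" "length vs \<le> 2"
  obtain b us where bus: "vs = b # us" using vs(2) by (cases vs) auto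
  have b: "b \<in> Basis" and us: "us \<in> A" "us \<in> lists Basis" using vs A by (auto simp: bus)
  define \<kappa> where "\<kappa> = iter_partial UNIV us k"
  have \<kappa>: "smooth_kernel \<kappa>" unfolding \<kappa>_def by (rule kernel_iter_partial[OF ker us(2)])
  have "has_partial UNIV (conv v \<kappa>) b (conv v (partial_deriv UNIV b \<kappa>))"
   by (rule conv_has_partial[OF \<kappa> v b])
  then have "\<bar>conv v (partial_deriv UNIV b \<kappa>) p\<bar> \<le> C / R"
  proof (rule partial_bound_Lipschitz)
   fix s
   have vd: "bounded_borel (\<bar>s\<bar> / R) (\<lambda>q. v (q + s *\<^sub>R b) - v q)"
    unfolding bounded_borel_def
   proof (intro conjI allI)
    show "(\<lambda>q. v (q + s *\<^sub>R b) - v q) \<in> borel_measurable borel"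
     using bounded_borel_shift[OF v] v by (intro borel_measurable_diff bounded_borel_meas)
    fix q
    have "norm (snd b) \<le> norm b" by (metis norm_snd_le prod.collapse)
    then have "norm (snd (s *\<^sub>R b)) \<le> \<bar>s\<bar> * norm b" by (simp add: mult_left_mono)
    then have "norm (snd (s *\<^sub>R b)) \<le> \<bar>s\<bar>" using b by simp
    then show "\<bar>v (q + s *\<^sub>R b) - v q\<bar> \<le> \<bar>s\<bar> / R"
     using vL[of q "s *\<^sub>R b"] R by (meson divide_right_mono less_imp_le order_trans)
   qed
   have "\<bar>conv v \<kappa> (p + s *\<^sub>R b) - conv v \<kappa> p\<bar> = \<bar>conv (\<lambda>q. v (q + s *\<^sub>R b) - v q) \<kappa> p\<bar>"
    using conv_linear(3)[OF \<kappa> bounded_borel_shift[OF v] v] conv_shift[OF \<kappa> v] by simp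
   also have "\<dots> \<le> C0 us * (\<bar>s\<bar> / R)"
    unfolding \<kappa>_def by (rule C0(2)[OF us(1) vd])
   also have "\<dots> \<le> C * (\<bar>s\<bar> / R)"
    using C(2)[OF us(1)] R by (intro mult_right_mono) auto
   finally show "\<bar>conv v \<kappa> (p + s *\<^sub>R b) - conv v \<kappa> p\<bar> \<le> C / R * \<bar>s\<bar>" by simp
  qed
  then show "\<bar>iter_partial UNIV vs (conv v k) p\<bar> \<le> \<delta>"
   using conv_iter_partial[OF ker v vs(1)] R(2) by (simp add: bus \<kappa>_def)
 qed
 show thesis
 proof
  show "deriv_bound 2 \<delta> (\<lambda>e. w (0, e))" by (rule slice_deriv_bound[OF db])
  show "0 \<le> w (0, e)" for e
   unfolding w_def by (rule conv_ge_avg[OF k v]) (use R in \<open>simp add: v_def\<close>)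
  show "w (0, e0) \<le> \<delta>"
   unfolding w_def
  proof (rule conv_le_avg[OF k v])
   fix \<sigma> :: real and e :: "'n space" assume "norm e < 1"
   then have "norm (e0 + e) \<le> norm e0 + 1" using norm_triangle_ineq[of e0 e] by simp
   then have "norm (e0 + e) / R \<le> (norm e0 + 1) / R" using R by (simp add: divide_right_mono)
   then show "v (0 + \<sigma>, e0 + e) \<le> \<delta>" using R(3) by (simp add: v_def)
  qed
  show "1 \<le> w (0, e)" if "R + 1 \<le> norm e" for e
   unfolding w_def
  proof (rule conv_ge_avg[OF k v])
   fix \<sigma> :: real and e' :: "'n space" assume "norm e' < 1"
   then have "R \<le> norm (e + e')" using that norm_diff_ineq[of e e'] by linarith
   then show "1 \<le> v (0 + \<sigma>, e + e')" using R by (simp add: v_def)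
  qed
 qed
qed

context triplets
begin

text \<open>A point where \<open>u\<close> exceeds \<open>w\<close> yields a smooth function \<open>w + \<pi>\<close> that touches \<open>u\<close> from above, with a
 perturbation \<open>\<pi>\<close> that grows strictly in time. The maximum of \<open>u - w\<close> is kept in a compact set by a
 flat penalty in space and by a large power of the time, which penalises the times close to \<open>T\<close>.\<close>

lemma touching:
 fixes u w :: "real \<times> 'n space => real" and \<rho> :: "real \<times> 'n space => real"
 assumes \<rho>: "mollifier \<rho>"
  and u: "continuous_on strip u" "bounded (u ` strip)"
  and w: "w \<in> Cb_inf cyl" "continuous_on ({t0..1} \<times> UNIV) w"
  and t0: "0 \<le> t0" "t0 < t1" "t1 < T" "T \<le> 1"
  and init: "\<And>e. u (t0, e) \<le> w (t0, e)" and gt: "w (t1, e1) < u (t1, e1)"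
 obtains \<kappa> \<pi> t e where "0 < \<kappa>" "\<pi> \<in> Cb_inf cyl" "t0 < t" "t < T"
  "\<And>q. q \<in> cyl ==> u q \<le> w q + \<pi> q" "u (t, e) = w (t, e) + \<pi> (t, e)"
  "\<kappa> \<le> partial_deriv cyl dt \<pi> (t, e)" "Gop \<Theta> (\<lambda>e. \<pi> (t, e)) e \<le> \<kappa> / 2"
proof -
 define d where "d = u (t1, e1) - w (t1, e1)"
 have d: "0 < d" using gt by (simp add: d_def)
 obtain M where M: "0 < M" "\<And>q. q \<in> cyl ==> \<bar>u q\<bar> \<le> M" "\<And>q. q \<in> cyl ==> \<bar>w q\<bar> \<le> M"
 proof -
  obtain M1 where "\<forall>q\<in>strip. \<bar>u q\<bar> \<le> M1" using u(2) by (auto simp: bounded_iff)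
  moreover obtain M2 where "\<forall>q\<in>cyl. \<bar>w q\<bar> \<le> M2" using Cb_inf_bdd[OF w(1)] by (auto simp: bounded_iff)
  moreover have "cyl \<subseteq> (strip :: (real \<times> 'n space) set)" by (auto simp: cyl_def)
  ultimately show ?thesis
   by (intro that[of "max 1 (max M1 M2)"]) (fastforce simp: le_max_iff_disj subset_iff)+
 qed
 define a where "a = 2 * M + 1"
 have a: "0 < a" using M by (simp add: a_def)
 define \<kappa> where "\<kappa> = d / 4"
 have \<kappa>: "0 < \<kappa>" using d by (simp add: \<kappa>_def)
 define \<delta> where "\<delta> = min (d / (8 * a)) (\<kappa> / (2 * (a * (CL + 1))))"
 have CL1: "0 < a * (CL + 1)" using CL_nonneg a by simp
 have \<delta>: "0 < \<delta>" "a * \<delta> \<le> d / 8" "CL * (a * \<delta>) \<le> \<kappa> / 2"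
 proof -
  show "0 < \<delta>" using d a \<kappa> CL1 by (simp add: \<delta>_def)
  have "\<delta> \<le> d / (8 * a)" by (simp add: \<delta>_def)
  then show "a * \<delta> \<le> d / 8" using a by (simp add: field_simps)
  have "\<delta> \<le> \<kappa> / (2 * (a * (CL + 1)))" by (simp add: \<delta>_def)
  then have "\<delta> * (2 * (a * (CL + 1))) \<le> \<kappa>" using CL1 by (simp add: pos_le_divide_eq)
  moreover have "CL * (a * \<delta>) \<le> a * (CL + 1) * \<delta>"
   using a \<open>0 < \<delta>\<close> by (simp add: algebra_simps)
  ultimately show "CL * (a * \<delta>) \<le> \<kappa> / 2" by (simp add: algebra_simps)
 qed
 obtain \<beta> R where \<beta>: "deriv_bound 2 \<delta> \<beta>" "\<And>e. 0 \<le> \<beta> e" "\<beta> e1 \<le> \<delta>" "\<And>e. R \<le> norm e ==> 1 \<le> \<beta> e"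
  using flat_penalty[OF \<rho> \<delta>(1), of e1] by metis
 define T' where "T' = (t1 + T) / 2"
 have T': "t1 < T'" "T' < T" "0 < T'" using t0 by (auto simp: T'_def)
 have "(\<lambda>n. a * (t1 / T') ^ n) \<longlonglongrightarrow> a * 0"
  using t0 T' by (intro tendsto_intros LIMSEQ_power_zero) simp
 then have "\<forall>\<^sub>F n in sequentially. a * (t1 / T') ^ n < d / 8"
  using d by (intro order_tendstoD(2)[where y = "a * 0"]) auto
 then obtain n where n: "a * (t1 / T') ^ n < d / 8" by (auto simp: eventually_sequentially)
 \<comment> \<open>The first term gives the growth in time, the second one keeps the maximum in a ball, and the power
  exceeds \<open>u - w\<close> from \<open>T'\<close> on, while it is negligible at \<open>t1\<close>.\<close>
 define P where "P p = \<kappa> * fst p + a * \<beta> (snd p) + a * (fst p / T') ^ n" for p :: "real \<times> 'n space"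
 define \<Phi> where "\<Phi> p = u p - w p - P p" for p
 have \<beta>s: "\<beta> \<in> Cb_inf UNIV" by (rule deriv_bound_smooth[OF \<beta>(1)])
 have Pcont: "continuous_on A P" for A
  unfolding P_def
  by (intro continuous_intros continuous_on_compose2[OF Cb_inf_cont[OF \<beta>s]]) (use T' in auto)
 have Pge: "0 \<le> P p" if "0 \<le> fst p" for p
  unfolding P_def using that \<kappa> a \<beta>(2) T' by (intro add_nonneg_nonneg mult_nonneg_nonneg zero_le_power) auto
 have "d / 2 \<le> \<Phi> (t1, e1)"
 proof -
  have "\<kappa> * t1 \<le> \<kappa> * 1" using \<kappa> t0 by (intro mult_left_mono) auto
  moreover have "a * \<beta> e1 \<le> a * \<delta>" using a \<beta>(3) by (intro mult_left_mono) auto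
  ultimately have "P (t1, e1) \<le> d / 4 + d / 8 + d / 8"
   using n \<delta>(2) by (simp add: P_def \<kappa>_def)
  then show ?thesis using d_def unfolding \<Phi>_def by linarith
 qed
 define R' where "R' = max R (norm e1)"
 define K where "K = {t0..1} \<times> cball (0 :: 'n space) R'"
 have "compact K" unfolding K_def by (intro compact_Times) auto
 moreover have K1: "(t1, e1) \<in> K" using t0 by (auto simp: K_def R'_def)
 moreover have "continuous_on K \<Phi>"
  unfolding \<Phi>_def
  by (intro continuous_intros Pcont continuous_on_subset[OF u(1)] continuous_on_subset[OF w(2)])
   (use t0 in \<open>auto simp: K_def\<close>)
 ultimately obtain p where p: "p \<in> K" "\<And>q. q \<in> K ==> \<Phi> q \<le> \<Phi> p"
  using continuous_attains_sup[of K \<Phi>] by (metis empty_iff)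
 define t e where "t = fst p" and "e = snd p"
 have pte: "p = (t, e)" by (simp add: t_def e_def)
 have m: "d / 2 \<le> \<Phi> p" using p(2)[OF K1] \<open>d / 2 \<le> \<Phi> (t1, e1)\<close> by simp
 have start: "\<Phi> (t0, e) \<le> 0" for e
  using init[of e] Pge[of "(t0, e)"] t0 by (simp add: \<Phi>_def)
 have t_gt: "t0 < t"
 proof -
  have "t \<noteq> t0" using start[of e] m d by (auto simp: pte)
  then show ?thesis using p(1) by (auto simp: K_def pte)
 qed
 have diff: "u q - w q \<le> 2 * M" if "q \<in> cyl" for q
  using M(2,3)[OF that] by linarith
 have late: "\<Phi> (s, e') \<le> 0" if s: "T' \<le> s" "s \<le> 1" for s e'
 proof -
  have "(s, e') \<in> cyl" using s T' by (auto simp: cyl_def)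
  moreover have "a * 1 \<le> a * (s / T') ^ n"
   using s T' a by (intro mult_left_mono one_le_power) auto
  moreover have "0 \<le> \<kappa> * s" "0 \<le> a * \<beta> e'" using \<kappa> a \<beta>(2) s T' by auto
  ultimately show ?thesis using diff[of "(s, e')"] by (simp add: \<Phi>_def P_def a_def)
 qed
 have t_lt: "t < T"
 proof (rule ccontr)
  assume "\<not> t < T"
  then have "\<Phi> p \<le> 0" using late[of t e] T' p(1) by (auto simp: K_def pte)
  then show False using m d by simp
 qed
 have max_all: "\<Phi> q \<le> \<Phi> p" if q: "q \<in> cyl" "t0 \<le> fst q" for q
 proof (cases "norm (snd q) \<le> R'")
  case True
  then have "q \<in> K" using q by (auto simp: K_def cyl_def mem_Times_iff)
  then show ?thesis by (rule p(2))
 next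
  case False
  then have "1 \<le> \<beta> (snd q)" by (intro \<beta>(4)) (auto simp: R'_def)
  then have "a * 1 \<le> a * \<beta> (snd q)" using a by (intro mult_left_mono) auto
  moreover have "0 \<le> fst q" using q by (auto simp: cyl_def)
  then have "0 \<le> \<kappa> * fst q" "0 \<le> a * (fst q / T') ^ n" using \<kappa> a T' by auto
  ultimately have "\<Phi> q \<le> 0" using diff[OF q(1)] by (simp add: \<Phi>_def P_def a_def)
  then show ?thesis using m d by simp
 qed
 \<comment> \<open>The maximum is over times after \<open>t0\<close>. A parabola in time makes the touching global, without
  changing the first derivatives at the maximum.\<close>
 define Kq where "Kq = 2 * M / (t - t0)\<^sup>2"
 have Kq: "0 \<le> Kq" using M by (simp add: Kq_def)
 define \<pi> where "\<pi> q = P q + (\<Phi> p + Kq * (fst q - t)\<^sup>2)" for q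
 show thesis
 proof (rule that[of \<kappa> \<pi> t e])
  show "0 < \<kappa>" by (rule \<kappa>)
  show "t0 < t" "t < T" by (rule t_gt, rule t_lt)
  have "(\<lambda>q. \<kappa> * fst q + a * \<beta> (snd q) + a * (1 / T' * fst q) ^ n + (\<Phi> p + Kq * (fst q - t)\<^sup>2)) \<in> Cb_inf cyl"
   by (intro Cb_inf_add Cb_inf_cmult Cb_inf_power Cb_inf_diff Cb_inf_const fst_smooth snd_smooth[OF \<beta>s] thick_cyl)
  then show "\<pi> \<in> Cb_inf cyl" by (simp add: \<pi>_def[abs_def] P_def)
  show "u (t, e) = w (t, e) + \<pi> (t, e)"
   by (simp add: \<pi>_def \<Phi>_def pte)
  show "u q \<le> w q + \<pi> q" if q: "q \<in> cyl" for q
  proof (cases "t0 \<le> fst q")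
   case True
   have "0 \<le> Kq * (fst q - t)\<^sup>2" using Kq by simp
   then show ?thesis using max_all[OF q True] unfolding \<pi>_def \<Phi>_def[of q] by linarith
  next
   case False
   have "2 * M = Kq * (t - t0)\<^sup>2" using t_gt by (simp add: Kq_def)
   also have "\<dots> \<le> Kq * (t - fst q)\<^sup>2"
    using Kq False t_gt by (intro mult_left_mono power_mono) auto
   finally have "2 * M \<le> Kq * (fst q - t)\<^sup>2" by (simp add: power2_commute)
   moreover have "0 \<le> P q" using q by (intro Pge) (auto simp: cyl_def)
   ultimately show ?thesis using diff[OF q] m d unfolding \<pi>_def by linarith
  qed
  show "\<kappa> \<le> partial_deriv cyl dt \<pi> (t, e)"
  proof -
   have tc: "(t, e) \<in> cyl" using t_gt t_lt t0 by (auto simp: cyl_def)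
   have "has_partial cyl \<pi> dt (\<lambda>q. \<kappa> + a * (real n * (fst q / T') ^ (n - 1) / T') + Kq * (2 * (fst q - t)))"
    unfolding has_partial_def
   proof
    fix q :: "real \<times> 'n space"
    have "((\<lambda>s. \<kappa> * (fst q + s) + a * \<beta> (snd q) + a * ((fst q + s) / T') ^ n + (\<Phi> p + Kq * (fst q + s - t)\<^sup>2))
      has_real_derivative \<kappa> + a * (real n * (fst q / T') ^ (n - 1) / T') + Kq * (2 * (fst q - t))) (at 0 within {s. q + s *\<^sub>R dt \<in> cyl})"
     using T'(3) by (auto intro!: derivative_eq_intros)
    then show "((\<lambda>s. \<pi> (q + s *\<^sub>R dt)) has_vector_derivative
      \<kappa> + a * (real n * (fst q / T') ^ (n - 1) / T') + Kq * (2 * (fst q - t))) (at 0 within {s. q + s *\<^sub>R dt \<in> cyl})"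
     by (simp add: \<pi>_def P_def dt_def has_real_derivative_iff_has_vector_derivative zero_prod_def[symmetric])
   qed
   from has_partial_unique[OF thick_cyl dt_Basis this tc]
   have "partial_deriv cyl dt \<pi> (t, e) = \<kappa> + a * (real n * (t / T') ^ (n - 1) / T')" by simp
   moreover have "0 \<le> a * (real n * (t / T') ^ (n - 1) / T')"
    using a T' t_gt t0 by (intro mult_nonneg_nonneg divide_nonneg_pos zero_le_power) auto
   ultimately show ?thesis by simp
  qed
  have "deriv_bound 2 (\<bar>a\<bar> * \<delta> + 0) (\<lambda>e. a * \<beta> e + (\<kappa> * t + a * (t / T') ^ n + (\<Phi> p + Kq * (t - t)\<^sup>2)))"
   by (intro deriv_bound_add deriv_bound_cmult \<beta>(1) deriv_bound_const) simp
  moreover have "(\<lambda>e. a * \<beta> e + (\<kappa> * t + a * (t / T') ^ n + (\<Phi> p + Kq * (t - t)\<^sup>2))) = (\<lambda>e. \<pi> (t, e))"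
   by (simp add: \<pi>_def P_def fun_eq_iff)
  ultimately have "deriv_bound 2 (a * \<delta>) (\<lambda>e. \<pi> (t, e))" using a by simp
  from abs_le_D1[OF Gop_bound[OF this, of e]] \<delta>(3)
  show "Gop \<Theta> (\<lambda>e. \<pi> (t, e)) e \<le> \<kappa> / 2" by simp
 qed
qed

lemma le_up_to_end:
 fixes u w :: "real \<times> 'n space => real"
 assumes u: "continuous_on strip u" and w: "continuous_on ({t0..1} \<times> UNIV) w"
  and t0: "0 \<le> t0" "t0 < T" "T \<le> 1" and le: "\<And>t. t0 \<le> t ==> t < T ==> u (t, e) \<le> w (t, e)"
  and t: "t0 \<le> t" "t \<le> T"
 shows "u (t, e) \<le> w (t, e)"
proof -
 have cl: "closure {t0..<T} = {t0..T}" using t0 by simp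
 have "continuous_on (closure {t0..<T}) (\<lambda>s. u (s, e) - w (s, e))"
  unfolding cl
  by (intro continuous_intros continuous_on_compose2[OF u] continuous_on_compose2[OF w]) (use t0 in auto)
 moreover have "t \<in> closure {t0..<T}" unfolding cl using t by simp
 moreover have "u (s, e) - w (s, e) \<le> 0" if "s \<in> {t0..<T}" for s using le that by simp
 ultimately have "u (t, e) - w (t, e) \<le> 0" by (rule continuous_le_on_closure)
 then show ?thesis by simp
qed

lemma le_unless_touching:
 fixes u w :: "real \<times> 'n space => real" and \<rho> :: "real \<times> 'n space => real"
 assumes \<rho>: "mollifier \<rho>"
  and u: "continuous_on strip u" "bounded (u ` strip)"
  and w: "w \<in> Cb_inf cyl" "continuous_on ({t0..1} \<times> UNIV) w"
  and t0: "0 \<le> t0" "t0 < T" "T \<le> 1" and init: "\<And>e. u (t0, e) \<le> w (t0, e)"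
  and t: "t0 \<le> t" "t \<le> T"
  and no: "\<And>\<kappa> \<pi> t e. 0 < \<kappa> ==> \<pi> \<in> Cb_inf cyl ==> t0 < t ==> t < T ==>
   (\<And>q. q \<in> cyl ==> u q \<le> w q + \<pi> q) ==> u (t, e) = w (t, e) + \<pi> (t, e) ==>
   \<kappa> \<le> partial_deriv cyl dt \<pi> (t, e) ==> Gop \<Theta> (\<lambda>e. \<pi> (t, e)) e \<le> \<kappa> / 2 ==> False"
 shows "u (t, e) \<le> w (t, e)"
proof (rule le_up_to_end[OF u(1) w(2) t0 _ t], rule ccontr)
 fix t1 assume t1: "t0 \<le> t1" "t1 < T" and "\<not> u (t1, e) \<le> w (t1, e)"
 then have gt: "w (t1, e) < u (t1, e)" by simp
 then have "t1 \<noteq> t0" using init[of e] by auto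
 then have "t0 < t1" using t1 by simp
 from touching[OF \<rho> u w t0(1) this t1(2) t0(3) init gt] no show False by metis
qed

text \<open>At the touching point the subsolution property of \<open>u\<close> and the supersolution property of \<open>w\<close>
 contradict the growth of the perturbation.\<close>

theorem comparison_sub:
 fixes u w :: "real \<times> 'n space => real" and \<rho> :: "real \<times> 'n space => real"
 assumes \<rho>: "mollifier \<rho>"
  and u: "continuous_on strip u" "bounded (u ` strip)" "sub_test \<Theta> u"
  and w: "w \<in> Cb_inf cyl" "continuous_on ({t0..1} \<times> UNIV) w"
  and super: "\<And>t e. t0 < t ==> t < T ==> Gop \<Theta> (\<lambda>e. w (t, e)) e \<le> partial_deriv cyl dt w (t, e)"
  and t0: "0 \<le> t0" "t0 < T" "T \<le> 1" and init: "\<And>e. u (t0, e) \<le> w (t0, e)"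
  and t: "t0 \<le> t" "t \<le> T"
 shows "u (t, e) \<le> w (t, e)"
proof (rule le_unless_touching[OF \<rho> u(1,2) w t0 init t])
 fix \<kappa> \<pi> t e assume *: "0 < \<kappa>" "\<pi> \<in> Cb_inf cyl" "t0 < t" "t < T"
  "\<And>q. q \<in> cyl ==> u q \<le> w q + \<pi> q" "u (t, e) = w (t, e) + \<pi> (t, e)"
  "\<kappa> \<le> partial_deriv cyl dt \<pi> (t, e)" "Gop \<Theta> (\<lambda>e. \<pi> (t, e)) e \<le> \<kappa> / 2"
 have t01: "0 < t" "t \<le> 1" using * t0 by auto
 have tc: "(t, e) \<in> cyl" using t01 by (auto simp: cyl_def)
 define \<psi> where "\<psi> = (\<lambda>q. w q + \<pi> q)"
 have \<psi>: "\<psi> \<in> Cb_inf cyl" unfolding \<psi>_def by (rule Cb_inf_add[OF thick_cyl w(1) *(2)])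
 moreover have "u q \<le> \<psi> q" if "q \<in> cyl" for q using *(5)[OF that] by (simp add: \<psi>_def)
 moreover have "\<psi> (t, e) = u (t, e)" using *(6) by (simp add: \<psi>_def)
 ultimately have "pide_op \<Theta> \<psi> (t, e) \<le> 0"
  using u(3) Cb_inf_subset_Cb23 tc unfolding sub_test_def by blast
 then have le: "partial_deriv cyl dt \<psi> (t, e) \<le> Gop \<Theta> (\<lambda>e. \<psi> (t, e)) e"
  using pide_op_eq[OF t01, of \<Theta> \<psi> e] by simp
 have s: "(t, e) \<in> cyl" for e :: "'n space" using t01 by (auto simp: cyl_def)
 have "Gop \<Theta> (\<lambda>e. \<psi> (t, e)) e \<le> Gop \<Theta> (\<lambda>e. w (t, e)) e + Gop \<Theta> (\<lambda>e. \<pi> (t, e)) e"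
  unfolding \<psi>_def by (rule Gop_add_le[OF slice_smooth[OF w(1) s] slice_smooth[OF *(2) s]])
 moreover have "partial_deriv cyl dt \<psi> (t, e) = partial_deriv cyl dt w (t, e) + partial_deriv cyl dt \<pi> (t, e)"
  using iter_partial_add[OF thick_cyl w(1) *(2), of "[dt]" "(t, e)"] tc by (simp add: \<psi>_def)
 ultimately show False using le *(1,7,8) super[OF *(3,4), of e] by linarith
qed

text \<open>The operator is not odd, so this does not follow from the previous theorem applied to \<open>- u\<close>;
 but the touching function of \<open>- u\<close> and \<open>- w\<close> serves again.\<close>

theorem comparison_super:
 fixes u w :: "real \<times> 'n space => real" and \<rho> :: "real \<times> 'n space => real"
 assumes \<rho>: "mollifier \<rho>"
  and u: "continuous_on strip u" "bounded (u ` strip)" "super_test \<Theta> u"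
  and w: "w \<in> Cb_inf cyl" "continuous_on ({t0..1} \<times> UNIV) w"
  and sub: "\<And>t e. t0 < t ==> t < T ==> partial_deriv cyl dt w (t, e) \<le> Gop \<Theta> (\<lambda>e. w (t, e)) e"
  and t0: "0 \<le> t0" "t0 < T" "T \<le> 1" and init: "\<And>e. w (t0, e) \<le> u (t0, e)"
  and t: "t0 \<le> t" "t \<le> T"
 shows "w (t, e) \<le> u (t, e)"
proof -
 define u' where "u' q = - u q" for q
 define w' where "w' q = - w q" for q
 have u': "continuous_on strip u'" "bounded (u' ` strip)"
  using u(1,2) unfolding u'_def by (auto intro: continuous_intros simp: bounded_iff)
 have w': "w' \<in> Cb_inf cyl" "continuous_on ({t0..1} \<times> UNIV) w'"
  using w unfolding w'_def by (auto intro: continuous_intros Cb_inf_uminus)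
 have init': "u' (t0, e) \<le> w' (t0, e)" for e using init[of e] by (simp add: u'_def w'_def)
 have "u' (t, e) \<le> w' (t, e)"
 proof (rule le_unless_touching[OF \<rho> u' w' t0 init' t])
  fix \<kappa> \<pi> t e assume *: "0 < \<kappa>" "\<pi> \<in> Cb_inf cyl" "t0 < t" "t < T"
   "\<And>q. q \<in> cyl ==> u' q \<le> w' q + \<pi> q" "u' (t, e) = w' (t, e) + \<pi> (t, e)"
   "\<kappa> \<le> partial_deriv cyl dt \<pi> (t, e)" "Gop \<Theta> (\<lambda>e. \<pi> (t, e)) e \<le> \<kappa> / 2"
  have t01: "0 < t" "t \<le> 1" using * t0 by auto
  have tc: "(t, e) \<in> cyl" using t01 by (auto simp: cyl_def)
  define \<psi> where "\<psi> = (\<lambda>q. w q - \<pi> q)"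
  have \<psi>: "\<psi> \<in> Cb_inf cyl" unfolding \<psi>_def by (rule Cb_inf_diff[OF thick_cyl w(1) *(2)])
  have "\<psi> q \<le> u q" if "q \<in> cyl" for q using *(5)[OF that] by (simp add: \<psi>_def u'_def w'_def)
  moreover have "\<psi> (t, e) = u (t, e)" using *(6) by (simp add: \<psi>_def u'_def w'_def)
  ultimately have "0 \<le> pide_op \<Theta> \<psi> (t, e)"
   using u(3) Cb_inf_subset_Cb23 \<psi> tc unfolding super_test_def by blast
  then have le: "Gop \<Theta> (\<lambda>e. \<psi> (t, e)) e \<le> partial_deriv cyl dt \<psi> (t, e)"
   using pide_op_eq[OF t01, of \<Theta> \<psi> e] by simp
  have s: "(t, e) \<in> cyl" for e :: "'n space" using t01 by (auto simp: cyl_def)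
  have "Gop \<Theta> (\<lambda>e. \<psi> (t, e) + \<pi> (t, e)) e \<le> Gop \<Theta> (\<lambda>e. \<psi> (t, e)) e + Gop \<Theta> (\<lambda>e. \<pi> (t, e)) e"
   by (rule Gop_add_le[OF slice_smooth[OF \<psi> s] slice_smooth[OF *(2) s]])
  then have "Gop \<Theta> (\<lambda>e. w (t, e)) e \<le> Gop \<Theta> (\<lambda>e. \<psi> (t, e)) e + Gop \<Theta> (\<lambda>e. \<pi> (t, e)) e"
   by (simp add: \<psi>_def)
  moreover have "partial_deriv cyl dt w (t, e) = partial_deriv cyl dt \<psi> (t, e) + partial_deriv cyl dt \<pi> (t, e)"
   using iter_partial_add[OF thick_cyl \<psi> *(2), of "[dt]" "(t, e)"] tc by (simp add: \<psi>_def)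
  ultimately show False using le *(1,7,8) sub[OF *(3,4), of e] by linarith
 qed
 then show ?thesis by (simp add: u'_def w'_def)
qed

end

section \<open>Linear flows and mollified supersolutions\<close>

type_synonym 'n jumps = "(real \<times> 'n space) list"

text \<open>The generator of a compound Poisson process with rates \<open>c\<close> and jumps \<open>l\<close>.\<close>

definition fd :: "'n::finite jumps => ('n space => real) => 'n space => real" where
 "fd cs f p = (\<Sum>(c, l)\<leftarrow>cs. c * (f (p + l) - f p))"

definition mass :: "'n::finite jumps => real" where
 "mass cs = (\<Sum>(c, l)\<leftarrow>cs. c)"

definition rates :: "'n::finite jumps => bool" where
 "rates cs \<longleftrightarrow> (\<forall>(c, l)\<in>set cs. 0 \<le> c)"

lemma fd_Nil [simp]: "fd [] f p = 0" and fd_Cons [simp]: "fd ((c, l) # cs) f p = c * (f (p + l) - f p) + fd cs f p"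
 by (simp_all add: fd_def)

lemma mass_simps [simp]: "mass [] = 0" "mass ((c, l) # cs) = c + mass cs"
 by (simp_all add: mass_def)

lemma rates_simps [simp]: "rates []" "rates ((c, l) # cs) \<longleftrightarrow> 0 \<le> c \<and> rates cs"
 "rates (cs @ ds) \<longleftrightarrow> rates cs \<and> rates ds"
 by (auto simp: rates_def)

lemma fd_append: "fd (cs @ ds) f p = fd cs f p + fd ds f p"
 by (simp add: fd_def)

lemma mass_nonneg: "rates cs ==> 0 \<le> mass cs"
 by (induction cs) auto

lemma fd_lin: "fd cs (\<lambda>p. f p + c * g p) p = fd cs f p + c * fd cs g p"
 by (induction cs) (auto simp: algebra_simps)

lemma fd_const [simp]: "fd cs (\<lambda>_. c) p = 0"
 by (induction cs) auto

lemma fd_abs_le: "rates cs ==> (\<And>p. \<bar>f p\<bar> \<le> M) ==> \<bar>fd cs f p\<bar> \<le> 2 * mass cs * M"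
proof (induction cs)
 case (Cons a cs)
 obtain c l where a: "a = (c, l)" by (cases a)
 have "\<bar>f (p + l) - f p\<bar> \<le> 2 * M" using Cons(3)[of "p + l"] Cons(3)[of p] by linarith
 then have "\<bar>c * (f (p + l) - f p)\<bar> \<le> c * (2 * M)"
  using Cons(2) by (simp add: a abs_mult mult_left_mono)
 then have "\<bar>c * (f (p + l) - f p) + fd cs f p\<bar> \<le> c * (2 * M) + 2 * mass cs * M"
  using Cons.IH Cons.prems by (intro order_trans[OF abs_triangle_ineq] add_mono) (auto simp: a)
 then show ?case by (simp add: a algebra_simps)
qed simp

lemma fd_smooth: "f \<in> Cb_inf UNIV ==> fd cs f \<in> Cb_inf UNIV"
proof (induction cs)
 case Nil
 then show ?case using Cb_inf_const[OF thick_UNIV, of 0] by (simp add: fd_def[abs_def])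
next
 case (Cons a cs)
 obtain c l where a: "a = (c, l)" by (cases a)
 have "(\<lambda>p. c * (f (p + l) - f p) + fd cs f p) \<in> Cb_inf UNIV"
  using Cons by (intro Cb_inf_add Cb_inf_cmult Cb_inf_diff Cb_inf_shift thick_UNIV) auto
 moreover have "fd (a # cs) f = (\<lambda>p. c * (f (p + l) - f p) + fd cs f p)" by (simp add: a fun_eq_iff)
 ultimately show ?case by simp
qed

lemma iter_partial_fd:
 assumes f: "f \<in> Cb_inf UNIV" and vs: "vs \<in> lists Basis"
 shows "iter_partial UNIV vs (fd cs f) p = fd cs (iter_partial UNIV vs f) p"
proof (induction cs)
 case Nil
 have "iter_partial UNIV vs (\<lambda>p. 0 * f p) p = 0 * iter_partial UNIV vs f p"
  by (rule iter_partial_cmult[OF thick_UNIV f vs]) simp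
 then show ?case by (simp add: fd_def[abs_def])
next
 case (Cons a cs)
 obtain c l where a: "a = (c, l)" by (cases a)
 have fs: "(\<lambda>p. f (p + l)) \<in> Cb_inf UNIV" by (rule Cb_inf_shift[OF f])
 have mf: "(\<lambda>p. -1 * f p) \<in> Cb_inf UNIV" by (rule Cb_inf_cmult[OF thick_UNIV f])
 have fm: "(\<lambda>p. f (p + l) + -1 * f p) \<in> Cb_inf UNIV" by (rule Cb_inf_add[OF thick_UNIV fs mf])
 have cfm: "(\<lambda>p. c * (f (p + l) + -1 * f p)) \<in> Cb_inf UNIV" by (rule Cb_inf_cmult[OF thick_UNIV fm])
 have eq: "fd (a # cs) f = (\<lambda>p. c * (f (p + l) + -1 * f p) + fd cs f p)"
  by (simp add: a fun_eq_iff)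
 show ?case
  unfolding eq
  using iter_partial_add[OF thick_UNIV cfm fd_smooth[OF f] vs, of p cs]
   iter_partial_cmult[OF thick_UNIV fm vs, of p c] iter_partial_add[OF thick_UNIV fs mf vs, of p]
   iter_partial_cmult[OF thick_UNIV f vs, of p "-1"] Cons
  by (simp add: a iter_partial_shift)
qed

text \<open>An explicit Euler step for the linear flow. It is monotone as long as the total rate is at most
 \<open>1 / \<tau>\<close>.\<close>

definition step :: "real => 'n::finite jumps => ('n space => real) => 'n space => real" where
 "step \<tau> cs f p = f p + \<tau> * fd cs f p"

lemma step_mono:
 assumes cs: "rates cs" and \<tau>: "0 \<le> \<tau>" "\<tau> * mass cs \<le> 1" and le: "\<And>p. f p \<le> g p"
 shows "step \<tau> cs f p \<le> step \<tau> cs g p"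
proof -
 have fd: "fd cs h p = (\<Sum>(c, l)\<leftarrow>cs. c * h (p + l)) - mass cs * h p" for h
  by (induction cs) (auto simp: algebra_simps)
 have "(\<Sum>(c, l)\<leftarrow>cs. c * f (p + l)) \<le> (\<Sum>(c, l)\<leftarrow>cs. c * g (p + l))"
  using cs by (induction cs) (auto intro!: add_mono mult_left_mono le)
 then have "\<tau> * (\<Sum>(c, l)\<leftarrow>cs. c * f (p + l)) \<le> \<tau> * (\<Sum>(c, l)\<leftarrow>cs. c * g (p + l))"
  using \<tau>(1) by (rule mult_left_mono)
 moreover have "(1 - \<tau> * mass cs) * f p \<le> (1 - \<tau> * mass cs) * g p"
  using \<tau> le by (intro mult_left_mono) auto
 ultimately show ?thesis
  unfolding step_def fd by (simp add: algebra_simps)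
qed

lemma step_lin: "step \<tau> cs (\<lambda>p. f p + c * g p) = (\<lambda>p. step \<tau> cs f p + c * step \<tau> cs g p)"
 by (rule ext) (simp add: step_def fd_lin algebra_simps)

lemma step_const [simp]: "step \<tau> cs (\<lambda>_. c) = (\<lambda>_. c)"
 by (simp add: step_def fun_eq_iff)

lemma steps_lin: "(step \<tau> cs ^^ k) (\<lambda>p. f p + c * g p) = (\<lambda>p. (step \<tau> cs ^^ k) f p + c * (step \<tau> cs ^^ k) g p)"
 by (induction k) (simp_all add: step_lin)

lemma steps_const [simp]: "(step \<tau> cs ^^ k) (\<lambda>_. c) = (\<lambda>_. c)"
 by (induction k) simp_all

lemma steps_mono:
 assumes cs: "rates cs" and \<tau>: "0 \<le> \<tau>" "\<tau> * mass cs \<le> 1" and le: "\<And>p. f p \<le> g p"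
 shows "(step \<tau> cs ^^ k) f p \<le> (step \<tau> cs ^^ k) g p"
 by (induction k arbitrary: p) (simp_all add: le step_mono[OF cs \<tau>])

lemma steps_sub_const: "(step \<tau> cs ^^ k) (\<lambda>p. f p - c) p = (step \<tau> cs ^^ k) f p - c"
 using steps_lin[of k \<tau> cs f "- c" "\<lambda>_. 1"] by simp

lemma steps_bound:
 assumes cs: "rates cs" and \<tau>: "0 \<le> \<tau>" "\<tau> * mass cs \<le> 1" and le: "\<And>p. \<bar>f p\<bar> \<le> C"
 shows "\<bar>(step \<tau> cs ^^ k) f p\<bar> \<le> C"
proof -
 have "f p \<le> C" "- C \<le> f p" for p using le[of p] by auto
 then show ?thesis
  using steps_mono[OF cs \<tau>, of f "\<lambda>_. C" k p] steps_mono[OF cs \<tau>, of "\<lambda>_. - C" f k p] by auto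
qed

lemma step_smooth: "f \<in> Cb_inf UNIV ==> step \<tau> cs f \<in> Cb_inf UNIV"
 unfolding step_def[abs_def] by (intro Cb_inf_add Cb_inf_cmult fd_smooth thick_UNIV)

lemma iter_partial_step:
 assumes f: "f \<in> Cb_inf UNIV" and vs: "vs \<in> lists Basis"
 shows "iter_partial UNIV vs (step \<tau> cs f) = step \<tau> cs (iter_partial UNIV vs f)"
proof
 fix p
 show "iter_partial UNIV vs (step \<tau> cs f) p = step \<tau> cs (iter_partial UNIV vs f) p"
  unfolding step_def[abs_def]
  using iter_partial_add[OF thick_UNIV f Cb_inf_cmult[OF thick_UNIV fd_smooth[OF f]] vs, of p \<tau> cs]
   iter_partial_cmult[OF thick_UNIV fd_smooth[OF f] vs, of p \<tau> cs] iter_partial_fd[OF f vs, of cs p]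
  by simp
qed

lemma step_deriv_bound:
 assumes cs: "rates cs" and \<tau>: "0 \<le> \<tau>" "\<tau> * mass cs \<le> 1" and f: "deriv_bound k B f"
 shows "deriv_bound k B (step \<tau> cs f)"
 using steps_bound[OF cs \<tau>, where k = 1] deriv_boundD[OF f] deriv_bound_smooth[OF f]
 by (simp add: deriv_bound_def step_smooth iter_partial_step del: iter_partial.simps)

text \<open>Expansion of the flow to the first order in time.\<close>

lemma steps_expansion:
 assumes cs: "rates cs" and \<tau>: "0 \<le> \<tau>" "\<tau> * mass cs \<le> 1"
  and C: "\<And>p. \<bar>fd cs (fd cs g) p\<bar> \<le> C"
 shows "g p + real k * \<tau> * fd cs g p - (real k * \<tau>)\<^sup>2 * C \<le> (step \<tau> cs ^^ k) g p"
proof -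
 have C0: "0 \<le> C" using C[of p] by linarith
 have sw: "(step \<tau> cs ^^ Suc k) g = (\<lambda>p. (step \<tau> cs ^^ k) g p + \<tau> * (step \<tau> cs ^^ k) (fd cs g) p)" for k g
 proof -
  have "step \<tau> cs g = (\<lambda>p. g p + \<tau> * fd cs g p)" by (simp add: step_def fun_eq_iff)
  then have "(step \<tau> cs ^^ k) (step \<tau> cs g) = (\<lambda>p. (step \<tau> cs ^^ k) g p + \<tau> * (step \<tau> cs ^^ k) (fd cs g) p)"
   by (simp only: steps_lin)
  then show ?thesis by (simp add: funpow_swap1)
 qed
 have h: "fd cs g p - real k * \<tau> * C \<le> (step \<tau> cs ^^ k) (fd cs g) p" for k p
 proof (induction k)
  case (Suc k)
  have "- C \<le> (step \<tau> cs ^^ k) (fd cs (fd cs g)) p"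
   using steps_bound[OF cs \<tau>, of "fd cs (fd cs g)" C k p] C by (simp add: abs_le_iff)
  then have "\<tau> * - C \<le> \<tau> * (step \<tau> cs ^^ k) (fd cs (fd cs g)) p" using \<tau> by (intro mult_left_mono)
  with Suc show ?case unfolding sw by (simp add: algebra_simps)
 qed simp
 show ?thesis
 proof (induction k)
  case (Suc k)
  have "\<tau> * (fd cs g p - real k * \<tau> * C) \<le> \<tau> * (step \<tau> cs ^^ k) (fd cs g) p"
   using h \<tau> by (intro mult_left_mono)
  then have "g p + real k * \<tau> * fd cs g p - (real k * \<tau>)\<^sup>2 * C + \<tau> * (fd cs g p - real k * \<tau> * C)
    \<le> (step \<tau> cs ^^ Suc k) g p"
   using Suc unfolding sw by linarith
  moreover have "0 \<le> \<tau>\<^sup>2 * C * (real k + 1)" using C0 by simp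
  ultimately show ?case
   by (simp add: power2_eq_square algebra_simps)
 qed simp
qed

subsection \<open>Approximation of the operators by finite differences\<close>

text \<open>The approximation error is uniform over all functions with given bounds on three derivatives.\<close>

definition approximable :: "(('n::finite space => real) => 'n space => real) => bool" where
 "approximable T \<longleftrightarrow> (\<forall>\<omega>>0. \<exists>cs. rates cs \<and>
   (\<forall>K f p. deriv_bound 3 K f --> \<bar>fd cs f p - T f p\<bar> \<le> \<omega> * K))"

lemma approximable_add:
 assumes S: "approximable S" and T: "approximable T"
 shows "approximable (\<lambda>f p. S f p + T f p)"
 unfolding approximable_def
proof (intro allI impI)
 fix \<omega> :: real assume \<omega>: "0 < \<omega>"
 obtain cs where cs: "rates cs" "\<And>K f p. deriv_bound 3 K f ==> \<bar>fd cs f p - S f p\<bar> \<le> \<omega> / 2 * K"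
  using S \<omega> unfolding approximable_def by (metis half_gt_zero)
 obtain ds where ds: "rates ds" "\<And>K f p. deriv_bound 3 K f ==> \<bar>fd ds f p - T f p\<bar> \<le> \<omega> / 2 * K"
  using T \<omega> unfolding approximable_def by (metis half_gt_zero)
 have "\<bar>fd (cs @ ds) f p - (S f p + T f p)\<bar> \<le> \<omega> * K" if "deriv_bound 3 K f" for K f p
  using cs(2)[OF that, of p] ds(2)[OF that, of p] unfolding fd_append by linarith
 then show "\<exists>cs. rates cs \<and> (\<forall>K f p. deriv_bound 3 K f --> \<bar>fd cs f p - (S f p + T f p)\<bar> \<le> \<omega> * K)"
  using cs ds by (intro exI[of _ "cs @ ds"]) auto
qed

lemma approximable_zero: "approximable (\<lambda>f (p :: 'n::finite space). 0)"
 unfolding approximable_def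
proof (intro allI impI exI[of _ "[]"] conjI)
 fix \<omega> K :: real and f :: "'n space => real" and p :: "'n space" assume "0 < \<omega>" "deriv_bound 3 K f"
 then show "\<bar>fd [] f p - 0\<bar> \<le> \<omega> * K" using deriv_bound_nonneg[of 3 K f] by simp
qed simp

text \<open>A forward difference with a small increment and a large rate.\<close>

lemma approximable_drift:
 fixes h :: "'n::finite space"
 shows "approximable (\<lambda>f p. \<Sum>b\<in>Basis. (h \<bullet> b) * partial_deriv UNIV b f p)"
 unfolding approximable_def
proof (intro allI impI)
 fix \<omega> :: real assume \<omega>: "0 < \<omega>"
 define r where "r = \<omega> / ((norm1 h)\<^sup>2 + 1)"
 have n: "0 < (norm1 h)\<^sup>2 + 1" by (simp add: add_nonneg_pos)
 have r: "0 < r" "r * (norm1 h)\<^sup>2 \<le> \<omega>"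
  using \<omega> n by (auto simp: r_def field_simps)
 have "\<bar>fd [(1 / r, r *\<^sub>R h)] f p - (\<Sum>b\<in>Basis. (h \<bullet> b) * partial_deriv UNIV b f p)\<bar> \<le> \<omega> * K"
  if f: "deriv_bound 3 K f" for K f p
 proof -
  have K: "0 \<le> K" using deriv_bound_nonneg[OF f] by simp
  define S where "S = (\<Sum>b\<in>Basis. (h \<bullet> b) * partial_deriv UNIV b f p)"
  have S: "(\<Sum>b\<in>Basis. ((r *\<^sub>R h) \<bullet> b) * partial_deriv UNIV b f p) = r * S"
   by (simp add: S_def sum_distrib_left mult.assoc)
  have f2: "deriv_bound 2 K f" by (rule deriv_bound_mono[OF f]) auto
  have "\<bar>f (p + r *\<^sub>R h) - f p - r * S\<bar> \<le> K * (r * norm1 h)\<^sup>2"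
   using Taylor2_norm1[OF f2, of p "r *\<^sub>R h"] r unfolding S by (simp add: norm1_scaleR)
  then have "\<bar>f (p + r *\<^sub>R h) - f p - r * S\<bar> / r \<le> K * (r * norm1 h)\<^sup>2 / r"
   using r by (intro divide_right_mono) auto
  also have "K * (r * norm1 h)\<^sup>2 / r = K * (r * (norm1 h)\<^sup>2)"
   using r by (simp add: power2_eq_square)
  also have "\<dots> \<le> K * \<omega>" using r(2) K by (rule mult_left_mono)
  also have "\<bar>f (p + r *\<^sub>R h) - f p - r * S\<bar> / r = \<bar>(f (p + r *\<^sub>R h) - f p - r * S) / r\<bar>"
   using r by (simp add: abs_divide)
  also have "(f (p + r *\<^sub>R h) - f p - r * S) / r = fd [(1 / r, r *\<^sub>R h)] f p - S"
   using r by (simp add: diff_divide_distrib)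
  finally show ?thesis by (simp add: S_def mult.commute)
 qed
 then show "\<exists>cs. rates cs \<and> (\<forall>K f p. deriv_bound 3 K f -->
   \<bar>fd cs f p - (\<Sum>b\<in>Basis. (h \<bullet> b) * partial_deriv UNIV b f p)\<bar> \<le> \<omega> * K)"
  using r by (intro exI[of _ "[(1 / r, r *\<^sub>R h)]"]) auto
qed

text \<open>A symmetric second difference; the third-order Taylor formula controls the error.\<close>

lemma approximable_second:
 fixes h :: "'n::finite space"
 shows "approximable (\<lambda>f p. 1 / 2 * (\<Sum>a\<in>Basis. \<Sum>b\<in>Basis. (h \<bullet> a) * (h \<bullet> b) * iter_partial UNIV [a, b] f p))"
 unfolding approximable_def
proof (intro allI impI)
 fix \<omega> :: real assume \<omega>: "0 < \<omega>"
 define r where "r = \<omega> / ((norm1 h) ^ 3 + 1)"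
 have n: "0 < (norm1 h) ^ 3 + 1" by (simp add: add_nonneg_pos)
 have r: "0 < r" "r * (norm1 h) ^ 3 \<le> \<omega>"
  using \<omega> n by (auto simp: r_def field_simps)
 define cs where "cs = [(1 / (2 * r\<^sup>2), r *\<^sub>R h), (1 / (2 * r\<^sup>2), - (r *\<^sub>R h))]"
 have "\<bar>fd cs f p - 1 / 2 * (\<Sum>a\<in>Basis. \<Sum>b\<in>Basis. (h \<bullet> a) * (h \<bullet> b) * iter_partial UNIV [a, b] f p)\<bar> \<le> \<omega> * K"
  if f: "deriv_bound 3 K f" for K f p
 proof -
  have K: "0 \<le> K" using deriv_bound_nonneg[OF f] by simp
  define S where "S = (\<Sum>a\<in>Basis. \<Sum>b\<in>Basis. (h \<bullet> a) * (h \<bullet> b) * iter_partial UNIV [a, b] f p)"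
  define D where "D = (\<Sum>b\<in>Basis. (h \<bullet> b) * partial_deriv UNIV b f p)"
  have T: "\<bar>f (p + s *\<^sub>R h) - f p - s * D - 1 / 2 * (s\<^sup>2 * S)\<bar> \<le> K * (\<bar>s\<bar> * norm1 h) ^ 3" for s
  proof -
   have "(\<Sum>b\<in>Basis. ((s *\<^sub>R h) \<bullet> b) * partial_deriv UNIV b f p) = s * D"
    by (simp add: D_def sum_distrib_left mult.assoc)
   moreover have "(\<Sum>a\<in>Basis. \<Sum>b\<in>Basis. ((s *\<^sub>R h) \<bullet> a) * ((s *\<^sub>R h) \<bullet> b) * iter_partial UNIV [a, b] f p) = s\<^sup>2 * S"
    by (simp add: S_def sum_distrib_left power2_eq_square mult_ac)
   ultimately show ?thesis
    using Taylor3_norm1[OF f, of p "s *\<^sub>R h"] by (simp only: norm1_scaleR)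
  qed
  have "\<bar>f (p + r *\<^sub>R h) + f (p + (- r) *\<^sub>R h) - 2 * f p - r\<^sup>2 * S\<bar> \<le> 2 * (K * (r * norm1 h) ^ 3)"
   using T[of r] T[of "- r"] r by (simp add: abs_le_iff)
  then have "\<bar>f (p + r *\<^sub>R h) + f (p + (- r) *\<^sub>R h) - 2 * f p - r\<^sup>2 * S\<bar> / (2 * r\<^sup>2)
    \<le> 2 * (K * (r * norm1 h) ^ 3) / (2 * r\<^sup>2)"
   by (rule divide_right_mono) simp
  also have "2 * (K * (r * norm1 h) ^ 3) / (2 * r\<^sup>2) = K * (r * (norm1 h) ^ 3)"
   using r by (simp add: power2_eq_square power3_eq_cube)
  also have "\<dots> \<le> K * \<omega>" using r(2) K by (rule mult_left_mono)
  also have "\<bar>f (p + r *\<^sub>R h) + f (p + (- r) *\<^sub>R h) - 2 * f p - r\<^sup>2 * S\<bar> / (2 * r\<^sup>2) =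
    \<bar>(f (p + r *\<^sub>R h) + f (p + (- r) *\<^sub>R h) - 2 * f p - r\<^sup>2 * S) / (2 * r\<^sup>2)\<bar>"
   by (simp add: abs_divide)
  also have "(f (p + r *\<^sub>R h) + f (p + (- r) *\<^sub>R h) - 2 * f p - r\<^sup>2 * S) / (2 * r\<^sup>2) = fd cs f p - 1 / 2 * S"
   using r by (simp add: cs_def field_simps)
  finally show ?thesis by (simp add: S_def mult.commute)
 qed
 moreover have "rates cs" by (simp add: cs_def)
 ultimately show "\<exists>cs. rates cs \<and> (\<forall>K f p. deriv_bound 3 K f -->
   \<bar>fd cs f p - 1 / 2 * (\<Sum>a\<in>Basis. \<Sum>b\<in>Basis. (h \<bullet> a) * (h \<bullet> b) * iter_partial UNIV [a, b] f p)\<bar> \<le> \<omega> * K)"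
  by blast
qed

text \<open>Completing a square annihilates one row and column, as in the Cholesky decomposition.\<close>

lemma psd_sum_of_squares:
 fixes Q :: "real^'n^'n"
 assumes "Q \<in> psd"
 shows "\<exists>vs :: (real^'n) list. \<forall>i j. Q $ i $ j = (\<Sum>v\<leftarrow>vs. v $ i * v $ j)"
 using assms
proof (induction "card {i. Q $ i \<noteq> 0}" arbitrary: Q rule: less_induct)
 case less
 have sym: "Q $ i $ j = Q $ j $ i" for i j
  using less(2) by (simp add: psd_def transpose_def vec_eq_iff)
 have pos: "0 \<le> x \<bullet> (Q *v x)" for x using less(2) by (simp add: psd_def)
 have Qe: "Q *v axis i 1 = Q $ i" for i
  by (simp add: matrix_vector_mul_component vec_eq_iff inner_axis sym)
 show ?case
 proof (cases "\<exists>i. 0 < Q $ i $ i")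
  case False
  have d0: "Q $ i $ i = 0" for i
   using pos[of "axis i 1"] False by (simp add: Qe inner_axis' not_less) (meson antisym)
  have "Q $ i $ j = 0" for i j
  proof -
   have "0 \<le> (axis i 1 + axis j 1) \<bullet> (Q *v (axis i 1 + axis j 1))"
    "0 \<le> (axis i 1 - axis j 1) \<bullet> (Q *v (axis i 1 - axis j 1))"
    by (rule pos)+
   then show ?thesis
    by (simp add: matrix_vector_right_distrib matrix_vector_mult_diff_distrib Qe inner_add_left inner_diff_left
      inner_axis' d0 sym[of j i])
  qed
  then show ?thesis by (intro exI[of _ "[]"]) simp
 next
  case True
  then obtain k where k: "0 < Q $ k $ k" by blast
  define a where "a = Q $ k $ k"
  define v where "v = (1 / sqrt a) *\<^sub>R (Q $ k)"
  define Q' where "Q' = (\<chi> i j. Q $ i $ j - v $ i * v $ j)"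
  have a: "0 < a" using k by (simp add: a_def)
  have vv: "v $ i * v $ j = Q $ k $ i * Q $ k $ j / a" for i j
   using a by (simp add: v_def)
  have Q'x: "x \<bullet> (Q' *v x) = x \<bullet> (Q *v x) - (v \<bullet> x)\<^sup>2" for x
  proof -
   have "Q' *v x = Q *v x - (v \<bullet> x) *\<^sub>R v"
   proof (rule vec_eq_iff[THEN iffD2], rule allI)
    fix i
    have "(Q' *v x) $ i = (\<Sum>j\<in>UNIV. Q $ i $ j * x $ j) - (\<Sum>j\<in>UNIV. v $ i * v $ j * x $ j)"
     by (simp add: Q'_def matrix_vector_mult_def left_diff_distrib sum_subtractf)
    also have "(\<Sum>j\<in>UNIV. v $ i * v $ j * x $ j) = (v \<bullet> x) * v $ i"
     by (simp add: inner_vec_def sum_distrib_left mult_ac)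
    finally show "(Q' *v x) $ i = (Q *v x - (v \<bullet> x) *\<^sub>R v) $ i"
     by (simp add: matrix_vector_mult_def)
   qed
   then show ?thesis by (simp add: inner_diff_right power2_eq_square inner_commute)
  qed
  have "0 \<le> x \<bullet> (Q' *v x)" for x
  proof -
   define t where "t = (Q $ k \<bullet> x) / a"
   have comp: "(Q *v x) $ k = Q $ k \<bullet> x" by (simp add: matrix_vector_mul_component)
   have "0 \<le> (x - t *\<^sub>R axis k 1) \<bullet> (Q *v (x - t *\<^sub>R axis k 1))" by (rule pos)
   also have "\<dots> = x \<bullet> (Q *v x) - 2 * t * (Q $ k \<bullet> x) + t\<^sup>2 * a"
    by (simp add: matrix_vector_mult_diff_distrib matrix_vector_mult_scaleR Qe inner_diff_left inner_diff_right
      inner_axis' comp power2_eq_square inner_commute algebra_simps) (simp add: a_def algebra_simps)?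
   also have "\<dots> = x \<bullet> (Q *v x) - (Q $ k \<bullet> x)\<^sup>2 / a"
    using a by (simp add: t_def power2_eq_square field_simps)
   also have "\<dots> = x \<bullet> (Q' *v x)"
    using a by (simp add: Q'x v_def power_divide)
   finally show ?thesis .
  qed
  moreover have "transpose Q' = Q'"
   by (simp add: transpose_def vec_eq_iff Q'_def sym mult.commute)
  ultimately have Q': "Q' \<in> psd" by (simp add: psd_def)
  have row0: "Q' $ i = 0" if "Q $ i = 0" for i
   using that by (simp add: vec_eq_iff Q'_def vv sym[of k i])
  have rowk: "Q' $ k = 0" using a by (simp add: vec_eq_iff Q'_def vv a_def)
  have "{i. Q' $ i \<noteq> 0} \<subseteq> {i. Q $ i \<noteq> 0}" using row0 by blast
  moreover have "k \<notin> {i. Q' $ i \<noteq> 0}" using rowk by simp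
  moreover have "k \<in> {i. Q $ i \<noteq> 0}" using k by (auto simp del: vec_eq_iff)
  ultimately have "{i. Q' $ i \<noteq> 0} \<subset> {i. Q $ i \<noteq> 0}" by blast
  then have "card {i. Q' $ i \<noteq> 0} < card {i. Q $ i \<noteq> 0}" by (intro psubset_card_mono) auto
  from less(1)[OF this Q'] obtain vs where vs: "\<forall>i j. Q' $ i $ j = (\<Sum>v\<leftarrow>vs. v $ i * v $ j)" by blast
  have "Q $ i $ j = (\<Sum>v\<leftarrow>v # vs. v $ i * v $ j)" for i j
   using vs[rule_format, of i j] by (simp add: Q'_def)
  then show ?thesis by blast
 qed
qed

lemma approximable_trace:
 fixes Q :: "real^'n^'n"
 assumes "Q \<in> psd"
 shows "approximable (\<lambda>f p. 1 / 2 * trace (hess_x f p ** Q))"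
proof -
 obtain vs :: "(real^'n) list" where vs: "\<And>i j. Q $ i $ j = (\<Sum>v\<leftarrow>vs. v $ i * v $ j)"
  using psd_sum_of_squares[OF assms] by blast
 define S where "S v f p = 1 / 2 * (\<Sum>a\<in>Basis. \<Sum>b\<in>Basis. ((v, 0, 0) \<bullet> a) * ((v, 0, 0) \<bullet> b) * iter_partial UNIV [a, b] f p)"
  for v :: "real^'n" and f :: "'n space => real" and p
 have "approximable (\<lambda>f p. \<Sum>v\<leftarrow>vs. S v f p)"
 proof (induction vs)
  case (Cons v vs)
  have "approximable (S v)" unfolding S_def by (rule approximable_second)
  from approximable_add[OF this Cons] show ?case by simp
 qed (simp add: approximable_zero)
 moreover have "(\<Sum>v\<leftarrow>vs. S v f p) = 1 / 2 * trace (hess_x f p ** Q)" for f p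
 proof -
  have S: "S v f p = 1 / 2 * (\<Sum>i\<in>UNIV. \<Sum>j\<in>UNIV. v $ i * v $ j * hess_x f p $ i $ j)" for v
   by (simp add: S_def sum_Basis_space hess_x_def)
  have "(\<Sum>v\<leftarrow>vs. S v f p) = 1 / 2 * (\<Sum>i\<in>UNIV. \<Sum>j\<in>UNIV. (\<Sum>v\<leftarrow>vs. v $ i * v $ j) * hess_x f p $ i $ j)"
   by (induction vs) (simp_all add: S distrib_right sum.distrib distrib_left)
  also have "\<dots> = 1 / 2 * (\<Sum>i\<in>UNIV. \<Sum>j\<in>UNIV. hess_x f p $ i $ j * Q $ j $ i)"
   by (simp add: vs mult.commute)
  finally show ?thesis by (simp add: trace_def matrix_matrix_mult_def)
 qed
 ultimately show ?thesis by simp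
qed

context triplets
begin

lemma jump_Lipschitz:
 fixes f :: "'n space => real"
 assumes f: "deriv_bound 2 K f"
 shows "\<bar>jump f p l - jump f p l'\<bar> \<le> 2 * real CARD('n) * K * norm (l - l')"
proof -
 have K: "0 \<le> K" using deriv_bound_nonneg[OF f] by simp
 have f1: "deriv_bound 1 K f" using deriv_bound_mono[OF f] by simp
 define h :: "'n space" where "h = (0, 0, l - l')"
 have pd: "\<bar>partial_deriv UNIV b f p\<bar> \<le> K" if "b \<in> Basis" for b
  using deriv_boundD[OF f1, of "[b]" p] that by simp
 have 1: "\<bar>f (p + (0, 0, l)) - f (p + (0, 0, l'))\<bar> \<le> K * norm1 h"
  using Lipschitz_norm1[OF f1, of "p + (0, 0, l')" h] by (simp add: h_def add.assoc)
 have "\<bar>grad_z f p \<bullet> (l - l')\<bar> \<le> (\<Sum>b\<in>Basis. \<bar>h \<bullet> b\<bar> * K)"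
  unfolding grad_z_inner h_def[symmetric]
 proof (rule order_trans[OF sum_abs], rule sum_mono)
  fix b :: "'n space" assume "b \<in> Basis"
  from mult_left_mono[OF pd[OF this], of "\<bar>h \<bullet> b\<bar>"]
  show "\<bar>(h \<bullet> b) * partial_deriv UNIV b f p\<bar> \<le> \<bar>h \<bullet> b\<bar> * K" by (simp add: abs_mult)
 qed
 also have "\<dots> = K * norm1 h" by (simp add: norm1_def sum_distrib_left mult.commute)
 finally have "\<bar>jump f p l - jump f p l'\<bar> \<le> 2 * (K * norm1 h)"
  using 1 unfolding jump_def inner_diff_right by linarith
 also have "\<dots> \<le> 2 * (K * (real CARD('n) * norm (l - l')))"
  using K norm1_z[of "l - l'"] unfolding h_def by (intro mult_left_mono) auto
 finally show ?thesis by (simp add: mult_ac)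
qed

text \<open>Near the origin and near infinity the jumps contribute little, since \<open>min \<bar>l\<bar> \<bar>l\<bar>\<^sup>2\<close> is
 integrable. On the remaining compact set the measure is finite, and there it is replaced by
 finitely many point masses.\<close>

lemma jump_quadrature:
 assumes th: "(F, q, Q) \<in> \<Theta>" and \<omega>: "0 < \<omega>"
 shows "\<exists>(N :: nat) c l. (\<forall>j. 0 \<le> c j) \<and> (\<forall>K f p. deriv_bound 2 K f -->
  \<bar>(\<integral>l. jump f p l \<partial>F) - (\<Sum>j<N. c j * jump f p (l j))\<bar> \<le> \<omega> * K)"
proof -
 note F = F_facts[OF th]
 have meas[measurable_cong]: "sets F = sets borel" by (rule F(1))
 have spF: "space F = UNIV" using sets_eq_imp_space_eq[OF F(1)] by simp
 define g :: "real^'n => real" where "g l = min (norm l) ((norm l)\<^sup>2)" for l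
 have gint: "integrable F g" using F(2) by (simp add: g_def[abs_def])
 have g0: "0 \<le> g l" for l by (simp add: g_def)
 define n where "n = real CARD('n)"
 have n: "1 \<le> n" by (simp add: n_def Suc_le_eq)
 define A where "A k = {l :: real^'n. 1 / real (Suc k) \<le> norm l \<and> norm l \<le> real (Suc k)}" for k
 have Acl: "closed (A k)" for k
  unfolding A_def Collect_conj_eq by (intro closed_Int closed_Collect_le continuous_intros)
 have Acp: "compact (A k)" for k
  using Acl[of k] unfolding compact_eq_bounded_closed by (auto simp: bounded_iff A_def)
 have Ab: "A k \<in> sets F" for k using Acl[of k] by (simp add: meas)
 have lim: "(\<lambda>k. \<integral>l. g l * indicator (- A k) l \<partial>F) \<longlonglongrightarrow> (\<integral>l. 0 \<partial>F)"
 proof (rule integral_dominated_convergence[where w = g])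
  show "AE l in F. (\<lambda>k. g l * indicator (- A k) l) \<longlonglongrightarrow> 0"
  proof (rule AE_I2, rule tendsto_eventually)
   fix l :: "real^'n"
   show "\<forall>\<^sub>F k in sequentially. g l * indicator (- A k) l = 0"
   proof (cases "l = 0")
    case False
    obtain k1 :: nat where k1: "norm l \<le> real k1" using real_arch_simple by blast
    obtain k2 :: nat where k2: "1 / norm l \<le> real k2" using real_arch_simple by blast
    have "l \<in> A k" if "max k1 k2 \<le> k" for k
    proof -
     have "norm l \<le> real (Suc k)" using k1 that by linarith
     moreover have "1 / norm l \<le> real (Suc k)" using k2 that by linarith
     then have "1 / real (Suc k) \<le> norm l" using False by (simp add: field_simps)
     ultimately show ?thesis by (simp add: A_def)
    qed
    then show ?thesis by (auto simp: eventually_sequentially intro!: exI[of _ "max k1 k2"])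
   qed (simp add: g_def)
  qed
  show "\<And>k. AE l in F. norm (g l * indicator (- A k) l) \<le> g l"
   by (rule AE_I2) (auto simp: g0 indicator_def)
  show "(\<lambda>l. g l * indicator (- A k) l) \<in> borel_measurable F" for k
   using gint Ab[of k] by (intro borel_measurable_times borel_measurable_integrable borel_measurable_indicator)
    (auto simp: Compl_eq_Diff_UNIV spF[symmetric])
 qed (use gint in auto)
 define \<omega>1 where "\<omega>1 = \<omega> / (4 * n\<^sup>2)"
 have \<omega>1: "0 < \<omega>1" using \<omega> n by (simp add: \<omega>1_def)
 have "\<forall>\<^sub>F k in sequentially. (\<integral>l. g l * indicator (- A k) l \<partial>F) < \<omega>1"
  using order_tendstoD(2)[OF lim] \<omega>1 by simp
 then obtain k where k: "(\<integral>l. g l * indicator (- A k) l \<partial>F) < \<omega>1" by (auto simp: eventually_sequentially)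
 define AA where "AA = A k"
 have AAs: "AA \<in> sets F" "compact AA" using Ab Acp by (auto simp: AA_def)
 have g_lower: "(1 / real (Suc k))\<^sup>2 \<le> g l" if "l \<in> AA" for l
 proof -
  have l: "1 / real (Suc k) \<le> norm l" using that by (simp add: AA_def A_def)
  then have "(1 / real (Suc k))\<^sup>2 \<le> (norm l)\<^sup>2" by (intro power_mono) auto
  moreover have "(1 / real (Suc k))\<^sup>2 \<le> 1 / real (Suc k)"
   unfolding power2_eq_square by (rule mult_left_le) auto
  ultimately show ?thesis using l unfolding g_def by linarith
 qed
 have Afin: "integrable F (indicator AA :: real^'n => real)"
 proof (rule Bochner_Integration.integrable_bound)
  show "integrable F (\<lambda>l. (real (Suc k))\<^sup>2 * g l)" using gint by (intro integrable_mult_right)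
  have "indicator AA l \<le> (real (Suc k))\<^sup>2 * g l" for l :: "real^'n"
  proof (cases "l \<in> AA")
   case True
   have "(real (Suc k))\<^sup>2 * (1 / real (Suc k))\<^sup>2 \<le> (real (Suc k))\<^sup>2 * g l"
    using g_lower[OF True] by (rule mult_left_mono) simp
   then show ?thesis using True by (simp add: power_one_over)
  qed (simp add: g0)
  then show "AE l in F. norm (indicator AA l :: real) \<le> norm ((real (Suc k))\<^sup>2 * g l)"
   by (intro AE_I2) (simp add: order_trans[OF _ abs_ge_self])
 qed (use AAs in simp)
 define m :: real where "m = (\<integral>l. indicator AA l \<partial>F)"
 have m: "0 \<le> m" unfolding m_def by (rule Bochner_Integration.integral_nonneg) simp
 define \<eta> where "\<eta> = \<omega> / (4 * n * (m + 1))"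
 have \<eta>: "0 < \<eta>" using \<omega> n m by (simp add: \<eta>_def)
 obtain X where X: "finite X" "X \<subseteq> AA" "AA \<subseteq> (\<Union>x\<in>X. ball x \<eta>)"
  using compactE_image[OF AAs(2), of AA "\<lambda>x. ball x \<eta>"] \<eta> by (metis UN_upper centre_in_ball UN_I open_ball subsetI)
 obtain l :: "nat => real^'n" and N :: nat where l: "X = l ` {..<N}"
  using finite_imp_nat_seg_image_inj_on[OF X(1)] by (metis lessThan_def)
 define D where "D j = AA \<inter> disjointed (\<lambda>j. ball (l j) \<eta>) j" for j
 have Dm: "D j \<in> sets F" for j
  unfolding D_def disjointed_def using AAs(1) by (auto simp: meas)
 have Dd: "disjoint_family_on D {..<N}"
  using disjoint_family_disjointed[of "\<lambda>j. ball (l j) \<eta>"] unfolding D_def disjoint_family_on_def by blast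
 have DU: "(\<Union>j<N. D j) = AA"
 proof -
  have "(\<Union>j<N. D j) = AA \<inter> (\<Union>j\<in>{0..<N}. disjointed (\<lambda>j. ball (l j) \<eta>) j)"
   by (auto simp: D_def)
  also have "\<dots> = AA \<inter> (\<Union>j\<in>{0..<N}. ball (l j) \<eta>)" by (simp only: finite_UN_disjointed_eq)
  also have "\<dots> = AA" using X(3) unfolding l by (auto simp: lessThan_atLeast0)
  finally show ?thesis .
 qed
 have ind: "(\<Sum>j<N. indicator (D j) x) = (indicator AA x :: real)" for x
 proof -
  have "(indicator (\<Union>j<N. D j) x :: real) = (\<Sum>j<N. indicator (D j) x)"
   by (rule indicator_UN_disjoint[OF _ Dd]) simp
  then show ?thesis by (simp add: DU)
 qed
 have Dfin: "integrable F (indicator (D j) :: real^'n => real)" for j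
  by (rule Bochner_Integration.integrable_bound[OF Afin]) (use Dm in \<open>auto simp: D_def indicator_def\<close>)
 define c :: "nat => real" where "c j = (\<integral>x. indicator (D j) x \<partial>F)" for j
 show ?thesis
 proof (intro exI[of _ N] exI[of _ c] exI[of _ l] conjI allI impI)
  show "0 \<le> c j" for j unfolding c_def by (rule Bochner_Integration.integral_nonneg) simp
  fix K and f :: "'n space => real" and p assume f: "deriv_bound 2 K f"
  have K: "0 \<le> K" using deriv_bound_nonneg[OF f] by simp
  have ji: "integrable F (jump f p)" by (rule jump_integrable[OF th deriv_bound_smooth[OF f]])
  have si: "integrable F (\<lambda>x. \<Sum>j<N. jump f p (l j) * indicator (D j) x)"
   using Dfin by (intro Bochner_Integration.integrable_sum integrable_mult_right)
  have "(\<Sum>j<N. c j * jump f p (l j)) = (\<integral>x. (\<Sum>j<N. jump f p (l j) * indicator (D j) x) \<partial>F)"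
   using Dfin by (subst Bochner_Integration.integral_sum) (auto simp: c_def mult.commute intro!: integrable_mult_right)
  then have "(\<integral>l. jump f p l \<partial>F) - (\<Sum>j<N. c j * jump f p (l j)) =
    (\<integral>x. jump f p x - (\<Sum>j<N. jump f p (l j) * indicator (D j) x) \<partial>F)"
   using ji si by simp
  also have "\<bar>\<dots>\<bar> \<le> (\<integral>x. 2 * n\<^sup>2 * K * (g x * indicator (- AA) x) + 2 * n * K * \<eta> * indicator AA x \<partial>F)"
  proof (rule integral_abs_bound_integral)
   have gi: "integrable F (\<lambda>x. g x * indicator (- AA) x)"
   proof (rule Bochner_Integration.integrable_bound[OF gint])
    show "(\<lambda>l. g l * indicator (- AA) l) \<in> borel_measurable F"
     using gint AAs(1) by (intro borel_measurable_times borel_measurable_integrable borel_measurable_indicator)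
      (auto simp: Compl_eq_Diff_UNIV spF[symmetric])
   qed (auto simp: g0 indicator_def)
   then show "integrable F (\<lambda>x. 2 * n\<^sup>2 * K * (g x * indicator (- AA) x) + 2 * n * K * \<eta> * indicator AA x)"
    using Afin by (intro Bochner_Integration.integrable_add integrable_mult_right)
   show "integrable F (\<lambda>x. jump f p x - (\<Sum>j<N. jump f p (l j) * indicator (D j) x))"
    using ji si by (rule Bochner_Integration.integrable_diff)
   fix x
   show "\<bar>jump f p x - (\<Sum>j<N. jump f p (l j) * indicator (D j) x)\<bar> \<le>
     2 * n\<^sup>2 * K * (g x * indicator (- AA) x) + 2 * n * K * \<eta> * indicator AA x"
   proof (cases "x \<in> AA")
    case False
    then have "indicator (D j) x = (0 :: real)" for j by (auto simp: D_def indicator_def)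
    then show ?thesis using False jump_bound[OF f, of p x] by (simp add: n_def g_def)
   next
    case True
    have "jump f p x = (\<Sum>j<N. jump f p x * indicator (D j) x)"
     unfolding sum_distrib_left[symmetric] ind using True by simp
    then have "jump f p x - (\<Sum>j<N. jump f p (l j) * indicator (D j) x) =
      (\<Sum>j<N. (jump f p x - jump f p (l j)) * indicator (D j) x)"
     by (simp add: left_diff_distrib sum_subtractf)
    also have "\<bar>\<dots>\<bar> \<le> (\<Sum>j<N. 2 * n * K * \<eta> * indicator (D j) x)"
    proof (rule order_trans[OF sum_abs], rule sum_mono)
     fix j
     show "\<bar>(jump f p x - jump f p (l j)) * indicator (D j) x\<bar> \<le> 2 * n * K * \<eta> * indicator (D j) x"
     proof (cases "x \<in> D j")
      case True
      then have "norm (x - l j) \<le> \<eta>"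
       using disjointed_subset[of "\<lambda>j. ball (l j) \<eta>" j] by (auto simp: D_def dist_norm norm_minus_commute subset_iff)
      then have "2 * n * K * norm (x - l j) \<le> 2 * n * K * \<eta>"
       using n K by (intro mult_left_mono) auto
      then have "\<bar>jump f p x - jump f p (l j)\<bar> \<le> 2 * n * K * \<eta>"
       using order_trans[OF jump_Lipschitz[OF f, of p x "l j"]] by (simp only: n_def)
      then show ?thesis using True by simp
     qed simp
    qed
    also have "\<dots> = 2 * n * K * \<eta> * indicator AA x"
     unfolding sum_distrib_left[symmetric] ind ..
    finally show ?thesis using True by simp
   qed
  qed
  also have "\<dots> = 2 * n\<^sup>2 * K * (\<integral>x. g x * indicator (- AA) x \<partial>F) + 2 * n * K * \<eta> * m"
  proof -
   have gi: "integrable F (\<lambda>x. g x * indicator (- AA) x)"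
   proof (rule Bochner_Integration.integrable_bound[OF gint])
    show "(\<lambda>l. g l * indicator (- AA) l) \<in> borel_measurable F"
     using gint AAs(1) by (intro borel_measurable_times borel_measurable_integrable borel_measurable_indicator)
      (auto simp: Compl_eq_Diff_UNIV spF[symmetric])
   qed (auto simp: g0 indicator_def)
   show ?thesis using gi Afin by (subst Bochner_Integration.integral_add) (auto simp: m_def)
  qed
  also have "\<dots> \<le> 2 * n\<^sup>2 * K * \<omega>1 + 2 * n * K * \<eta> * (m + 1)"
   using k K n m \<eta> by (intro add_mono mult_left_mono) (auto simp: AA_def)
  also have "\<dots> = \<omega> * K"
  proof -
   have "2 * n\<^sup>2 * K * \<omega>1 = \<omega> * K / 2" using n by (simp add: \<omega>1_def)
   moreover have "2 * n * K * (\<omega> / (4 * n * a)) * a = \<omega> * K / 2" if "a \<noteq> 0" for a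
    using n that by simp
   then have "2 * n * K * \<eta> * (m + 1) = \<omega> * K / 2" using m unfolding \<eta>_def by simp
   ultimately show ?thesis by linarith
  qed
  finally show "\<bar>(\<integral>l. jump f p l \<partial>F) - (\<Sum>j<N. c j * jump f p (l j))\<bar> \<le> \<omega> * K" .
 qed
qed

text \<open>Quadrature reduces the jump part to finitely many differences and a drift that compensates them;
 the diffusion part is a sum of squares, hence of second differences.\<close>

lemma approximable_Lop:
 assumes th: "\<theta> \<in> \<Theta>"
 shows "approximable (Lop \<theta>)"
proof -
 obtain F q Q where \<theta>: "\<theta> = (F, q, Q)" by (cases \<theta>)
 note th' = th[unfolded \<theta>]
 have jmp: "approximable (\<lambda>f p. \<integral>l. jump f p l \<partial>F)"
  unfolding approximable_def
 proof (intro allI impI)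
  fix \<omega> :: real assume \<omega>: "0 < \<omega>"
  then have \<omega>2: "0 < \<omega> / 2" by simp
  obtain N c l where cl: "\<And>j::nat. 0 \<le> c j"
   "\<And>K f p. deriv_bound 2 K f ==> \<bar>(\<integral>l. jump f p l \<partial>F) - (\<Sum>j<N. c j * jump f p (l j))\<bar> \<le> \<omega> / 2 * K"
   using jump_quadrature[OF th' \<omega>2] by blast
  define b where "b = (\<Sum>j<N. c j *\<^sub>R l j)"
  obtain ds where ds: "rates ds" "\<And>K f p. deriv_bound 3 K f ==>
    \<bar>fd ds f p - (\<Sum>a\<in>Basis. ((0, 0, - b) \<bullet> a) * partial_deriv UNIV a f p)\<bar> \<le> \<omega> / 2 * K"
   using approximable_drift[of "(0, 0, - b)", unfolded approximable_def, rule_format, OF \<omega>2] by blast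
  define cs :: "'n jumps" where "cs = map (\<lambda>j. (c j, (0, 0, l j))) [0..<N]"
  have cs: "rates cs" using cl(1) by (auto simp: cs_def rates_def)
  have fdcs: "fd cs f p = (\<Sum>j<N. c j * (f (p + (0, 0, l j)) - f p))" for f p
   by (simp add: cs_def fd_def o_def interv_sum_list_conv_sum_set_nat lessThan_atLeast0)
  have "\<bar>fd (cs @ ds) f p - (\<integral>l. jump f p l \<partial>F)\<bar> \<le> \<omega> * K" if f: "deriv_bound 3 K f" for K f p
  proof -
   have f2: "deriv_bound 2 K f" by (rule deriv_bound_mono[OF f]) auto
   have "(\<Sum>a\<in>Basis. ((0, 0, - b) \<bullet> a) * partial_deriv UNIV a f p) = grad_z f p \<bullet> (- b)"
    by (simp only: grad_z_inner)
   also have "\<dots> = - (\<Sum>j<N. c j * (grad_z f p \<bullet> l j))"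
    by (simp add: b_def inner_sum_right)
   finally have "(\<Sum>j<N. c j * jump f p (l j)) = fd cs f p + (\<Sum>a\<in>Basis. ((0, 0, - b) \<bullet> a) * partial_deriv UNIV a f p)"
    unfolding fdcs jump_def by (simp add: right_diff_distrib sum_subtractf)
   then show ?thesis using cl(2)[OF f2, of p] ds(2)[OF f, of p] unfolding fd_append by linarith
  qed
  then show "\<exists>cs. rates cs \<and> (\<forall>K f p. deriv_bound 3 K f --> \<bar>fd cs f p - (\<integral>l. jump f p l \<partial>F)\<bar> \<le> \<omega> * K)"
   using cs ds(1) by (intro exI[of _ "cs @ ds"]) simp
 qed
 have "approximable (\<lambda>f p. grad_y f p \<bullet> q)"
  unfolding grad_y_inner by (rule approximable_drift)
 from approximable_add[OF approximable_add[OF jmp this] approximable_trace[of Q]] F_facts(5)[OF th']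
 show ?thesis by (simp add: Lop_def \<theta>)
qed

end

lemma small_multiple:
 fixes D x \<eta> k :: real
 assumes "0 \<le> D" "0 \<le> x" "x \<le> \<eta> / (k * (D + 1))" "0 < k"
 shows "D * x \<le> \<eta> / k"
proof -
 have "D * x \<le> (D + 1) * x" using assms by (intro mult_right_mono) auto
 also have "\<dots> \<le> (D + 1) * (\<eta> / (k * (D + 1)))" using assms by (intro mult_left_mono) auto
 also have "\<dots> = \<eta> / k" using assms by (simp add: add_nonneg_eq_0_iff)
 finally show ?thesis .
qed

lemma strip_bounded: "bounded (u ` S) ==> \<exists>M. \<forall>q\<in>S. \<bar>u q :: real\<bar> \<le> M"
 by (simp add: bounded_iff)

lemma fd_deriv_bound:
 assumes f: "f \<in> Cb_inf UNIV" and b: "\<And>vs p. vs \<in> lists Basis ==> vs \<noteq> [] ==> length vs \<le> k ==>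
  \<bar>fd cs (iter_partial UNIV vs f) p\<bar> \<le> B"
 shows "deriv_bound k B (fd cs f)"
 unfolding deriv_bound_def using fd_smooth[OF f] b iter_partial_fd[OF f]
 by (simp del: iter_partial.simps)

lemma deriv_bound_sub_const: "deriv_bound k B f ==> 1 \<le> k ==> deriv_bound k B (\<lambda>p. f p - c)"
 using deriv_bound_add[OF _ deriv_bound_const[of 0 k "- c"], of B f] by simp

context triplets
begin

text \<open>The function \<open>f + (s - t) * fd cs f\<close>, lowered by the error terms, is a smooth subsolution of the linear
 equation of the triplet, hence of the equation.\<close>

lemma one_step:
 fixes u \<rho> :: "real \<times> 'n space => real"
 assumes \<rho>: "mollifier \<rho>" and u: "continuous_on strip u" "bounded (u ` strip)" "super_test \<Theta> u"
  and th: "\<theta> \<in> \<Theta>" and cs: "rates cs" and f: "deriv_bound 3 B f"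
  and approx: "\<And>p. \<bar>fd cs f p - Lop \<theta> f p\<bar> \<le> r"
  and t: "0 \<le> t" "0 \<le> s" "t + s \<le> 1" and le: "\<And>e. f e \<le> u (t, e)"
 shows "step s cs f e - (s * r + CL * (mass cs * B) * s\<^sup>2) \<le> u (t + s, e)"
proof (cases "s = 0")
 case True
 then show ?thesis using le by (simp add: step_def)
next
 case False
 then have s: "0 < s" using t by simp
 define K where "K = CL * (mass cs * B)"
 define g where "g = fd cs f"
 note fs = deriv_bound_smooth[OF f]
 have gs: "g \<in> Cb_inf UNIV" unfolding g_def by (rule fd_smooth[OF fs])
 have B: "0 \<le> B" using deriv_bound_nonneg[OF f] by simp
 have K: "0 \<le> K" using CL_nonneg mass_nonneg[OF cs] B by (simp add: K_def)
 have gb: "deriv_bound 2 (2 * mass cs * B) g"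
  unfolding g_def
 proof (rule fd_deriv_bound[OF fs])
  fix vs p assume "vs \<in> lists (Basis :: 'n space set)" "vs \<noteq> []" "length vs \<le> 2"
  then show "\<bar>fd cs (iter_partial UNIV vs f) p\<bar> \<le> 2 * mass cs * B"
   using deriv_boundD[OF f] by (intro fd_abs_le[OF cs]) auto
 qed
 \<comment> \<open>The quadratic term in time dominates \<open>Lop \<theta>\<close> of the first-order term.\<close>
 define w where "w q = f (snd q) + (fst q - t) * g (snd q) - ((fst q - t) * r + K * (fst q - t)\<^sup>2)" for q :: "real \<times> 'n space"
 have wsm: "w \<in> Cb_inf cyl"
  unfolding w_def[abs_def]
  by (intro Cb_inf_add Cb_inf_cmult Cb_inf_mult Cb_inf_power Cb_inf_diff Cb_inf_const fst_smooth snd_smooth fs gs thick_cyl)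
 have wc: "continuous_on ({t..1} \<times> UNIV) w"
  unfolding w_def[abs_def]
  by (intro continuous_intros continuous_on_compose2[OF Cb_inf_cont[OF fs]] continuous_on_compose2[OF Cb_inf_cont[OF gs]]) auto
 have "w (t + s, e) \<le> u (t + s, e)"
 proof (rule comparison_super[OF \<rho> u wsm wc _ t(1) _ t(3)])
  fix t' and e :: "'n space" assume t': "t < t'" "t' < t + s"
  have tc: "(t', e) \<in> cyl" using t' t by (auto simp: cyl_def)
  have "has_partial cyl w dt (\<lambda>q. g (snd q) - (r + K * (2 * (fst q - t))))"
   unfolding has_partial_def
  proof
   fix q :: "real \<times> 'n space"
   have "((\<lambda>s. f (snd q) + (fst q + s - t) * g (snd q) - ((fst q + s - t) * r + K * (fst q + s - t)\<^sup>2))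
     has_real_derivative g (snd q) - (r + K * (2 * (fst q - t)))) (at 0 within {s. q + s *\<^sub>R dt \<in> cyl})"
    by (auto intro!: derivative_eq_intros)
   then show "((\<lambda>s. w (q + s *\<^sub>R dt)) has_vector_derivative g (snd q) - (r + K * (2 * (fst q - t))))
     (at 0 within {s. q + s *\<^sub>R dt \<in> cyl})"
    by (simp add: w_def dt_def has_real_derivative_iff_has_vector_derivative zero_prod_def[symmetric])
  qed
  from has_partial_unique[OF thick_cyl dt_Basis this tc]
  have dw: "partial_deriv cyl dt w (t', e) = g e - (r + K * (2 * (t' - t)))" by simp
  have cc: "(\<lambda>e. (t' - t) * g e) \<in> Cb_inf UNIV" by (rule Cb_inf_cmult[OF thick_UNIV gs])
  have fg: "(\<lambda>e. f e + (t' - t) * g e) \<in> Cb_inf UNIV" by (rule Cb_inf_add[OF thick_UNIV fs cc])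
  define c where "c = - ((t' - t) * r + K * (t' - t)\<^sup>2)"
  have ws: "(\<lambda>e. w (t', e)) = (\<lambda>e. (f e + (t' - t) * g e) + c)"
   by (simp add: w_def c_def fun_eq_iff)
  have "Lop \<theta> (\<lambda>e. c) e = 0"
   using Lop_bound[OF th deriv_bound_const[of 0 2 c]] by simp
  then have "Lop \<theta> (\<lambda>e. w (t', e)) e = Lop \<theta> f e + (t' - t) * Lop \<theta> g e"
   unfolding ws Lop_linear(1)[OF th fg Cb_inf_const[OF thick_UNIV]] Lop_linear(1)[OF th fs cc] Lop_linear(2)[OF th gs gs]
   by simp
  moreover have "(\<lambda>e. w (t', e)) \<in> Cb_inf UNIV"
   unfolding ws by (intro Cb_inf_add[OF thick_UNIV fg] Cb_inf_const thick_UNIV)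
  note Gop_ge[OF th this, of e]
  moreover have "g e - r \<le> Lop \<theta> f e" using approx[of e] by (simp add: g_def abs_le_iff)
  moreover have "- (CL * (2 * mass cs * B)) \<le> Lop \<theta> g e" using Lop_bound[OF th gb, of e] by linarith
  then have "(t' - t) * - (CL * (2 * mass cs * B)) \<le> (t' - t) * Lop \<theta> g e" using t' by (intro mult_left_mono) auto
  moreover have "(t' - t) * - (CL * (2 * mass cs * B)) = - (K * (2 * (t' - t)))" by (simp add: K_def)
  ultimately show "partial_deriv cyl dt w (t', e) \<le> Gop \<Theta> (\<lambda>e. w (t', e)) e"
   unfolding dw by linarith
 next
  show "w (t, e) \<le> u (t, e)" for e using le by (simp add: w_def)
 qed (use s in auto)
 then show ?thesis by (simp add: w_def step_def g_def K_def)
qed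

lemma many_steps:
 fixes u \<rho> :: "real \<times> 'n space => real"
 assumes \<rho>: "mollifier \<rho>" and u: "continuous_on strip u" "bounded (u ` strip)" "super_test \<Theta> u"
  and th: "\<theta> \<in> \<Theta>" and cs: "rates cs" and f: "deriv_bound 3 B f"
  and approx: "\<And>g p. deriv_bound 3 B g ==> \<bar>fd cs g p - Lop \<theta> g p\<bar> \<le> r"
  and t: "0 \<le> t" "0 \<le> \<tau>" "\<tau> * mass cs \<le> 1" "t + real k * \<tau> \<le> 1" and le: "\<And>e. f e \<le> u (t, e)"
 shows "(step \<tau> cs ^^ k) f e - real k * (\<tau> * r + CL * (mass cs * B) * \<tau>\<^sup>2) \<le> u (t + real k * \<tau>, e)"
 using t(4)
proof (induction k arbitrary: e)
 case 0
 then show ?case using le by simp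
next
 case (Suc k)
 define c where "c = \<tau> * r + CL * (mass cs * B) * \<tau>\<^sup>2"
 define g where "g e = (step \<tau> cs ^^ k) f e - real k * c" for e
 have tk: "t + real k * \<tau> + \<tau> \<le> 1" using Suc(2) by (simp add: algebra_simps)
 have tk1: "t + real k * \<tau> \<le> 1" using tk t by linarith
 have "deriv_bound 3 B ((step \<tau> cs ^^ k) f)"
  by (induction k) (use f step_deriv_bound[OF cs t(2,3)] in auto)
 then have g: "deriv_bound 3 B g" unfolding g_def by (rule deriv_bound_sub_const) simp
 have "step \<tau> cs g e - c \<le> u (t + real k * \<tau> + \<tau>, e)"
  unfolding c_def
  by (rule one_step[OF \<rho> u th cs g approx[OF g]]) (use Suc.IH[OF tk1] t tk in \<open>auto simp: g_def c_def\<close>)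
 moreover have "step \<tau> cs g e = (step \<tau> cs ^^ Suc k) f e - real k * c"
  using steps_sub_const[of 1 \<tau> cs "(step \<tau> cs ^^ k) f" "real k * c" e] by (simp add: g_def[abs_def])
 moreover have "t + real k * \<tau> + \<tau> = t + real (Suc k) * \<tau>" by (simp add: algebra_simps)
 ultimately show ?case by (simp add: c_def algebra_simps)
qed

text \<open>The slice of \<open>u\<close> is not smooth enough to start the Euler steps; a mollification of it in space is.
 The Lipschitz bound makes the mollified slice uniformly close to the slice, and the steps do not
 increase the distance.\<close>

lemma linear_flow_below:
 fixes u \<rho> :: "real \<times> 'n space => real"
 assumes \<rho>: "mollifier \<rho>" and u: "continuous_on strip u" "bounded (u ` strip)" "super_test \<Theta> u"
  and Lip: "\<And>t e e'. 0 \<le> t ==> t \<le> 1 ==> \<bar>u (t, e) - u (t, e')\<bar> \<le> Lu * norm (e - e')" and Lu: "0 \<le> Lu"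
  and th: "\<theta> \<in> \<Theta>" and \<eta>: "0 < \<eta>" and \<omega>: "0 < \<omega>"
 shows "\<exists>cs N. rates cs \<and> (\<forall>K f p. deriv_bound 3 K f --> \<bar>fd cs f p - Lop \<theta> f p\<bar> \<le> \<omega> * K) \<and> 0 < N \<and>
  mass cs \<le> real N \<and>
  (\<forall>t s e. 0 \<le> t --> 0 \<le> s --> t + s \<le> 1 -->
   (step (s / real N) cs ^^ N) (\<lambda>e. u (t, e)) e - \<eta> \<le> u (t + s, e))"
proof -
 define \<epsilon> where "\<epsilon> = \<eta> / (6 * (Lu + 1))"
 have \<epsilon>: "0 < \<epsilon>" "2 * (Lu * \<epsilon>) \<le> \<eta> / 3"
 proof -
  show "0 < \<epsilon>" using \<eta> Lu by (simp add: \<epsilon>_def)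
  then have "Lu * \<epsilon> \<le> \<eta> / 6" by (intro small_multiple[OF Lu]) (simp_all add: \<epsilon>_def)
  then show "2 * (Lu * \<epsilon>) \<le> \<eta> / 3" by simp
 qed
 define k where "k = rescaled \<rho> \<epsilon>"
 have k: "averaging \<epsilon> k" unfolding k_def by (rule rescaled_averaging[OF \<rho> \<epsilon>(1)])
 note ker = averaging_kernel[OF k]
 obtain M where M: "\<And>q. q \<in> strip ==> \<bar>u q\<bar> \<le> M" using strip_bounded[OF u(2)] by blast
 obtain C where C: "0 \<le> C" "\<And>v M. bounded_borel M v ==> deriv_bound 3 (C * M) (conv v k)"
  using conv_deriv_bound_exists[OF ker] by metis
 have M0: "0 \<le> M" using M[of "(0, 0)"] by auto
 define B where "B = C * M"
 have B: "0 \<le> B" using C M0 by (simp add: B_def)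
 define \<omega>1 where "\<omega>1 = min \<omega> (\<eta> / (3 * (B + 1)))"
 have \<omega>1: "0 < \<omega>1" "\<omega>1 \<le> \<omega>" "\<omega>1 * B \<le> \<eta> / 3"
 proof -
  show "0 < \<omega>1" "\<omega>1 \<le> \<omega>" using \<omega> \<eta> B by (auto simp: \<omega>1_def)
  then show "\<omega>1 * B \<le> \<eta> / 3"
   using small_multiple[OF B, of \<omega>1 \<eta> 3] by (simp add: \<omega>1_def mult.commute)
 qed
 obtain cs where cs: "rates cs" "\<And>K f p. deriv_bound 3 K f ==> \<bar>fd cs f p - Lop \<theta> f p\<bar> \<le> \<omega>1 * K"
  using approximable_Lop[OF th, unfolded approximable_def, rule_format, OF \<omega>1(1)] by blast
 define D where "D = CL * (mass cs * B)"
 have D: "0 \<le> D" using CL_nonneg mass_nonneg[OF cs(1)] B by (simp add: D_def)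
 obtain N :: nat where N: "max (max (mass cs) 1) (3 * D / \<eta>) \<le> real N" using real_arch_simple by blast
 have N1: "mass cs \<le> real N" "0 < N" "3 * D / \<eta> \<le> real N" using N by auto
 have DN: "D / real N \<le> \<eta> / 3" using N1 \<eta> by (simp add: field_simps)
 have main: "(step (s / real N) cs ^^ N) (\<lambda>e. u (t, e)) e - \<eta> \<le> u (t + s, e)"
  if t: "0 \<le> t" "0 \<le> s" "t + s \<le> 1" for t s e
 proof -
  define \<tau> where "\<tau> = s / real N"
  have \<tau>: "0 \<le> \<tau>" "real N * \<tau> = s" using t N1 by (auto simp: \<tau>_def)
  have "\<tau> * mass cs \<le> \<tau> * real N" using N1 \<tau> by (intro mult_left_mono) auto
  also have "\<dots> \<le> 1" using \<tau> t by (simp add: mult.commute)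
  finally have \<tau>m: "\<tau> * mass cs \<le> 1" .
  define v where "v q = u (t, snd q)" for q :: "real \<times> 'n space"
  have tin: "t \<in> {0..1}" using t by auto
  have v: "bounded_borel M v"
   unfolding bounded_borel_def
  proof (intro conjI allI)
   have "continuous_on UNIV v"
    unfolding v_def by (rule continuous_on_compose2[OF u(1)]) (use tin in \<open>auto intro!: continuous_intros\<close>)
   then show "v \<in> borel_measurable borel" by (rule borel_measurable_continuous_onI)
   show "\<bar>v q\<bar> \<le> M" for q using M[of "(t, snd q)"] tin by (simp add: v_def)
  qed
  define f where "f e = conv v k (0, e) - Lu * \<epsilon>" for e
  have f: "deriv_bound 3 B f"
   unfolding f_def B_def by (rule deriv_bound_sub_const[OF slice_deriv_bound[OF C(2)[OF v]]]) simp
  have near: "\<bar>v (0 + \<sigma>, e + e') - u (t, e)\<bar> \<le> Lu * \<epsilon>" if "norm e' < \<epsilon>" for \<sigma> e e'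
  proof -
   have "\<bar>v (0 + \<sigma>, e + e') - u (t, e)\<bar> \<le> Lu * norm e'"
    using Lip[of t "e + e'" e] tin by (simp add: v_def)
   also have "\<dots> \<le> Lu * \<epsilon>" using that Lu by (intro mult_left_mono) auto
   finally show ?thesis .
  qed
  have f1: "f e \<le> u (t, e)" for e
  proof -
   have "conv v k (0, e) \<le> u (t, e) + Lu * \<epsilon>"
   proof (rule conv_le_avg[OF k v])
    fix \<sigma> :: real and e' :: "'n space" assume "norm e' < \<epsilon>"
    from near[OF this, of \<sigma> e] show "v (0 + \<sigma>, e + e') \<le> u (t, e) + Lu * \<epsilon>" by linarith
   qed
   then show ?thesis by (simp add: f_def)
  qed
  have f2: "u (t, e) - 2 * (Lu * \<epsilon>) \<le> f e" for e
  proof -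
   have "u (t, e) - Lu * \<epsilon> \<le> conv v k (0, e)"
   proof (rule conv_ge_avg[OF k v])
    fix \<sigma> :: real and e' :: "'n space" assume "norm e' < \<epsilon>"
    from near[OF this, of \<sigma> e] show "u (t, e) - Lu * \<epsilon> \<le> v (0 + \<sigma>, e + e')" by linarith
   qed
   then show ?thesis by (simp add: f_def)
  qed
  have "(step \<tau> cs ^^ N) (\<lambda>e. u (t, e)) e - \<eta> / 3 \<le> (step \<tau> cs ^^ N) (\<lambda>e. u (t, e)) e - 2 * (Lu * \<epsilon>)"
   using \<epsilon> by simp
  also have "\<dots> = (step \<tau> cs ^^ N) (\<lambda>e. u (t, e) - 2 * (Lu * \<epsilon>)) e" by (rule steps_sub_const[symmetric])
  also have "\<dots> \<le> (step \<tau> cs ^^ N) f e" by (rule steps_mono[OF cs(1) \<tau>(1) \<tau>m f2])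
  finally have 1: "(step \<tau> cs ^^ N) (\<lambda>e. u (t, e)) e - \<eta> / 3 \<le> (step \<tau> cs ^^ N) f e" .
  have 2: "(step \<tau> cs ^^ N) f e - real N * (\<tau> * (\<omega>1 * B) + D * \<tau>\<^sup>2) \<le> u (t + real N * \<tau>, e)"
   unfolding D_def
   by (rule many_steps[OF \<rho> u th cs(1) f cs(2)]) (use t \<tau> \<tau>m f1 in auto)
  have "real N * (\<tau> * (\<omega>1 * B) + D * \<tau>\<^sup>2) = s * (\<omega>1 * B) + s\<^sup>2 * (D / real N)"
   using N1 by (simp add: \<tau>_def power2_eq_square field_simps)
  also have "\<dots> \<le> 1 * (\<eta> / 3) + 1 * (\<eta> / 3)"
   using t \<omega>1 B DN D by (intro add_mono mult_mono power_le_one) auto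
  finally have 3: "real N * (\<tau> * (\<omega>1 * B) + D * \<tau>\<^sup>2) \<le> 1 * (\<eta> / 3) + 1 * (\<eta> / 3)" .
  show ?thesis using 1 2[unfolded \<tau>(2)] 3 unfolding \<tau>_def[symmetric] by linarith
 qed
 have "\<bar>fd cs f p - Lop \<theta> f p\<bar> \<le> \<omega> * K" if f: "deriv_bound 3 K f" for K f p
 proof -
  have "0 \<le> K" using deriv_bound_nonneg[OF f] by simp
  then have "\<omega>1 * K \<le> \<omega> * K" using \<omega>1 by (intro mult_right_mono)
  then show ?thesis using cs(2)[OF f, of p] by linarith
 qed
 with main cs(1) N1 show ?thesis by blast
qed

end

lemma clamp_bounded_borel:
 fixes u :: "real \<times> 'n::finite space => real"
 assumes u: "continuous_on strip u" and M: "\<And>q. q \<in> strip ==> \<bar>u q\<bar> \<le> M"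
 shows "bounded_borel M (clamp_time u)"
 unfolding bounded_borel_def
proof (intro conjI allI)
 have "continuous_on UNIV (clamp_time u)"
  unfolding clamp_time_def case_prod_unfold
  by (rule continuous_on_compose2[OF u]) (auto intro!: continuous_intros)
 then show "clamp_time u \<in> borel_measurable borel" by (rule borel_measurable_continuous_onI)
 show "\<bar>clamp_time u q\<bar> \<le> M" for q by (auto simp: clamp_time_def case_prod_unfold intro!: M)
qed

text \<open>A step combines finitely many translations, which commute with convolution.\<close>

lemma steps_conv:
 fixes k v :: "real \<times> 'n::finite space => real"
 assumes k: "smooth_kernel k" and v: "bounded_borel M v"
 shows "\<exists>N. bounded_borel N (\<lambda>(t, e). (step \<tau> cs ^^ j) (\<lambda>e. v (t, e)) e)"
  "conv (\<lambda>(t, e). (step \<tau> cs ^^ j) (\<lambda>e. v (t, e)) e) k (t, e) = (step \<tau> cs ^^ j) (\<lambda>e. conv v k (t, e)) e"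
proof -
 have fdc: "(\<exists>N. bounded_borel N (\<lambda>(t, e). fd cs (\<lambda>e. w (t, e)) e)) \<and>
   (\<forall>t e. conv (\<lambda>(t, e). fd cs (\<lambda>e. w (t, e)) e) k (t, e) = fd cs (\<lambda>e. conv w k (t, e)) e)"
  if w: "bounded_borel M w" for w :: "real \<times> 'n space => real" and M
 proof (induction cs)
  case Nil
  then show ?case using bounded_borel_const[of 0] by (auto simp: conv_def case_prod_unfold)
 next
  case (Cons a cs)
  obtain c l where a: "a = (c, l)" by (cases a)
  define r where "r = (\<lambda>q :: real \<times> 'n space. fd cs (\<lambda>e. w (fst q, e)) (snd q))"
  obtain N where r: "bounded_borel N r" using Cons by (auto simp: r_def case_prod_unfold)
  have rc: "conv r k (t, e) = fd cs (\<lambda>e. conv w k (t, e)) e" for t e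
   using Cons unfolding r_def case_prod_unfold by blast
  note ws = bounded_borel_shift[OF w, of "(0, l)"]
  note d = bounded_borel_add(3)[OF ws w]
  note cd = bounded_borel_add(2)[OF d, of c]
  have eq: "(\<lambda>(t, e). fd (a # cs) (\<lambda>e. w (t, e)) e) = (\<lambda>q. c * (w (q + (0, l)) - w q) + r q)"
   by (auto simp: a r_def fun_eq_iff)
  have "conv (\<lambda>q. c * (w (q + (0, l)) - w q) + r q) k (t, e) = fd (a # cs) (\<lambda>e. conv w k (t, e)) e" for t e
   using conv_linear(1)[OF k cd r, of "(t, e)"] conv_linear(2)[OF k d d, of c "(t, e)"]
    conv_linear(3)[OF k ws w, of "(t, e)"] conv_shift[OF k w, of "(0, l)" "(t, e)"] rc[of t e]
   by (simp add: a)
  then show ?case unfolding eq using bounded_borel_add(1)[OF cd r] by blast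
 qed
 have "(\<exists>N. bounded_borel N (\<lambda>(t, e). (step \<tau> cs ^^ j) (\<lambda>e. v (t, e)) e)) \<and>
   (\<forall>t e. conv (\<lambda>(t, e). (step \<tau> cs ^^ j) (\<lambda>e. v (t, e)) e) k (t, e) = (step \<tau> cs ^^ j) (\<lambda>e. conv v k (t, e)) e)"
 proof (induction j)
  case 0
  then show ?case using v by (auto simp: case_prod_unfold)
 next
  case (Suc j)
  define w where "w = (\<lambda>(t, e). (step \<tau> cs ^^ j) (\<lambda>e. v (t, e)) e)"
  obtain N where w: "bounded_borel N w" using Suc by (auto simp: w_def)
  have wc: "conv w k (t, e) = (step \<tau> cs ^^ j) (\<lambda>e. conv v k (t, e)) e" for t e using Suc unfolding w_def by blast
  have ws: "(\<lambda>e. w (t, e)) = (step \<tau> cs ^^ j) (\<lambda>e. v (t, e))" for t by (simp add: w_def fun_eq_iff)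
  define r where "r = (\<lambda>(t, e). fd cs (\<lambda>e. w (t, e)) e)"
  obtain N' where r: "bounded_borel N' r" using fdc[OF w] by (auto simp: r_def)
  have rc: "conv r k (t, e) = fd cs (\<lambda>e. conv w k (t, e)) e" for t e using fdc[OF w] unfolding r_def by blast
  note tr = bounded_borel_add(2)[OF r, of \<tau>]
  have eq: "(\<lambda>(t, e). (step \<tau> cs ^^ Suc j) (\<lambda>e. v (t, e)) e) = (\<lambda>q. w q + \<tau> * r q)"
   by (auto simp: step_def r_def ws[symmetric] fun_eq_iff)
  have "conv (\<lambda>q. w q + \<tau> * r q) k (t, e) = (step \<tau> cs ^^ Suc j) (\<lambda>e. conv v k (t, e)) e" for t e
   using conv_linear(1)[OF k w tr, of "(t, e)"] conv_linear(2)[OF k r r, of \<tau> "(t, e)"] rc[of t e]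
   by (simp add: step_def wc)
  then show ?case unfolding eq using bounded_borel_add(1)[OF w tr] by blast
 qed
 then show "\<exists>N. bounded_borel N (\<lambda>(t, e). (step \<tau> cs ^^ j) (\<lambda>e. v (t, e)) e)"
  "conv (\<lambda>(t, e). (step \<tau> cs ^^ j) (\<lambda>e. v (t, e)) e) k (t, e) = (step \<tau> cs ^^ j) (\<lambda>e. conv v k (t, e)) e"
  by blast+
qed

lemma slice_diff_bound:
 fixes W :: "real \<times> 'n::finite space => real"
 assumes W: "deriv_bound 3 B W"
 shows "deriv_bound 2 (B * \<bar>s\<bar>) (\<lambda>e. W (t, e) - W (t - s, e))"
proof -
 have J: "linear (\<lambda>e::'n space. (0::real, e))" by (auto simp: linear_iff)
 have sl: "iter_partial UNIV vs (\<lambda>e. W (t, e)) e = iter_partial UNIV (map (Pair 0) vs) W (t, e)" for t vs e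
  using iter_partial_embed[OF J, of "(t, 0)" UNIV vs W e] by simp
 note sm = slice_deriv_bound[OF W, THEN deriv_bound_smooth]
 have m: "(\<lambda>e. -1 * W (t - s, e)) \<in> Cb_inf UNIV" by (rule Cb_inf_cmult[OF thick_UNIV sm])
 show ?thesis
  unfolding deriv_bound_def
 proof (intro conjI ballI impI allI)
  show "(\<lambda>e. W (t, e) - W (t - s, e)) \<in> Cb_inf UNIV" by (rule Cb_inf_diff[OF thick_UNIV sm sm])
  fix vs :: "'n space list" and e assume vs: "vs \<in> lists Basis" "vs \<noteq> []" "length vs \<le> 2"
  define us where "us = map (Pair (0::real)) vs"
  have us: "us \<in> lists Basis" "length us \<le> 2" using vs by (auto simp: us_def in_lists_conv_set Basis_prod_def)
  have "deriv_bound (Suc 2 - 2) B (iter_partial UNIV us W)"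
   using W us by (intro deriv_bound_partial) (auto simp: eval_nat_numeral)
  then have b: "deriv_bound 1 B (iter_partial UNIV us W)" by simp
  have n1: "norm1 ((- s, 0) :: real \<times> 'n space) = \<bar>s\<bar>"
   by (simp add: norm1_def sum_Basis_prod)
  have "iter_partial UNIV vs (\<lambda>e. W (t, e) - W (t - s, e)) e =
    iter_partial UNIV us W (t, e) - iter_partial UNIV us W (t - s, e)"
   using iter_partial_add[OF thick_UNIV sm[of t] m vs(1), of e] iter_partial_cmult[OF thick_UNIV sm[of "t - s"] vs(1), of e "-1"]
   by (simp add: sl us_def)
  moreover have "\<bar>iter_partial UNIV us W ((t, e) + (- s, 0)) - iter_partial UNIV us W (t, e)\<bar> \<le> B * \<bar>s\<bar>"
   using Lipschitz_norm1[OF b, of "(t, e)" "(- s, 0)"] unfolding n1 .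
  ultimately show "\<bar>iter_partial UNIV vs (\<lambda>e. W (t, e) - W (t - s, e)) e\<bar> \<le> B * \<bar>s\<bar>"
   by (simp add: abs_minus_commute)
 qed
qed

text \<open>Written for a backward increment, which is the one that occurs in the scheme.\<close>

lemma time_Taylor:
 fixes W :: "real \<times> 'n::finite space => real"
 assumes W: "deriv_bound 2 B W"
 shows "\<bar>W (t - s, e) - W (t, e) + s * partial_deriv UNIV dt W (t, e)\<bar> \<le> B * s\<^sup>2"
proof -
 have n1: "norm1 ((- s, 0) :: real \<times> 'n space) = \<bar>s\<bar>"
  by (simp add: norm1_def sum_Basis_prod)
 have dt: "dt = (1, 0 :: 'n space)" by (simp add: dt_def zero_prod_def)
 have "(\<Sum>b\<in>Basis. ((- s, 0 :: 'n space) \<bullet> b) * partial_deriv UNIV b W (t, e)) = - s * partial_deriv UNIV dt W (t, e)"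
  unfolding dt by (subst sum_Basis_prod) simp
 then show ?thesis
  using Taylor2_norm1[OF W, of "(t, e)" "(- s, 0)"] by (simp add: n1)
qed

context triplets
begin

text \<open>The lower bound by the linear flow passes to the mollification \<open>W\<close>, since the steps commute with
 convolution and the averages are monotone. Dividing the resulting inequality
 \<open>W (t - s) + s * Lop \<theta> (W (t - s)) - O(s\<^sup>2) \<le> W t\<close> by \<open>s\<close> gives the claim for each triplet \<open>\<theta>\<close>.\<close>

theorem mollified_super:
 fixes u \<rho> :: "real \<times> 'n space => real"
 assumes \<rho>: "mollifier \<rho>" and u: "continuous_on strip u" "bounded (u ` strip)" "super_test \<Theta> u"
  and Lip: "\<And>t e e'. 0 \<le> t ==> t \<le> 1 ==> \<bar>u (t, e) - u (t, e')\<bar> \<le> Lu * norm (e - e')" and Lu: "0 \<le> Lu"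
  and \<epsilon>: "0 < \<epsilon>" and t: "0 < t" "t + \<epsilon>\<^sup>2 \<le> 1"
 shows "Gop \<Theta> (\<lambda>e. conv (clamp_time u) (rescaled \<rho> \<epsilon>) (t, e)) e \<le>
  partial_deriv UNIV dt (conv (clamp_time u) (rescaled \<rho> \<epsilon>)) (t, e)"
proof -
 define k where "k = rescaled \<rho> \<epsilon>"
 have k: "averaging \<epsilon> k" unfolding k_def by (rule rescaled_averaging[OF \<rho> \<epsilon>])
 note ker = averaging_kernel[OF k]
 obtain M where M: "\<And>q. q \<in> strip ==> \<bar>u q\<bar> \<le> M" using strip_bounded[OF u(2)] by blast
 have v: "bounded_borel M (clamp_time u)" by (rule clamp_bounded_borel[OF u(1) M])
 define W where "W = conv (clamp_time u) k"
 obtain B where B: "0 \<le> B" "deriv_bound 6 B W"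
  using deriv_bound_exists[OF conv_smooth[OF ker v]] unfolding W_def by metis
 have B2: "deriv_bound 2 B W" and B3: "deriv_bound 3 B W" using deriv_bound_mono[OF B(2)] by auto
 define C where "C = (CL + 1) * ((CL + 1) * B)"
 have lower: "Lop \<theta> (\<lambda>e. W (t, e)) e * s - (C + B + CL * B) * s\<^sup>2 \<le> s * partial_deriv UNIV dt W (t, e)"
  if th: "\<theta> \<in> \<Theta>" and s: "0 < s" "s \<le> t" for \<theta> s
 proof -
  define w where "w e = W (t - s, e)" for e
  have w6: "deriv_bound 6 B w" unfolding w_def by (rule slice_deriv_bound[OF B(2)])
  have w3: "deriv_bound 3 B w" by (rule deriv_bound_mono[OF w6]) auto
  note wsm = deriv_bound_smooth[OF w6]
  have approx: "w e + s * (Lop \<theta> w e - \<omega> * B) - s\<^sup>2 * C - \<omega> \<le> W (t, e)" if \<omega>: "0 < \<omega>" "\<omega> \<le> 1" for \<omega>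
  proof -
   obtain cs N where cs: "rates cs" "\<And>K f p. deriv_bound 3 K f ==> \<bar>fd cs f p - Lop \<theta> f p\<bar> \<le> \<omega> * K"
    "0 < N" "mass cs \<le> real N" "\<And>t s e. 0 \<le> t ==> 0 \<le> s ==> t + s \<le> 1 ==>
     (step (s / real N) cs ^^ N) (\<lambda>e. u (t, e)) e - \<omega> \<le> u (t + s, e)"
    using linear_flow_below[OF \<rho> u Lip Lu th \<omega>(1) \<omega>(1)] by blast
   define \<tau> where "\<tau> = s / real N"
   have \<tau>: "0 \<le> \<tau>" "real N * \<tau> = s" using s cs(3) by (auto simp: \<tau>_def)
   have "\<tau> * mass cs \<le> \<tau> * real N" using cs(4) \<tau> by (intro mult_left_mono) auto
   also have "\<dots> \<le> 1" using \<tau> s t by (simp add: mult.commute) (smt (verit) zero_le_power2)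
   finally have \<tau>m: "\<tau> * mass cs \<le> 1" .
   have fdle: "\<bar>fd cs f p\<bar> \<le> (CL + 1) * K" if f: "deriv_bound 3 K f" for K f p
   proof -
    have K: "0 \<le> K" using deriv_bound_nonneg[OF f] by simp
    have "\<bar>Lop \<theta> f p\<bar> \<le> CL * K" by (rule Lop_bound[OF th deriv_bound_mono[OF f]]) auto
    moreover have "\<omega> * K \<le> 1 * K" using \<omega> K by (intro mult_right_mono) auto
    ultimately show ?thesis using cs(2)[OF f, of p] by (simp add: algebra_simps abs_le_iff)
   qed
   have "deriv_bound 3 ((CL + 1) * B) (fd cs w)"
   proof (rule fd_deriv_bound[OF wsm])
    fix vs p assume vs: "vs \<in> lists (Basis :: 'n space set)" "vs \<noteq> []" "length vs \<le> 3"
    have "deriv_bound (Suc 5 - 3) B (iter_partial UNIV vs w)"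
     by (rule deriv_bound_partial[where m = "length vs"]) (use w6 vs in auto)
    then show "\<bar>fd cs (iter_partial UNIV vs w) p\<bar> \<le> (CL + 1) * B"
     by (intro fdle) (simp add: eval_nat_numeral)
   qed
   from fdle[OF this] have fdfd: "\<bar>fd cs (fd cs w) p\<bar> \<le> C" for p by (simp add: C_def)
   have "w e + real N * \<tau> * fd cs w e - (real N * \<tau>)\<^sup>2 * C \<le> (step \<tau> cs ^^ N) w e"
    by (rule steps_expansion[OF cs(1) \<tau>(1) \<tau>m fdfd])
   then have 1: "w e + s * fd cs w e - s\<^sup>2 * C \<le> (step \<tau> cs ^^ N) w e" by (simp only: \<tau>(2))
   have "Lop \<theta> w e - \<omega> * B \<le> fd cs w e" using cs(2)[OF w3, of e] by (simp add: abs_le_iff)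
   then have 2: "s * (Lop \<theta> w e - \<omega> * B) \<le> s * fd cs w e" using s by (intro mult_left_mono) auto
   define V where "V = (\<lambda>(t, e). (step \<tau> cs ^^ N) (\<lambda>e. clamp_time u (t, e)) e)"
   obtain N' where V: "bounded_borel N' V" using steps_conv(1)[OF ker v] unfolding V_def by blast
   have Vc: "conv V k (t - s, e) = (step \<tau> cs ^^ N) w e"
    unfolding V_def w_def W_def by (rule steps_conv(2)[OF ker v])
   note Vm = bounded_borel_add(3)[OF V bounded_borel_const[of \<omega>]]
   have "conv (\<lambda>q. V q - \<omega>) k (t - s, e) \<le> conv (clamp_time u) k (t, e)"
   proof (rule conv_mono_avg[OF k Vm v])
    fix \<sigma> :: real and e' :: "'n space" assume \<sigma>: "0 \<le> \<sigma>" "\<sigma> \<le> \<epsilon>\<^sup>2"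
    have c: "clamp_time u (t - s + \<sigma>, e) = u (t - s + \<sigma>, e)" "clamp_time u (t + \<sigma>, e) = u (t + \<sigma>, e)" for e
     using \<sigma> s t by (auto simp: clamp_time_def)
    have "(step (s / real N) cs ^^ N) (\<lambda>e. u (t - s + \<sigma>, e)) (e + e') - \<omega> \<le> u (t - s + \<sigma> + s, e + e')"
     by (rule cs(5)) (use \<sigma> s t in auto)
    then show "V (t - s + \<sigma>, e + e') - \<omega> \<le> clamp_time u (t + \<sigma>, e + e')"
     unfolding V_def prod.case c \<tau>_def by (simp add: add.commute)
   qed
   then have "(step \<tau> cs ^^ N) w e - \<omega> \<le> W (t, e)"
    using conv_linear(3)[OF ker V bounded_borel_const[of \<omega>], of "(t - s, e)"] conv_const[OF k, of \<omega> "(t - s, e)"]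
    by (simp add: Vc W_def)
   then show ?thesis using 1 2 by linarith
  qed
  have "w e + s * Lop \<theta> w e - s\<^sup>2 * C \<le> W (t, e)"
  proof (rule field_le_epsilon)
   fix \<zeta> :: real assume \<zeta>: "0 < \<zeta>"
   define \<omega> where "\<omega> = min 1 (\<zeta> / (s * B + 1))"
   have sB: "0 < s * B + 1" using s B by (simp add: add_nonneg_pos)
   have \<omega>: "0 < \<omega>" "\<omega> \<le> 1" using \<zeta> sB by (auto simp: \<omega>_def)
   have "\<omega> * (s * B + 1) \<le> \<zeta> / (s * B + 1) * (s * B + 1)"
    using sB by (intro mult_right_mono) (auto simp: \<omega>_def)
   then have "\<omega> * (s * B + 1) \<le> \<zeta>" using sB by simp
   then show "w e + s * Lop \<theta> w e - s\<^sup>2 * C \<le> W (t, e) + \<zeta>"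
    using approx[OF \<omega>] by (simp add: algebra_simps)
  qed
  moreover have "Lop \<theta> (\<lambda>e. W (t, e)) e - CL * (B * s) \<le> Lop \<theta> w e"
  proof -
   have d: "deriv_bound 2 (B * s) (\<lambda>e. W (t, e) - W (t - s, e))"
    using slice_diff_bound[OF B3, of s t] s by simp
   have "Lop \<theta> (\<lambda>e. w e + (W (t, e) - W (t - s, e))) e = Lop \<theta> w e + Lop \<theta> (\<lambda>e. W (t, e) - W (t - s, e)) e"
    by (rule Lop_linear(1)[OF th wsm deriv_bound_smooth[OF d]])
   then have "Lop \<theta> (\<lambda>e. W (t, e)) e = Lop \<theta> w e + Lop \<theta> (\<lambda>e. W (t, e) - W (t - s, e)) e"
    by (simp add: w_def)
   then show ?thesis using abs_le_D1[OF Lop_bound[OF th d, of e]] by linarith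
  qed
  then have "s * (Lop \<theta> (\<lambda>e. W (t, e)) e - CL * (B * s)) \<le> s * Lop \<theta> w e" using s by (intro mult_left_mono) auto
  moreover have "W (t, e) - w e \<le> s * partial_deriv UNIV dt W (t, e) + B * s\<^sup>2"
   using time_Taylor[OF B2, of t s e] by (simp add: w_def abs_le_iff)
  ultimately show ?thesis by (simp add: algebra_simps power2_eq_square)
 qed
 show ?thesis
  unfolding k_def[symmetric] W_def[symmetric]
 proof (rule Gop_le)
  fix \<theta> assume th: "\<theta> \<in> \<Theta>"
  define A where "A = C + B + CL * B"
  show "Lop \<theta> (\<lambda>e. W (t, e)) e \<le> partial_deriv UNIV dt W (t, e)"
  proof (rule field_le_epsilon)
   fix \<zeta> :: real assume \<zeta>: "0 < \<zeta>"
   define s where "s = min t (\<zeta> / (\<bar>A\<bar> + 1))"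
   have s: "0 < s" "s \<le> t" using \<zeta> t by (auto simp: s_def)
   have "A * s \<le> (\<bar>A\<bar> + 1) * s" using s by (intro mult_right_mono) auto
   also have "\<dots> \<le> (\<bar>A\<bar> + 1) * (\<zeta> / (\<bar>A\<bar> + 1))" by (intro mult_left_mono) (auto simp: s_def)
   also have "\<dots> = \<zeta>" by simp
   finally have "A * s \<le> \<zeta>" .
   have "s * (Lop \<theta> (\<lambda>e. W (t, e)) e - A * s) \<le> s * partial_deriv UNIV dt W (t, e)"
    using lower[OF th s] by (simp add: A_def algebra_simps power2_eq_square)
   then have "Lop \<theta> (\<lambda>e. W (t, e)) e - A * s \<le> partial_deriv UNIV dt W (t, e)" using s by simp
   then show "Lop \<theta> (\<lambda>e. W (t, e)) e \<le> partial_deriv UNIV dt W (t, e) + \<zeta>" using \<open>A * s \<le> \<zeta>\<close> by linarith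
  qed
 qed
qed

end

section \<open>The scheme as an iterated sublinear expectation\<close>

text \<open>The norm in which the initial datum is Lipschitz with the constant of the theorem; it splits
 into the three blocks without loss of constants.\<close>

definition snorm :: "'n::finite space => real" where
 "snorm p = norm (fst p) + norm (fst (snd p)) + norm (snd (snd p))"

lemma snorm_simp [simp]: "snorm (x, y, z) = norm x + norm y + norm z"
 by (simp add: snorm_def)

lemma snorm_nonneg [simp]: "0 \<le> snorm p"
 by (simp add: snorm_def)

lemma norm_le_snorm: "norm (p :: 'n::finite space) \<le> snorm p"
proof -
 obtain x y z where p: "p = (x, y, z)" by (cases p) auto
 have "norm (x, y, z) \<le> norm x + norm (y, z)" by (rule norm_Pair_le)
 also have "norm (y, z) \<le> norm y + norm z" by (rule norm_Pair_le)
 finally show ?thesis by (simp add: p)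
qed

lemma snorm_le: "snorm (p :: 'n::finite space) \<le> 2 * norm p"
proof (rule power2_le_imp_le)
 obtain x y z where p: "p = (x, y, z)" by (cases p) auto
 define a b c where "a = norm x" and "b = norm y" and "c = norm z"
 have "0 \<le> (a - b)\<^sup>2 + (b - c)\<^sup>2 + (a - c)\<^sup>2 + (a\<^sup>2 + b\<^sup>2 + c\<^sup>2)" by simp
 then have "(a + b + c)\<^sup>2 \<le> 4 * (a\<^sup>2 + (b\<^sup>2 + c\<^sup>2))" by (simp add: power2_eq_square algebra_simps)
 then show "(snorm p)\<^sup>2 \<le> (2 * norm p)\<^sup>2"
  by (simp add: p norm_Pair a_def b_def c_def power_mult_distrib)
qed simp

lemma snorm_triangle: "snorm (p + q) \<le> snorm p + snorm q"
 using norm_triangle_ineq[of "fst p" "fst q"] norm_triangle_ineq[of "fst (snd p)" "fst (snd q)"]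
  norm_triangle_ineq[of "snd (snd p)" "snd (snd q)"] by (simp add: snorm_def)

lemma snorm_minus [simp]: "snorm (- p) = snorm p"
 by (simp add: snorm_def)

definition lipb :: "real => real => ('n::finite space => real) => bool" where
 "lipb M L f \<longleftrightarrow> 0 \<le> L \<and> (\<forall>p. \<bar>f p\<bar> \<le> M) \<and> (\<forall>p q. \<bar>f p - f q\<bar> \<le> L * snorm (p - q))"

lemma lipbD: "lipb M L f ==> \<bar>f p\<bar> \<le> M" "lipb M L f ==> \<bar>f p - f q\<bar> \<le> L * snorm (p - q)" "lipb M L f ==> 0 \<le> L"
 unfolding lipb_def by blast+

lemma lipb_norm: "lipb M L f ==> \<bar>f p - f q\<bar> \<le> 2 * L * norm (p - q)"
proof -
 assume f: "lipb M L f"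
 show "\<bar>f p - f q\<bar> \<le> 2 * L * norm (p - q)"
  using lipbD(2)[OF f, of p q] mult_left_mono[OF snorm_le[of "p - q"] lipbD(3)[OF f]] by simp
qed

lemma lipb_cont: "lipb M L f ==> continuous_on UNIV f"
proof (rule lipschitz_on_continuous_on[of "2 * L"])
 assume f: "lipb M L f"
 show "(2 * L)-lipschitz_on UNIV f"
  by (rule lipschitz_onI) (use lipb_norm[OF f] lipbD(3)[OF f] in \<open>auto simp: dist_norm\<close>)
qed

lemma lipb_add: "lipb M L f ==> lipb M' L' g ==> lipb (M + M') (L + L') (\<lambda>p. f p + g p)"
proof -
 assume f: "lipb M L f" and g: "lipb M' L' g"
 show ?thesis
  unfolding lipb_def
 proof (intro conjI allI)
  fix p q
  show "0 \<le> L + L'" using lipbD(3)[OF f] lipbD(3)[OF g] by simp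
  show "\<bar>f p + g p\<bar> \<le> M + M'" using lipbD(1)[OF f, of p] lipbD(1)[OF g, of p] by linarith
  show "\<bar>f p + g p - (f q + g q)\<bar> \<le> (L + L') * snorm (p - q)"
   using lipbD(2)[OF f, of p q] lipbD(2)[OF g, of p q] unfolding distrib_right by linarith
 qed
qed

lemma lipb_const: "lipb \<bar>c\<bar> 0 (\<lambda>_. c)"
 by (simp add: lipb_def)

lemma lipb_min:
 assumes "0 \<le> B" "0 \<le> L" "\<And>p. 0 \<le> f p" "\<And>p q. \<bar>f p - f q\<bar> \<le> L * snorm (p - q)"
 shows "lipb B L (\<lambda>p. min B (f p))"
 unfolding lipb_def
proof (intro conjI allI)
 fix p q
 show "\<bar>min B (f p)\<bar> \<le> B" using assms(1) assms(3)[of p] by (simp add: min_def)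
 show "\<bar>min B (f p) - min B (f q)\<bar> \<le> L * snorm (p - q)"
  using assms(4)[of p q] by (auto simp: min_def abs_if split: if_splits)
qed (use assms in simp)

context sublinear_expectation
begin

lemma const_in: "(\<lambda>\<omega>. c) \<in> H"
 using lipschitz_in[of 0 "\<lambda>_ _. 0" "\<lambda>_. c"] by (simp add: family_lipschitz_def)

lemma neg_in: "\<xi> \<in> H ==> (\<lambda>\<omega>. - \<xi> \<omega>) \<in> H"
 using scale_in[of \<xi> "-1"] by simp

lemma sum_in: "(\<And>i. i \<in> I ==> \<xi> i \<in> H) ==> (\<lambda>\<omega>. \<Sum>i\<in>I. \<xi> i \<omega>) \<in> H"
 by (induction I rule: infinite_finite_induct) (simp_all add: zero_in add_in)

lemma E_sum_le:
 assumes "finite I" "\<And>i. i \<in> I ==> \<xi> i \<in> H"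
 shows "E (\<lambda>\<omega>. \<Sum>i\<in>I. \<xi> i \<omega>) \<le> (\<Sum>i\<in>I. E (\<xi> i))"
 using assms
proof (induction I rule: finite_induct)
 case (insert i I)
 have "E (\<lambda>\<omega>. \<xi> i \<omega> + (\<Sum>i\<in>I. \<xi> i \<omega>)) \<le> E (\<xi> i) + E (\<lambda>\<omega>. \<Sum>i\<in>I. \<xi> i \<omega>)"
  by (intro subadd sum_in) (use insert in auto)
 also have "\<dots> \<le> E (\<xi> i) + (\<Sum>i\<in>I. E (\<xi> i))" using insert by (intro add_left_mono) auto
 finally show ?case using insert(1,2) by simp
qed (simp add: const)

lemma E_le_add:
 assumes "\<xi> \<in> H" "\<eta> \<in> H" "\<And>\<omega>. \<xi> \<omega> \<le> \<eta> \<omega> + c"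
 shows "E \<xi> \<le> E \<eta> + c"
proof -
 have "E \<xi> \<le> E (\<lambda>\<omega>. \<eta> \<omega> + c)" by (rule mono) (use assms add_in const_in in auto)
 also have "\<dots> \<le> E \<eta> + E (\<lambda>\<omega>. c)" by (rule subadd[OF assms(2) const_in])
 finally show ?thesis by (simp add: const)
qed

lemma E_diff_le:
 assumes "\<xi> \<in> H" "\<eta> \<in> H" "\<And>\<omega>. \<bar>\<xi> \<omega> - \<eta> \<omega>\<bar> \<le> c"
 shows "\<bar>E \<xi> - E \<eta>\<bar> \<le> c"
proof -
 have "\<xi> \<omega> \<le> \<eta> \<omega> + c" "\<eta> \<omega> \<le> \<xi> \<omega> + c" for \<omega> using assms(3)[of \<omega>] by linarith+
 from E_le_add[OF assms(1,2) this(1)] E_le_add[OF assms(2,1) this(2)] show ?thesis by linarith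
qed

lemma E_nonneg: "\<xi> \<in> H ==> (\<And>\<omega>. 0 \<le> \<xi> \<omega>) ==> 0 \<le> E \<xi>"
 using mono[OF zero_in, of \<xi>] const[of 0] by simp

text \<open>The space of random variables is stable under Lipschitz functions of finitely many real
 random variables, here the coordinates of the vector.\<close>

lemma Lipschitz_in:
 fixes \<xi> :: "'w => 'b::euclidean_space" and f :: "'b => real"
 assumes \<xi>: "random_vector H \<xi>" and f: "\<And>a b. \<bar>f a - f b\<bar> \<le> C * norm (a - b)"
 shows "(\<lambda>\<omega>. f (\<xi> \<omega>)) \<in> H"
proof -
 define n where "n = DIM('b)"
 obtain e where e: "bij_betw e {..<n} (Basis :: 'b set)"
  using ex_bij_betw_nat_finite[OF finite_Basis] by (auto simp: n_def lessThan_atLeast0)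
 define F where "F a = f (\<Sum>i<n. a i *\<^sub>R e i)" for a :: "nat => real"
 have eB: "e i \<in> Basis" if "i < n" for i using bij_betwE[OF e] that by auto
 have "family_lipschitz {..<n} F"
  unfolding family_lipschitz_def
 proof (intro exI allI)
  fix a b
  have "\<bar>F a - F b\<bar> \<le> C * norm ((\<Sum>i<n. a i *\<^sub>R e i) - (\<Sum>i<n. b i *\<^sub>R e i))"
   unfolding F_def by (rule f)
  also have "\<dots> \<le> \<bar>C\<bar> * norm ((\<Sum>i<n. a i *\<^sub>R e i) - (\<Sum>i<n. b i *\<^sub>R e i))"
   by (intro mult_right_mono) auto
  also have "norm ((\<Sum>i<n. a i *\<^sub>R e i) - (\<Sum>i<n. b i *\<^sub>R e i)) \<le> (\<Sum>i<n. L2_set (\<lambda>i. norm (a i - b i)) {..<n})"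
   unfolding sum_subtractf[symmetric] scaleR_diff_left[symmetric]
  proof (rule norm_sum[THEN order_trans], rule sum_mono)
   fix i assume i: "i \<in> {..<n}"
   have "norm ((a i - b i) *\<^sub>R e i) = norm (a i - b i)" using eB i by simp
   also have "\<dots> \<le> L2_set (\<lambda>i. norm (a i - b i)) {..<n}" by (rule member_le_L2_set) (use i in auto)
   finally show "norm ((a i - b i) *\<^sub>R e i) \<le> L2_set (\<lambda>i. norm (a i - b i)) {..<n}" .
  qed
  finally show "\<bar>F a - F b\<bar> \<le> \<bar>C\<bar> * real n * L2_set (\<lambda>i. norm (a i - b i)) {..<n}"
   by (simp add: mult_left_mono mult.assoc)
 qed
 moreover have "(\<lambda>\<omega>. \<xi> \<omega> \<bullet> e i) \<in> H" if "i < n" for i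
  using \<xi> eB[OF that] by (simp add: random_vector_def)
 ultimately have "(\<lambda>\<omega>. F (\<lambda>i. \<xi> \<omega> \<bullet> e i)) \<in> H"
  using lipschitz_in[of n "\<lambda>i \<omega>. \<xi> \<omega> \<bullet> e i" F] by blast
 moreover have "(\<Sum>i<n. (x \<bullet> e i) *\<^sub>R e i) = x" for x
  using sum.reindex_bij_betw[OF e, of "\<lambda>b. (x \<bullet> b) *\<^sub>R b"] by (simp add: euclidean_representation)
 ultimately show ?thesis by (simp add: F_def)
qed

end

lemma nonneg_powr_numeral: "0 \<le> (x :: real) ==> x powr (numeral n) = x ^ numeral n"
 by (cases "x = 0") (auto simp: powr_numeral)

locale driven = sublinear_expectation H E + triplets \<Theta> C\<Theta>
 for H :: "('w => real) set" and E and \<Theta> :: "'n::finite levy_triplet set" and C\<Theta> +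
 fixes X Y Z :: "nat => 'w => real^'n" and X' Y' Z' :: "'w => real^'n" and \<alpha> :: real
 assumes alpha: "1 < \<alpha>" "\<alpha> < 2"
  and iid: "iid H E (\<lambda>i \<omega>. (X i \<omega>, Y i \<omega>, Z i \<omega>))"
  and A1: "assumption_A1 H E (X 1) (Y 1)"
  and A2: "assumption_A2 H E \<alpha> Z"
  and A3: "assumption_A3 H E \<alpha> \<Theta> (X 1) (Y 1) (Z 1)"
  and copy_in: "random_vector H (\<lambda>\<omega>. (X' \<omega>, Y' \<omega>, Z' \<omega>))"
  and copy: "eq_distr E (\<lambda>\<omega>. (X' \<omega>, Y' \<omega>, Z' \<omega>)) E (\<lambda>\<omega>. (X 1 \<omega>, Y 1 \<omega>, Z 1 \<omega>))"
begin

abbreviation \<Xi> :: "nat => 'w => 'n space" where "\<Xi> \<equiv> \<lambda>i \<omega>. (X i \<omega>, Y i \<omega>, Z i \<omega>)"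
abbreviation \<Xi>' :: "'w => 'n space" where "\<Xi>' \<equiv> \<lambda>\<omega>. (X' \<omega>, Y' \<omega>, Z' \<omega>)"

text \<open>The increment of the scheme over a step \<open>h\<close>, with the three different orders of scaling.\<close>

definition scaling :: "real => 'n space => 'n space" where
 "scaling h p = (sqrt h *\<^sub>R fst p, h *\<^sub>R fst (snd p), h powr (1 / \<alpha>) *\<^sub>R snd (snd p))"

definition T :: "real => ('n space => real) => 'n space => real" where
 "T h f p = E (\<lambda>\<omega>. f (p + scaling h (\<Xi>' \<omega>)))"

definition MX :: real where "MX = moment E (X 1) 2"
definition MY :: real where "MY = moment E (Y 1) 1"
definition MZ :: real where "MZ = M_star E \<alpha> Z"

lemma rv: "1 \<le> i ==> random_vector H (\<Xi> i)"
 using iid by (simp add: iid_def)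

lemma scaling_Lipschitz: "\<exists>K\<ge>0. \<forall>a b. norm (scaling h a - scaling h b) \<le> K * norm (a - b)"
proof -
 have "linear (scaling h)"
  by (auto simp: scaling_def linear_iff scaleR_add_right)
 then have bl: "bounded_linear (scaling h)" by (simp add: linear_conv_bounded_linear)
 obtain K where "0 \<le> K" "\<And>x. norm (scaling h x) \<le> norm x * K"
  using bounded_linear.nonneg_bounded[OF bl] by blast
 then show ?thesis
  by (metis bounded_linear.linear[OF bl] linear_diff mult.commute)
qed

lemma lipb_scaling: "lipb M L f ==> \<exists>C\<ge>0. \<forall>a b. \<bar>f (p + scaling h a) - f (p + scaling h b)\<bar> \<le> C * norm (a - b)"
proof -
 assume f: "lipb M L f"
 obtain K where K: "0 \<le> K" "\<And>a b. norm (scaling h a - scaling h b) \<le> K * norm (a - b)"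
  using scaling_Lipschitz by blast
 have "\<bar>f (p + scaling h a) - f (p + scaling h b)\<bar> \<le> 2 * L * K * norm (a - b)" for a b
 proof -
  have "\<bar>f (p + scaling h a) - f (p + scaling h b)\<bar> \<le> 2 * L * norm (scaling h a - scaling h b)"
   using lipb_norm[OF f, of "p + scaling h a" "p + scaling h b"] by simp
  also have "\<dots> \<le> 2 * L * (K * norm (a - b))"
   using K lipbD(3)[OF f] by (intro mult_left_mono) auto
  finally show ?thesis by simp
 qed
 then show ?thesis using K lipbD(3)[OF f] by (intro exI[of _ "2 * L * K"]) auto
qed

lemma lipb_in:
 assumes "lipb M L f" "random_vector H \<xi>"
 shows "(\<lambda>\<omega>. f (p + scaling h (\<xi> \<omega>))) \<in> H"
 using lipb_scaling[OF assms(1), of p h] Lipschitz_in[OF assms(2), of "\<lambda>a. f (p + scaling h a)"] by blast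

lemma lipb_Cb_Lip:
 assumes f: "lipb M L f"
 shows "(\<lambda>a. f (p + scaling h a)) \<in> Cb_Lip"
proof -
 obtain C where C: "0 \<le> C" "\<And>a b. \<bar>f (p + scaling h a) - f (p + scaling h b)\<bar> \<le> C * norm (a - b)"
  using lipb_scaling[OF f] by blast
 have "C-lipschitz_on UNIV (\<lambda>a. f (p + scaling h a))"
  by (rule lipschitz_onI) (use C in \<open>auto simp: dist_norm\<close>)
 moreover have "bounded (range (\<lambda>a. f (p + scaling h a)))"
 proof (rule boundedI[of _ M])
  fix x assume "x \<in> range (\<lambda>a. f (p + scaling h a))"
  then obtain a where "x = f (p + scaling h a)" by blast
  then show "norm x \<le> M" using lipbD(1)[OF f, of "p + scaling h a"] by simp
 qed
 ultimately show ?thesis unfolding Cb_Lip_def by blast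
qed

lemma eq_distr_1: "1 \<le> i ==> g \<in> Cb_Lip ==> E (\<lambda>\<omega>. g (\<Xi> i \<omega>)) = E (\<lambda>\<omega>. g (\<Xi> 1 \<omega>))"
proof (induction i rule: dec_induct)
 case (step i)
 have "eq_distr E (\<Xi> (i + 1)) E (\<Xi> i)" using iid step(1) unfolding iid_def by blast
 then have "E (\<lambda>\<omega>. g (\<Xi> (i + 1) \<omega>)) = E (\<lambda>\<omega>. g (\<Xi> i \<omega>))" using step(4) unfolding eq_distr_def by blast
 then show ?case using step(3,4) by simp
qed simp

text \<open>The entry of the sequence may be chosen anew at each step, which lets independence enter.\<close>

lemma T_transfer:
 assumes f: "lipb M L f" and i: "1 \<le> i"
 shows "T h f p = E (\<lambda>\<omega>. f (p + scaling h (\<Xi> i \<omega>)))"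
 using eq_distr_1[OF i lipb_Cb_Lip[OF f, of p h]]
  copy[unfolded eq_distr_def, rule_format, OF lipb_Cb_Lip[OF f, of p h]]
 unfolding T_def by simp

lemma T_lipb:
 assumes f: "lipb M L f"
 shows "lipb M L (T h f)"
proof -
 note i = lipb_in[OF f copy_in]
 have "\<bar>T h f p\<bar> \<le> M" for p
 proof -
  have "\<bar>T h f p - E (\<lambda>\<omega>. 0)\<bar> \<le> M"
   unfolding T_def by (rule E_diff_le[OF i const_in]) (use lipbD(1)[OF f] in simp)
  then show ?thesis by (simp add: const)
 qed
 moreover have "\<bar>T h f p - T h f q\<bar> \<le> L * snorm (p - q)" for p q
  unfolding T_def
 proof (rule E_diff_le[OF i i])
  fix \<omega>
  show "\<bar>f (p + scaling h (\<Xi>' \<omega>)) - f (q + scaling h (\<Xi>' \<omega>))\<bar> \<le> L * snorm (p - q)"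
   using lipbD(2)[OF f, of "p + scaling h (\<Xi>' \<omega>)" "q + scaling h (\<Xi>' \<omega>)"] by simp
 qed
 ultimately show ?thesis using lipbD(3)[OF f] by (simp add: lipb_def)
qed

lemma Tk_lipb: "lipb M L f ==> lipb M L ((T h ^^ k) f)"
 by (induction k) (auto intro: T_lipb)

lemma T_mono:
 assumes f: "lipb M L f" and g: "lipb M' L' g" and le: "\<And>p. f p \<le> g p"
 shows "T h f p \<le> T h g p"
 unfolding T_def by (rule mono[OF lipb_in[OF f copy_in] lipb_in[OF g copy_in]]) (rule le)

lemma T_add_le:
 assumes f: "lipb M L f" and g: "lipb M' L' g"
 shows "T h (\<lambda>p. f p + g p) p \<le> T h f p + T h g p"
 unfolding T_def by (rule subadd[OF lipb_in[OF f copy_in] lipb_in[OF g copy_in]])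

lemma Tk_mono:
 assumes f: "lipb M L f" and g: "lipb M' L' g" and le: "\<And>p. f p \<le> g p"
 shows "(T h ^^ k) f p \<le> (T h ^^ k) g p"
proof (induction k arbitrary: p)
 case (Suc k)
 show ?case using T_mono[OF Tk_lipb[OF f] Tk_lipb[OF g] Suc] by simp
qed (use le in simp)

lemma Tk_add_le:
 assumes f: "lipb M L f" and g: "lipb M' L' g"
 shows "(T h ^^ k) (\<lambda>p. f p + g p) p \<le> (T h ^^ k) f p + (T h ^^ k) g p"
proof (induction k arbitrary: p)
 case (Suc k)
 have "T h ((T h ^^ k) (\<lambda>p. f p + g p)) p \<le> T h (\<lambda>p. (T h ^^ k) f p + (T h ^^ k) g p) p"
  by (rule T_mono[OF Tk_lipb[OF lipb_add[OF f g]] lipb_add[OF Tk_lipb[OF f] Tk_lipb[OF g]] Suc])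
 also have "\<dots> \<le> T h ((T h ^^ k) f) p + T h ((T h ^^ k) g) p"
  by (rule T_add_le[OF Tk_lipb[OF f] Tk_lipb[OF g]])
 finally show ?case by simp
qed simp

lemma Tk_const: "(T h ^^ k) (\<lambda>_. c) = (\<lambda>_. c)"
 by (induction k) (simp_all add: T_def const)

subsection \<open>Moments\<close>

lemma component_in:
 "1 \<le> i ==> (\<lambda>\<omega>. X i \<omega> $ j) \<in> H" "1 \<le> i ==> (\<lambda>\<omega>. Y i \<omega> $ j) \<in> H" "1 \<le> i ==> (\<lambda>\<omega>. Z i \<omega> $ j) \<in> H"
proof -
 assume i: "1 \<le> i"
 have b: "(\<lambda>\<omega>. \<Xi> i \<omega> \<bullet> b) \<in> H" if "b \<in> Basis" for b using rv[OF i] that by (simp add: random_vector_def)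
 show "(\<lambda>\<omega>. X i \<omega> $ j) \<in> H" "(\<lambda>\<omega>. Y i \<omega> $ j) \<in> H" "(\<lambda>\<omega>. Z i \<omega> $ j) \<in> H"
  using b[of "ex j"] b[of "ey j"] b[of "ez j"] by auto
qed

lemma inner_in: "(\<lambda>\<omega>. v \<bullet> X 1 \<omega>) \<in> H" "(\<lambda>\<omega>. v \<bullet> Y 1 \<omega>) \<in> H"
 unfolding inner_vec_def inner_real_def by (intro sum_in scale_in component_in; simp)+

lemma E_inner_X: "E (\<lambda>\<omega>. v \<bullet> X 1 \<omega>) \<le> 0"
proof -
 have mz: "E (\<lambda>\<omega>. X 1 \<omega> $ j) = 0" "E (\<lambda>\<omega>. - (X 1 \<omega> $ j)) = 0" for j
  using A1 by (auto simp: assumption_A1_def mean_zero_def)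
 have c: "E (\<lambda>\<omega>. v $ j * X 1 \<omega> $ j) = 0" for j
 proof (cases "0 \<le> v $ j")
  case True
  then show ?thesis using pos_hom[OF component_in(1)[of 1 j], of "v $ j"] mz by simp
 next
  case False
  then show ?thesis using pos_hom[OF neg_in[OF component_in(1)[of 1 j]], of "- v $ j"] mz by simp
 qed
 have "E (\<lambda>\<omega>. \<Sum>j\<in>UNIV. v $ j * X 1 \<omega> $ j) \<le> (\<Sum>j\<in>UNIV. E (\<lambda>\<omega>. v $ j * X 1 \<omega> $ j))"
  by (rule E_sum_le) (auto intro!: scale_in component_in(1))
 then show ?thesis by (simp add: inner_vec_def c del: One_nat_def)
qed

lemma Cb_inf_Cb: "Cb_inf UNIV \<subseteq> Cb k"
proof
 fix f :: "'b::euclidean_space => real" assume f: "f \<in> Cb_inf UNIV"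
 have mono: "g \<in> Cb_diff S A" if "A \<subseteq> B" "g \<in> Cb_diff S B" for g :: "'b => real" and S A B
  using that unfolding Cb_diff_def cont_diff_def by blast
 show "f \<in> Cb k"
  unfolding Cb_def by (rule mono[OF _ f[unfolded Cb_inf_def]]) (auto simp: in_lists_conv_set)
qed

lemma zero_Cb: "(\<lambda>_. 0) \<in> Cb 3"
 using Cb_inf_Cb Cb_inf_const[OF thick_UNIV] by blast

lemma sup_norm_le: "(\<And>x. \<bar>f x\<bar> \<le> c) ==> sup_norm f \<le> c"
 unfolding sup_norm_def by (rule cSUP_least) auto

lemma sup_norm_nonneg: "(\<And>x. \<bar>f x\<bar> \<le> c) ==> 0 \<le> sup_norm f"
 unfolding sup_norm_def
 by (rule cSUP_upper2[where x = undefined]) (auto intro!: bdd_aboveI2[where M = c])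

text \<open>Choosing \<open>f = 0\<close>, or \<open>p = 0\<close> and \<open>A = 0\<close>, separates the first two blocks from the third one.\<close>

lemma A3_split:
 "\<exists>l :: real => real => real. (\<forall>C. 0 < C --> uniform_limit {0..C} l (\<lambda>_. 0) (at_right 0)) \<and>
  (\<forall>p A s. transpose A = A --> 0 < s --> s \<le> 1 -->
   (\<lambda>\<omega>. p \<bullet> (s *\<^sub>R Y 1 \<omega>) + s / 2 * ((A *v X 1 \<omega>) \<bullet> X 1 \<omega>)) \<in> H \<and>
   s * G \<Theta> p A (\<lambda>_. 0) - s * l s (norm p + norm A) \<le> E (\<lambda>\<omega>. p \<bullet> (s *\<^sub>R Y 1 \<omega>) + s / 2 * ((A *v X 1 \<omega>) \<bullet> X 1 \<omega>))) \<and>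
  (\<forall>f z s. f \<in> Cb 3 --> 0 < s --> s \<le> 1 -->
   s * G \<Theta> 0 0 (\<lambda>l. f (z + l)) - s * l s (sup_norm f + (\<Sum>i=1..3. sup_norm (deriv_norm i f)))
    \<le> E (\<lambda>\<omega>. f (z + s powr (1 / \<alpha>) *\<^sub>R Z 1 \<omega>) - f z))"
proof -
 obtain l :: "real => real => real" where l: "\<And>C. 0 < C ==> uniform_limit {0..C} l (\<lambda>_. 0) (at_right 0)"
  and b: "\<And>p A f z s. transpose A = A \<and> f \<in> Cb 3 \<and> 0 < s \<and> s \<le> 1 ==>
      (let \<zeta> = (\<lambda>\<omega>. f (z + s powr (1 / \<alpha>) *\<^sub>R Z 1 \<omega>) - f z + p \<bullet> (s *\<^sub>R Y 1 \<omega>)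
           + 1 / 2 * ((A *v (sqrt s *\<^sub>R X 1 \<omega>)) \<bullet> (sqrt s *\<^sub>R X 1 \<omega>)));
        L0 = norm p + norm A + sup_norm f + (\<Sum>i=1..3. sup_norm (deriv_norm i f))
      in \<zeta> \<in> H \<and>
        1 / s * \<bar>E \<zeta> - s * G \<Theta> p A (\<lambda>l. f (z + l))\<bar> \<le> l s L0)"
  using A3 unfolding assumption_A3_def by blast
 have gen: "s * g - s * L \<le> e" if "1 / s * \<bar>e - s * g\<bar> \<le> L" "0 < s" for s g L e :: real
  using that by (simp add: field_simps abs_le_iff)
 have it0: "iter_partial UNIV vs (\<lambda>_. 0) x = 0" if "vs \<in> lists Basis" for vs and x :: "real^'n"
  using iter_partial_const[OF thick_UNIV that, of x 0] by (cases "vs = []") auto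
 have z: "sup_norm (\<lambda>_ :: real^'n. 0) + (\<Sum>i=1..3. sup_norm (deriv_norm i (\<lambda>_ :: real^'n. 0))) = 0"
 proof -
  have "deriv_norm i (\<lambda>_ :: real^'n. 0) = (\<lambda>_. 0)" for i
   unfolding deriv_norm_def fun_eq_iff L2_set_def using it0 by (auto simp: in_lists_conv_set subset_iff intro!: sum.neutral)
  then show ?thesis by (simp add: sup_norm_def)
 qed
 show ?thesis
 proof (intro exI[of _ l] conjI[of "\<forall>C. 0 < C --> uniform_limit {0..C} l (\<lambda>_. 0) (at_right 0)"]
   conjI[of "\<forall>p A s. _ p A s"] allI impI)
  fix C :: real assume "0 < C"
  then show "uniform_limit {0..C} l (\<lambda>_. 0) (at_right 0)" by (rule l)
 next
  fix p :: "real^'n" and A :: "real^'n^'n" and s assume a: "transpose A = A" "0 < s" "s \<le> (1 :: real)"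
  have sq: "1 / 2 * ((A *v (sqrt s *\<^sub>R X 1 \<omega>)) \<bullet> (sqrt s *\<^sub>R X 1 \<omega>)) = s / 2 * ((A *v X 1 \<omega>) \<bullet> X 1 \<omega>)" for \<omega>
   using a by (simp add: matrix_vector_mult_scaleR flip: mult.assoc)
  have zc: "(\<lambda>_ :: real^'n. 0 :: real) \<in> Cb 3" by (rule zero_Cb)
  have L0: "norm p + norm A + sup_norm (\<lambda>_ :: real^'n. 0) + (\<Sum>i=1..3. sup_norm (deriv_norm i (\<lambda>_ :: real^'n. 0)))
    = norm p + norm A" using z by linarith
  define \<zeta> where "\<zeta> = (\<lambda>\<omega>. p \<bullet> (s *\<^sub>R Y 1 \<omega>) + s / 2 * ((A *v X 1 \<omega>) \<bullet> X 1 \<omega>))"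
  have "\<zeta> \<in> H \<and> 1 / s * \<bar>E \<zeta> - s * G \<Theta> p A (\<lambda>l. 0)\<bar> \<le> l s (norm p + norm A)"
   using b[of A "\<lambda>_. 0" s 0 p, OF conjI[OF a(1) conjI[OF zc conjI[OF a(2,3)]]]] unfolding Let_def sq L0 \<zeta>_def by simp
  then show "(\<lambda>\<omega>. p \<bullet> (s *\<^sub>R Y 1 \<omega>) + s / 2 * ((A *v X 1 \<omega>) \<bullet> X 1 \<omega>)) \<in> H \<and>
   s * G \<Theta> p A (\<lambda>_. 0) - s * l s (norm p + norm A) \<le> E (\<lambda>\<omega>. p \<bullet> (s *\<^sub>R Y 1 \<omega>) + s / 2 * ((A *v X 1 \<omega>) \<bullet> X 1 \<omega>))"
   unfolding \<zeta>_def[symmetric] using gen a(2) by blast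
 next
  fix f :: "real^'n => real" and z s assume a: "f \<in> Cb 3" "0 < s" "s \<le> (1 :: real)"
  have tz: "transpose (0 :: real^'n^'n) = 0" by (simp add: transpose_def vec_eq_iff)
  show "s * G \<Theta> 0 0 (\<lambda>l. f (z + l)) - s * l s (sup_norm f + (\<Sum>i=1..3. sup_norm (deriv_norm i f)))
    \<le> E (\<lambda>\<omega>. f (z + s powr (1 / \<alpha>) *\<^sub>R Z 1 \<omega>) - f z)"
   using b[of 0 f s z 0, OF conjI[OF tz conjI[OF a(1) conjI[OF a(2,3)]]]] gen[OF _ a(2)] unfolding Let_def by simp
 qed
qed

lemma X_square_in: "(\<lambda>\<omega>. (norm (X 1 \<omega>))\<^sup>2) \<in> H"
proof -
 have "\<forall>p A s. transpose A = A --> 0 < s --> s \<le> 1 -->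
   (\<lambda>\<omega>. p \<bullet> (s *\<^sub>R Y 1 \<omega>) + s / 2 * ((A *v X 1 \<omega>) \<bullet> X 1 \<omega>)) \<in> H"
  using A3_split by blast
 from this[rule_format, of "mat 1" 1 0] have "(\<lambda>\<omega>. 1 / 2 * (X 1 \<omega> \<bullet> X 1 \<omega>)) \<in> H" by (simp add: transpose_mat)
 from scale_in[OF this, of 2] show ?thesis by (simp add: power2_norm_eq_inner)
qed

lemma MX_eq: "MX = E (\<lambda>\<omega>. (norm (X 1 \<omega>))\<^sup>2)" and MX_nonneg: "0 \<le> MX"
proof -
 show eq: "MX = E (\<lambda>\<omega>. (norm (X 1 \<omega>))\<^sup>2)" by (simp add: MX_def moment_def nonneg_powr_numeral)
 show "0 \<le> MX" unfolding eq by (rule E_nonneg[OF X_square_in]) simp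
qed

lemma X_cube_in: "(\<lambda>\<omega>. (norm (X 1 \<omega>)) ^ 3) \<in> H"
 using A1 by (simp add: assumption_A1_def has_moment_def nonneg_powr_numeral)

lemma Y_square_in: "(\<lambda>\<omega>. (norm (Y 1 \<omega>))\<^sup>2) \<in> H"
 using A1 by (simp add: assumption_A1_def has_moment_def nonneg_powr_numeral)

lemma Y_norm_in: "(\<lambda>\<omega>. norm (Y 1 \<omega>)) \<in> H"
proof -
 have "\<bar>norm (fst (snd a)) - norm (fst (snd b))\<bar> \<le> 1 * norm (a - b)" for a b :: "'n space"
 proof -
  have "\<bar>norm (fst (snd a)) - norm (fst (snd b))\<bar> \<le> norm (fst (snd (a - b)))"
   using norm_triangle_ineq3[of "fst (snd a)" "fst (snd b)"] by simp
  also have "\<dots> \<le> norm (snd (a - b))" by (metis norm_fst_le prod.collapse)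
  also have "\<dots> \<le> norm (a - b)" by (metis norm_snd_le prod.collapse)
  finally show ?thesis by simp
 qed
 from Lipschitz_in[OF rv[of 1] this] show ?thesis by simp
qed

lemma MY_eq: "MY = E (\<lambda>\<omega>. norm (Y 1 \<omega>))" and MY_nonneg: "0 \<le> MY"
proof -
 show eq: "MY = E (\<lambda>\<omega>. norm (Y 1 \<omega>))" by (simp add: MY_def moment_def)
 show "0 \<le> MY" unfolding eq by (rule E_nonneg[OF Y_norm_in]) simp
qed

end

subsection \<open>Growth along the coordinate blocks\<close>

text \<open>Truncated cones in the three blocks. A bounded Lipschitz function lies below its value at the vertex
 plus the sum of the three, see \<open>g_dominates\<close>.\<close>

definition gx :: "real => real => 'n::finite space => 'n space => real" where
 "gx C B p0 p = min B (C * norm (fst p - fst p0))"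
definition gy :: "real => real => 'n::finite space => 'n space => real" where
 "gy C B p0 p = min B (C * norm (fst (snd p) - fst (snd p0)))"
definition gz :: "real => real => 'n::finite space => 'n space => real" where
 "gz C B p0 p = min B (C * norm (snd (snd p) - snd (snd p0)))"

lemma g_lipb:
 fixes p0 :: "'n::finite space"
 assumes "0 \<le> C" "0 \<le> B"
 shows "lipb B C (gx C B p0)" "lipb B C (gy C B p0)" "lipb B C (gz C B p0)"
proof -
 have *: "\<bar>C * norm (a - c) - C * norm (b - c)\<bar> \<le> C * s" if "norm (a - b) \<le> s" for a b c :: "real^'n" and s
 proof -
  have "\<bar>norm (a - c) - norm (b - c)\<bar> \<le> s" using norm_triangle_ineq3[of "a - c" "b - c"] that by simp
  then show ?thesis using assms by (simp add: abs_mult mult_left_mono flip: right_diff_distrib)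
 qed
 have s: "norm (fst p - fst q) \<le> snorm (p - q)" "norm (fst (snd p) - fst (snd q)) \<le> snorm (p - q)"
  "norm (snd (snd p) - snd (snd q)) \<le> snorm (p - q)" for p q :: "'n space"
  by (simp_all add: snorm_def)
 show "lipb B C (gx C B p0)" unfolding gx_def[abs_def]
  by (rule lipb_min[OF assms(2,1) _ *[OF s(1)]]) (use assms in simp)
 show "lipb B C (gy C B p0)" unfolding gy_def[abs_def]
  by (rule lipb_min[OF assms(2,1) _ *[OF s(2)]]) (use assms in simp)
 show "lipb B C (gz C B p0)" unfolding gz_def[abs_def]
  by (rule lipb_min[OF assms(2,1) _ *[OF s(3)]]) (use assms in simp)
qed

lemma g_dominates:
 assumes f: "lipb M C f"
 shows "f p \<le> f p0 + (gx C (2 * M) p0 p + gy C (2 * M) p0 p + gz C (2 * M) p0 p)"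
  "f p0 - (gx C (2 * M) p0 p + gy C (2 * M) p0 p + gz C (2 * M) p0 p) \<le> f p"
proof -
 have "\<bar>f p - f p0\<bar> \<le> 2 * M" using lipbD(1)[OF f, of p] lipbD(1)[OF f, of p0] by linarith
 moreover have "\<bar>f p - f p0\<bar> \<le> C * snorm (p - p0)" by (rule lipbD(2)[OF f])
 moreover have nn: "0 \<le> C * norm a" for a :: "real^'n" using lipbD(3)[OF f] by simp
 moreover have M: "0 \<le> M" using lipbD(1)[OF f, of p] by linarith
 moreover have three: "d \<le> min m a + min m b + min m c"
  if "d \<le> m" "d \<le> a + b + c" "0 \<le> a" "0 \<le> b" "0 \<le> c" "0 \<le> m" for d m a b c :: real
  using that by (cases "m \<le> a"; cases "m \<le> b"; cases "m \<le> c"; simp add: min_def)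
 ultimately have "\<bar>f p - f p0\<bar> \<le> gx C (2 * M) p0 p + gy C (2 * M) p0 p + gz C (2 * M) p0 p"
  unfolding gx_def gy_def gz_def by (intro three) (simp_all add: snorm_def distrib_left)
 then show "f p \<le> f p0 + (gx C (2 * M) p0 p + gy C (2 * M) p0 p + gz C (2 * M) p0 p)"
  "f p0 - (gx C (2 * M) p0 p + gy C (2 * M) p0 p + gz C (2 * M) p0 p) \<le> f p" by linarith+
qed

lemma sqrt_from_parabolas:
 assumes "\<And>\<delta>. 0 < \<delta> ==> t \<le> C * (\<delta> / 2) + C / (2 * \<delta>) * m" "0 \<le> C" "0 \<le> m"
 shows "t \<le> C * sqrt m"
proof (cases "m = 0")
 case True
 show ?thesis
 proof (rule field_le_epsilon)
  fix e :: real assume e: "0 < e"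
  have "t \<le> C * (e / (C + 1) / 2)" using assms(1)[of "e / (C + 1)"] e assms(2) True by (simp add: add_nonneg_pos)
  also have "\<dots> \<le> (C + 1) * (e / (C + 1) / 2)" using e assms(2) by (intro mult_right_mono) auto
  also have "\<dots> \<le> e"
  proof -
   have "a * (e / a / 2) \<le> e" if "0 < a" for a using that e by simp
   from this[of "C + 1"] show ?thesis using assms(2) by simp
  qed
  finally show "t \<le> C * sqrt m + e" using True by simp
 qed
next
 case False
 then have m: "0 < sqrt m" using assms(3) by simp
 have "C / (2 * sqrt m) * m = C * (sqrt m / 2)"
  using m assms(3) by (simp add: field_simps)
 then show ?thesis using assms(1)[OF m] by (simp add: algebra_simps)
qed

context driven
begin

lemma scaling_simps [simp]:
 "fst (scaling h p) = sqrt h *\<^sub>R fst p" "fst (snd (scaling h p)) = h *\<^sub>R fst (snd p)"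
 "snd (snd (scaling h p)) = h powr (1 / \<alpha>) *\<^sub>R snd (snd p)"
 by (simp_all add: scaling_def)

text \<open>A cone lies below a parabola, and a parabola grows linearly in time under the scheme because
 \<open>X\<close> has mean zero.\<close>

lemma block_x_parabola:
 assumes h: "0 \<le> h" and CB: "0 \<le> C" "0 \<le> B" and ab: "0 \<le> a" "0 \<le> b" "\<And>r. 0 \<le> r ==> C * r \<le> a + b * r\<^sup>2"
 shows "(T h ^^ j) (gx C B p0) p \<le> a + b * (norm (fst p - fst p0))\<^sup>2 + b * (real j * h * MX)"
proof (induction j arbitrary: p)
 case 0
 show ?case using ab(3)[of "norm (fst p - fst p0)"] by (simp add: gx_def)
next
 case (Suc j)
 define F where "F = (T h ^^ j) (gx C B p0)"
 have F: "lipb B C F" unfolding F_def by (rule Tk_lipb[OF g_lipb(1)[OF CB]])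
 define v where "v = (2 * b * sqrt h) *\<^sub>R (fst p - fst p0)"
 define c where "c = a + b * (norm (fst p - fst p0))\<^sup>2 + b * (real j * h * MX)"
 have le: "F (p + scaling h (\<Xi> 1 \<omega>)) \<le> c + (v \<bullet> X 1 \<omega> + b * h * (norm (X 1 \<omega>))\<^sup>2)" for \<omega>
 proof -
  have "(norm (fst p + sqrt h *\<^sub>R X 1 \<omega> - fst p0))\<^sup>2 = (norm (fst p - fst p0 + sqrt h *\<^sub>R X 1 \<omega>))\<^sup>2"
   by (simp add: algebra_simps)
  also have "\<dots> = (norm (fst p - fst p0))\<^sup>2 + 2 * sqrt h * ((fst p - fst p0) \<bullet> X 1 \<omega>) + h * (norm (X 1 \<omega>))\<^sup>2"
  proof -
   have "(norm (a + r *\<^sub>R x))\<^sup>2 = (norm a)\<^sup>2 + 2 * r * (a \<bullet> x) + r\<^sup>2 * (norm x)\<^sup>2" for a x :: "real^'n" and r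
    unfolding power2_norm_eq_inner
    by (simp add: inner_add_left inner_add_right inner_commute[of x a] power2_eq_square distrib_left)
   then show ?thesis using h by simp
  qed
  finally have eq: "(norm (fst p + sqrt h *\<^sub>R X 1 \<omega> - fst p0))\<^sup>2 =
    (norm (fst p - fst p0))\<^sup>2 + 2 * sqrt h * ((fst p - fst p0) \<bullet> X 1 \<omega>) + h * (norm (X 1 \<omega>))\<^sup>2" .
  have "F (p + scaling h (\<Xi> 1 \<omega>)) \<le> a + b * ((norm (fst p - fst p0))\<^sup>2 +
    2 * sqrt h * ((fst p - fst p0) \<bullet> X 1 \<omega>) + h * (norm (X 1 \<omega>))\<^sup>2) + b * (real j * h * MX)"
   using Suc[of "p + scaling h (\<Xi> 1 \<omega>)"] unfolding F_def[symmetric] fst_add scaling_simps fst_conv eq .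
  also have "\<dots> = c + (v \<bullet> X 1 \<omega> + b * h * (norm (X 1 \<omega>))\<^sup>2)"
   unfolding c_def v_def inner_scaleR_left distrib_left by (simp only: mult_ac add_ac)
  finally show ?thesis .
 qed
 have H1: "(\<lambda>\<omega>. b * h * (norm (X 1 \<omega>))\<^sup>2) \<in> H" by (rule scale_in[OF X_square_in])
 have "T h F p = E (\<lambda>\<omega>. F (p + scaling h (\<Xi> 1 \<omega>)))" by (rule T_transfer[OF F]) simp
 also have "\<dots> \<le> E (\<lambda>\<omega>. v \<bullet> X 1 \<omega> + b * h * (norm (X 1 \<omega>))\<^sup>2) + c"
  by (rule E_le_add[OF lipb_in[OF F rv] add_in[OF inner_in(1) H1]]) (use le in \<open>simp_all add: add.commute\<close>)
 also have "\<dots> \<le> E (\<lambda>\<omega>. v \<bullet> X 1 \<omega>) + E (\<lambda>\<omega>. b * h * (norm (X 1 \<omega>))\<^sup>2) + c"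
  by (intro add_right_mono subadd inner_in H1)
 also have "\<dots> \<le> 0 + b * h * MX + c"
  using E_inner_X[of v] pos_hom[OF X_square_in, of "b * h"] h ab by (simp add: MX_eq)
 finally show ?case by (simp add: F_def c_def algebra_simps)
qed

text \<open>Optimising the parabola turns linear growth of the square into growth of order \<open>sqrt\<close>.\<close>

lemma block_x:
 assumes h: "0 \<le> h" and CB: "0 \<le> C" "0 \<le> B"
 shows "(T h ^^ j) (gx C B p0) p0 \<le> C * sqrt (real j * h * MX)"
proof (rule sqrt_from_parabolas)
 fix \<delta> :: real assume \<delta>: "0 < \<delta>"
 have "C * r \<le> C * (\<delta> / 2) + C / (2 * \<delta>) * r\<^sup>2" if "0 \<le> r" for r
 proof -
  have "0 \<le> (\<delta> - r)\<^sup>2" by simp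
  then have "2 * \<delta> * r \<le> \<delta> * \<delta> + r\<^sup>2" by (simp add: power2_eq_square algebra_simps)
  then have "r \<le> \<delta> / 2 + r\<^sup>2 / (2 * \<delta>)" using \<delta> by (simp add: field_simps)
  then have "C * r \<le> C * (\<delta> / 2 + r\<^sup>2 / (2 * \<delta>))" using CB by (intro mult_left_mono)
  then show ?thesis by (simp add: distrib_left)
 qed
 from block_x_parabola[OF h CB _ _ this, of j p0 p0] \<delta> CB
 show "(T h ^^ j) (gx C B p0) p0 \<le> C * (\<delta> / 2) + C / (2 * \<delta>) * (real j * h * MX)" by simp
qed (use CB h MX_nonneg in auto)

text \<open>The triangle inequality; nothing better is available without a centred variable.\<close>

lemma block_y:
 assumes h: "0 \<le> h" and CB: "0 \<le> C" "0 \<le> B"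
 shows "(T h ^^ j) (gy C B p0) p \<le> C * norm (fst (snd p) - fst (snd p0)) + C * (real j * h * MY)"
proof (induction j arbitrary: p)
 case (Suc j)
 define F where "F = (T h ^^ j) (gy C B p0)"
 have F: "lipb B C F" unfolding F_def by (rule Tk_lipb[OF g_lipb(2)[OF CB]])
 define c where "c = C * norm (fst (snd p) - fst (snd p0)) + C * (real j * h * MY)"
 have le: "F (p + scaling h (\<Xi> 1 \<omega>)) \<le> C * h * norm (Y 1 \<omega>) + c" for \<omega>
 proof -
  have "norm (fst (snd p) + h *\<^sub>R Y 1 \<omega> - fst (snd p0)) \<le> norm (fst (snd p) - fst (snd p0)) + h * norm (Y 1 \<omega>)"
   using norm_triangle_ineq[of "fst (snd p) - fst (snd p0)" "h *\<^sub>R Y 1 \<omega>"] h by (simp add: algebra_simps)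
  from mult_left_mono[OF this CB(1)] show ?thesis
   using Suc[of "p + scaling h (\<Xi> 1 \<omega>)"] by (simp add: F_def c_def algebra_simps)
 qed
 have "T h F p = E (\<lambda>\<omega>. F (p + scaling h (\<Xi> 1 \<omega>)))" by (rule T_transfer[OF F]) simp
 also have "\<dots> \<le> E (\<lambda>\<omega>. C * h * norm (Y 1 \<omega>)) + c"
  by (rule E_le_add[OF lipb_in[OF F rv] scale_in[OF Y_norm_in] le]) simp
 also have "\<dots> = C * h * MY + c"
  using pos_hom[OF Y_norm_in, of "C * h"] h CB by (simp add: MY_eq)
 finally show ?case by (simp add: F_def c_def algebra_simps)
qed (simp add: gy_def)

definition Zsum :: "nat => 'w => real^'n" where "Zsum k \<omega> = (\<Sum>i=1..k. Z i \<omega>)"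

lemma Zsum_rv: "random_vector H (Zsum k)"
 unfolding random_vector_def
proof
 fix b :: "real^'n" assume "b \<in> Basis"
 then obtain j where b: "b = axis j 1" by (auto simp: Basis_vec_real)
 have "(\<lambda>\<omega>. \<Sum>i=1..k. Z i \<omega> $ j) \<in> H" by (intro sum_in component_in(3)) auto
 then show "(\<lambda>\<omega>. Zsum k \<omega> \<bullet> b) \<in> H" by (simp add: Zsum_def b inner_axis)
qed

lemma Zsum_norm_in: "(\<lambda>\<omega>. norm (Zsum k \<omega>)) \<in> H"
 by (rule Lipschitz_in[OF Zsum_rv, where C = 1]) (simp add: norm_triangle_ineq3)

text \<open>Independence turns the iterated expectation into the expectation of a sum. The new increment is
 integrated first, with the previous ones frozen.\<close>

lemma iterate_as_sum:
 fixes g :: "real^'n => real"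
 assumes g: "lipb M L (\<lambda>p. g (snd (snd p)))"
 shows "(T h ^^ k) (\<lambda>p. g (snd (snd p))) p = E (\<lambda>\<omega>. g (snd (snd p) + h powr (1 / \<alpha>) *\<^sub>R Zsum k \<omega>))"
 using g
proof (induction k arbitrary: g)
 case 0
 then show ?case by (simp add: Zsum_def const)
next
 case (Suc k)
 define c where "c = h powr (1 / \<alpha>)"
 define g' where "g' z = E (\<lambda>\<omega>. g (z + c *\<^sub>R Z (Suc k) \<omega>))" for z
 have Tg: "T h (\<lambda>p. g (snd (snd p))) = (\<lambda>p. g' (snd (snd p)))"
 proof
  fix p
  show "T h (\<lambda>p. g (snd (snd p))) p = g' (snd (snd p))"
   using T_transfer[OF Suc.prems, of "Suc k" h p] by (simp add: g'_def c_def)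
 qed
 have g': "lipb M L (\<lambda>p. g' (snd (snd p)))" using T_lipb[OF Suc.prems, of h] unfolding Tg .
 have "(T h ^^ Suc k) (\<lambda>p. g (snd (snd p))) p = (T h ^^ k) (\<lambda>p. g' (snd (snd p))) p"
  by (simp add: funpow_swap1 Tg)
 also have "\<dots> = E (\<lambda>\<omega>. g' (snd (snd p) + c *\<^sub>R Zsum k \<omega>))"
  using Suc.IH[OF g'] by (simp add: c_def)
 also have "\<dots> = E (\<lambda>\<omega>. g (snd (snd p) + c *\<^sub>R Zsum (Suc k) \<omega>))"
 proof (cases "k = 0")
  case True
  then show ?thesis by (simp add: Zsum_def g'_def const)
 next
  case False
  define f where "f a y = g (snd (snd p) + c *\<^sub>R (\<Sum>i=1..k. snd (snd (a i))) + c *\<^sub>R snd (snd y))"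
   for a :: "nat => 'n space" and y :: "'n space"
  have gb: "\<bar>g z\<bar> \<le> M" for z using lipbD(1)[OF Suc.prems, of "(0, 0, z)"] by simp
  have gL: "\<bar>g z - g z'\<bar> \<le> L * norm (z - z')" for z z'
   using lipbD(2)[OF Suc.prems, of "(0, 0, z)" "(0, 0, z')"] by simp
  have L: "0 \<le> L" by (rule lipbD(3)[OF Suc.prems])
  have c: "0 \<le> c" by (simp add: c_def)
  have s2: "norm (snd (snd a)) \<le> norm (a :: 'n space)" for a
   by (metis norm_snd_le order_trans prod.collapse)
  have lipf: "\<bar>f a y - f a' y'\<bar> \<le> L * c * (real k + 1) * (L2_set (\<lambda>i. norm (a i - a' i)) {1..k} + norm (y - y'))" for a a' y y'
  proof -
   define S where "S = L2_set (\<lambda>i. norm (a i - a' i)) {1..k}"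
   have S: "0 \<le> S" by (simp add: S_def)
   have "norm ((\<Sum>i=1..k. snd (snd (a i))) - (\<Sum>i=1..k. snd (snd (a' i)))) \<le> (\<Sum>i=1..k. S)"
    unfolding sum_subtractf[symmetric]
   proof (rule norm_sum[THEN order_trans], rule sum_mono)
    fix i assume i: "i \<in> {1..k}"
    have "norm (snd (snd (a i)) - snd (snd (a' i))) \<le> norm (a i - a' i)" using s2[of "a i - a' i"] by simp
    also have "\<dots> \<le> S" unfolding S_def by (rule member_le_L2_set) (use i in auto)
    finally show "norm (snd (snd (a i)) - snd (snd (a' i))) \<le> S" .
   qed
   then have 1: "norm ((\<Sum>i=1..k. snd (snd (a i))) - (\<Sum>i=1..k. snd (snd (a' i)))) \<le> real k * S" by simp
   have "\<bar>f a y - f a' y'\<bar> \<le> L * norm (c *\<^sub>R ((\<Sum>i=1..k. snd (snd (a i))) - (\<Sum>i=1..k. snd (snd (a' i)))) + c *\<^sub>R snd (snd (y - y')))"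
    unfolding f_def by (rule order_trans[OF gL]) (simp add: algebra_simps)
   also have "\<dots> \<le> L * (c * (real k * S) + c * norm (y - y'))"
   proof (intro mult_left_mono[OF _ L] norm_triangle_le add_mono)
    show "norm (c *\<^sub>R ((\<Sum>i=1..k. snd (snd (a i))) - (\<Sum>i=1..k. snd (snd (a' i))))) \<le> c * (real k * S)"
     using mult_left_mono[OF 1 c] c by simp
    show "norm (c *\<^sub>R snd (snd (y - y'))) \<le> c * norm (y - y')"
     using mult_left_mono[OF s2[of "y - y'"] c] c by simp
   qed
   also have "\<dots> \<le> L * (c * ((real k + 1) * (S + norm (y - y'))))"
   proof (rule mult_left_mono[OF _ L])
    have "real k * S + norm (y - y') \<le> (real k + 1) * (S + norm (y - y'))"
     using S by (simp add: algebra_simps)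
    from mult_left_mono[OF this c] show "c * (real k * S) + c * norm (y - y') \<le> c * ((real k + 1) * (S + norm (y - y')))"
     by (simp add: distrib_left)
   qed
   finally show ?thesis by (simp add: S_def mult_ac)
  qed
  have k1: "1 \<le> k" using False by simp
  have "indep_from E (\<Xi> (k + 1)) {1..k} \<Xi>" using iid k1 unfolding iid_def by blast
  note ind = this[unfolded indep_from_def, rule_format, of f]
  have "\<exists>B. \<forall>a y. \<bar>f a y\<bar> \<le> B" unfolding f_def using gb by blast
  moreover have "\<exists>C. \<forall>a a' y y'. \<bar>f a y - f a' y'\<bar> \<le> C * (L2_set (\<lambda>i. norm (a i - a' i)) {1..k} + norm (y - y'))"
   using lipf by blast
  ultimately have "E (\<lambda>\<omega>. f (\<lambda>i. \<Xi> i \<omega>) (\<Xi> (k + 1) \<omega>)) = E (\<lambda>\<omega>. E (\<lambda>\<omega>'. f (\<lambda>i. \<Xi> i \<omega>) (\<Xi> (k + 1) \<omega>')))"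
   by (intro ind conjI)
  moreover have "f (\<lambda>i. \<Xi> i \<omega>) (\<Xi> (k + 1) \<omega>') = g (snd (snd p) + c *\<^sub>R Zsum k \<omega> + c *\<^sub>R Z (Suc k) \<omega>')" for \<omega> \<omega>'
   by (simp add: f_def Zsum_def)
  moreover have "snd (snd p) + c *\<^sub>R Zsum (Suc k) \<omega> = snd (snd p) + c *\<^sub>R Zsum k \<omega> + c *\<^sub>R Z (Suc k) \<omega>" for \<omega>
   by (simp add: Zsum_def scaleR_add_right)
  ultimately show ?thesis by (simp add: g'_def add.assoc)
 qed
 finally show ?case by (simp add: c_def)
qed

lemma stable_mean_eq: "stable_mean E \<alpha> Z k = real k powr (- 1 / \<alpha>) * E (\<lambda>\<omega>. norm (Zsum k \<omega>))"
 unfolding stable_mean_def Zsum_def[symmetric] by (rule pos_hom[OF Zsum_norm_in]) simp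

lemma stable_mean_le: "1 \<le> k ==> stable_mean E \<alpha> Z k \<le> MZ"
 unfolding MZ_def M_star_def
 by (rule cSUP_upper) (use A2 in \<open>auto simp: assumption_A2_def\<close>)

lemma MZ_nonneg: "0 \<le> MZ"
proof -
 have "0 \<le> stable_mean E \<alpha> Z 1"
  unfolding stable_mean_eq by (intro mult_nonneg_nonneg E_nonneg[OF Zsum_norm_in]) auto
 then show ?thesis using stable_mean_le[of 1] by simp
qed

text \<open>By \<open>iterate_as_sum\<close> the growth is the mean of a normalised sum, which A2 bounds.\<close>

lemma block_z:
 assumes h: "0 \<le> h" and CB: "0 \<le> C" "0 \<le> B"
 shows "(T h ^^ j) (gz C B p0) p0 \<le> C * ((real j * h) powr (1 / \<alpha>) * MZ)"
proof (cases "j = 0")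
 case True
 then show ?thesis using CB MZ_nonneg by (simp add: gz_def)
next
 case False
 define c where "c = h powr (1 / \<alpha>)"
 define g where "g z = min B (C * norm (z - snd (snd p0)))" for z
 have gz: "gz C B p0 = (\<lambda>p. g (snd (snd p)))" by (simp add: fun_eq_iff gz_def g_def)
 have gl: "lipb B C (\<lambda>p. g (snd (snd p)))" using g_lipb(3)[OF CB, of p0] unfolding gz .
 have "(T h ^^ j) (gz C B p0) p0 = E (\<lambda>\<omega>. g (snd (snd p0) + c *\<^sub>R Zsum j \<omega>))"
  unfolding gz c_def by (rule iterate_as_sum[OF gl])
 also have "\<dots> \<le> E (\<lambda>\<omega>. C * c * norm (Zsum j \<omega>))"
 proof (rule mono[OF _ scale_in[OF Zsum_norm_in]])
  have "\<bar>g (snd (snd p0) + c *\<^sub>R a) - g (snd (snd p0) + c *\<^sub>R b)\<bar> \<le> C * c * norm (a - b)" for a b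
   using lipbD(2)[OF gl, of "(0, 0, snd (snd p0) + c *\<^sub>R a)" "(0, 0, snd (snd p0) + c *\<^sub>R b)"]
   by (simp add: c_def flip: scaleR_diff_right)
  then show "(\<lambda>\<omega>. g (snd (snd p0) + c *\<^sub>R Zsum j \<omega>)) \<in> H"
   by (rule Lipschitz_in[OF Zsum_rv])
  show "g (snd (snd p0) + c *\<^sub>R Zsum j \<omega>) \<le> C * c * norm (Zsum j \<omega>)" for \<omega>
   by (simp add: g_def c_def)
 qed
 also have "\<dots> = C * c * E (\<lambda>\<omega>. norm (Zsum j \<omega>))"
  using CB by (intro pos_hom[OF Zsum_norm_in]) (auto simp: c_def)
 also have "E (\<lambda>\<omega>. norm (Zsum j \<omega>)) = real j powr (1 / \<alpha>) * stable_mean E \<alpha> Z j"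
  using False by (simp add: stable_mean_eq flip: mult.assoc powr_add)
 also have "C * c * (real j powr (1 / \<alpha>) * stable_mean E \<alpha> Z j) \<le> C * c * (real j powr (1 / \<alpha>) * MZ)"
  using CB False stable_mean_le[of j] by (intro mult_left_mono mult_nonneg_nonneg) (auto simp: c_def)
 also have "\<dots> = C * ((real j * h) powr (1 / \<alpha>) * MZ)"
  using h by (simp add: c_def powr_mult mult_ac)
 finally show ?thesis .
qed

text \<open>The modulus of continuity in time, block by block; on \<open>[0, 1]\<close> it is at most \<open>C0 * sqrt s\<close>.\<close>

definition rate :: "real => real => real" where
 "rate C s = C * (sqrt (s * MX) + s * MY + s powr (1 / \<alpha>) * MZ)"

lemma blocks_sum:
 assumes "0 \<le> h" "0 \<le> C" "0 \<le> B"
 shows "(T h ^^ j) (gx C B p0) p0 + (T h ^^ j) (gy C B p0) p0 + (T h ^^ j) (gz C B p0) p0 \<le> rate C (real j * h)"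
 using block_x[OF assms, of j p0] block_y[OF assms, of j p0 p0] block_z[OF assms, of j p0]
 by (simp add: rate_def distrib_left)

lemma rate_mono:
 assumes "0 \<le> C" "0 \<le> s" "s \<le> s'"
 shows "rate C s \<le> rate C s'"
 unfolding rate_def using assms MX_nonneg MY_nonneg MZ_nonneg alpha
 by (intro mult_left_mono add_mono real_sqrt_le_mono mult_right_mono powr_mono2) auto

lemma rate_le_sqrt:
 assumes "0 \<le> C" "0 \<le> s" "s \<le> 1" and C0: "C * (sqrt MX + MY + MZ) \<le> C0"
 shows "rate C s \<le> C0 * sqrt s"
proof -
 have s1: "s \<le> sqrt s" using assms by (simp add: real_le_rsqrt power2_eq_square mult_left_le)
 have s2: "s powr (1 / \<alpha>) \<le> sqrt s"
 proof (cases "s = 0")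
  case False
  then have "s powr (1 / \<alpha>) \<le> s powr (1 / 2)"
   using assms alpha by (intro powr_mono') (auto simp: field_simps)
  then show ?thesis using assms by (simp add: powr_half_sqrt)
 qed simp
 have "rate C s \<le> C * (sqrt s * sqrt MX + sqrt s * MY + sqrt s * MZ)"
  unfolding rate_def real_sqrt_mult using assms s1 s2 MY_nonneg MZ_nonneg
  by (intro mult_left_mono add_mono mult_right_mono) auto
 also have "\<dots> = C * (sqrt MX + MY + MZ) * sqrt s" by (simp add: algebra_simps)
 also have "\<dots> \<le> C0 * sqrt s" using C0 assms by (intro mult_right_mono) auto
 finally show ?thesis .
qed

lemma rate_tendsto: "(rate C \<longlongrightarrow> rate C s) (at s within {s..})" if "0 \<le> s"
 unfolding rate_def using alpha that
 by (auto intro!: tendsto_intros tendsto_powr' simp: eventually_at_filter)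

text \<open>Below and above, a Lipschitz function is compared with the sum of the three cones at \<open>p\<close>.\<close>

lemma Tk_growth:
 assumes f: "lipb M C f" and h: "0 \<le> h"
 shows "\<bar>(T h ^^ j) f p - f p\<bar> \<le> rate C (real j * h)"
proof -
 have C: "0 \<le> C" by (rule lipbD(3)[OF f])
 have M: "0 \<le> 2 * M" using lipbD(1)[OF f, of p] by linarith
 define G where "G q = gx C (2 * M) p q + gy C (2 * M) p q + gz C (2 * M) p q" for q
 note gl = g_lipb[OF C M, of p]
 have G: "lipb (2 * M + 2 * M + 2 * M) (C + C + C) G"
  unfolding G_def by (intro lipb_add gl)
 have "(T h ^^ j) G p \<le> (T h ^^ j) (\<lambda>q. gx C (2 * M) p q + gy C (2 * M) p q) p + (T h ^^ j) (gz C (2 * M) p) p"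
  unfolding G_def by (rule Tk_add_le[OF lipb_add[OF gl(1,2)] gl(3)])
 also have "\<dots> \<le> (T h ^^ j) (gx C (2 * M) p) p + (T h ^^ j) (gy C (2 * M) p) p + (T h ^^ j) (gz C (2 * M) p) p"
  by (intro add_right_mono Tk_add_le[OF gl(1,2)])
 also have "\<dots> \<le> rate C (real j * h)" by (rule blocks_sum[OF h C M])
 finally have TG: "(T h ^^ j) G p \<le> rate C (real j * h)" .
 have "(T h ^^ j) f p \<le> (T h ^^ j) (\<lambda>q. f p + G q) p"
  by (rule Tk_mono[OF f lipb_add[OF lipb_const G]]) (use g_dominates(1)[OF f, of _ p] in \<open>simp add: G_def\<close>)
 also have "\<dots> \<le> f p + (T h ^^ j) G p"
  using Tk_add_le[OF lipb_const G, of j h "f p" p] by (simp add: Tk_const)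
 finally have 1: "(T h ^^ j) f p \<le> f p + rate C (real j * h)" using TG by linarith
 have "f p \<le> (T h ^^ j) (\<lambda>q. f q + G q) p"
  using Tk_mono[OF lipb_const lipb_add[OF f G], of "f p" j h p] g_dominates(2)[OF f, of p]
  by (simp add: Tk_const G_def algebra_simps)
 also have "\<dots> \<le> (T h ^^ j) f p + (T h ^^ j) G p" by (rule Tk_add_le[OF f G])
 finally show ?thesis using 1 TG by linarith
qed

end

subsection \<open>Consistency for functions of one block\<close>

text \<open>The property is preserved by \<open>T h\<close> and by convolution, because \<open>\<pi>\<close> is additive.\<close>

definition depends :: "('n::finite space => real^'n) => ('n space => real) => bool" where
 "depends \<pi> f \<longleftrightarrow> (\<forall>p q. \<pi> p = \<pi> q --> f p = f q)"

definition projs :: "('n::finite space => real^'n) set" where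
 "projs = {fst, \<lambda>p. fst (snd p), \<lambda>p. snd (snd p)}"

lemma projs_add: "\<pi> \<in> projs ==> \<pi> (p + q) = \<pi> p + \<pi> q"
 by (auto simp: projs_def)

lemma dependsD: "depends \<pi> f ==> \<pi> p = \<pi> q ==> f p = f q"
 unfolding depends_def by blast

lemma partial_deriv_zero_line:
 assumes "\<And>s. f (p + s *\<^sub>R b) = f p"
 shows "partial_deriv UNIV b f p = 0"
 by (simp add: partial_deriv_def assms vector_derivative_at)

lemma norm_matrix_le:
 fixes A :: "real^'n^'n"
 assumes "\<And>i j. \<bar>A $ i $ j\<bar> \<le> B"
 shows "norm A \<le> (real CARD('n))\<^sup>2 * B"
proof -
 have "norm A \<le> (\<Sum>i\<in>UNIV. norm (A $ i))" unfolding norm_vec_def by (rule L2_set_le_sum) simp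
 also have "\<dots> \<le> (\<Sum>i\<in>(UNIV :: 'n set). \<Sum>j\<in>(UNIV :: 'n set). B)"
  by (intro sum_mono order_trans[OF norm_le_l1_cart]) (use assms in auto)
 finally show ?thesis by (simp add: power2_eq_square)
qed

lemma trace_symmetrise:
 fixes A Q :: "real^'n^'n"
 assumes "transpose Q = Q"
 shows "trace ((\<chi> i j. (A $ i $ j + A $ j $ i) / 2) ** Q) = trace (A ** Q)"
proof -
 have Q: "Q $ i $ j = Q $ j $ i" for i j using assms by (simp add: transpose_def vec_eq_iff)
 have "(\<Sum>i\<in>UNIV. \<Sum>j\<in>UNIV. A $ j $ i * Q $ j $ i) = (\<Sum>i\<in>UNIV. \<Sum>j\<in>UNIV. A $ i $ j * Q $ i $ j)"
  by (rule sum.swap)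
 then have "(\<Sum>i\<in>UNIV. \<Sum>j\<in>UNIV. A $ j $ i * Q $ j $ i) = (\<Sum>i\<in>UNIV. \<Sum>j\<in>UNIV. A $ i $ j * Q $ j $ i)"
  by (simp add: Q)
 then show ?thesis
  by (simp add: trace_def matrix_matrix_mult_def add_divide_distrib distrib_right sum.distrib
    flip: sum_divide_distrib)
qed

context driven
begin

lemma T_depends:
 assumes \<pi>: "\<pi> \<in> projs" and f: "depends \<pi> f"
 shows "depends \<pi> (T h f)"
 unfolding depends_def
proof (intro allI impI)
 fix p q assume "\<pi> p = \<pi> q"
 then have "f (p + x) = f (q + x)" for x by (intro dependsD[OF f]) (simp add: projs_add[OF \<pi>])
 then show "T h f p = T h f q" by (simp add: T_def)
qed

lemma Tk_depends: "\<pi> \<in> projs ==> depends \<pi> f ==> depends \<pi> ((T h ^^ k) f)"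
 by (induction k) (auto intro: T_depends)

lemma deriv_bound_lipb:
 fixes f :: "'n space => real"
 assumes f: "deriv_bound 1 B f" and M: "\<And>p. \<bar>f p\<bar> \<le> M"
 shows "lipb M (B * DIM('n space)) f"
 unfolding lipb_def
proof (intro conjI allI M)
 have B: "0 \<le> B" by (rule deriv_bound_nonneg[OF f]) simp
 then show "0 \<le> B * DIM('n space)" by simp
 fix p q :: "'n space"
 have "\<bar>f (q + (p - q)) - f q\<bar> \<le> B * norm1 (p - q)" by (rule Lipschitz_norm1[OF f])
 also have "\<dots> \<le> B * (DIM('n space) * norm (p - q))" using B by (intro mult_left_mono norm1_le)
 also have "\<dots> \<le> B * (DIM('n space) * snorm (p - q))" using B by (intro mult_left_mono norm_le_snorm) auto
 finally show "\<bar>f p - f q\<bar> \<le> B * DIM('n space) * snorm (p - q)" by (simp del: DIM_prod)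
qed

text \<open>Taylor's formula of the third order. The linear term has mean at most zero, and the quadratic form is
 the one that A3 treats, after symmetrising the Hessian.\<close>

lemma consistency_x:
 fixes f :: "'n space => real"
 assumes f: "deriv_bound 3 B f" and M: "\<And>p. \<bar>f p\<bar> \<le> M" and dep: "depends fst f" and h: "0 < h"
  and H: "(\<lambda>\<omega>. h / 2 * ((A *v X 1 \<omega>) \<bullet> X 1 \<omega>)) \<in> H"
  and A: "A = (\<chi> i j. (hess_x f p $ i $ j + hess_x f p $ j $ i) / 2)"
 shows "E (\<lambda>\<omega>. h / 2 * ((A *v X 1 \<omega>) \<bullet> X 1 \<omega>)) \<le>
  T h f p - f p + B * (sqrt h * real CARD('n)) ^ 3 * E (\<lambda>\<omega>. (norm (X 1 \<omega>)) ^ 3)"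
  "Gop \<Theta> f p = G \<Theta> 0 A (\<lambda>_. 0)"
proof -
 have B: "0 \<le> B" using deriv_bound_nonneg[OF f] by simp
 have f1: "deriv_bound 1 B f" by (rule deriv_bound_mono[OF f]) auto
 note fl = deriv_bound_lipb[OF f1 M]
 define d where "d = (\<chi> i. partial_deriv UNIV (ex i) f p)"
 define c where "c = B * (sqrt h * real CARD('n)) ^ 3"
 have c: "0 \<le> c" using B h by (simp add: c_def)
 have le: "h / 2 * ((A *v X 1 \<omega>) \<bullet> X 1 \<omega>) \<le>
   (f (p + scaling h (\<Xi> 1 \<omega>)) + - f p) + ((- sqrt h *\<^sub>R d) \<bullet> X 1 \<omega> + c * (norm (X 1 \<omega>)) ^ 3)" for \<omega>
 proof -
  define x where "x = X 1 \<omega>"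
  define v :: "'n space" where "v = (sqrt h *\<^sub>R x, 0, 0)"
  have D: "(\<Sum>b\<in>Basis. (v \<bullet> b) * partial_deriv UNIV b f p) = sqrt h * (d \<bullet> x)"
   by (simp add: v_def sum_Basis_space d_def inner_vec_def sum_distrib_left mult_ac)
  have "(\<Sum>a\<in>Basis. \<Sum>b\<in>Basis. (v \<bullet> a) * (v \<bullet> b) * iter_partial UNIV [a, b] f p) =
    (\<Sum>i\<in>UNIV. \<Sum>j\<in>UNIV. sqrt h * x $ i * (sqrt h * x $ j) * hess_x f p $ i $ j)"
   by (simp add: v_def sum_Basis_space hess_x_def)
  also have "\<dots> = h * (\<Sum>i\<in>UNIV. \<Sum>j\<in>UNIV. x $ i * x $ j * hess_x f p $ i $ j)"
  proof -
   have "sqrt h * a * (sqrt h * b) * r = h * (a * b * r)" for a b r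
    using h by (simp add: mult_ac)
   then show ?thesis by (simp only: sum_distrib_left)
  qed
  also have "(\<Sum>i\<in>UNIV. \<Sum>j\<in>UNIV. x $ i * x $ j * hess_x f p $ i $ j) = (A *v x) \<bullet> x"
  proof -
   have "(\<Sum>i\<in>UNIV. \<Sum>j\<in>UNIV. x $ i * x $ j * hess_x f p $ j $ i) = (\<Sum>i\<in>UNIV. \<Sum>j\<in>UNIV. x $ j * x $ i * hess_x f p $ i $ j)"
    by (rule sum.swap)
   then have sw: "(\<Sum>i\<in>UNIV. \<Sum>j\<in>UNIV. x $ i * x $ j * hess_x f p $ j $ i) = (\<Sum>i\<in>UNIV. \<Sum>j\<in>UNIV. x $ i * x $ j * hess_x f p $ i $ j)"
    by (simp add: mult_ac)
   have "(A *v x) \<bullet> x = (\<Sum>i\<in>UNIV. \<Sum>j\<in>UNIV. (x $ i * x $ j * hess_x f p $ i $ j + x $ i * x $ j * hess_x f p $ j $ i) / 2)"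
    by (simp add: inner_vec_def matrix_vector_mult_def A sum_distrib_right sum_distrib_left algebra_simps add_divide_distrib)
   also have "\<dots> = (\<Sum>i\<in>UNIV. \<Sum>j\<in>UNIV. x $ i * x $ j * hess_x f p $ i $ j)"
    using sw by (simp add: sum.distrib flip: sum_divide_distrib)
   finally show ?thesis ..
  qed
  finally have S: "(\<Sum>a\<in>Basis. \<Sum>b\<in>Basis. (v \<bullet> a) * (v \<bullet> b) * iter_partial UNIV [a, b] f p) = h * ((A *v x) \<bullet> x)" .
  have n1: "norm1 v \<le> sqrt h * real CARD('n) * norm x"
  proof -
   have "norm1 v = (\<Sum>i\<in>UNIV. sqrt h * \<bar>x $ i\<bar>)" using h by (simp add: v_def norm1_def sum_Basis_space abs_mult)
   also have "\<dots> \<le> (\<Sum>i\<in>(UNIV :: 'n set). sqrt h * norm x)"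
    using h by (intro sum_mono mult_left_mono component_le_norm_cart) auto
   finally show ?thesis by (simp add: mult_ac)
  qed
  have "B * (norm1 v) ^ 3 \<le> B * (sqrt h * real CARD('n) * norm x) ^ 3"
   using B n1 by (intro mult_left_mono power_mono) auto
  also have "\<dots> = c * norm x ^ 3" by (simp add: c_def power_mult_distrib)
  finally have "\<bar>f (p + v) - f p - sqrt h * (d \<bullet> x) - 1 / 2 * (h * ((A *v x) \<bullet> x))\<bar> \<le> c * norm x ^ 3"
   using Taylor3_norm1[OF f, of p v] unfolding D S by linarith
  moreover have "f (p + scaling h (\<Xi> 1 \<omega>)) = f (p + v)"
   by (rule dependsD[OF dep]) (simp add: v_def x_def)
  ultimately show ?thesis unfolding x_def by (simp add: abs_le_iff)
 qed
 note fi = lipb_in[OF fl rv[of 1], of p h]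
 have i1: "(\<lambda>\<omega>. f (p + scaling h (\<Xi> 1 \<omega>)) + - f p) \<in> H" using fi by (intro add_in const_in) simp
 have i2: "(\<lambda>\<omega>. c * (norm (X 1 \<omega>)) ^ 3) \<in> H" by (rule scale_in[OF X_cube_in])
 have "E (\<lambda>\<omega>. h / 2 * ((A *v X 1 \<omega>) \<bullet> X 1 \<omega>)) \<le>
   E (\<lambda>\<omega>. (f (p + scaling h (\<Xi> 1 \<omega>)) + - f p) + ((- sqrt h *\<^sub>R d) \<bullet> X 1 \<omega> + c * (norm (X 1 \<omega>)) ^ 3))"
  by (rule mono[OF H add_in[OF i1 add_in[OF inner_in(1) i2]] le])
 also have "\<dots> \<le> E (\<lambda>\<omega>. f (p + scaling h (\<Xi> 1 \<omega>)) + - f p) + E (\<lambda>\<omega>. (- sqrt h *\<^sub>R d) \<bullet> X 1 \<omega> + c * (norm (X 1 \<omega>)) ^ 3)"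
  by (rule subadd[OF i1 add_in[OF inner_in(1) i2]])
 also have "\<dots> \<le> (T h f p + - f p) + (0 + c * E (\<lambda>\<omega>. (norm (X 1 \<omega>)) ^ 3))"
 proof (rule add_mono)
  show "E (\<lambda>\<omega>. f (p + scaling h (\<Xi> 1 \<omega>)) + - f p) \<le> T h f p + - f p"
   using E_le_add[OF i1, of "\<lambda>\<omega>. f (p + scaling h (\<Xi> 1 \<omega>))" "- f p"] fi T_transfer[OF fl, of 1 h p] by simp
  have "E (\<lambda>\<omega>. (- sqrt h *\<^sub>R d) \<bullet> X 1 \<omega> + c * (norm (X 1 \<omega>)) ^ 3) \<le> E (\<lambda>\<omega>. (- sqrt h *\<^sub>R d) \<bullet> X 1 \<omega>) + E (\<lambda>\<omega>. c * (norm (X 1 \<omega>)) ^ 3)"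
   by (rule subadd[OF inner_in(1) i2])
  then show "E (\<lambda>\<omega>. (- sqrt h *\<^sub>R d) \<bullet> X 1 \<omega> + c * (norm (X 1 \<omega>)) ^ 3) \<le> 0 + c * E (\<lambda>\<omega>. (norm (X 1 \<omega>)) ^ 3)"
   using E_inner_X[of "- sqrt h *\<^sub>R d"] pos_hom[OF X_cube_in c] by linarith
 qed
 finally show "E (\<lambda>\<omega>. h / 2 * ((A *v X 1 \<omega>) \<bullet> X 1 \<omega>)) \<le>
  T h f p - f p + B * (sqrt h * real CARD('n)) ^ 3 * E (\<lambda>\<omega>. (norm (X 1 \<omega>)) ^ 3)" by (simp add: c_def)
 have gz: "grad_z f p = 0"
  by (simp add: grad_z_def vec_eq_iff, intro allI partial_deriv_zero_line dependsD[OF dep]) (simp add: ez_def)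
 have gy: "grad_y f p = 0"
  by (simp add: grad_y_def vec_eq_iff, intro allI partial_deriv_zero_line dependsD[OF dep]) (simp add: ey_def)
 have j: "jump f p = (\<lambda>_. 0)"
 proof
  fix l
  have "f (p + (0, 0, l)) = f p" by (rule dependsD[OF dep]) simp
  then show "jump f p l = 0" by (simp add: jump_def gz)
 qed
 have inc: "increment (\<lambda>_ :: real^'n. 0) 0 = (\<lambda>_. 0)"
  by (simp add: increment_def gradient_def partial_deriv_zero_line fun_eq_iff inner_vec_def)
 show "Gop \<Theta> f p = G \<Theta> 0 A (\<lambda>_. 0)"
  unfolding Gop_def G_def
 proof (rule SUP_cong[OF refl], clarify)
  fix F q Q assume "(F, q, Q) \<in> \<Theta>"
  then have "transpose Q = Q" using F_facts(5) by (simp add: psd_def)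
  then have "trace (A ** Q) = trace (hess_x f p ** Q)" unfolding A by (rule trace_symmetrise)
  then show "Lop (F, q, Q) f p = (\<integral>l. increment (\<lambda>_. 0) 0 l \<partial>F) + 0 \<bullet> q + 1 / 2 * trace (A ** Q)"
   by (simp add: Lop_def gy j inc)
 qed
qed

lemma consistency_y:
 fixes f :: "'n space => real"
 assumes f: "deriv_bound 3 B f" and M: "\<And>p. \<bar>f p\<bar> \<le> M" and dep: "depends (\<lambda>p. fst (snd p)) f" and h: "0 < h"
 shows "E (\<lambda>\<omega>. grad_y f p \<bullet> (h *\<^sub>R Y 1 \<omega>)) \<le>
  T h f p - f p + B * (h * real CARD('n))\<^sup>2 * E (\<lambda>\<omega>. (norm (Y 1 \<omega>))\<^sup>2)"
  "Gop \<Theta> f p = G \<Theta> (grad_y f p) 0 (\<lambda>_. 0)"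
proof -
 have B: "0 \<le> B" using deriv_bound_nonneg[OF f] by simp
 have f1: "deriv_bound 1 B f" and f2: "deriv_bound 2 B f" by (rule deriv_bound_mono[OF f], simp, simp)+
 note fl = deriv_bound_lipb[OF f1 M]
 define c where "c = B * (h * real CARD('n))\<^sup>2"
 have c: "0 \<le> c" using B h by (simp add: c_def)
 have le: "grad_y f p \<bullet> (h *\<^sub>R Y 1 \<omega>) \<le>
   (f (p + scaling h (\<Xi> 1 \<omega>)) + - f p) + c * (norm (Y 1 \<omega>))\<^sup>2" for \<omega>
 proof -
  define y where "y = Y 1 \<omega>"
  define v :: "'n space" where "v = (0, h *\<^sub>R y, 0)"
  have D: "(\<Sum>b\<in>Basis. (v \<bullet> b) * partial_deriv UNIV b f p) = grad_y f p \<bullet> (h *\<^sub>R y)"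
   by (simp only: grad_y_inner v_def)
  have n1: "norm1 v \<le> h * real CARD('n) * norm y"
  proof -
   have "norm1 v = (\<Sum>i\<in>UNIV. h * \<bar>y $ i\<bar>)" using h by (simp add: v_def norm1_def sum_Basis_space abs_mult)
   also have "\<dots> \<le> (\<Sum>i\<in>(UNIV :: 'n set). h * norm y)"
    using h by (intro sum_mono mult_left_mono component_le_norm_cart) auto
   finally show ?thesis by (simp add: mult_ac)
  qed
  have "B * (norm1 v)\<^sup>2 \<le> B * (h * real CARD('n) * norm y)\<^sup>2"
   using B n1 by (intro mult_left_mono power_mono) auto
  also have "\<dots> = c * (norm y)\<^sup>2" by (simp add: c_def power_mult_distrib)
  finally have "\<bar>f (p + v) - f p - grad_y f p \<bullet> (h *\<^sub>R y)\<bar> \<le> c * (norm y)\<^sup>2"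
   using Taylor2_norm1[OF f2, of p v] unfolding D by linarith
  moreover have "f (p + scaling h (\<Xi> 1 \<omega>)) = f (p + v)"
   by (rule dependsD[OF dep]) (simp add: v_def y_def)
  ultimately show ?thesis unfolding y_def by linarith
 qed
 note fi = lipb_in[OF fl rv[of 1], of p h]
 have i1: "(\<lambda>\<omega>. f (p + scaling h (\<Xi> 1 \<omega>)) + - f p) \<in> H" using fi by (intro add_in const_in) simp
 have i2: "(\<lambda>\<omega>. c * (norm (Y 1 \<omega>))\<^sup>2) \<in> H" by (rule scale_in[OF Y_square_in])
 have i3: "(\<lambda>\<omega>. grad_y f p \<bullet> (h *\<^sub>R Y 1 \<omega>)) \<in> H" using inner_in(2)[of "h *\<^sub>R grad_y f p"] by simp
 have "E (\<lambda>\<omega>. grad_y f p \<bullet> (h *\<^sub>R Y 1 \<omega>)) \<le> E (\<lambda>\<omega>. (f (p + scaling h (\<Xi> 1 \<omega>)) + - f p) + c * (norm (Y 1 \<omega>))\<^sup>2)"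
  by (rule mono[OF i3 add_in[OF i1 i2] le])
 also have "\<dots> \<le> E (\<lambda>\<omega>. f (p + scaling h (\<Xi> 1 \<omega>)) + - f p) + E (\<lambda>\<omega>. c * (norm (Y 1 \<omega>))\<^sup>2)"
  by (rule subadd[OF i1 i2])
 also have "\<dots> \<le> (T h f p + - f p) + c * E (\<lambda>\<omega>. (norm (Y 1 \<omega>))\<^sup>2)"
 proof (rule add_mono)
  show "E (\<lambda>\<omega>. f (p + scaling h (\<Xi> 1 \<omega>)) + - f p) \<le> T h f p + - f p"
   using E_le_add[OF i1, of "\<lambda>\<omega>. f (p + scaling h (\<Xi> 1 \<omega>))" "- f p"] fi T_transfer[OF fl, of 1 h p] by simp
  show "E (\<lambda>\<omega>. c * (norm (Y 1 \<omega>))\<^sup>2) \<le> c * E (\<lambda>\<omega>. (norm (Y 1 \<omega>))\<^sup>2)"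
   using pos_hom[OF Y_square_in c] by simp
 qed
 finally show "E (\<lambda>\<omega>. grad_y f p \<bullet> (h *\<^sub>R Y 1 \<omega>)) \<le>
  T h f p - f p + B * (h * real CARD('n))\<^sup>2 * E (\<lambda>\<omega>. (norm (Y 1 \<omega>))\<^sup>2)" by (simp add: c_def)
 have gz: "grad_z f p = 0"
  by (simp add: grad_z_def vec_eq_iff, intro allI partial_deriv_zero_line dependsD[OF dep]) (simp add: ez_def)
 have "partial_deriv UNIV (ex i) f = (\<lambda>_. 0)" for i
  by (rule ext, intro partial_deriv_zero_line dependsD[OF dep]) (simp add: ex_def)
 then have hx: "hess_x f p = 0"
  by (simp add: hess_x_def vec_eq_iff partial_deriv_zero_line)
 have j: "jump f p = (\<lambda>_. 0)"
 proof
  fix l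
  have "f (p + (0, 0, l)) = f p" by (rule dependsD[OF dep]) simp
  then show "jump f p l = 0" by (simp add: jump_def gz)
 qed
 have inc: "increment (\<lambda>_ :: real^'n. 0) 0 = (\<lambda>_. 0)"
  by (simp add: increment_def gradient_def partial_deriv_zero_line fun_eq_iff inner_vec_def)
 show "Gop \<Theta> f p = G \<Theta> (grad_y f p) 0 (\<lambda>_. 0)"
  unfolding Gop_def G_def by (rule SUP_cong[OF refl], clarify) (simp add: Lop_def hx j inc)
qed

text \<open>For functions of the third block A3 applies directly to the function.\<close>

lemma consistency_z:
 fixes f :: "'n space => real"
 assumes f: "deriv_bound 3 B f" and M: "\<And>p. \<bar>f p\<bar> \<le> M" and dep: "depends (\<lambda>p. snd (snd p)) f"
 defines "f' \<equiv> \<lambda>l. f ((0, 0, 0) + (0, 0, l))"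
 shows "E (\<lambda>\<omega>. f' (snd (snd p) + h powr (1 / \<alpha>) *\<^sub>R Z 1 \<omega>) - f' (snd (snd p))) \<le> T h f p - f p"
  "Gop \<Theta> f p = G \<Theta> 0 0 (\<lambda>l. f' (snd (snd p) + l))" "deriv_bound 3 B f'"
proof -
 have J: "linear (\<lambda>l::real^'n. (0::real^'n, 0::real^'n, l))" by (auto simp: linear_iff)
 have JB: "(0::real^'n, 0::real^'n, b) \<in> Basis" if "b \<in> Basis" for b :: "real^'n"
  using that by (auto simp: Basis_prod_def zero_prod_def)
 show "deriv_bound 3 B f'" unfolding f'_def by (rule deriv_bound_embed[OF f J JB])
 have f1: "deriv_bound 1 B f" by (rule deriv_bound_mono[OF f]) auto
 note fl = deriv_bound_lipb[OF f1 M]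
 note fi = lipb_in[OF fl rv[of 1], of p h]
 have eq: "f' (snd (snd p) + h powr (1 / \<alpha>) *\<^sub>R Z 1 \<omega>) - f' (snd (snd p)) = f (p + scaling h (\<Xi> 1 \<omega>)) + - f p" for \<omega>
  unfolding f'_def diff_conv_add_uminus
  by (intro arg_cong2[of _ _ _ _ "(+)"] arg_cong[of _ _ uminus] dependsD[OF dep]) simp_all
 have i1: "(\<lambda>\<omega>. f (p + scaling h (\<Xi> 1 \<omega>)) + - f p) \<in> H" using fi by (intro add_in const_in) simp
 show "E (\<lambda>\<omega>. f' (snd (snd p) + h powr (1 / \<alpha>) *\<^sub>R Z 1 \<omega>) - f' (snd (snd p))) \<le> T h f p - f p"
  unfolding eq
  using E_le_add[OF i1, of "\<lambda>\<omega>. f (p + scaling h (\<Xi> 1 \<omega>))" "- f p"] fi T_transfer[OF fl, of 1 h p] by simp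
 have gy: "grad_y f p = 0"
  by (simp add: grad_y_def vec_eq_iff, intro allI partial_deriv_zero_line dependsD[OF dep]) (simp add: ey_def)
 have "partial_deriv UNIV (ex i) f = (\<lambda>_. 0)" for i
  by (rule ext, intro partial_deriv_zero_line dependsD[OF dep]) (simp add: ex_def)
 then have hx: "hess_x f p = 0"
  by (simp add: hess_x_def vec_eq_iff partial_deriv_zero_line)
 have fz: "f' (snd (snd p) + l) = f (p + (0, 0, l))" for l
  unfolding f'_def by (rule dependsD[OF dep]) simp
 have gr: "gradient (\<lambda>l. f (p + (0, 0, l))) 0 = grad_z f p"
  using iter_partial_embed[OF J, of p UNIV "[axis _ 1]" f 0]
  by (simp add: gradient_def grad_z_def vec_eq_iff ez_def zero_prod_def[symmetric])
 have "increment (\<lambda>l. f' (snd (snd p) + l)) 0 = jump f p"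
  unfolding fz by (rule ext) (simp add: increment_def jump_def gr zero_prod_def[symmetric])
 then show "Gop \<Theta> f p = G \<Theta> 0 0 (\<lambda>l. f' (snd (snd p) + l))"
  unfolding Gop_def G_def by (intro SUP_cong[OF refl]) (auto simp: Lop_def hx gy)
qed

text \<open>On functions of a single block the scheme is consistent with the equation, uniformly under bounds on
 three derivatives: the Taylor remainders are of higher order in \<open>h\<close>, and the error in A3 is
 uniform on bounded sets of its argument.\<close>

lemma consistency:
 assumes B: "0 \<le> B" and \<eta>: "0 < \<eta>"
 shows "\<forall>\<^sub>F h in at_right 0. \<forall>(f :: 'n space => real) p. deriv_bound 3 B f --> (\<forall>p. \<bar>f p\<bar> \<le> B) -->
  (\<exists>\<pi>\<in>projs. depends \<pi> f) --> f p + h * Gop \<Theta> f p - h * \<eta> \<le> T h f p"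
proof -
 obtain l :: "real => real => real" where l: "\<forall>C. 0 < C --> uniform_limit {0..C} l (\<lambda>_. 0) (at_right 0)"
  and lxy: "\<forall>p A s. transpose A = A --> 0 < s --> s \<le> 1 -->
   (\<lambda>\<omega>. p \<bullet> (s *\<^sub>R Y 1 \<omega>) + s / 2 * ((A *v X 1 \<omega>) \<bullet> X 1 \<omega>)) \<in> H \<and>
   s * G \<Theta> p A (\<lambda>_. 0) - s * l s (norm p + norm A) \<le> E (\<lambda>\<omega>. p \<bullet> (s *\<^sub>R Y 1 \<omega>) + s / 2 * ((A *v X 1 \<omega>) \<bullet> X 1 \<omega>))"
  and lz: "\<forall>f z s. f \<in> Cb 3 --> 0 < s --> s \<le> 1 -->
   s * G \<Theta> 0 0 (\<lambda>l. f (z + l)) - s * l s (sup_norm f + (\<Sum>i=1..3. sup_norm (deriv_norm i f)))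
    \<le> E (\<lambda>\<omega>. f (z + s powr (1 / \<alpha>) *\<^sub>R Z 1 \<omega>) - f z)"
  using A3_split by blast
 define n where "n = real CARD('n)"
 have n: "1 \<le> n" by (simp add: n_def Suc_le_eq)
 define N where "N i = real (card {vs :: (real^'n) list. set vs \<subseteq> Basis \<and> length vs = i})" for i
 define C where "C = 1 + n\<^sup>2 * B + n * B + B + (\<Sum>i=1..3. N i * B)"
 have C: "1 \<le> C" "n\<^sup>2 * B \<le> C" "n * B \<le> C" "B + (\<Sum>i=1..3. N i * B) \<le> C"
 proof -
  have "0 \<le> n\<^sup>2 * B" "0 \<le> n * B" "0 \<le> (\<Sum>i=1..3. N i * B)" using B n by (auto simp: N_def intro!: sum_nonneg)
  then show "1 \<le> C" "n\<^sup>2 * B \<le> C" "n * B \<le> C" "B + (\<Sum>i=1..3. N i * B) \<le> C" using B unfolding C_def by linarith+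
 qed
 define mX where "mX = E (\<lambda>\<omega>. (norm (X 1 \<omega>)) ^ 3)"
 define mY where "mY = E (\<lambda>\<omega>. (norm (Y 1 \<omega>))\<^sup>2)"
 have ul: "\<forall>\<^sub>F h in at_right 0. \<forall>L\<in>{0..C}. dist (l h L) 0 < \<eta> / 2"
  using uniform_limitD[OF l[rule_format, of C], of "\<eta> / 2"] C \<eta> by simp
 have t1: "((\<lambda>h. B * n ^ 3 * sqrt h * mX) \<longlongrightarrow> B * n ^ 3 * sqrt 0 * mX) (at_right 0)"
  by (intro tendsto_intros)
 have e1: "\<forall>\<^sub>F h in at_right 0. B * n ^ 3 * sqrt h * mX < \<eta> / 2"
  using order_tendstoD(2)[OF t1, of "\<eta> / 2"] \<eta> by simp
 have t2: "((\<lambda>h. B * n\<^sup>2 * h * mY) \<longlongrightarrow> B * n\<^sup>2 * 0 * mY) (at_right 0)"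
  by (intro tendsto_intros)
 have e2: "\<forall>\<^sub>F h in at_right 0. B * n\<^sup>2 * h * mY < \<eta> / 2"
  using order_tendstoD(2)[OF t2, of "\<eta> / 2"] \<eta> by simp
 have e3: "\<forall>\<^sub>F h in at_right 0. 0 < h \<and> h < (1 :: real)"
  unfolding eventually_at_right_field by (rule exI[of _ 1]) auto
 from ul e1 e2 e3 show ?thesis
 proof eventually_elim
  fix h :: real
  assume ul: "\<forall>L\<in>{0..C}. dist (l h L) 0 < \<eta> / 2" and e1: "B * n ^ 3 * sqrt h * mX < \<eta> / 2"
   and e2: "B * n\<^sup>2 * h * mY < \<eta> / 2" and e3: "0 < h \<and> h < 1"
  have h: "0 < h" "h \<le> 1" using e3 by auto
  have lb: "h * l h L \<le> h * (\<eta> / 2)" if "0 \<le> L" "L \<le> C" for L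
  proof (rule mult_left_mono)
   have "dist (l h L) 0 < \<eta> / 2" using ul that by auto
   then show "l h L \<le> \<eta> / 2" by (simp add: dist_norm)
  qed (use h in simp)
  show "\<forall>(f :: 'n space => real) p. deriv_bound 3 B f --> (\<forall>p. \<bar>f p\<bar> \<le> B) -->
   (\<exists>\<pi>\<in>projs. depends \<pi> f) --> f p + h * Gop \<Theta> f p - h * \<eta> \<le> T h f p"
  proof (intro allI impI)
   fix f :: "'n space => real" and p
   assume f: "deriv_bound 3 B f" and M: "\<forall>p. \<bar>f p\<bar> \<le> B" and dep: "\<exists>\<pi>\<in>projs. depends \<pi> f"
   from dep consider "depends fst f" | "depends (\<lambda>p. fst (snd p)) f" | "depends (\<lambda>p. snd (snd p)) f"
    unfolding projs_def by blast
   then show "f p + h * Gop \<Theta> f p - h * \<eta> \<le> T h f p"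
   proof cases
    case 1
    define A where "A = (\<chi> i j. (hess_x f p $ i $ j + hess_x f p $ j $ i) / 2)"
    have At: "transpose A = A" by (simp add: A_def transpose_def vec_eq_iff add.commute)
    have hb: "\<bar>hess_x f p $ i $ j\<bar> \<le> B" for i j
     using deriv_boundD[OF f, of "[ex i, ex j]" p] by (simp add: hess_x_def)
    have "\<bar>A $ i $ j\<bar> \<le> B" for i j
     using hb[of i j] hb[of j i] by (simp add: A_def)
    then have "norm A \<le> n\<^sup>2 * B" unfolding n_def by (rule norm_matrix_le)
    then have "norm A \<le> C" using C by linarith
    then have l1: "h * l h (norm A) \<le> h * (\<eta> / 2)" by (intro lb) auto
    have HA: "(\<lambda>\<omega>. h / 2 * ((A *v X 1 \<omega>) \<bullet> X 1 \<omega>)) \<in> H \<and>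
      h * G \<Theta> 0 A (\<lambda>_. 0) - h * l h (norm A) \<le> E (\<lambda>\<omega>. h / 2 * ((A *v X 1 \<omega>) \<bullet> X 1 \<omega>))"
     using lxy[rule_format, of A h 0] At h by simp
    note cx = consistency_x[OF f M[rule_format] 1 h(1) conjunct1[OF HA] A_def]
    have "B * (sqrt h * n) ^ 3 * mX = h * (B * n ^ 3 * sqrt h * mX)"
    proof -
     have "(sqrt h) ^ 3 = h * sqrt h" using h by (simp add: power3_eq_cube)
     then show ?thesis by (simp add: power_mult_distrib)
    qed
    also have "\<dots> \<le> h * (\<eta> / 2)" using e1 h by (intro mult_left_mono) auto
    finally show ?thesis
     using cx HA l1 unfolding n_def mX_def by (simp add: algebra_simps)
   next
    case 2
    have pd: "\<bar>partial_deriv UNIV b f p\<bar> \<le> B" if "b \<in> Basis" for b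
     using deriv_boundD[OF f, of "[b]" p] that by simp
    have pde: "\<bar>grad_y f p $ i\<bar> \<le> B" for i using pd[of "ey i"] by (simp add: grad_y_def)
    have "norm (grad_y f p) \<le> (\<Sum>i\<in>UNIV. \<bar>grad_y f p $ i\<bar>)" by (rule norm_le_l1_cart)
    also have "\<dots> \<le> (\<Sum>i\<in>(UNIV :: 'n set). B)" using pde by (intro sum_mono)
    finally have "norm (grad_y f p) \<le> n * B" by (simp add: n_def)
    then have "norm (grad_y f p) \<le> C" using C by linarith
    then have l1: "h * l h (norm (grad_y f p)) \<le> h * (\<eta> / 2)" by (intro lb) auto
    have t0: "transpose (0 :: real^'n^'n) = 0" by (simp add: transpose_def vec_eq_iff)
    have HA: "h * G \<Theta> (grad_y f p) 0 (\<lambda>_. 0) - h * l h (norm (grad_y f p)) \<le> E (\<lambda>\<omega>. grad_y f p \<bullet> (h *\<^sub>R Y 1 \<omega>))"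
     using lxy[rule_format, of 0 h "grad_y f p"] t0 h by simp
    note cy = consistency_y[OF f M[rule_format] 2 h(1), of p]
    have "B * (h * n)\<^sup>2 * mY = h * (B * n\<^sup>2 * h * mY)"
     by (simp add: power2_eq_square)
    also have "\<dots> \<le> h * (\<eta> / 2)" using e2 h by (intro mult_left_mono) auto
    finally show ?thesis
     using cy HA l1 unfolding n_def mY_def by (simp add: algebra_simps)
   next
    case 3
    note cz = consistency_z[OF f M[rule_format] 3]
    define f' where "f' = (\<lambda>l. f ((0, 0, 0) + (0, 0, l)))"
    define L where "L = sup_norm f' + (\<Sum>i=1..3. sup_norm (deriv_norm i f'))"
    have db: "deriv_bound 3 B f'" using cz(3) by (simp add: f'_def)
    have f'b: "\<bar>f' x\<bar> \<le> B" for x using M unfolding f'_def by blast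
    have dn: "0 \<le> deriv_norm i f' x \<and> deriv_norm i f' x \<le> N i * B" if "i \<in> {1..3}" for i x
    proof -
     have "deriv_norm i f' x \<le> (\<Sum>vs\<in>{vs. set vs \<subseteq> Basis \<and> length vs = i}. \<bar>iter_partial UNIV vs f' x\<bar>)"
      unfolding deriv_norm_def by (rule L2_set_le_sum_abs)
     also have "\<dots> \<le> (\<Sum>vs\<in>{vs :: (real^'n) list. set vs \<subseteq> Basis \<and> length vs = i}. B)"
      by (rule sum_mono, rule deriv_boundD[OF db]) (use that in \<open>auto simp: in_lists_conv_set\<close>)
     finally show ?thesis by (simp add: N_def deriv_norm_def)
    qed
    have sn: "0 \<le> sup_norm (deriv_norm i f') \<and> sup_norm (deriv_norm i f') \<le> N i * B" if "i \<in> {1..3}" for i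
    proof
     have b: "\<bar>deriv_norm i f' x\<bar> \<le> N i * B" for x using dn[OF that, of x] by simp
     show "sup_norm (deriv_norm i f') \<le> N i * B" by (rule sup_norm_le[OF b])
     show "0 \<le> sup_norm (deriv_norm i f')" by (rule sup_norm_nonneg[OF b])
    qed
    have "0 \<le> L" unfolding L_def
     by (intro add_nonneg_nonneg sup_norm_nonneg[OF f'b] sum_nonneg) (use sn in blast)
    moreover have "L \<le> C"
    proof -
     have "(\<Sum>i=1..3. sup_norm (deriv_norm i f')) \<le> (\<Sum>i=1..3. N i * B)"
      by (rule sum_mono) (use sn in blast)
     then show ?thesis using sup_norm_le[of f' B] f'b C(4) unfolding L_def by fastforce
    qed
    ultimately have l1: "h * l h L \<le> h * (\<eta> / 2)" by (rule lb)
    have "f' \<in> Cb 3" using Cb_inf_Cb deriv_bound_smooth[OF db] by blast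
    then have "h * G \<Theta> 0 0 (\<lambda>l. f' (snd (snd p) + l)) - h * l h L
      \<le> E (\<lambda>\<omega>. f' (snd (snd p) + h powr (1 / \<alpha>) *\<^sub>R Z 1 \<omega>) - f' (snd (snd p)))"
     unfolding L_def using lz[rule_format, of f' h] h by simp
    moreover have "h * (\<eta> / 2) \<le> h * \<eta>" using h \<eta> by simp
    moreover have "E (\<lambda>\<omega>. f' (snd (snd p) + h powr (1 / \<alpha>) *\<^sub>R Z 1 \<omega>) - f' (snd (snd p))) \<le> T h f p - f p"
     unfolding f'_def by (rule cz(1))
    moreover have gp: "Gop \<Theta> f p = G \<Theta> 0 0 (\<lambda>l. f' (snd (snd p) + l))"
     unfolding f'_def by (rule cz(2))
    ultimately show ?thesis unfolding gp using l1 by linarith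
   qed
  qed
 qed
qed

end

subsection \<open>Mollification of the scheme\<close>

text \<open>A mollification is approximated uniformly by combinations of translates with nonnegative weights;
 this carries sublinearity from finite sums over to the integral. The hypothesis on \<open>v\<close> says that it
 is a step function in time; the quadrature points then depend only on the step and on the ball that
 contain the translation, and serve for all such \<open>v\<close> with a given Lipschitz constant.\<close>

lemma conv_quadrature:
 fixes k :: "real \<times> 'n::finite space => real"
 assumes k: "averaging \<epsilon> k" and \<eta>: "0 < \<eta>" and L: "0 \<le> L"
 shows "\<exists>(J :: (int \<times> nat) set) w q. finite J \<and> (\<forall>j\<in>J. 0 \<le> w j \<and> 0 \<le> fst (q j)) \<and>
  (\<forall>v M. bounded_borel M v --> (\<forall>t e e'. \<bar>v (t, e) - v (t, e')\<bar> \<le> L * norm (e - e')) -->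
   (\<forall>t t' e. \<lfloor>t / h\<rfloor> = \<lfloor>t' / h\<rfloor> --> v (t, e) = v (t', e)) -->
   (\<forall>c. \<bar>conv v k (s, c) - (\<Sum>j\<in>J. w j * v ((s, c) + q j))\<bar> \<le> \<eta>))"
proof -
 note ker = averaging_kernel[OF k]
 have km [measurable]: "k \<in> borel_measurable borel" by (rule kernel_meas[OF ker])
 define \<delta> where "\<delta> = \<eta> / (2 * (L + 1))"
 have \<delta>: "0 < \<delta>" "L * (2 * \<delta>) \<le> \<eta>"
 proof -
  show "0 < \<delta>" using \<eta> L by (simp add: \<delta>_def)
  then have "L * \<delta> \<le> \<eta> / 2" by (intro small_multiple[OF L]) (simp_all add: \<delta>_def)
  then show "L * (2 * \<delta>) \<le> \<eta>" by simp
 qed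
 define AA where "AA = cball (0 :: 'n space) \<epsilon>"
 have cAA: "compact AA" by (simp add: AA_def)
 obtain X where X: "finite X" "X \<subseteq> AA" "AA \<subseteq> (\<Union>x\<in>X. ball x \<delta>)"
  using seq_compact_imp_totally_bounded[of AA] cAA \<delta>(1) unfolding compact_eq_seq_compact_metric by blast
 obtain l :: "nat => 'n space" and N :: nat where l: "X = l ` {..<N}"
  using finite_imp_nat_seg_image_inj_on[OF X(1)] unfolding lessThan_def[symmetric] by blast
 define A where "A j = disjointed (\<lambda>j. ball (l j) \<delta>) j" for j
 define m where "m d = \<lfloor>(s - fst d) / h\<rfloor>" for d :: "real \<times> 'n space"
 define S where "S = {d :: real \<times> 'n space. - \<epsilon>\<^sup>2 \<le> fst d \<and> fst d \<le> 0 \<and> snd d \<in> AA}"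
 \<comment> \<open>On \<open>D x\<close> the value \<open>v ((s, c) - d)\<close> varies by at most \<open>\<eta>\<close>, uniformly in \<open>c\<close>.\<close>
 define D where "D x = {d \<in> S. m d = fst x \<and> snd d \<in> A (snd x)}" for x :: "int \<times> nat"
 define I where "I = {\<lfloor>min (s / h) ((s + \<epsilon>\<^sup>2) / h)\<rfloor>..\<lfloor>max (s / h) ((s + \<epsilon>\<^sup>2) / h)\<rfloor>}"
 define J where "J = {x \<in> I \<times> {..<N}. D x \<noteq> {}}"
 have fJ: "finite J" by (simp add: J_def I_def)
 have Sm: "S \<in> sets borel"
 proof -
  have "closed S"
   unfolding S_def AA_def mem_cball Collect_conj_eq
   by (intro closed_Int closed_Collect_le continuous_intros)
  then show ?thesis by simp
 qed
 have Dm: "D x \<in> sets borel" for x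
 proof -
  have 1: "{d :: real \<times> 'n space. m d = i} \<in> sets borel" for i
  proof -
   have "{d :: real \<times> 'n space. m d = i} = {d. real_of_int i \<le> (s - fst d) / h} \<inter> {d. (s - fst d) / h < real_of_int i + 1}"
    by (auto simp: m_def floor_eq_iff)
   moreover have "closed {d :: real \<times> 'n space. real_of_int i \<le> (s - fst d) / h}"
    by (cases "h = 0") (auto intro!: closed_Collect_le continuous_intros)
   moreover have "open {d :: real \<times> 'n space. (s - fst d) / h < real_of_int i + 1}"
    by (cases "h = 0") (auto intro!: open_Collect_less continuous_intros)
   ultimately show ?thesis by auto
  qed
  have "A j \<in> sets borel" for j unfolding A_def disjointed_def by auto
  moreover have "snd \<in> borel_measurable (borel :: (real \<times> 'n space) measure)"
   by (intro borel_measurable_continuous_onI continuous_intros)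
  ultimately have 2: "snd -` A j \<in> sets (borel :: (real \<times> 'n space) measure)" for j
   by (metis measurable_sets_borel)
  have "D x = S \<inter> ({d. m d = fst x} \<inter> snd -` A (snd x))" by (auto simp: D_def)
  then show ?thesis using Sm 1 2 by auto
 qed
 have Adisj: "j = j'" if "x \<in> A j" "x \<in> A j'" for x j j'
  using disjoint_family_disjointed[of "\<lambda>j. ball (l j) \<delta>"] that unfolding A_def disjoint_family_on_def by blast
 have Ab: "dist (l j) x < \<delta>" if "x \<in> A j" for j x
  using disjointed_subset[of "\<lambda>j. ball (l j) \<delta>" j, THEN subsetD, of x] that unfolding A_def by simp
 have Dd: "disjoint_family_on D J"
  unfolding disjoint_family_on_def
 proof (intro ballI impI)
  fix x y :: "int \<times> nat" assume "x \<noteq> y"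
  show "D x \<inter> D y = {}"
  proof (rule ccontr)
   assume "D x \<inter> D y \<noteq> {}"
   then obtain d where "d \<in> D x" "d \<in> D y" by blast
   then have *: "fst x = fst y" "snd d \<in> A (snd x)" "snd d \<in> A (snd y)" by (simp_all add: D_def)
   have "snd x = snd y" by (rule Adisj[OF *(2,3)])
   then show False using \<open>x \<noteq> y\<close> *(1) by (simp add: prod_eq_iff)
  qed
 qed
 have DU: "(\<Union>x\<in>J. D x) = S"
 proof
  show "(\<Union>x\<in>J. D x) \<subseteq> S" by (auto simp: D_def)
  show "S \<subseteq> (\<Union>x\<in>J. D x)"
  proof
   fix d assume d: "d \<in> S"
   have "snd d \<in> AA" using d by (simp add: S_def)
   then have "snd d \<in> (\<Union>x\<in>X. ball x \<delta>)" using X(3) by (rule subsetD[rotated])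
   moreover have "(\<Union>x\<in>X. ball x \<delta>) = (\<Union>j\<in>{0..<N}. ball (l j) \<delta>)"
    unfolding l lessThan_atLeast0 by simp
   ultimately have "snd d \<in> (\<Union>j\<in>{0..<N}. ball (l j) \<delta>)" by (rule back_subst[where P = "\<lambda>A. snd d \<in> A"])
   then have "snd d \<in> (\<Union>j\<in>{0..<N}. A j)" unfolding A_def finite_UN_disjointed_eq .
   then obtain j where j: "j < N" "snd d \<in> A j" by auto
   have dx: "d \<in> D (m d, j)" using d j by (simp add: D_def)
   have "m d \<in> I"
   proof -
    have "s \<le> s - fst d" "s - fst d \<le> s + \<epsilon>\<^sup>2" using d by (auto simp: S_def)
    then have "min (s / h) ((s + \<epsilon>\<^sup>2) / h) \<le> (s - fst d) / h \<and> (s - fst d) / h \<le> max (s / h) ((s + \<epsilon>\<^sup>2) / h)"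
     by (cases "0 \<le> h") (auto simp: min_le_iff_disj le_max_iff_disj divide_right_mono divide_right_mono_neg)
    then show ?thesis unfolding I_def m_def by (auto intro: floor_mono)
   qed
   then have "(m d, j) \<in> J" using dx j by (auto simp: J_def)
   then show "d \<in> (\<Union>x\<in>J. D x)" using dx by blast
  qed
 qed
 have ind: "(\<Sum>x\<in>J. indicator (D x) d) = (indicator S d :: real)" for d
 proof -
  have "(indicator (\<Union>x\<in>J. D x) d :: real) = (\<Sum>x\<in>J. indicator (D x) d)"
   by (rule indicator_UN_disjoint[OF fJ Dd])
  then show ?thesis by (simp add: DU)
 qed
 have k0: "0 \<le> k d" for d using k unfolding averaging_def by blast
 have kS: "k d * indicator S d = k d" for d
 proof (cases "k d = 0")
  case False
  then have "k (fst d, snd d) \<noteq> 0" by simp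
  then have "- \<epsilon>\<^sup>2 \<le> fst d \<and> fst d \<le> 0 \<and> norm (snd d) < \<epsilon>" using k unfolding averaging_def by blast
  then have "d \<in> S" by (simp add: S_def AA_def)
  then show ?thesis by simp
 qed simp
 have kint: "integrable lborel k" by (rule kernel_reflect_integrable(2)[OF ker])
 have kD: "integrable lborel (\<lambda>d. k d * indicator (D x) d)" for x
  by (rule Bochner_Integration.integrable_bound[OF kint]) (use Dm[of x] in \<open>auto simp: indicator_def\<close>)
 define w where "w x = (LINT d|lborel. k d * indicator (D x) d)" for x :: "int \<times> nat"
 define r where "r x = (SOME d. d \<in> D x)" for x :: "int \<times> nat"
 have r: "r x \<in> D x" if "x \<in> J" for x
  using that unfolding J_def r_def by (auto intro: someI_ex)
 have w0: "0 \<le> w x" for x unfolding w_def by (rule Bochner_Integration.integral_nonneg) (simp add: k0)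
 have main: "\<bar>conv v k (s, c) - (\<Sum>x\<in>J. w x * v ((s, c) + - r x))\<bar> \<le> \<eta>"
  if v: "bounded_borel M v" and vL: "\<forall>t e e'. \<bar>v (t, e) - v (t, e')\<bar> \<le> L * norm (e - e')"
   and vs: "\<forall>t t' e. \<lfloor>t / h\<rfloor> = \<lfloor>t' / h\<rfloor> --> v (t, e) = v (t', e)" for v M c
 proof -
  have vi: "integrable lborel (\<lambda>d. v ((s, c) - d) * k d)" by (rule conv_integrable(2)[OF ker v])
  have si: "integrable lborel (\<lambda>d. \<Sum>x\<in>J. v ((s, c) - r x) * (k d * indicator (D x) d))"
   by (intro Bochner_Integration.integrable_sum integrable_mult_right kD)
  have "(\<Sum>x\<in>J. w x * v ((s, c) + - r x)) = (LINT d|lborel. (\<Sum>x\<in>J. v ((s, c) - r x) * (k d * indicator (D x) d)))"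
   using kD by (subst Bochner_Integration.integral_sum) (auto simp: w_def mult.commute intro!: integrable_mult_right)
  then have "conv v k (s, c) - (\<Sum>x\<in>J. w x * v ((s, c) + - r x)) =
    (LINT d|lborel. v ((s, c) - d) * k d - (\<Sum>x\<in>J. v ((s, c) - r x) * (k d * indicator (D x) d)))"
   using vi si by (simp add: conv_alt[OF ker v])
  also have "\<bar>\<dots>\<bar> \<le> (LINT d|lborel. \<eta> * k d)"
  proof (rule integral_abs_bound_integral)
   show "integrable lborel (\<lambda>d. v ((s, c) - d) * k d - (\<Sum>x\<in>J. v ((s, c) - r x) * (k d * indicator (D x) d)))"
    by (rule Bochner_Integration.integrable_diff[OF vi si])
   show "integrable lborel (\<lambda>d. \<eta> * k d)" using kint by (rule integrable_mult_right)
   fix d :: "real \<times> 'n space"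
   have "v ((s, c) - d) * k d = v ((s, c) - d) * (k d * (\<Sum>x\<in>J. indicator (D x) d))"
    unfolding ind kS ..
   also have "\<dots> = (\<Sum>x\<in>J. v ((s, c) - d) * (k d * indicator (D x) d))"
    by (simp add: sum_distrib_left)
   finally have "v ((s, c) - d) * k d - (\<Sum>x\<in>J. v ((s, c) - r x) * (k d * indicator (D x) d)) =
     (\<Sum>x\<in>J. (v ((s, c) - d) - v ((s, c) - r x)) * (k d * indicator (D x) d))"
    by (simp add: left_diff_distrib sum_subtractf)
   also have "\<bar>\<dots>\<bar> \<le> (\<Sum>x\<in>J. \<eta> * (k d * indicator (D x) d))"
   proof (rule order_trans[OF sum_abs], rule sum_mono)
    fix x assume x: "x \<in> J"
    show "\<bar>(v ((s, c) - d) - v ((s, c) - r x)) * (k d * indicator (D x) d)\<bar> \<le> \<eta> * (k d * indicator (D x) d)"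
    proof (cases "d \<in> D x")
     case True
     have rx: "r x \<in> D x" by (rule r[OF x])
     have "m d = m (r x)" using True rx by (simp add: D_def)
     then have fl: "\<lfloor>(s - fst d) / h\<rfloor> = \<lfloor>(s - fst (r x)) / h\<rfloor>" by (simp add: m_def)
     have b: "dist (l (snd x)) (snd d) < \<delta>" "dist (l (snd x)) (snd (r x)) < \<delta>"
      using True rx by (auto simp: D_def intro: Ab)
     then have "dist (snd d) (snd (r x)) \<le> 2 * \<delta>"
      using dist_triangle3[of "snd d" "snd (r x)" "l (snd x)"] by linarith
     then have nd: "norm ((c - snd d) - (c - snd (r x))) \<le> 2 * \<delta>"
      by (simp add: dist_norm norm_minus_commute)
     have "v ((s, c) - r x) = v (s - fst d, c - snd (r x))"
      using vs[rule_format, OF fl] by (metis diff_Pair prod.collapse)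
     moreover have "v ((s, c) - d) = v (s - fst d, c - snd d)" by (metis diff_Pair prod.collapse)
     ultimately have "\<bar>v ((s, c) - d) - v ((s, c) - r x)\<bar> \<le> L * norm ((c - snd d) - (c - snd (r x)))"
      using vL[THEN spec[of _ "s - fst d"], THEN spec[of _ "c - snd d"], THEN spec[of _ "c - snd (r x)"]]
      by (simp only: )
     also have "\<dots> \<le> L * (2 * \<delta>)" using nd L by (rule mult_left_mono)
     also have "\<dots> \<le> \<eta>" by (rule \<delta>(2))
     finally have "\<bar>v ((s, c) - d) - v ((s, c) - r x)\<bar> * k d \<le> \<eta> * k d" using k0 by (intro mult_right_mono)
     then show ?thesis using True k0[of d] by (simp add: abs_mult)
    qed simp
   qed
   also have "\<dots> = \<eta> * (k d * (\<Sum>x\<in>J. indicator (D x) d))" by (simp add: sum_distrib_left)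
   also have "\<dots> = \<eta> * k d" unfolding ind kS ..
   finally show "\<bar>v ((s, c) - d) * k d - (\<Sum>x\<in>J. v ((s, c) - r x) * (k d * indicator (D x) d))\<bar> \<le> \<eta> * k d" .
  qed
  also have "\<dots> = \<eta>" using k by (simp add: averaging_def)
  finally show ?thesis .
 qed
 have r0: "0 \<le> w x \<and> 0 \<le> fst (- r x)" if "x \<in> J" for x using r[OF that] w0 by (simp add: D_def S_def)
 show ?thesis
  by (rule exI[of _ J], rule exI[of _ w], rule exI[of _ "\<lambda>x. - r x"],
    intro conjI fJ ballI r0 allI impI, assumption, rule main)
qed

lemma conv_slice_lipb:
 fixes v :: "real \<times> 'n::finite space => real"
 assumes k: "averaging \<epsilon> k" and v: "bounded_borel M v" and vl: "\<And>t. lipb M L (\<lambda>e. v (t, e))"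
 shows "lipb M L (\<lambda>e. conv v k (s, e))"
 unfolding lipb_def
proof (intro conjI allI)
 note ker = averaging_kernel[OF k]
 show "0 \<le> L" by (rule lipbD(3)[OF vl])
 fix e
 have "v q \<le> M" "- M \<le> v q" for q using bounded_borelD[OF v, of q] by linarith+
 then show "\<bar>conv v k (s, e)\<bar> \<le> M"
  using conv_le_avg[OF k v, of s e M] conv_ge_avg[OF k v, of "- M" s e] by (simp add: abs_le_iff)
 have le: "conv v k (s, a) \<le> conv v k (s, b) + L * snorm (a - b)" for a b
 proof -
  define c where "c = L * snorm (a - b)"
  note vc = bounded_borel_add(1)[OF v bounded_borel_const[of c]]
  have "conv v k (s, a) \<le> conv (\<lambda>q. v q + c) k (s, b)"
  proof (rule conv_mono_avg[OF k v vc])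
   fix \<sigma> :: real and e' :: "'n space"
   show "v (s + \<sigma>, a + e') \<le> v (s + \<sigma>, b + e') + c"
    using lipbD(2)[OF vl[of "s + \<sigma>"], of "a + e'" "b + e'"] by (simp add: c_def)
  qed
  then show ?thesis
   using conv_linear(1)[OF ker v bounded_borel_const[of c], of "(s, b)"] conv_const[OF k, of c "(s, b)"]
   by (simp add: c_def)
 qed
 fix e'
 have "snorm (e' - e) = snorm (e - e')" using snorm_minus[of "e - e'"] by simp
 then show "\<bar>conv v k (s, e) - conv v k (s, e')\<bar> \<le> L * snorm (e - e')"
  using le[of e e'] le[of e' e] by simp
qed

context driven
begin

text \<open>The scheme as a function of all real times, constant on time intervals of length \<open>h\<close>.\<close>

definition sch :: "real => ('n space => real) => real \<times> 'n space => real" where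
 "sch h f = (\<lambda>(t, e). (T h ^^ nat \<lfloor>t / h\<rfloor>) f e)"

lemma sch_lipb: "lipb M L f ==> lipb M L (\<lambda>e. sch h f (t, e))"
 by (simp add: sch_def Tk_lipb)

lemma sch_rec:
 assumes h: "0 < h" "h \<le> t"
 shows "sch h f (t, e) = T h (\<lambda>e. sch h f (t - h, e)) e"
proof -
 have "(t - h) / h = t / h - 1" using h by (simp add: diff_divide_distrib)
 moreover have "1 \<le> \<lfloor>t / h\<rfloor>" using h by (simp add: le_floor_iff)
 moreover from calculation have "\<lfloor>(t - h) / h\<rfloor> = \<lfloor>t / h\<rfloor> - 1" by simp
 ultimately have "nat \<lfloor>t / h\<rfloor> = Suc (nat \<lfloor>(t - h) / h\<rfloor>)" by linarith
 then show ?thesis by (simp add: sch_def)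
qed

lemma sch_steps: "0 < h ==> 0 \<le> t ==> real (nat \<lfloor>t / h\<rfloor>) * h \<le> t"
proof -
 assume h: "0 < h" and t: "0 \<le> t"
 have "real (nat \<lfloor>t / h\<rfloor>) \<le> t / h" using h t by simp
 then show ?thesis using h by (simp add: pos_le_divide_eq)
qed

lemma sch_borel:
 assumes f: "lipb M L f"
 shows "bounded_borel M (sch h f)"
 unfolding bounded_borel_def
proof (intro conjI allI)
 have "(\<lambda>p :: real \<times> 'n space. (T h ^^ i) f (snd p)) \<in> borel_measurable borel" for i
  by (intro borel_measurable_continuous_onI continuous_on_compose2[OF lipb_cont[OF Tk_lipb[OF f]]] continuous_intros) auto
 moreover have "(\<lambda>p :: real \<times> 'n space. nat \<lfloor>fst p / h\<rfloor>) \<in> measurable borel (count_space UNIV)"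
 proof -
  have [measurable]: "(\<lambda>p :: real \<times> 'n space. fst p) \<in> borel_measurable borel"
   by (intro borel_measurable_continuous_onI continuous_intros)
  show ?thesis by measurable
 qed
 ultimately have "(\<lambda>p :: real \<times> 'n space. (T h ^^ (nat \<lfloor>fst p / h\<rfloor>)) f (snd p)) \<in> borel_measurable borel"
  by (rule measurable_compose_countable)
 then show "sch h f \<in> borel_measurable borel" by (simp add: sch_def case_prod_unfold)
 show "\<bar>sch h f q\<bar> \<le> M" for q
  using lipbD(1)[OF Tk_lipb[OF f]] by (simp add: sch_def case_prod_unfold)
qed

text \<open>Jensen's inequality: by sublinearity the average of the values after one step is at least the value
 of the averaged function after one step.\<close>

lemma sch_jensen:
 assumes f: "lipb M L f" and k: "averaging \<epsilon> k" and h: "0 < h" and s: "0 \<le> s"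
 shows "T h (\<lambda>e. conv (sch h f) k (s, e)) e \<le> conv (sch h f) k (s + h, e)"
proof (rule field_le_epsilon)
 fix \<zeta> :: real assume "0 < \<zeta>"
 then have \<zeta>: "0 < \<zeta> / 2" by simp
 note ker = averaging_kernel[OF k]
 note vb = sch_borel[OF f, of h]
 have L: "0 \<le> 2 * L" using lipbD(3)[OF f] by simp
 obtain J w q where J: "finite (J :: (int \<times> nat) set)" "\<forall>j\<in>J. 0 \<le> w j \<and> 0 \<le> fst (q j :: real \<times> 'n space)" and
  quad: "\<forall>v M. bounded_borel M v --> (\<forall>t e e'. \<bar>v (t, e) - v (t, e')\<bar> \<le> 2 * L * norm (e - e')) -->
   (\<forall>t t' e. \<lfloor>t / h\<rfloor> = \<lfloor>t' / h\<rfloor> --> v (t, e) = v (t', e)) -->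
   (\<forall>c. \<bar>conv v k (s, c) - (\<Sum>j\<in>J. w j * v ((s, c) + q j))\<bar> \<le> \<zeta> / 2)"
  using conv_quadrature[OF k \<zeta> L, of h s] by (elim exE conjE) (rule that)
 define V where "V = sch h f"
 define V' where "V' q = V (q + (h, 0))" for q
 have V'b: "bounded_borel M V'" unfolding V'_def V_def by (rule bounded_borel_shift[OF vb])
 have VL: "\<bar>V (t, e) - V (t, e')\<bar> \<le> 2 * L * norm (e - e')" for t e e'
  unfolding V_def by (rule lipb_norm[OF sch_lipb[OF f]])
 have V'L: "\<bar>V' (t, e) - V' (t, e')\<bar> \<le> 2 * L * norm (e - e')" for t e e'
  using VL[of "t + h" e e'] by (simp add: V'_def)
 have Vs: "V (t, e) = V (t', e)" if "\<lfloor>t / h\<rfloor> = \<lfloor>t' / h\<rfloor>" for t t' e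
  using that by (simp add: V_def sch_def)
 have V's: "V' (t, e) = V' (t', e)" if "\<lfloor>t / h\<rfloor> = \<lfloor>t' / h\<rfloor>" for t t' e
 proof -
  have "\<lfloor>(t + h) / h\<rfloor> = \<lfloor>(t' + h) / h\<rfloor>" using that h by (simp add: add_divide_distrib)
  from Vs[OF this] show ?thesis by (simp add: V'_def)
 qed
 have q1: "\<bar>conv V k (s, c) - (\<Sum>j\<in>J. w j * V ((s, c) + q j))\<bar> \<le> \<zeta> / 2" for c
 proof (rule quad[THEN spec[of _ V], THEN spec[of _ M], THEN mp, THEN mp, THEN mp, THEN spec])
  show "bounded_borel M V" unfolding V_def by (rule vb)
 qed (intro allI impI VL, intro allI impI, rule Vs)
 have q2: "\<bar>conv V' k (s, c) - (\<Sum>j\<in>J. w j * V' ((s, c) + q j))\<bar> \<le> \<zeta> / 2" for c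
  by (rule quad[THEN spec[of _ V'], THEN spec[of _ M], THEN mp, THEN mp, THEN mp, THEN spec])
   (rule V'b, intro allI impI V'L, intro allI impI, rule V's)
 define g where "g j e = V (s + fst (q j), e)" for j e
 have gl: "lipb M L (g j)" for j unfolding g_def V_def by (rule sch_lipb[OF f])
 have Vg: "V ((s, c) + q j) = g j (c + snd (q j))" for c j
  unfolding g_def by (metis add_Pair prod.collapse)
 have gi: "(\<lambda>\<omega>. g j (e + scaling h (\<Xi>' \<omega>) + snd (q j))) \<in> H" for j
  using lipb_in[OF gl copy_in, of j "e + snd (q j)" h] by (simp add: add_ac)
 have Tg: "E (\<lambda>\<omega>. g j (e + scaling h (\<Xi>' \<omega>) + snd (q j))) = V' ((s, e) + q j)" if j: "j \<in> J" for j
 proof -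
  have "E (\<lambda>\<omega>. g j (e + scaling h (\<Xi>' \<omega>) + snd (q j))) = T h (g j) (e + snd (q j))"
   by (simp add: T_def add_ac)
  also have "\<dots> = sch h f (s + fst (q j) + h, e + snd (q j))"
   using sch_rec[of h "s + fst (q j) + h" f "e + snd (q j)"] h s J(2) j by (simp add: g_def[abs_def] V_def)
  also have "\<dots> = V' ((s, e) + q j)"
   unfolding V'_def V_def by (metis add.right_neutral add_Pair prod.collapse)
  finally show ?thesis .
 qed
 note cl = conv_slice_lipb[OF k vb sch_lipb[OF f], of s]
 have "T h (\<lambda>e. conv V k (s, e)) e = E (\<lambda>\<omega>. conv V k (s, e + scaling h (\<Xi>' \<omega>)))"
  by (simp add: T_def)
 also have "\<dots> \<le> E (\<lambda>\<omega>. \<Sum>j\<in>J. w j * g j (e + scaling h (\<Xi>' \<omega>) + snd (q j))) + \<zeta> / 2"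
 proof (rule E_le_add)
  show "(\<lambda>\<omega>. conv V k (s, e + scaling h (\<Xi>' \<omega>))) \<in> H"
   using lipb_in[OF cl copy_in] by (simp add: V_def)
  show "(\<lambda>\<omega>. \<Sum>j\<in>J. w j * g j (e + scaling h (\<Xi>' \<omega>) + snd (q j))) \<in> H"
   by (intro sum_in scale_in gi)
  fix \<omega>
  show "conv V k (s, e + scaling h (\<Xi>' \<omega>)) \<le> (\<Sum>j\<in>J. w j * g j (e + scaling h (\<Xi>' \<omega>) + snd (q j))) + \<zeta> / 2"
   using q1[of "e + scaling h (\<Xi>' \<omega>)"] unfolding Vg by linarith
 qed
 also have "E (\<lambda>\<omega>. \<Sum>j\<in>J. w j * g j (e + scaling h (\<Xi>' \<omega>) + snd (q j))) \<le>
   (\<Sum>j\<in>J. E (\<lambda>\<omega>. w j * g j (e + scaling h (\<Xi>' \<omega>) + snd (q j))))"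
  by (intro E_sum_le J(1) scale_in gi)
 also have "\<dots> = (\<Sum>j\<in>J. w j * V' ((s, e) + q j))"
  by (rule sum.cong[OF refl]) (use pos_hom[OF gi] J(2) Tg in simp)
 also have "\<dots> \<le> conv V' k (s, e) + \<zeta> / 2" using q2[of e] by linarith
 also have "conv V' k (s, e) = conv V k (s + h, e)"
  using conv_shift[OF ker vb, of "(h, 0)" "(s, e)"] by (simp add: V'_def[abs_def] V_def)
 finally show "T h (\<lambda>e. conv (sch h f) k (s, e)) e \<le> conv (sch h f) k (s + h, e) + \<zeta>" by (simp add: V_def)
qed

end

section \<open>Barriers and regularity of viscosity solutions\<close>

subsection \<open>Smooth barriers\<close>

context triplets
begin

lemma Gop_add_const:
 assumes f: "f \<in> Cb_inf UNIV"
 shows "Gop \<Theta> (\<lambda>p. f p + c) p = Gop \<Theta> f p"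
proof -
 have c: "\<bar>Gop \<Theta> (\<lambda>_. d) p\<bar> \<le> CL * 0" for d by (rule Gop_bound[OF deriv_bound_const]) simp
 note sm = Cb_inf_const[OF thick_UNIV]
 have "Gop \<Theta> (\<lambda>p. f p + c) p \<le> Gop \<Theta> f p + Gop \<Theta> (\<lambda>_. c) p" by (rule Gop_add_le[OF f sm])
 moreover have "Gop \<Theta> (\<lambda>p. (f p + c) + - c) p \<le> Gop \<Theta> (\<lambda>p. f p + c) p + Gop \<Theta> (\<lambda>_. - c) p"
  by (rule Gop_add_le[OF Cb_inf_add[OF thick_UNIV f sm] sm])
 ultimately show ?thesis using c[of c] c[of "- c"] by simp
qed

text \<open>An affine function of time absorbs the error in a differential inequality; it is unbounded on the
 whole space, but smooth on the cylinder.\<close>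

lemma add_affine_time:
 fixes f :: "real \<times> 'n space => real" and a c :: real
 assumes f: "f \<in> Cb_inf UNIV"
 defines "w \<equiv> \<lambda>q. f q + a * fst q + c"
 shows "w \<in> Cb_inf cyl" "continuous_on A w"
  "q \<in> cyl ==> partial_deriv cyl dt w q = partial_deriv UNIV dt f q + a"
  "Gop \<Theta> (\<lambda>e. w (t, e)) e = Gop \<Theta> (\<lambda>e. f (t, e)) e"
proof -
 have g: "(\<lambda>q. a * fst q + c) \<in> Cb_inf (cyl :: (real \<times> 'n space) set)"
  by (intro Cb_inf_add Cb_inf_cmult Cb_inf_const fst_smooth thick_cyl)
 note fc = Cb_inf_UNIV_restrict[OF thick_cyl f]
 have we: "w = (\<lambda>q. f q + (a * fst q + c))" by (simp add: w_def add.assoc)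
 show "w \<in> Cb_inf cyl" unfolding we by (rule Cb_inf_add[OF thick_cyl fc g])
 show "continuous_on A w" unfolding w_def
  by (intro continuous_intros continuous_on_subset[OF Cb_inf_cont[OF f]]) auto
 show "partial_deriv cyl dt w q = partial_deriv UNIV dt f q + a" if q: "q \<in> cyl"
 proof -
  have "has_partial cyl (\<lambda>q. a * fst q + c) (dt :: real \<times> 'n space) (\<lambda>_. a)"
   unfolding has_partial_def
  proof
   fix p :: "real \<times> 'n space"
   have "((\<lambda>s. a * (fst p + s) + c) has_real_derivative a) (at 0 within {s. p + s *\<^sub>R dt \<in> cyl})"
    by (auto intro!: derivative_eq_intros)
   then show "((\<lambda>s. a * fst (p + s *\<^sub>R dt) + c) has_vector_derivative a) (at 0 within {s. p + s *\<^sub>R dt \<in> cyl})"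
    by (simp add: dt_def has_real_derivative_iff_has_vector_derivative)
  qed
  from has_partial_unique[OF thick_cyl dt_Basis this q]
  have "partial_deriv cyl dt (\<lambda>q. a * fst q + c) q = a" .
  then show ?thesis
   using iter_partial_add[OF thick_cyl fc g, of "[dt]" q] q partial_deriv_restrict[OF thick_cyl f dt_Basis q]
   by (simp add: we)
 qed
 have "(\<lambda>e. w (t, e)) = (\<lambda>e. f (t, e) + (a * t + c))" by (simp add: w_def add.assoc)
 then show "Gop \<Theta> (\<lambda>e. w (t, e)) e = Gop \<Theta> (\<lambda>e. f (t, e)) e"
  using Gop_add_const[OF slice_smooth[OF f]] by simp
qed

end

lemma conv_depends:
 fixes v :: "real \<times> 'n::finite space => real"
 assumes k: "averaging \<epsilon> k" and v: "bounded_borel M v" and \<pi>: "\<pi> \<in> projs" and dep: "\<And>t. depends \<pi> (\<lambda>e. v (t, e))"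
 shows "depends \<pi> (\<lambda>e. conv v k (t, e))"
 unfolding depends_def
proof (intro allI impI)
 have le: "conv v k (t, p) \<le> conv v k (t, q)" if eq: "\<pi> p = \<pi> q" for p q
 proof (rule conv_mono_avg[OF k v v])
  fix \<sigma> :: real and e :: "'n space"
  have "\<pi> (p + e) = \<pi> (q + e)" unfolding projs_add[OF \<pi>] eq ..
  from dependsD[OF dep this] show "v (t + \<sigma>, p + e) \<le> v (t + \<sigma>, q + e)" by (rule eq_refl)
 qed
 fix p q :: "'n space" assume "\<pi> p = \<pi> q"
 from le[OF this] le[OF this[symmetric]] show "conv v k (t, p) = conv v k (t, q)" by (rule antisym)
qed

context driven
begin

lemma sch_depends: "\<pi> \<in> projs ==> depends \<pi> f ==> depends \<pi> (\<lambda>e. sch h f (t, e))"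
 by (simp add: sch_def Tk_depends)

text \<open>Consistency at time \<open>t - h\<close> and Jensen's inequality give a discrete version of the inequality. The
 derivatives of the mollification are bounded uniformly in \<open>h\<close>, so that passing to time \<open>t\<close> and to
 the time derivative costs only \<open>O(h)\<close>.\<close>

lemma mollified_scheme_super:
 fixes g :: "'n space => real"
 assumes g: "lipb M L g" and \<pi>: "\<pi> \<in> projs" "depends \<pi> g" and k: "averaging \<epsilon> k" and \<eta>: "0 < \<eta>"
 shows "\<forall>\<^sub>F h in at_right 0. \<forall>t e. h \<le> t -->
  Gop \<Theta> (\<lambda>e. conv (sch h g) k (t, e)) e \<le> partial_deriv UNIV dt (conv (sch h g) k) (t, e) + \<eta>"
proof -
 obtain C where C: "0 \<le> C" "\<And>v :: real \<times> 'n space => real. \<And>M. bounded_borel M v ==> deriv_bound 3 (C * M) (conv v k)"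
  "\<And>v :: real \<times> 'n space => real. \<And>M p. bounded_borel M v ==> \<bar>conv v k p\<bar> \<le> C * M"
  using conv_deriv_bound_exists[OF averaging_kernel[OF k]] by metis
 define B where "B = C * M"
 note vb = sch_borel[OF g]
 have B: "0 \<le> B" using C(1) bounded_borel_nonneg[OF vb[of 0]] by (simp add: B_def)
 have D: "0 \<le> B + CL * B" using B CL_nonneg by simp
 define \<delta> where "\<delta> = \<eta> / (2 * (B + CL * B + 1))"
 have \<delta>: "0 < \<delta>" using D \<eta> by (simp add: \<delta>_def)
 have \<delta>D: "(B + CL * B) * h \<le> \<eta> / 2" if h: "0 < h" "h < \<delta>" for h
  by (rule small_multiple[OF D]) (use h in \<open>simp_all add: \<delta>_def\<close>)
 have "\<eta> / 2 > 0" using \<eta> by simp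
 note cons = consistency[OF B this]
 have "\<forall>\<^sub>F h in at_right 0. 0 < h \<and> h < \<delta>" using eventually_at_right_less eventually_at_right_field \<delta> by blast
 with cons show ?thesis
 proof eventually_elim
  case (elim h)
  then have h: "0 < h" "h < \<delta>" and cons: "\<forall>(f :: 'n space => real) p. deriv_bound 3 B f --> (\<forall>p. \<bar>f p\<bar> \<le> B) -->
   (\<exists>\<pi>\<in>projs. depends \<pi> f) --> f p + h * Gop \<Theta> f p - h * (\<eta> / 2) \<le> T h f p" by blast+
  define W where "W = conv (sch h g) k"
  have W: "deriv_bound 3 B W" unfolding W_def B_def by (rule C(2)[OF vb])
  have Wb: "\<bar>W q\<bar> \<le> B" for q unfolding W_def B_def by (rule C(3)[OF vb])
  have W2: "deriv_bound 2 B W" by (rule deriv_bound_mono[OF W]) auto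
  show ?case
  proof (intro allI impI)
   fix t e assume t: "h \<le> t"
   define f where "f = (\<lambda>e. W (t - h, e))"
   have f: "deriv_bound 3 B f" unfolding f_def by (rule slice_deriv_bound[OF W])
   have "f e + h * Gop \<Theta> f e - h * (\<eta> / 2) \<le> T h f e"
   proof (rule cons[THEN spec, THEN spec, THEN mp, THEN mp, THEN mp])
    show "deriv_bound 3 B f" by (rule f)
    show "\<forall>p. \<bar>f p\<bar> \<le> B" unfolding f_def by (intro allI Wb)
    show "\<exists>\<pi>\<in>projs. depends \<pi> f"
     unfolding f_def W_def by (rule bexI[of _ \<pi>], rule conv_depends[OF k vb \<pi>(1) sch_depends[OF \<pi>]], rule \<pi>(1))
   qed
   also have "T h f e \<le> W (t, e)"
    using sch_jensen[OF g k h(1), of "t - h" e] t unfolding f_def W_def by simp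
   finally have 1: "h * Gop \<Theta> f e \<le> W (t, e) - W (t - h, e) + h * (\<eta> / 2)" by (simp add: f_def)
   have 2: "W (t, e) - W (t - h, e) \<le> h * partial_deriv UNIV dt W (t, e) + h * (B * h)"
    using time_Taylor[OF W2, of t h e] by (simp add: power2_eq_square abs_le_iff algebra_simps)
   have "h * Gop \<Theta> f e \<le> h * (partial_deriv UNIV dt W (t, e) + B * h + \<eta> / 2)"
    using 1 2 by (simp add: algebra_simps)
   then have 3: "Gop \<Theta> f e \<le> partial_deriv UNIV dt W (t, e) + B * h + \<eta> / 2" using h by simp
   have "Gop \<Theta> (\<lambda>e. f e + (W (t, e) - W (t - h, e))) e \<le> Gop \<Theta> f e + Gop \<Theta> (\<lambda>e. W (t, e) - W (t - h, e)) e"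
    by (rule Gop_add_le[OF deriv_bound_smooth[OF f] deriv_bound_smooth[OF slice_diff_bound[OF W]]])
   moreover have "\<bar>Gop \<Theta> (\<lambda>e. W (t, e) - W (t - h, e)) e\<bar> \<le> CL * (B * \<bar>h\<bar>)"
    by (rule Gop_bound[OF slice_diff_bound[OF W]])
   ultimately have "Gop \<Theta> (\<lambda>e. W (t, e)) e \<le> Gop \<Theta> f e + CL * B * h"
    using h by (simp add: f_def mult.assoc)
   then show "Gop \<Theta> (\<lambda>e. conv (sch h g) k (t, e)) e \<le> partial_deriv UNIV dt (conv (sch h g) k) (t, e) + \<eta>"
    using 3 \<delta>D[OF h] unfolding W_def[symmetric] by (simp add: algebra_simps)
  qed
 qed
qed

lemma rate_zero: "rate C 0 = 0"
 using alpha by (simp add: rate_def)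

text \<open>The barrier is the sum of the mollified iterates from the three cones, plus an affine
 function of time. At its vertex the growth is that of the iterates, i.e. \<open>rate\<close>, up to errors
 that vanish as the radius \<open>\<epsilon>\<close> of the mollification and then the step \<open>h\<close> tend to zero.\<close>

lemma barrier:
 fixes \<rho> :: "real \<times> 'n space => real"
 assumes \<rho>: "mollifier \<rho>" and CB: "0 \<le> C" "0 \<le> B" and t: "0 \<le> t0" "t0 < t1" "t1 \<le> 1" and \<eta>: "0 < \<eta>"
 shows "\<exists>w. w \<in> Cb_inf cyl \<and> continuous_on ({t0..1} \<times> UNIV) w \<and>
  (\<forall>t e. t0 < t --> t \<le> 1 --> Gop \<Theta> (\<lambda>e. w (t, e)) e \<le> partial_deriv cyl dt w (t, e)) \<and>
  (\<forall>e. c0 + (gx C B p0 e + gy C B p0 e + gz C B p0 e) \<le> w (t0, e)) \<and> w (t1, p0) \<le> c0 + rate C (t1 - t0) + \<eta>"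
proof -
 have close: "\<exists>d>0. \<forall>x. s \<le> x --> x < s + d --> rate C x \<le> rate C s + \<eta> / 8" if s: "0 \<le> s" for s
 proof -
  have "\<forall>\<^sub>F x in at s within {s..}. rate C x < rate C s + \<eta> / 8"
   using \<eta> by (intro order_tendstoD(2)[OF rate_tendsto[OF s]]) simp
  then obtain d where d: "0 < d" "\<And>x. x \<in> {s..} ==> x \<noteq> s ==> dist x s < d ==> rate C x < rate C s + \<eta> / 8"
   unfolding eventually_at by metis
  show ?thesis
  proof (intro exI[of _ d] conjI allI impI d(1))
   fix x assume "s \<le> x" "x < s + d"
   then show "rate C x \<le> rate C s + \<eta> / 8"
    using d(2)[of x] \<eta> by (cases "x = s") (auto simp: dist_real_def intro: less_imp_le)
  qed
 qed
 obtain d0 where d0: "0 < d0" "\<And>x. 0 \<le> x ==> x < d0 ==> rate C x \<le> \<eta> / 8"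
  using close[of 0] by (auto simp: rate_zero)
 obtain d1 where d1: "0 < d1" "\<And>x. t1 - t0 \<le> x ==> x < t1 - t0 + d1 ==> rate C x \<le> rate C (t1 - t0) + \<eta> / 8"
  using close[of "t1 - t0"] t by auto
 define \<epsilon> where "\<epsilon> = min (min (1 / 2) (\<eta> / (96 * (C + 1)))) (min (d0 / 4) (d1 / 4))"
 have \<epsilon>: "0 < \<epsilon>" using \<eta> CB d0 d1 by (simp add: \<epsilon>_def)
 have \<epsilon>2: "\<epsilon>\<^sup>2 \<le> \<epsilon>"
 proof -
  have "\<epsilon> \<le> 1" by (simp add: \<epsilon>_def min_le_iff_disj)
  then show ?thesis using \<epsilon> mult_left_mono[of \<epsilon> 1 \<epsilon>] by (simp add: power2_eq_square)
 qed
 have \<epsilon>C: "12 * (C * \<epsilon>) \<le> \<eta> / 8"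
 proof -
  have "C * \<epsilon> \<le> \<eta> / 96" by (rule small_multiple[OF CB(1)]) (use \<epsilon> in \<open>simp_all add: \<epsilon>_def\<close>)
  then show ?thesis by simp
 qed
 define k where "k = rescaled \<rho> \<epsilon>"
 have k: "averaging \<epsilon> k" unfolding k_def by (rule rescaled_averaging[OF \<rho> \<epsilon>])
 note ker = averaging_kernel[OF k]
 note gl = g_lipb[OF CB, of p0]
 define g where "g i = (if i = 0 then gx C B p0 else if i = 1 then gy C B p0 else gz C B p0)" for i :: nat
 have sum3: "(\<Sum>i<3. G i) = G 0 + G 1 + G 2" for G :: "nat => real"
  by (simp add: numeral_3_eq_3 numeral_2_eq_2)
 have gl: "lipb B C (g i)" for i using gl by (simp add: g_def)
 have gsum: "(\<Sum>i<3. g i e) = gx C B p0 e + gy C B p0 e + gz C B p0 e" for e by (simp add: sum3 g_def)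
 have gd: "\<exists>\<pi>\<in>projs. depends \<pi> (g i)" for i
 proof -
  have "depends fst (gx C B p0)" "depends (\<lambda>p. fst (snd p)) (gy C B p0)" "depends (\<lambda>p. snd (snd p)) (gz C B p0)"
   by (simp_all add: depends_def gx_def gy_def gz_def)
  then show ?thesis unfolding projs_def g_def by (cases "i = 0"; cases "i = 1") auto
 qed
 have e12: "0 < \<eta> / 12" using \<eta> by simp
 have ev: "\<forall>\<^sub>F h in at_right 0. \<forall>t e. h \<le> t -->
   Gop \<Theta> (\<lambda>e. conv (sch h (g i)) k (t, e)) e \<le> partial_deriv UNIV dt (conv (sch h (g i)) k) (t, e) + \<eta> / 12" for i
 proof -
  obtain \<pi> where "\<pi> \<in> projs" "depends \<pi> (g i)" using gd by blast
  then show ?thesis by (rule mollified_scheme_super[OF gl _ _ k e12])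
 qed
 have "\<forall>\<^sub>F h in at_right 0. 0 < h \<and> h < \<epsilon>\<^sup>2"
  using eventually_at_right_less[of 0] eventually_at_right_field[of _ "0::real"] \<epsilon> zero_less_power by blast
 with ev[of 0] ev[of 1] ev[of 2]
 have "\<forall>\<^sub>F h in at_right 0. 0 < h \<and> h < \<epsilon>\<^sup>2 \<and> (\<forall>i<3. \<forall>t e. h \<le> t -->
   Gop \<Theta> (\<lambda>e. conv (sch h (g i)) k (t, e)) e \<le> partial_deriv UNIV dt (conv (sch h (g i)) k) (t, e) + \<eta> / 12)"
 proof eventually_elim
  case (elim h)
  have "i = 0 \<or> i = 1 \<or> i = 2" if "i < 3" for i :: nat using that by linarith
  with elim show ?case by metis
 qed
 from eventually_happens'[OF trivial_limit_at_right_real this]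
 obtain h where h: "0 < h" "h < \<epsilon>\<^sup>2" and hs': "\<forall>i<3. \<forall>t e. h \<le> t -->
   Gop \<Theta> (\<lambda>e. conv (sch h (g i)) k (t, e)) e \<le> partial_deriv UNIV dt (conv (sch h (g i)) k) (t, e) + \<eta> / 12"
  by (elim exE conjE) (rule that)
 note hs = hs'[rule_format]
 define V where "V i = sch h (g i)" for i
 define W where "W i = conv (V i) k" for i
 have Vb: "bounded_borel B (V i)" for i unfolding V_def by (rule sch_borel[OF gl])
 have Wi: "W i \<in> Cb_inf UNIV" for i unfolding W_def by (rule conv_smooth[OF ker Vb])
 \<comment> \<open>The time is shifted such that the barrier starts with the iterates at time \<open>h\<close>, the first one
  with a past.\<close>
 define W' where "W' i q = W i (q + (h - t0, 0))" for i q
 have W'i: "W' i \<in> Cb_inf UNIV" for i unfolding W'_def by (rule Cb_inf_shift[OF Wi])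
 define F where "F q = (\<Sum>i<3. W' i q)" for q
 have Fs: "F = (\<lambda>q. W' 0 q + W' 1 q + W' 2 q)" unfolding F_def sum3 ..
 have W2: "(\<lambda>q. W' 0 q + W' 1 q) \<in> Cb_inf UNIV" by (intro Cb_inf_add thick_UNIV W'i)
 have F: "F \<in> Cb_inf UNIV" unfolding Fs by (intro Cb_inf_add thick_UNIV W'i)
 define s where "s = h + \<epsilon>\<^sup>2"
 have s: "0 \<le> s" "s < d0" "s < d1" using h \<epsilon> \<epsilon>2 d0 d1 by (auto simp: s_def \<epsilon>_def min_le_iff_disj)
 have rs: "rate C s \<le> \<eta> / 8" by (rule d0(2)[OF s(1,2)])
 \<comment> \<open>The constant lifts the mollified iterates at time \<open>h\<close> above the cones.\<close>
 define c where "c = c0 + 3 * (2 * C * \<epsilon> + rate C s) - \<eta> / 4 * t0"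
 define w where "w = (\<lambda>q. F q + \<eta> / 4 * fst q + c)"
 note w = add_affine_time[where a = "\<eta> / 4" and c = c, OF F, folded w_def]
 have w4: "Gop \<Theta> (\<lambda>e. w (t, e)) e = Gop \<Theta> (\<lambda>e. F (t, e)) e" for t e
  using w(4)[of t e] by (simp add: w_def)
 have Vnear: "\<bar>V i (r, e + e') - (T h ^^ nat \<lfloor>r / h\<rfloor>) (g i) e\<bar> \<le> 2 * C * \<epsilon>" if "norm e' < \<epsilon>" for i r e e'
 proof -
  have "\<bar>V i (r, e + e') - V i (r, e)\<bar> \<le> 2 * C * norm (e + e' - e)"
   unfolding V_def by (rule lipb_norm[OF sch_lipb[OF gl]])
  also have "\<dots> \<le> 2 * C * \<epsilon>" using that CB by (intro mult_left_mono) auto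
  finally show ?thesis by (simp add: V_def sch_def)
 qed
 have super: "Gop \<Theta> (\<lambda>e. w (t, e)) e \<le> partial_deriv cyl dt w (t, e)" if tt: "t0 < t" "t \<le> 1" for t e
 proof -
  have sm: "(\<lambda>e. f (t, e)) \<in> Cb_inf UNIV" if "f \<in> Cb_inf UNIV" for f :: "real \<times> 'n space => real"
   by (rule slice_smooth[OF that]) simp
  have W'e: "Gop \<Theta> (\<lambda>e. W' i (t, e)) e \<le> partial_deriv UNIV dt (W' i) (t, e) + \<eta> / 12" if "i < 3" for i
   using hs[OF that, of "t + (h - t0)" e] tt
   by (simp add: W'_def[abs_def] W_def V_def partial_deriv_shift)
  have "Gop \<Theta> (\<lambda>e. w (t, e)) e = Gop \<Theta> (\<lambda>e. W' 0 (t, e) + W' 1 (t, e) + W' 2 (t, e)) e"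
   unfolding w4 Fs ..
  also have "\<dots> \<le> Gop \<Theta> (\<lambda>e. W' 0 (t, e) + W' 1 (t, e)) e + Gop \<Theta> (\<lambda>e. W' 2 (t, e)) e"
   by (rule Gop_add_le[OF sm[OF W2] sm[OF W'i]])
  also have "Gop \<Theta> (\<lambda>e. W' 0 (t, e) + W' 1 (t, e)) e \<le> Gop \<Theta> (\<lambda>e. W' 0 (t, e)) e + Gop \<Theta> (\<lambda>e. W' 1 (t, e)) e"
   by (rule Gop_add_le[OF sm[OF W'i] sm[OF W'i]])
  finally have "Gop \<Theta> (\<lambda>e. w (t, e)) e \<le> partial_deriv UNIV dt (W' 0) (t, e) + partial_deriv UNIV dt (W' 1) (t, e)
    + partial_deriv UNIV dt (W' 2) (t, e) + \<eta> / 4"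
   using W'e[of 0] W'e[of 1] W'e[of 2] by simp
  also have "\<dots> = partial_deriv UNIV dt F (t, e) + \<eta> / 4"
   unfolding Fs partial_linear(1)[OF W2 W'i dt_Basis] partial_linear(1)[OF W'i W'i dt_Basis] ..
  also have "\<dots> = partial_deriv cyl dt w (t, e)"
   by (rule w(3)[symmetric]) (use tt t in \<open>auto simp: cyl_def\<close>)
  finally show ?thesis .
 qed
 have init: "c0 + (gx C B p0 e + gy C B p0 e + gz C B p0 e) \<le> w (t0, e)" for e
 proof -
  have "g i e - 2 * C * \<epsilon> - rate C s \<le> W' i (t0, e)" for i
  proof -
   have "g i e - 2 * C * \<epsilon> - rate C s \<le> conv (V i) k (h, e)"
   proof (rule conv_ge_avg[OF k Vb])
    fix \<sigma> :: real and e' :: "'n space" assume \<sigma>: "0 \<le> \<sigma>" "\<sigma> \<le> \<epsilon>\<^sup>2" "norm e' < \<epsilon>"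
    define j where "j = nat \<lfloor>(h + \<sigma>) / h\<rfloor>"
    have "real j * h \<le> h + \<sigma>" unfolding j_def using h \<sigma> by (intro sch_steps) auto
    also have "\<dots> \<le> s" using \<sigma> by (simp add: s_def)
    finally have "rate C (real j * h) \<le> rate C s" using h CB by (intro rate_mono) auto
    moreover have "\<bar>(T h ^^ j) (g i) e - g i e\<bar> \<le> rate C (real j * h)" using h by (intro Tk_growth[OF gl]) simp
    ultimately show "g i e - 2 * C * \<epsilon> - rate C s \<le> V i (h + \<sigma>, e + e')"
     using Vnear[OF \<sigma>(3), of i "h + \<sigma>" e] by (simp add: j_def)
   qed
   then show ?thesis by (simp add: W'_def W_def)
  qed
  from this[of 0] this[of 1] this[of 2] show ?thesis
   using gsum[of e] by (simp add: w_def Fs c_def sum3)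
 qed
 have "w (t1, p0) \<le> c0 + rate C (t1 - t0) + \<eta>"
 proof -
  define r where "r = t1 + (h - t0)"
  have V2: "bounded_borel (B + B) (\<lambda>q. V 0 q + V 1 q)" by (rule bounded_borel_add(1)[OF Vb Vb])
  have V3: "bounded_borel (B + B + B) (\<lambda>q. V 0 q + V 1 q + V 2 q)" by (rule bounded_borel_add(1)[OF V2 Vb])
  have "F (t1, p0) = conv (\<lambda>q. V 0 q + V 1 q + V 2 q) k (r, p0)"
   unfolding conv_linear(1)[OF ker V2 Vb] conv_linear(1)[OF ker Vb Vb]
   by (simp add: Fs W'_def W_def r_def)
  also have "\<dots> \<le> rate C (t1 - t0) + \<eta> / 8 + 6 * C * \<epsilon>"
  proof (rule conv_le_avg[OF k V3])
   fix \<sigma> :: real and e' :: "'n space" assume \<sigma>: "0 \<le> \<sigma>" "\<sigma> \<le> \<epsilon>\<^sup>2" "norm e' < \<epsilon>"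
   define j where "j = nat \<lfloor>(r + \<sigma>) / h\<rfloor>"
   have "real j * h \<le> r + \<sigma>" unfolding j_def using h \<sigma> t by (intro sch_steps) (auto simp: r_def)
   also have "\<dots> \<le> t1 - t0 + s" using \<sigma> by (simp add: r_def s_def)
   finally have "rate C (real j * h) \<le> rate C (t1 - t0 + s)" using h CB by (intro rate_mono) auto
   moreover have "rate C (t1 - t0 + s) \<le> rate C (t1 - t0) + \<eta> / 8" by (rule d1(2)) (use s in auto)
   moreover have "(T h ^^ j) (g 0) p0 + (T h ^^ j) (g 1) p0 + (T h ^^ j) (g 2) p0 \<le> rate C (real j * h)"
    using blocks_sum[of h C B j p0] h CB by (simp add: g_def)
   ultimately show "V 0 (r + \<sigma>, p0 + e') + V 1 (r + \<sigma>, p0 + e') + V 2 (r + \<sigma>, p0 + e')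
     \<le> rate C (t1 - t0) + \<eta> / 8 + 6 * C * \<epsilon>"
    using Vnear[OF \<sigma>(3), of 0 "r + \<sigma>" p0] Vnear[OF \<sigma>(3), of 1 "r + \<sigma>" p0] Vnear[OF \<sigma>(3), of 2 "r + \<sigma>" p0]
    unfolding j_def[symmetric] by linarith
  qed
  finally have "w (t1, p0) \<le> rate C (t1 - t0) + \<eta> / 8 + 12 * (C * \<epsilon>) + 3 * rate C s + c0 + \<eta> / 4 * (t1 - t0)"
   by (simp add: w_def c_def algebra_simps diff_divide_distrib)
  moreover have "\<eta> / 4 * (t1 - t0) \<le> \<eta> / 4 * 1" using t \<eta> by (intro mult_left_mono) auto
  ultimately show ?thesis using rs \<epsilon>C \<eta> by linarith
 qed
 with w(1,2) super init show ?thesis by blast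
qed

subsection \<open>Regularity in time\<close>

text \<open>A barrier with its vertex at \<open>p0\<close> lies above \<open>f\<close>, hence above \<open>u\<close>, at the initial time.\<close>

lemma sub_growth:
 fixes u \<rho> :: "real \<times> 'n space => real"
 assumes \<rho>: "mollifier \<rho>" and u: "continuous_on strip u" "bounded (u ` strip)" "sub_test \<Theta> u"
  and t: "0 \<le> t0" "t0 \<le> t1" "t1 \<le> 1" and f: "lipb M C f" and init: "\<And>e. u (t0, e) \<le> f e"
 shows "u (t1, p0) \<le> f p0 + rate C (t1 - t0)"
proof (cases "t0 = t1")
 case True then show ?thesis using init[of p0] by (simp add: rate_zero)
next
 case False
 then have t': "t0 < t1" using t by simp
 have CM: "0 \<le> C" "0 \<le> 2 * M" using lipbD(3)[OF f] lipbD(1)[OF f, of p0] by auto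
 show ?thesis
 proof (rule field_le_epsilon)
  fix \<eta> :: real assume "0 < \<eta>"
  from barrier[OF \<rho> CM t(1) t' t(3) this, of "f p0" p0]
  obtain w where w: "w \<in> Cb_inf cyl" "continuous_on ({t0..1} \<times> UNIV) w"
   "\<And>t e. t0 < t ==> t \<le> 1 ==> Gop \<Theta> (\<lambda>e. w (t, e)) e \<le> partial_deriv cyl dt w (t, e)"
   "\<And>e. f p0 + (gx C (2 * M) p0 e + gy C (2 * M) p0 e + gz C (2 * M) p0 e) \<le> w (t0, e)"
   "w (t1, p0) \<le> f p0 + rate C (t1 - t0) + \<eta>" by metis
  have "u (t1, p0) \<le> w (t1, p0)"
  proof (rule comparison_sub[OF \<rho> u w(1,2) _ t(1) t' t(3)])
   show "u (t0, e) \<le> w (t0, e)" for e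
    using init[of e] g_dominates(1)[OF f, of e p0] w(4)[of e] by linarith
  qed (use w(3) t t' in auto)
  then show "u (t1, p0) \<le> f p0 + rate C (t1 - t0) + \<eta>" using w(5) by linarith
 qed
qed

text \<open>The negative of a barrier is a subsolution, since \<open>- G f \<le> G (- f)\<close>.\<close>

lemma super_growth:
 fixes u \<rho> :: "real \<times> 'n space => real"
 assumes \<rho>: "mollifier \<rho>" and u: "continuous_on strip u" "bounded (u ` strip)" "super_test \<Theta> u"
  and t: "0 \<le> t0" "t0 \<le> t1" "t1 \<le> 1" and f: "lipb M C f" and init: "\<And>e. f e \<le> u (t0, e)"
 shows "f p0 - rate C (t1 - t0) \<le> u (t1, p0)"
proof (cases "t0 = t1")
 case True then show ?thesis using init[of p0] by (simp add: rate_zero)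
next
 case False
 then have t': "t0 < t1" using t by simp
 have CM: "0 \<le> C" "0 \<le> 2 * M" using lipbD(3)[OF f] lipbD(1)[OF f, of p0] by auto
 have "f p0 - rate C (t1 - t0) \<le> u (t1, p0) + \<eta>" if "0 < \<eta>" for \<eta>
 proof -
  from barrier[OF \<rho> CM t(1) t' t(3) that, of "- f p0" p0]
  obtain w where w: "w \<in> Cb_inf cyl" "continuous_on ({t0..1} \<times> UNIV) w"
   "\<And>t e. t0 < t ==> t \<le> 1 ==> Gop \<Theta> (\<lambda>e. w (t, e)) e \<le> partial_deriv cyl dt w (t, e)"
   "\<And>e. - f p0 + (gx C (2 * M) p0 e + gy C (2 * M) p0 e + gz C (2 * M) p0 e) \<le> w (t0, e)"
   "w (t1, p0) \<le> - f p0 + rate C (t1 - t0) + \<eta>" by metis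
  define w' where "w' q = - w q" for q
  have "w' (t1, p0) \<le> u (t1, p0)"
  proof (rule comparison_super[OF \<rho> u _ _ _ t(1) t' t(3)])
   show "w' \<in> Cb_inf cyl" unfolding w'_def by (rule Cb_inf_uminus[OF thick_cyl w(1)])
   show "continuous_on ({t0..1} \<times> UNIV) w'" unfolding w'_def by (intro continuous_intros w(2))
   show "w' (t0, e) \<le> u (t0, e)" for e
    using init[of e] g_dominates(2)[OF f, of p0 e] w(4)[of e] by (simp add: w'_def)
   fix t e assume tt: "t0 < t" "t < t1"
   have c: "(t, e) \<in> cyl" for e :: "'n space" using tt t by (auto simp: cyl_def)
   have "partial_deriv cyl dt w' (t, e) = - partial_deriv cyl dt w (t, e)"
    using iter_partial_cmult[OF thick_cyl w(1), of "[dt]" "(t, e)" "- 1"] c by (simp add: w'_def[abs_def])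
   also have "\<dots> \<le> - Gop \<Theta> (\<lambda>e. w (t, e)) e" using w(3)[of t e] tt t by simp
   also have "\<dots> \<le> Gop \<Theta> (\<lambda>e. w' (t, e)) e"
    unfolding w'_def by (rule Gop_neg[OF slice_smooth[OF w(1) c]])
   finally show "partial_deriv cyl dt w' (t, e) \<le> Gop \<Theta> (\<lambda>e. w' (t, e)) e" .
  qed (use t t' in auto)
  then show ?thesis using w(5) by (simp add: w'_def)
 qed
 then show ?thesis by (rule field_le_epsilon)
qed

end

subsection \<open>Translation invariance of the equation\<close>

lemma cyl_shift [simp]: "q + (0, a) \<in> cyl \<longleftrightarrow> (q :: real \<times> 'n::finite space) \<in> cyl"
 by (cases q) (simp add: cyl_def)

lemma partial_deriv_shift_add:
 fixes f :: "'a::euclidean_space => real"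
 assumes "\<And>q. q + a \<in> S \<longleftrightarrow> q \<in> S"
 shows "partial_deriv S v (\<lambda>q. f (q + a) + c) p = partial_deriv S v f (p + a)"
proof -
 have e: "p + s *\<^sub>R v + a = p + a + s *\<^sub>R v" for s by (simp add: add_ac)
 have "p + s *\<^sub>R v \<in> S \<longleftrightarrow> p + a + s *\<^sub>R v \<in> S" for s using assms[of "p + s *\<^sub>R v"] unfolding e by simp
 then show ?thesis
  unfolding partial_deriv_def e vector_derivative_def has_vector_derivative_add_const by simp
qed

lemma iter_partial_shift_add:
 fixes f :: "'a::euclidean_space => real"
 assumes S: "\<And>q. q + a \<in> S \<longleftrightarrow> q \<in> S"
 shows "iter_partial S vs (\<lambda>q. f (q + a) + c) = (\<lambda>q. iter_partial S vs f (q + a) + (if vs = [] then c else 0))"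
proof (induction vs)
 case (Cons v vs)
 show ?case unfolding iter_partial.simps Cons.IH partial_deriv_shift_add[OF S] by simp
qed simp

lemma Cb23_shift_add:
 assumes f: "f \<in> Cb23"
 shows "(\<lambda>q. f (q + (0, a)) + c) \<in> (Cb23 :: (real \<times> 'n::finite space => real) set)"
proof -
 define A where "A = {vs. set vs \<subseteq> (Basis :: (real \<times> 'n space) set) \<and>
   length (filter (\<lambda>v. v = dt) vs) \<le> 2 \<and> length (filter (\<lambda>v. v \<noteq> dt) vs) \<le> 3}"
 note it = iter_partial_shift_add[OF cyl_shift, of _ f a c]
 have c: "continuous_on cyl (iter_partial cyl vs f)" and b: "bounded (iter_partial cyl vs f ` cyl)" if "vs \<in> A" for vs
  using f that unfolding Cb23_def A_def[symmetric] Cb_diff_def cont_diff_def by blast+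
 have d: "(\<lambda>s. iter_partial cyl vs f (p + s *\<^sub>R v)) differentiable (at 0 within {s. p + s *\<^sub>R v \<in> cyl})"
  if "v # vs \<in> A" "p \<in> cyl" for v vs p
  using f that unfolding Cb23_def A_def[symmetric] Cb_diff_def cont_diff_def by blast
 show ?thesis
  unfolding Cb23_def A_def[symmetric] Cb_diff_def cont_diff_def mem_Collect_eq it
 proof (intro conjI ballI allI impI)
  fix vs assume vs: "vs \<in> A"
  show "continuous_on cyl (\<lambda>q. iter_partial cyl vs f (q + (0, a)) + (if vs = [] then c else 0))"
   by (intro continuous_intros continuous_on_compose2[OF c[OF vs]] image_subsetI) (simp only: cyl_shift)
  obtain B where B: "\<And>q. q \<in> cyl ==> \<bar>iter_partial cyl vs f q\<bar> \<le> B"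
   using b[OF vs] unfolding bounded_iff by fastforce
  show "bounded ((\<lambda>q. iter_partial cyl vs f (q + (0, a)) + (if vs = [] then c else 0)) ` cyl)"
   unfolding bounded_iff
  proof (intro exI ballI)
   fix y assume "y \<in> (\<lambda>q. iter_partial cyl vs f (q + (0, a)) + (if vs = [] then c else 0)) ` cyl"
   then obtain q where q: "q \<in> cyl" "y = iter_partial cyl vs f (q + (0, a)) + (if vs = [] then c else 0)" by blast
   have "\<bar>iter_partial cyl vs f (q + (0, a))\<bar> \<le> B" by (rule B) (simp only: cyl_shift q)
   then show "norm y \<le> B + \<bar>c\<bar>" unfolding q(2) by (auto simp del: iter_partial.simps)
  qed
 next
  fix v vs p assume vs: "v # vs \<in> A" and p: "p \<in> (cyl :: (real \<times> 'n space) set)"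
  have e: "p + s *\<^sub>R v + (0, a) = p + (0, a) + s *\<^sub>R v" for s by (simp add: add_ac)
  have "p + (0, a) \<in> cyl" using p by (simp only: cyl_shift)
  from d[OF vs this]
  have "(\<lambda>s. iter_partial cyl vs f (p + s *\<^sub>R v + (0, a)) + (if vs = [] then c else 0))
    differentiable (at 0 within {s. p + s *\<^sub>R v + (0, a) \<in> cyl})"
   unfolding e by (intro differentiable_add differentiable_const)
  then show "(\<lambda>s. iter_partial cyl vs f (p + s *\<^sub>R v + (0, a)) + (if vs = [] then c else 0))
    differentiable (at 0 within {s. p + s *\<^sub>R v \<in> cyl})"
   unfolding cyl_shift .
 qed
qed

lemma G_add_const: "G \<Theta> p A (\<lambda>l. f l + c) = G \<Theta> p A f"
proof -
 have "gradient (\<lambda>l. f l + c) z = gradient f z" for z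
  using partial_deriv_shift_add[of 0 UNIV _ f c z] by (simp add: gradient_def)
 then show ?thesis by (simp add: G_def increment_def)
qed

lemma pide_op_shift_add: "pide_op \<Theta> (\<lambda>q. f (q + (0, a)) + c) p = pide_op \<Theta> f (p + (0, a))"
proof -
 obtain t x y z where p: "p = (t, x, y, z)" by (cases p)
 obtain a1 a2 a3 where a: "a = (a1, a2, a3)" by (cases a)
 have it: "iter_partial cyl [dx i, dx j] (\<lambda>q. f (q + (0, a)) + c) p =
   iter_partial cyl [dx i, dx j] f (p + (0, a))" for i j
  using iter_partial_shift_add[OF cyl_shift, of "[dx i, dx j]" f a c] by simp
 have pd: "partial_deriv cyl v (\<lambda>q. f (q + (0, a)) + c) p = partial_deriv cyl v f (p + (0, a))" for v
  by (rule partial_deriv_shift_add[OF cyl_shift])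
 have l: "(\<lambda>l. f ((t, x, y, z + l) + (0, a)) + c) = (\<lambda>l. f (t, x + a1, y + a2, z + a3 + l) + c)"
  by (simp add: a add_ac)
 have pa: "p + (0, a) = (t, x + a1, y + a2, z + a3)" by (simp add: p a)
 show ?thesis
  unfolding pa using it pd unfolding pa unfolding p pide_op.simps l G_add_const by simp
qed

text \<open>Where a test function touches the infimum from below, its translate touches the translate of \<open>u\<close>
 that attains the infimum.\<close>

lemma super_test_inf_translates:
 fixes u v :: "real \<times> 'n::finite space => real"
 assumes u: "super_test \<Theta> u" and le: "\<And>t e d. 0 < t ==> t \<le> 1 ==> v (t, e) \<le> u (t, e + d) + k d"
  and att: "\<And>t e. 0 < t ==> t \<le> 1 ==> \<exists>d. v (t, e) = u (t, e + d) + k d"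
 shows "super_test \<Theta> v"
 unfolding super_test_def
proof (intro ballI impI)
 fix p \<psi> assume p: "p \<in> cyl" and \<psi>: "\<psi> \<in> Cb23" and touch: "(\<forall>q\<in>cyl. \<psi> q \<le> v q) \<and> \<psi> p = v p"
 obtain t e where te: "p = (t, e)" "0 < t" "t \<le> 1" using p by (auto simp: cyl_def)
 obtain d where d: "v (t, e) = u (t, e + d) + k d" using att[OF te(2,3)] by blast
 define \<psi>' where "\<psi>' = (\<lambda>q. \<psi> (q + (0, - d)) + - k d)"
 have "\<psi>' \<in> Cb23" unfolding \<psi>'_def by (rule Cb23_shift_add[OF \<psi>])
 moreover have "(t, e + d) \<in> cyl" using te by (simp add: cyl_def)
 moreover have "\<psi>' q \<le> u q" if q: "q \<in> cyl" for q
 proof -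
  obtain s e' where s: "q = (s, e')" "0 < s" "s \<le> 1" using q by (auto simp: cyl_def)
  have "q + (0, - d) \<in> cyl" using q by (simp only: cyl_shift)
  then have "\<psi> (q + (0, - d)) \<le> v (q + (0, - d))" using touch by blast
  also have "v (q + (0, - d)) = v (s, e' - d)" by (simp add: s)
  also have "\<dots> \<le> u (s, e' - d + d) + k d" by (rule le[OF s(2,3)])
  finally show ?thesis by (simp add: \<psi>'_def s)
 qed
 moreover have "\<psi>' (t, e + d) = u (t, e + d)"
 proof -
  have "(t, e + d) + (0, - d) = p" by (simp add: te)
  then show ?thesis using touch d by (simp add: \<psi>'_def te)
 qed
 ultimately have "0 \<le> pide_op \<Theta> \<psi>' (t, e + d)" using u unfolding super_test_def by blast
 also have "pide_op \<Theta> \<psi>' (t, e + d) = pide_op \<Theta> \<psi> ((t, e + d) + (0, - d))"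
  unfolding \<psi>'_def by (rule pide_op_shift_add)
 also have "(t, e + d) + (0, - d) = p" by (simp add: te)
 finally show "0 \<le> pide_op \<Theta> \<psi> p" .
qed

subsection \<open>Inf-convolution\<close>

definition inf_conv :: "real => (real \<times> 'n::finite space => real) => real \<times> 'n space => real" where
 "inf_conv K u = (\<lambda>(t, e). INF d. u (t, e + d) + K * snorm d)"

lemma snorm_cont [continuous_intros]: "continuous_on S g ==> continuous_on S (\<lambda>x. snorm (g x))"
 unfolding snorm_def by (intro continuous_intros)

text \<open>Outside the ball of radius \<open>2 * M / K\<close> the penalty exceeds the oscillation of \<open>u\<close>. Hence the
 infimum is attained in the ball, and the uniform continuity of \<open>u\<close> on compact sets gives continuity.\<close>

lemma inf_conv_props:
 fixes u :: "real \<times> 'n::finite space => real"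
 assumes u: "continuous_on strip u" and M: "\<forall>q\<in>strip. \<bar>u q\<bar> \<le> M" and K: "0 < K"
 shows "0 \<le> t ==> t \<le> 1 ==> inf_conv K u (t, e) \<le> u (t, e + d) + K * snorm d"
  "0 \<le> t ==> t \<le> 1 ==> \<exists>d. norm d \<le> 2 * M / K \<and> inf_conv K u (t, e) = u (t, e + d) + K * snorm d"
  "q \<in> strip ==> \<bar>inf_conv K u q\<bar> \<le> M"
  "0 \<le> t ==> t \<le> 1 ==> \<bar>inf_conv K u (t, e) - inf_conv K u (t, e')\<bar> \<le> K * snorm (e - e')"
  "continuous_on strip (inf_conv K u)"
proof -
 define R where "R = 2 * M / K"
 have Mt: "\<bar>u (t, e)\<bar> \<le> M" if "0 \<le> t" "t \<le> 1" for t e using M[THEN bspec, of "(t, e)"] that by simp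
 have "0 \<le> M" using Mt[of 0 0] by simp
 then have R: "0 \<le> R" "R * K = 2 * M" using K by (simp_all add: R_def)
 have ex: "\<exists>d. norm d \<le> R \<and> (\<forall>d'. u (t, e + d) + K * snorm d \<le> u (t, e + d') + K * snorm d')"
  if t: "0 \<le> t" "t \<le> 1" for t e
 proof -
  have "continuous_on (cball 0 R) (\<lambda>d. u (t, e + d) + K * snorm d)"
   by (intro continuous_intros continuous_on_compose2[OF u]) (use t in auto)
  from continuous_attains_inf[OF compact_cball _ this]
  obtain d where d: "norm d \<le> R" "\<And>d'. norm d' \<le> R ==> u (t, e + d) + K * snorm d \<le> u (t, e + d') + K * snorm d'"
   using R(1) by (metis cball_eq_empty mem_cball_0 not_less)
  have "u (t, e + d) + K * snorm d \<le> u (t, e + d') + K * snorm d'" for d'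
  proof (cases "norm d' \<le> R")
   case False
   have "2 * M \<le> K * norm d'" using False R K by (metis less_eq_real_def mult.commute mult_left_mono not_le)
   also have "\<dots> \<le> K * snorm d'" using K norm_le_snorm[of d'] by simp
   finally have "u (t, e) \<le> u (t, e + d') + K * snorm d'" using Mt[OF t, of e] Mt[OF t, of "e + d'"] by linarith
   moreover have "u (t, e + d) + K * snorm d \<le> u (t, e)"
    using d(2)[of 0] R unfolding add.right_neutral by (simp add: snorm_def)
   ultimately show ?thesis by linarith
  qed (use d in blast)
  then show ?thesis using d(1) by blast
 qed
 have val: "\<exists>d. norm d \<le> R \<and> inf_conv K u (t, e) = u (t, e + d) + K * snorm d \<and>
   (\<forall>d'. inf_conv K u (t, e) \<le> u (t, e + d') + K * snorm d')" if t: "0 \<le> t" "t \<le> 1" for t e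
 proof -
  obtain d where d: "norm d \<le> R" "\<And>d'. u (t, e + d) + K * snorm d \<le> u (t, e + d') + K * snorm d'" using ex[OF t] by blast
  have "inf_conv K u (t, e) = u (t, e + d) + K * snorm d"
   unfolding inf_conv_def case_prod_conv by (rule cInf_eq_minimum) (use d in auto)
  then show ?thesis using d by metis
 qed
 show le: "inf_conv K u (t, e) \<le> u (t, e + d) + K * snorm d" if "0 \<le> t" "t \<le> 1" for t e d
  using val[OF that] by blast
 show att: "\<exists>d. norm d \<le> 2 * M / K \<and> inf_conv K u (t, e) = u (t, e + d) + K * snorm d" if "0 \<le> t" "t \<le> 1" for t e
  using val[OF that] unfolding R_def by blast
 show bd: "\<bar>inf_conv K u q\<bar> \<le> M" if "q \<in> strip" for q
 proof -
  obtain t e where q: "q = (t, e)" "0 \<le> t" "t \<le> 1" using \<open>q \<in> strip\<close> by (cases q) auto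
  obtain d where d: "inf_conv K u (t, e) = u (t, e + d) + K * snorm d" using att[OF q(2,3)] by blast
  have "0 \<le> K * snorm d" using K by simp
  then have "- M \<le> inf_conv K u (t, e)" using d Mt[OF q(2,3), of "e + d"] by linarith
  moreover have "inf_conv K u (t, e) \<le> M"
   using le[OF q(2,3), of e 0] Mt[OF q(2,3), of e] unfolding add.right_neutral by (simp add: snorm_def)
  ultimately show ?thesis by (simp add: q)
 qed
 have lip1: "inf_conv K u (t, e) \<le> inf_conv K u (t, e') + K * snorm (e - e')" if t: "0 \<le> t" "t \<le> 1" for t e e'
 proof -
  obtain d where d: "inf_conv K u (t, e') = u (t, e' + d) + K * snorm d" using att[OF t] by blast
  have "snorm (e' - e + d) \<le> snorm (e - e') + snorm d"
   using snorm_triangle[of "e' - e" d] snorm_minus[of "e - e'"] by simp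
  then have "K * snorm (e' - e + d) \<le> K * snorm (e - e') + K * snorm d"
   using K by (simp flip: distrib_left)
  moreover have "e + (e' - e + d) = e' + d" by (simp add: algebra_simps)
  ultimately show ?thesis using le[OF t, of e "e' - e + d"] d by simp
 qed
 show lip: "\<bar>inf_conv K u (t, e) - inf_conv K u (t, e')\<bar> \<le> K * snorm (e - e')" if t: "0 \<le> t" "t \<le> 1" for t e e'
  using lip1[OF t, of e e'] lip1[OF t, of e' e] snorm_minus[of "e - e'"] by simp
 show "continuous_on strip (inf_conv K u)"
  unfolding continuous_on_iff
 proof (intro ballI allI impI)
  fix q :: "real \<times> 'n space" and \<eta> :: real assume q: "q \<in> strip" and \<eta>: "0 < \<eta>"
  obtain t e where te: "q = (t, e)" "0 \<le> t" "t \<le> 1" using q by (cases q) auto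
  have "compact ({0..1 :: real} \<times> cball e R)" by (intro compact_Times compact_cball compact_Icc)
  moreover have "continuous_on ({0..1} \<times> cball e R) u" by (rule continuous_on_subset[OF u]) auto
  ultimately have uc: "uniformly_continuous_on ({0..1} \<times> cball e R) u" by (intro compact_uniformly_continuous)
  have "0 < \<eta> / 2" using \<eta> by simp
  with uc obtain \<delta> where \<delta>: "0 < \<delta>" "\<And>a b. a \<in> {0..1} \<times> cball e R ==> b \<in> {0..1} \<times> cball e R ==>
   dist b a < \<delta> ==> dist (u b) (u a) < \<eta> / 2" unfolding uniformly_continuous_on_def by metis
  have time: "inf_conv K u (s, e) \<le> inf_conv K u (r, e) + \<eta> / 2"
   if s: "0 \<le> s" "s \<le> 1" and r: "0 \<le> r" "r \<le> 1" and "\<bar>s - r\<bar> < \<delta>" for s r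
  proof -
   obtain d where d: "norm d \<le> R" "inf_conv K u (r, e) = u (r, e + d) + K * snorm d"
    using att[OF r] unfolding R_def[symmetric] by blast
   have "dist (u (s, e + d)) (u (r, e + d)) < \<eta> / 2"
    by (rule \<delta>(2)) (use s r d that(5) in \<open>auto simp: dist_Pair_Pair dist_norm\<close>)
   then show ?thesis using le[OF s, of e d] d(2) unfolding dist_real_def by linarith
  qed
  show "\<exists>d>0. \<forall>q'\<in>strip. dist q' q < d --> dist (inf_conv K u q') (inf_conv K u q) < \<eta>"
  proof (intro exI[of _ "min \<delta> (\<eta> / (4 * K))"] conjI ballI impI)
   show "0 < min \<delta> (\<eta> / (4 * K))" using \<delta> \<eta> K by simp
   fix q' :: "real \<times> 'n space" assume q': "q' \<in> strip" and dq: "dist q' q < min \<delta> (\<eta> / (4 * K))"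
   obtain t' e' where te': "q' = (t', e')" "0 \<le> t'" "t' \<le> 1" using q' by (cases q') auto
   have "\<bar>t' - t\<bar> \<le> dist q' q" using dist_fst_le[of q' q] by (simp add: te te' dist_real_def)
   then have dt1: "\<bar>t' - t\<bar> < \<delta>" "\<bar>t - t'\<bar> < \<delta>" using dq by auto
   have "norm (e' - e) \<le> dist q' q" using dist_snd_le[of q' q] by (simp add: te te' dist_norm)
   then have "norm (e' - e) < \<eta> / (4 * K)" using dq by simp
   then have "K * (2 * norm (e' - e)) < \<eta> / 2" using K by (simp add: pos_less_divide_eq algebra_simps)
   moreover have "K * snorm (e' - e) \<le> K * (2 * norm (e' - e))" using K snorm_le[of "e' - e"] by simp
   ultimately have "\<bar>inf_conv K u (t', e') - inf_conv K u (t', e)\<bar> < \<eta> / 2" using lip[OF te'(2,3), of e' e] by linarith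
   then show "dist (inf_conv K u q') (inf_conv K u q) < \<eta>"
    using time[OF te'(2,3) te(2,3) dt1(1)] time[OF te(2,3) te'(2,3) dt1(2)]
    unfolding te(1) te'(1) dist_real_def by linarith
  qed
 qed
qed

subsection \<open>Regularity of viscosity solutions\<close>

context driven
begin

text \<open>The inf-convolution \<open>v\<close> is a supersolution with initial values close to \<open>f\<close>, because \<open>K\<close> exceeds the
 Lipschitz constant of \<open>f\<close>. Comparison of \<open>u\<close> with the mollification of \<open>v\<close>, which is possible
 as \<open>v\<close> is Lipschitz, gives the claim when the radius tends to zero.\<close>

lemma le_inf_conv:
 fixes u \<rho> :: "real \<times> 'n space => real"
 assumes \<rho>: "mollifier \<rho>" and u: "continuous_on strip u" "bounded (u ` strip)" "sub_test \<Theta> u" "super_test \<Theta> u"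
  and f: "lipb M C f" and u0: "\<And>e. u (0, e) = f e" and K: "C < K" and t: "0 \<le> t" "t \<le> 1"
 shows "u (t, e) \<le> inf_conv K u (t, e)"
proof -
 have C: "0 \<le> C" by (rule lipbD(3)[OF f])
 then have K0: "0 < K" using K by simp
 obtain N where N: "\<forall>q\<in>strip. \<bar>u q\<bar> \<le> N" using strip_bounded[OF u(2)] by blast
 define v where "v = inf_conv K u"
 note vp = inf_conv_props[OF u(1) N K0, folded v_def]
 have vs: "super_test \<Theta> v"
 proof (rule super_test_inf_translates[OF u(4)])
  show "v (t, e) \<le> u (t, e + d) + K * snorm d" if "0 < t" "t \<le> 1" for t e d using vp(1) that by simp
  show "\<exists>d. v (t, e) = u (t, e + d) + K * snorm d" if "0 < t" "t \<le> 1" for t e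
   using vp(2)[of t e] that by auto
 qed
 have vb: "bounded (v ` strip)"
  by (rule boundedI[of _ N], elim imageE) (simp only: real_norm_def vp(3))
 have vl: "\<bar>v (t, e) - v (t, e')\<bar> \<le> (2 * K) * norm (e - e')" if "0 \<le> t" "t \<le> 1" for t e e'
 proof -
  have "K * snorm (e - e') \<le> K * (2 * norm (e - e'))" using K0 snorm_le[of "e - e'"] by simp
  then show ?thesis using vp(4)[OF that, of e e'] by (simp add: mult.assoc mult.left_commute)
 qed
 have v0: "f e - rate C \<sigma> \<le> v (\<sigma>, e)" if \<sigma>: "0 \<le> \<sigma>" "\<sigma> \<le> 1" for \<sigma> e
 proof -
  obtain d where d: "v (\<sigma>, e) = u (\<sigma>, e + d) + K * snorm d" using vp(2)[OF \<sigma>] by blast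
  have "f (e + d) - rate C (\<sigma> - 0) \<le> u (\<sigma>, e + d)"
   by (rule super_growth[OF \<rho> u(1,2,4) _ \<sigma> f]) (simp_all add: u0)
  moreover have "\<bar>f e - f (e + d)\<bar> \<le> C * snorm d" using lipbD(2)[OF f, of e "e + d"] by simp
  moreover have "C * snorm d \<le> K * snorm d" using K by (intro mult_right_mono) auto
  ultimately show ?thesis using d by simp
 qed
 define D where "D = 2 * C + C * (sqrt MX + MY + MZ)"
 have D: "0 \<le> D" using C MX_nonneg MY_nonneg MZ_nonneg by (simp add: D_def)
 have main: "u (t, e) \<le> v (t, e)" if t: "0 \<le> t" "t < 1" for t e
 proof (rule field_le_epsilon)
  fix \<eta> :: real assume \<eta>: "0 < \<eta>"
  have "0 < \<eta> / 2" using \<eta> by simp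
  moreover have "(t, e) \<in> strip" using t by simp
  ultimately obtain \<delta> where \<delta>: "0 < \<delta>" "\<And>q. q \<in> strip ==> dist q (t, e) < \<delta> ==> dist (v q) (v (t, e)) < \<eta> / 2"
   using vp(5) unfolding continuous_on_iff by metis
  define \<epsilon> where "\<epsilon> = min (min (1 / 2) (1 - t)) (min (\<delta> / 4) (\<eta> / (2 * (D + 1))))"
  have \<epsilon>: "0 < \<epsilon>" "\<epsilon> \<le> 1 / 2" "\<epsilon> \<le> 1 - t" "\<epsilon> \<le> \<delta> / 4"
  proof -
   have "0 < \<eta> / (2 * (D + 1))" using \<eta> D by simp
   then show "0 < \<epsilon>" using \<delta>(1) t by (simp add: \<epsilon>_def)
   show "\<epsilon> \<le> 1 / 2" "\<epsilon> \<le> 1 - t" "\<epsilon> \<le> \<delta> / 4" unfolding \<epsilon>_def by linarith+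
  qed
  have \<epsilon>2: "\<epsilon>\<^sup>2 \<le> \<epsilon>" using \<epsilon> mult_left_mono[of \<epsilon> 1 \<epsilon>] by (simp add: power2_eq_square)
  have D\<epsilon>: "D * \<epsilon> \<le> \<eta> / 2"
   by (rule small_multiple[OF D]) (use \<epsilon>(1) in \<open>simp_all add: \<epsilon>_def\<close>)
  define k where "k = rescaled \<rho> \<epsilon>"
  have k: "averaging \<epsilon> k" unfolding k_def by (rule rescaled_averaging[OF \<rho> \<epsilon>(1)])
  have vbb: "bounded_borel N (clamp_time v)" by (rule clamp_bounded_borel[OF vp(5) vp(3)])
  define W where "W = conv (clamp_time v) k"
  have W: "W \<in> Cb_inf UNIV" unfolding W_def by (rule conv_smooth[OF averaging_kernel[OF k] vbb])
  define w where "w = (\<lambda>q. W q + 0 * fst q + D * \<epsilon>)"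
  note w = add_affine_time[where a = 0 and c = "D * \<epsilon>", OF W, folded w_def]
  have w4: "Gop \<Theta> (\<lambda>e. w (t, e)) e = Gop \<Theta> (\<lambda>e. W (t, e)) e" for t e
   using w(4)[of t e] by (simp add: w_def)
  have "u (t, e) \<le> w (t, e)"
  proof (rule comparison_sub[OF \<rho> u(1,2,3) w(1,2), of 0 "1 - \<epsilon>\<^sup>2"])
   fix s e assume s: "0 < s" "s < 1 - \<epsilon>\<^sup>2"
   have "Gop \<Theta> (\<lambda>e. W (s, e)) e \<le> partial_deriv UNIV dt W (s, e)"
    unfolding W_def k_def by (rule mollified_super[OF \<rho> vp(5) vb vs vl _ \<epsilon>(1)]) (use K0 s in auto)
   moreover have "s \<le> 1" using s zero_le_power2[of \<epsilon>] by linarith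
   then have "partial_deriv cyl dt w (s, e) = partial_deriv UNIV dt W (s, e) + 0"
    by (intro w(3)) (use s in \<open>simp add: cyl_def\<close>)
   ultimately show "Gop \<Theta> (\<lambda>e. w (s, e)) e \<le> partial_deriv cyl dt w (s, e)" unfolding w4 by simp
  next
   fix e
   have "f e - D * \<epsilon> \<le> W (0, e)"
    unfolding W_def
   proof (rule conv_ge_avg[OF k vbb])
    fix \<sigma> :: real and e' :: "'n space" assume \<sigma>: "0 \<le> \<sigma>" "\<sigma> \<le> \<epsilon>\<^sup>2" "norm e' < \<epsilon>"
    have \<sigma>1: "\<sigma> \<le> 1" using \<sigma> \<epsilon> \<epsilon>2 by linarith
    have "rate C \<sigma> \<le> C * (sqrt MX + MY + MZ) * sqrt \<sigma>" by (rule rate_le_sqrt[OF C \<sigma>(1) \<sigma>1]) simp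
    also have "sqrt \<sigma> \<le> \<epsilon>" using \<sigma> \<epsilon> by (simp add: real_le_lsqrt)
    then have "C * (sqrt MX + MY + MZ) * sqrt \<sigma> \<le> C * (sqrt MX + MY + MZ) * \<epsilon>"
     using C MX_nonneg MY_nonneg MZ_nonneg by (intro mult_left_mono) auto
    finally have 1: "rate C \<sigma> \<le> C * (sqrt MX + MY + MZ) * \<epsilon>" .
    have "\<bar>f e - f (e + e')\<bar> \<le> 2 * C * norm (e - (e + e'))" by (rule lipb_norm[OF f])
    also have "\<dots> \<le> 2 * C * \<epsilon>" using \<sigma> C by (intro mult_left_mono) auto
    finally have "f e - D * \<epsilon> \<le> v (\<sigma>, e + e')"
     using v0[OF \<sigma>(1) \<sigma>1, of "e + e'"] 1 by (simp add: D_def algebra_simps abs_le_iff)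
    then show "f e - D * \<epsilon> \<le> clamp_time v (0 + \<sigma>, e + e')" using \<sigma> \<sigma>1 by (simp add: clamp_time_def)
   qed
   then show "u (0, e) \<le> w (0, e)" by (simp add: w_def u0)
  qed (use t \<epsilon> \<epsilon>2 in auto)
  also have "W (t, e) \<le> v (t, e) + \<eta> / 2"
   unfolding W_def
  proof (rule conv_le_avg[OF k vbb])
   fix \<sigma> :: real and e' :: "'n space" assume \<sigma>: "0 \<le> \<sigma>" "\<sigma> \<le> \<epsilon>\<^sup>2" "norm e' < \<epsilon>"
   have t\<sigma>: "t + \<sigma> \<le> 1" using \<sigma> \<epsilon> \<epsilon>2 by linarith
   have "dist (t + \<sigma>, e + e') (t, e) \<le> \<sigma> + norm e'"
    using norm_Pair_le[of \<sigma> e'] \<sigma> by (simp add: dist_norm)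
   also have "\<dots> < \<delta>" using \<sigma> \<epsilon> \<epsilon>2 \<delta>(1) by linarith
   finally have "dist (v (t + \<sigma>, e + e')) (v (t, e)) < \<eta> / 2" by (intro \<delta>(2)) (use t \<sigma> t\<sigma> in auto)
   then have "v (t + \<sigma>, e + e') \<le> v (t, e) + \<eta> / 2" unfolding dist_real_def by linarith
   then show "clamp_time v (t + \<sigma>, e + e') \<le> v (t, e) + \<eta> / 2"
    using t \<sigma> t\<sigma> by (simp add: clamp_time_def)
  qed
  then have "w (t, e) \<le> v (t, e) + \<eta>" using D\<epsilon> by (simp add: w_def)
  finally show "u (t, e) \<le> v (t, e) + \<eta>" .
 qed
 show ?thesis
  unfolding v_def[symmetric]
  by (rule le_up_to_end[OF u(1) vp(5) _ _ _ main t]) auto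
qed

text \<open>Let \<open>K\<close> tend to the Lipschitz constant of the initial datum.\<close>

lemma spatial_Lipschitz:
 fixes u \<rho> :: "real \<times> 'n space => real"
 assumes \<rho>: "mollifier \<rho>" and u: "continuous_on strip u" "bounded (u ` strip)" "sub_test \<Theta> u" "super_test \<Theta> u"
  and f: "lipb M C f" and u0: "\<And>e. u (0, e) = f e" and t: "0 \<le> t" "t \<le> 1"
 shows "\<bar>u (t, e) - u (t, e')\<bar> \<le> C * snorm (e - e')"
proof -
 obtain N where N: "\<forall>q\<in>strip. \<bar>u q\<bar> \<le> N" using strip_bounded[OF u(2)] by blast
 have C: "0 \<le> C" by (rule lipbD(3)[OF f])
 have le: "u (t, a) - u (t, b) \<le> C * snorm (b - a)" for a b
 proof (rule field_le_epsilon)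
  fix \<eta> :: real assume \<eta>: "0 < \<eta>"
  define K where "K = C + \<eta> / (snorm (b - a) + 1)"
  have s: "0 < snorm (b - a) + 1" using snorm_nonneg[of "b - a"] by linarith
  have K: "C < K" "0 < K" using \<eta> s C by (auto simp: K_def intro: add_nonneg_pos)
  have "u (t, a) \<le> inf_conv K u (t, a)" by (rule le_inf_conv[OF \<rho> u f u0 K(1) t])
  also have "\<dots> \<le> u (t, a + (b - a)) + K * snorm (b - a)"
   by (rule inf_conv_props(1)[OF u(1) N K(2) t])
  finally have "u (t, a) - u (t, b) \<le> C * snorm (b - a) + \<eta> / (snorm (b - a) + 1) * snorm (b - a)"
   by (simp add: K_def distrib_right)
  moreover have "\<eta> / (snorm (b - a) + 1) * snorm (b - a) \<le> \<eta> / (snorm (b - a) + 1) * (snorm (b - a) + 1)"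
   using \<eta> s by (intro mult_left_mono) auto
  moreover have "\<eta> / (snorm (b - a) + 1) * (snorm (b - a) + 1) = \<eta>" using s by simp
  ultimately show "u (t, a) - u (t, b) \<le> C * snorm (b - a) + \<eta>" by linarith
 qed
 show ?thesis using le[of e e'] le[of e' e] snorm_minus[of "e - e'"] by simp
qed

lemma time_regularity:
 fixes u \<rho> :: "real \<times> 'n space => real"
 assumes \<rho>: "mollifier \<rho>" and u: "continuous_on strip u" "bounded (u ` strip)" "sub_test \<Theta> u" "super_test \<Theta> u"
  and f: "lipb M C f" and u0: "\<And>e. u (0, e) = f e" and t: "0 \<le> t0" "t0 \<le> t1" "t1 \<le> 1"
 shows "\<bar>u (t1, e) - u (t0, e)\<bar> \<le> rate C (t1 - t0)"
proof -
 obtain N where N: "\<forall>q\<in>strip. \<bar>u q\<bar> \<le> N" using strip_bounded[OF u(2)] by blast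
 have t0: "t0 \<le> 1" using t by simp
 have l: "lipb N C (\<lambda>e. u (t0, e))"
  unfolding lipb_def
 proof (intro conjI allI)
  show "0 \<le> C" by (rule lipbD(3)[OF f])
  show "\<bar>u (t0, e)\<bar> \<le> N" for e by (rule N[rule_format]) (use t in auto)
  show "\<bar>u (t0, e) - u (t0, e')\<bar> \<le> C * snorm (e - e')" for e e'
   by (rule spatial_Lipschitz[OF \<rho> u f u0 t(1) t0])
 qed
 have "u (t1, e) \<le> u (t0, e) + rate C (t1 - t0)" by (rule sub_growth[OF \<rho> u(1,2,3) t l order_refl])
 moreover have "u (t0, e) - rate C (t1 - t0) \<le> u (t1, e)" by (rule super_growth[OF \<rho> u(1,2,4) t l order_refl])
 ultimately show ?thesis by simp
qed

end

section \<open>Error bounds\<close>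

lemma clamp_time_measurable:
 fixes v :: "real \<times> 'n::finite space => real"
 assumes v: "bounded_borel M v"
 shows "bounded_borel M (clamp_time v)"
proof -
 have e: "clamp_time v = v \<circ> (\<lambda>q. (max 0 (min 1 (fst q)), snd q))" by (auto simp: clamp_time_def)
 have "(\<lambda>q :: real \<times> 'n space. (max 0 (min 1 (fst q)), snd q)) \<in> borel_measurable borel"
  by (intro borel_measurable_continuous_onI continuous_intros)
 then have "clamp_time v \<in> borel_measurable borel"
  unfolding e using bounded_borel_meas[OF v] by (rule measurable_comp)
 moreover have "\<bar>clamp_time v q\<bar> \<le> M" for q unfolding e comp_def by (rule bounded_borelD[OF v])
 ultimately show ?thesis by (simp add: bounded_borel_def)
qed

lemma pide_op_mollify:
 fixes \<rho> :: "real \<times> 'n::finite space => real"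
 assumes \<rho>: "mollifier \<rho>" and \<epsilon>: "0 < \<epsilon>" and v: "bounded_borel M (clamp_time v)" and t: "0 < t" "t \<le> 1"
 shows "pide_op \<Theta> (mollify \<rho> \<epsilon> v) (t, e) =
  partial_deriv UNIV dt (conv (clamp_time v) (rescaled \<rho> \<epsilon>)) (t, e) -
  Gop \<Theta> (\<lambda>e. conv (clamp_time v) (rescaled \<rho> \<epsilon>) (t, e)) e"
proof -
 define W where "W = conv (clamp_time v) (rescaled \<rho> \<epsilon>)"
 have eq: "mollify \<rho> \<epsilon> v (s, a) = W (s, a)" if "0 < s" for s a
  unfolding W_def by (rule mollify_eq_conv[OF \<rho> \<epsilon> v]) (use that in simp)
 have W: "W \<in> Cb_inf UNIV"
  unfolding W_def by (rule conv_smooth[OF averaging_kernel[OF rescaled_averaging[OF \<rho> \<epsilon>]] v])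
 have c: "(t, e) \<in> cyl" using t by (simp add: cyl_def)
 have "has_partial cyl (mollify \<rho> \<epsilon> v) dt (partial_deriv cyl dt W)"
 proof (rule has_partial_cong[OF Cb_inf_has_partial[OF Cb_inf_UNIV_restrict[OF thick_cyl W] dt_Basis]])
  fix p :: "real \<times> 'n space" assume "p \<in> cyl"
  then have "0 < fst p" by (auto simp: cyl_def)
  then show "W p = mollify \<rho> \<epsilon> v p" using eq[of "fst p" "snd p"] by (simp only: prod.collapse)
 qed simp
 from has_partial_unique[OF thick_cyl dt_Basis this c]
 have "partial_deriv cyl dt (mollify \<rho> \<epsilon> v) (t, e) = partial_deriv UNIV dt W (t, e)"
  using partial_deriv_restrict[OF thick_cyl W dt_Basis c] by simp
 then show ?thesis unfolding pide_op_eq[OF t] eq[OF t(1)] W_def by simp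
qed

lemma sqrt_add_square_le: "0 \<le> h ==> 0 \<le> s ==> s \<le> \<epsilon>\<^sup>2 ==> 0 \<le> \<epsilon> ==> sqrt (h + s) \<le> sqrt h + \<epsilon>"
proof -
 assume *: "0 \<le> h" "0 \<le> s" "s \<le> \<epsilon>\<^sup>2" "0 \<le> \<epsilon>"
 have "sqrt (h + s) \<le> sqrt h + sqrt s" by (rule sqrt_add_le_add_sqrt) (use * in auto)
 moreover have "sqrt s \<le> \<epsilon>" using * by (simp add: real_le_lsqrt)
 ultimately show ?thesis by simp
qed

context driven
begin

lemma S_op_eq: "S_op E \<alpha> X' Y' Z' h x y z p g = 1 / h * (p - T h g (x, y, z))"
 by (simp add: S_op_def T_def scaling_def)

lemma scheme_eq_sch:
 assumes h: "0 < h"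
 shows "scheme E \<alpha> X' Y' Z' f h = sch h f"
proof
 fix p :: "real \<times> 'n space"
 have "scheme E \<alpha> X' Y' Z' f h (t, e) = sch h f (t, e)" for t e
 proof (induction "nat \<lfloor>t / h\<rfloor>" arbitrary: t e rule: less_induct)
  case less
  obtain x y z where e: "e = (x, y, z)" by (cases e)
  show ?case
  proof (cases "t < h")
   case True
   then have "t / h < 1" using h by simp
   then have "\<lfloor>t / h\<rfloor> < 1" by linarith
   then have "nat \<lfloor>t / h\<rfloor> = 0" by simp
   then have "sch h f (t, e) = f e" by (simp add: sch_def)
   moreover have "scheme E \<alpha> X' Y' Z' f h (t, e) = f e"
    unfolding e by (subst scheme.simps) (simp add: True)
   ultimately show ?thesis by simp
  next
   case False
   then have th: "h \<le> t" by simp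
   have "(t - h) / h = t / h - 1" using h by (simp add: diff_divide_distrib)
   then have f1: "\<lfloor>(t - h) / h\<rfloor> = \<lfloor>t / h\<rfloor> - 1" by simp
   have f2: "1 \<le> \<lfloor>t / h\<rfloor>" using h th by (simp add: le_floor_iff)
   have lt: "nat \<lfloor>(t - h) / h\<rfloor> < nat \<lfloor>t / h\<rfloor>" using f1 f2 by linarith
   have "scheme E \<alpha> X' Y' Z' f h (t, e) = E (\<lambda>\<omega>. scheme E \<alpha> X' Y' Z' f h
       (t - h, x + sqrt h *\<^sub>R X' \<omega>, y + h *\<^sub>R Y' \<omega>, z + h powr (1 / \<alpha>) *\<^sub>R Z' \<omega>))"
    unfolding e by (subst scheme.simps) (use h th in simp)
   also have "\<dots> = E (\<lambda>\<omega>. sch h f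
       (t - h, x + sqrt h *\<^sub>R X' \<omega>, y + h *\<^sub>R Y' \<omega>, z + h powr (1 / \<alpha>) *\<^sub>R Z' \<omega>))"
    unfolding less[OF lt] ..
   also have "\<dots> = T h (\<lambda>e. sch h f (t - h, e)) e" by (simp add: T_def scaling_def e)
   also have "\<dots> = sch h f (t, e)" by (rule sch_rec[OF h th, symmetric])
   finally show ?thesis .
  qed
 qed
 from this[of "fst p" "snd p"] show "scheme E \<alpha> X' Y' Z' f h p = sch h f p" by (simp only: prod.collapse)
qed

end

locale scheme_error = driven H E \<Theta> C\<Theta> X Y Z X' Y' Z' \<alpha>
 for H :: "('w => real) set" and E and \<Theta> :: "'n::finite levy_triplet set" and C\<Theta> X Y Z X' Y' Z' \<alpha> +
 fixes u \<rho> :: "real \<times> 'n space => real" and \<phi> :: "'n space => real" and M C C0 :: real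
 assumes \<rho>: "mollifier \<rho>"
  and u: "continuous_on strip u" "bounded (u ` strip)" "sub_test \<Theta> u" "super_test \<Theta> u"
  and u0: "u (0, e) = \<phi> e"
  and \<phi>: "lipb M C \<phi>"
  and C0: "C \<le> C0" "C * (sqrt MX + MY + MZ) \<le> C0"
begin

lemma C: "0 \<le> C" and C0_nonneg: "0 \<le> C0"
 using lipbD(3)[OF \<phi>] C0 by auto

lemma near_space: "norm e' < \<epsilon> ==> lipb N C f ==> \<bar>f (e + e') - f e\<bar> \<le> 2 * C0 * \<epsilon>"
proof -
 assume e': "norm e' < \<epsilon>" and f: "lipb N C f"
 have "\<bar>f (e + e') - f e\<bar> \<le> 2 * C * norm (e + e' - e)" by (rule lipb_norm[OF f])
 also have "\<dots> \<le> 2 * C0 * \<epsilon>" using e' C C0 by (intro mult_mono) auto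
 finally show ?thesis .
qed

lemma u_slice: "\<exists>N. \<forall>t. 0 \<le> t --> t \<le> 1 --> lipb N C (\<lambda>e. u (t, e))"
proof -
 obtain N where N: "\<forall>q\<in>strip. \<bar>u q\<bar> \<le> N" using strip_bounded[OF u(2)] by blast
 have "lipb N C (\<lambda>e. u (t, e))" if t: "0 \<le> t" "t \<le> 1" for t
  unfolding lipb_def
 proof (intro conjI allI)
  show "0 \<le> C" by (rule C)
  show "\<bar>u (t, e)\<bar> \<le> N" for e by (rule N[rule_format]) (use t in auto)
  show "\<bar>u (t, e) - u (t, e')\<bar> \<le> C * snorm (e - e')" for e e'
   by (rule spatial_Lipschitz[OF \<rho> u \<phi> u0 t])
 qed
 then show ?thesis by blast
qed

lemma rate_sqrt: "0 \<le> s ==> s \<le> 1 ==> rate C s \<le> C0 * sqrt s"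
 by (rule rate_le_sqrt[OF C _ _ C0(2)])

lemma u_time: "0 \<le> t0 ==> t0 \<le> t1 ==> t1 \<le> 1 ==> \<bar>u (t1, e) - u (t0, e)\<bar> \<le> C0 * sqrt (t1 - t0)"
 using time_regularity[OF \<rho> u \<phi> u0, of t0 t1 e] rate_sqrt[of "t1 - t0"] by simp

lemma u_initial: "0 \<le> t ==> t \<le> 1 ==> \<bar>u (t, e) - \<phi> e\<bar> \<le> C0 * sqrt t"
 using u_time[of 0 t e] by (simp add: u0)

lemma sch_initial:
 assumes h: "0 < h" and t: "0 \<le> t" "t \<le> 1"
 shows "\<bar>sch h \<phi> (t, e) - \<phi> e\<bar> \<le> C0 * sqrt t"
proof -
 define j where "j = nat \<lfloor>t / h\<rfloor>"
 have "\<bar>(T h ^^ j) \<phi> e - \<phi> e\<bar> \<le> rate C (real j * h)" by (rule Tk_growth[OF \<phi>]) (use h in simp)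
 also have "\<dots> \<le> rate C t"
  by (rule rate_mono[OF C]) (use h sch_steps[OF h t(1)] in \<open>simp_all add: j_def\<close>)
 also have "\<dots> \<le> C0 * sqrt t" by (rule rate_sqrt[OF t])
 finally show ?thesis by (simp add: sch_def j_def)
qed

text \<open>The times may lie in different steps, hence the additional \<open>h\<close>.\<close>

lemma sch_time:
 assumes h: "0 < h" and t: "0 \<le> a" "0 \<le> b" "\<bar>a - b\<bar> \<le> s" "h + s \<le> 1"
 shows "\<bar>sch h \<phi> (a, e) - sch h \<phi> (b, e)\<bar> \<le> C0 * sqrt (h + s)"
proof -
 have main: "\<bar>sch h \<phi> (b, e) - sch h \<phi> (a, e)\<bar> \<le> C0 * sqrt (h + s)"
  if ab: "0 \<le> a" "a \<le> b" "b - a \<le> s" for a b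
 proof -
  define i where "i = nat \<lfloor>a / h\<rfloor>"
  define j where "j = nat \<lfloor>b / h\<rfloor>"
  have ij: "i \<le> j" unfolding i_def j_def using ab h by (intro nat_mono floor_mono divide_right_mono) auto
  have "a / h < real i + 1" using h ab unfolding i_def by simp
  then have "a < (real i + 1) * h" using h by (simp add: pos_divide_less_eq)
  moreover have "real j * h \<le> b" unfolding j_def using h ab by (intro sch_steps) auto
  ultimately have "real (j - i) * h \<le> h + s" using ij ab by (simp add: of_nat_diff algebra_simps)
  then have "rate C (real (j - i) * h) \<le> rate C (h + s)" using h by (intro rate_mono[OF C]) auto
  also have "\<dots> \<le> C0 * sqrt (h + s)" by (rule rate_sqrt) (use h ab t in auto)
  finally have "\<bar>(T h ^^ (j - i)) ((T h ^^ i) \<phi>) e - (T h ^^ i) \<phi> e\<bar> \<le> C0 * sqrt (h + s)"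
   using Tk_growth[OF Tk_lipb[OF \<phi>, of i h] less_imp_le[OF h], of "j - i" e] by linarith
  moreover have "(T h ^^ (j - i)) ((T h ^^ i) \<phi>) = (T h ^^ j) \<phi>"
   using ij funpow_add[of "j - i" i "T h"] by simp
  ultimately show ?thesis by (simp add: sch_def i_def j_def)
 qed
 show ?thesis
 proof (cases "a \<le> b")
  case True with main[of a b] t show ?thesis by (simp add: abs_minus_commute)
 next
  case False with main[of b a] t show ?thesis by simp
 qed
qed

text \<open>Used where a mollification has no room: for small \<open>t\<close>, and for large \<open>\<epsilon>\<close> or \<open>h\<close>.\<close>

lemma trivial_bound:
 assumes h: "0 < h" and t: "0 \<le> t" "t \<le> 1" and r: "sqrt t \<le> r"
 shows "\<bar>u (t, e) - sch h \<phi> (t, e)\<bar> \<le> 2 * C0 * r"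
proof -
 have "C0 * sqrt t \<le> C0 * r" using r C0_nonneg by (rule mult_left_mono)
 then show ?thesis using u_initial[OF t, of e] sch_initial[OF h t, of e] by linarith
qed

text \<open>On \<open>[h, 1 - \<epsilon>\<^sup>2]\<close> the mollified scheme plus a drift \<open>e1\<close> is a smooth supersolution. Its initial
 value at \<open>h\<close> costs \<open>2 * C0 * sqrt h + 3 * C0 * \<epsilon>\<close>, removing the mollification costs
 \<open>C0 * sqrt h + 3 * C0 * \<epsilon>\<close>, and the times after \<open>1 - \<epsilon>\<^sup>2\<close> cost another \<open>C0 * \<epsilon>\<close>.\<close>

theorem lower_bound:
 assumes h: "0 < h" and \<epsilon>: "0 < \<epsilon>" and t: "0 \<le> t" "t \<le> 1" and e1: "0 \<le> e1"
  and C2: "\<And>s e. \<epsilon> < 1 ==> h \<le> s ==> s \<le> 1 ==>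
   1 / h * (mollify \<rho> \<epsilon> (sch h \<phi>) (s, e) - T h (\<lambda>e. mollify \<rho> \<epsilon> (sch h \<phi>) (s - h, e)) e)
    \<le> pide_op \<Theta> (mollify \<rho> \<epsilon> (sch h \<phi>)) (s, e) + e1"
 shows "u (t, e) - sch h \<phi> (t, e) \<le> 4 * C0 * sqrt h + (8 * C0 * \<epsilon> + e1)"
proof -
 define v where "v = sch h \<phi>"
 define S where "S = 1 - \<epsilon>\<^sup>2"
 have nn: "0 \<le> C0 * sqrt h" "0 \<le> C0 * \<epsilon>" using C0_nonneg h \<epsilon> by auto
 have sq: "C0 * sqrt (h + \<sigma>) \<le> C0 * sqrt h + C0 * \<epsilon>" if "0 \<le> \<sigma>" "\<sigma> \<le> \<epsilon>\<^sup>2" for \<sigma>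
 proof -
  have "sqrt (h + \<sigma>) \<le> sqrt h + \<epsilon>" by (rule sqrt_add_square_le) (use that h \<epsilon> in auto)
  then show ?thesis using mult_left_mono[OF _ C0_nonneg] by (simp flip: distrib_left)
 qed
 consider "S \<le> h" | "t < h" "h < S" | "h \<le> t" "h < S" by linarith
 then show ?thesis
 proof cases
  case 1
  have "sqrt t \<le> sqrt (h + \<epsilon>\<^sup>2)" using 1 t by (simp add: S_def)
  also have "\<dots> \<le> sqrt h + \<epsilon>" by (rule sqrt_add_square_le) (use h \<epsilon> in auto)
  finally have "\<bar>u (t, e) - v (t, e)\<bar> \<le> 2 * C0 * (sqrt h + \<epsilon>)" unfolding v_def by (rule trivial_bound[OF h t])
  then show ?thesis using nn e1 unfolding v_def[symmetric] by (simp add: distrib_left abs_le_iff)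
 next
  case 2
  have "sqrt t \<le> sqrt h" using 2 by simp
  from trivial_bound[OF h t this, of e]
  show ?thesis using nn e1 by (simp add: abs_le_iff)
 next
  case 3
  have \<epsilon>1: "\<epsilon> < 1"
  proof (rule ccontr)
   assume "\<not> \<epsilon> < 1"
   then have "1 \<le> \<epsilon>\<^sup>2" by (simp add: one_le_power)
   then show False using 3 h by (simp add: S_def)
  qed
  have S: "0 < S" "S < 1" "S + \<epsilon>\<^sup>2 = 1" using 3 h \<epsilon> by (auto simp: S_def)
  have hS: "h + \<epsilon>\<^sup>2 \<le> 1" using 3 by (simp add: S_def)
  define k where "k = rescaled \<rho> \<epsilon>"
  have k: "averaging \<epsilon> k" unfolding k_def by (rule rescaled_averaging[OF \<rho> \<epsilon>])
  have vb: "bounded_borel M v" unfolding v_def by (rule sch_borel[OF \<phi>])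
  note cb = clamp_time_measurable[OF vb]
  define W where "W = conv (clamp_time v) k"
  have W: "W \<in> Cb_inf UNIV" unfolding W_def by (rule conv_smooth[OF averaging_kernel[OF k] cb])
  have vl: "lipb M C (\<lambda>e. v (t, e))" for t unfolding v_def by (rule sch_lipb[OF \<phi>])
  have mol: "mollify \<rho> \<epsilon> v (s, e) = W (s, e)" if "0 \<le> s" for s e
   unfolding W_def k_def by (rule mollify_eq_conv[OF \<rho> \<epsilon> cb that])
  have clamp: "clamp_time v (s + \<sigma>, a) = v (s + \<sigma>, a)" if "0 \<le> s" "s \<le> S" "0 \<le> \<sigma>" "\<sigma> \<le> \<epsilon>\<^sup>2" for s \<sigma> a
   using that by (simp add: clamp_time_def S_def)
  have Wv: "W (s, a) = conv v k (s, a)" if s: "0 \<le> s" "s \<le> S" for s a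
  proof (rule antisym)
   show "W (s, a) \<le> conv v k (s, a)"
    unfolding W_def by (rule conv_mono_avg[OF k cb vb]) (simp add: clamp[OF s])
   show "conv v k (s, a) \<le> W (s, a)"
    unfolding W_def by (rule conv_mono_avg[OF k vb cb]) (simp add: clamp[OF s])
  qed
  have W_super: "Gop \<Theta> (\<lambda>e. W (s, e)) e \<le> partial_deriv UNIV dt W (s, e) + e1" if s: "h \<le> s" "s \<le> S" for s e
  proof -
   have s1: "0 < s" "s \<le> 1" "0 \<le> s - h" "s - h \<le> S" "0 \<le> s" using s S h by linarith+
   have "T h (\<lambda>e. conv v k (s - h, e)) e \<le> conv v k (s, e)"
    using sch_jensen[OF \<phi> k h s1(3), of e] unfolding v_def by simp
   then have "0 \<le> 1 / h * (W (s, e) - T h (\<lambda>e. W (s - h, e)) e)"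
    unfolding Wv[OF s1(3,4)] Wv[OF s1(5) s(2)] using h by simp
   also have "\<dots> \<le> pide_op \<Theta> (mollify \<rho> \<epsilon> v) (s, e) + e1"
    using C2[OF \<epsilon>1 s(1) s1(2), of e] unfolding v_def[symmetric] mol[OF s1(5)] mol[OF s1(3)] .
   also have "pide_op \<Theta> (mollify \<rho> \<epsilon> v) (s, e) = partial_deriv UNIV dt W (s, e) - Gop \<Theta> (\<lambda>e. W (s, e)) e"
    unfolding W_def k_def by (rule pide_op_mollify[OF \<rho> \<epsilon> cb s1(1,2)])
   finally show ?thesis by simp
  qed
  define D where "D = 2 * (C0 * sqrt h) + 3 * (C0 * \<epsilon>)"
  \<comment> \<open>The drift absorbs the consistency error.\<close>
  define w where "w = (\<lambda>q. W q + e1 * fst q + (D - e1 * h))"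
  note w = add_affine_time[where a = e1 and c = "D - e1 * h", OF W, folded w_def]
  have w4: "Gop \<Theta> (\<lambda>e. w (t, e)) e = Gop \<Theta> (\<lambda>e. W (t, e)) e" for t e
   using w(4)[of t e] by (simp add: w_def)
  have cmp: "u (s, a) \<le> W (s, a) + D + e1" if s: "h \<le> s" "s \<le> S" for s a
  proof -
   have "u (s, a) \<le> w (s, a)"
   proof (rule comparison_sub[OF \<rho> u(1,2,3) w(1,2) _ _ 3(2) _ _ s])
    fix r e assume r: "h < r" "r < S"
    then have "partial_deriv cyl dt w (r, e) = partial_deriv UNIV dt W (r, e) + e1"
     using S h by (intro w(3)) (simp add: cyl_def)
    then show "Gop \<Theta> (\<lambda>e. w (r, e)) e \<le> partial_deriv cyl dt w (r, e)"
     unfolding w4 using W_super[of r e] r by simp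
   next
    fix e
    have "\<phi> e - C0 * sqrt h - 3 * (C0 * \<epsilon>) \<le> W (h, e)"
     unfolding W_def
    proof (rule conv_ge_avg[OF k cb])
     fix \<sigma> :: real and e' :: "'n space" assume \<sigma>: "0 \<le> \<sigma>" "\<sigma> \<le> \<epsilon>\<^sup>2" "norm e' < \<epsilon>"
     have "\<bar>v (h + \<sigma>, e) - \<phi> e\<bar> \<le> C0 * sqrt (h + \<sigma>)"
      unfolding v_def by (rule sch_initial[OF h]) (use h \<sigma> hS in auto)
     then have "\<phi> e - C0 * sqrt h - 3 * (C0 * \<epsilon>) \<le> v (h + \<sigma>, e + e')"
      using sq[OF \<sigma>(1,2)] near_space[OF \<sigma>(3) vl, of "h + \<sigma>" e] by linarith
     then show "\<phi> e - C0 * sqrt h - 3 * (C0 * \<epsilon>) \<le> clamp_time v (h + \<sigma>, e + e')"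
      using clamp[of h \<sigma>] h 3 \<sigma> by simp
    qed
    moreover have "u (h, e) \<le> \<phi> e + C0 * sqrt h" using u_initial[of h e] h hS \<epsilon> 3 S by (simp add: abs_le_iff)
    ultimately show "u (h, e) \<le> w (h, e)" by (simp add: w_def D_def)
   qed (use h S in auto)
   also have "w (s, a) = W (s, a) + D + e1 * (s - h)" by (simp add: w_def algebra_simps)
   also have "e1 * (s - h) \<le> e1 * 1" using e1 s S h by (intro mult_left_mono) auto
   finally show ?thesis by simp
  qed
  have upper: "W (r, e) \<le> v (t, e) + C0 * sqrt h + 3 * (C0 * \<epsilon>)"
   if r: "0 \<le> r" "r \<le> S" and d: "\<And>\<sigma>. 0 \<le> \<sigma> ==> \<sigma> \<le> \<epsilon>\<^sup>2 ==> \<bar>r + \<sigma> - t\<bar> \<le> \<epsilon>\<^sup>2" for r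
   unfolding W_def
  proof (rule conv_le_avg[OF k cb])
   fix \<sigma> :: real and e' :: "'n space" assume \<sigma>: "0 \<le> \<sigma>" "\<sigma> \<le> \<epsilon>\<^sup>2" "norm e' < \<epsilon>"
   have "\<bar>v (r + \<sigma>, e) - v (t, e)\<bar> \<le> C0 * sqrt (h + \<epsilon>\<^sup>2)"
    unfolding v_def by (rule sch_time[OF h _ t(1) d[OF \<sigma>(1,2)] hS]) (use r \<sigma> in simp)
   then have "v (r + \<sigma>, e + e') \<le> v (t, e) + C0 * sqrt h + 3 * (C0 * \<epsilon>)"
    using sq[of "\<epsilon>\<^sup>2"] near_space[OF \<sigma>(3) vl, of "r + \<sigma>" e] by simp
   then show "clamp_time v (r + \<sigma>, e + e') \<le> v (t, e) + C0 * sqrt h + 3 * (C0 * \<epsilon>)"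
    using clamp[OF r \<sigma>(1,2)] by simp
  qed
  show ?thesis
  proof (cases "t \<le> S")
   case True
   then have "u (t, e) \<le> W (t, e) + D + e1" using cmp 3 by blast
   moreover have "W (t, e) \<le> v (t, e) + C0 * sqrt h + 3 * (C0 * \<epsilon>)" by (rule upper[OF t(1) True]) auto
   ultimately show ?thesis using nn unfolding v_def[symmetric] by (simp add: D_def)
  next
   case False
   have "u (S, e) \<le> W (S, e) + D + e1" using cmp[of S e] 3 by simp
   moreover have "W (S, e) \<le> v (t, e) + C0 * sqrt h + 3 * (C0 * \<epsilon>)"
    by (rule upper) (use S False t in auto)
   moreover have "\<bar>u (t, e) - u (S, e)\<bar> \<le> C0 * sqrt (t - S)" by (rule u_time) (use S False t in auto)
   moreover have "C0 * sqrt (t - S) \<le> C0 * \<epsilon>"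
    by (rule mult_left_mono[OF _ C0_nonneg]) (use False t \<epsilon> in \<open>simp add: S_def real_le_lsqrt\<close>)
   ultimately show ?thesis using nn unfolding v_def[symmetric] by (simp add: D_def)
  qed
 qed
qed

text \<open>The scheme is compared with the mollification at a time earlier by \<open>\<epsilon>\<^sup>2\<close>, because the mollification
 looks ahead and is a supersolution only up to \<open>1 - \<epsilon>\<^sup>2\<close>. The shift costs no more than the
 mollification itself.\<close>

theorem upper_bound:
 assumes h: "0 < h" and \<epsilon>: "0 < \<epsilon>" and t: "0 \<le> t" "t \<le> 1" and e2: "0 \<le> e2"
  and C3: "\<And>s e. \<epsilon> < 1 ==> h \<le> s ==> s \<le> 1 ==>
   pide_op \<Theta> (mollify \<rho> \<epsilon> u) (s, e) - e2
    \<le> 1 / h * (mollify \<rho> \<epsilon> u (s, e) - T h (\<lambda>e. mollify \<rho> \<epsilon> u (s - h, e)) e)"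
 shows "sch h \<phi> (t, e) - u (t, e) \<le> 2 * C0 * sqrt h + (8 * C0 * \<epsilon> + e2)"
proof -
 define v where "v = sch h \<phi>"
 have nn: "0 \<le> C0 * sqrt h" "0 \<le> C0 * \<epsilon>" using C0_nonneg h \<epsilon> by auto
 show ?thesis
 proof (cases "t < \<epsilon>\<^sup>2 \<or> 1 \<le> \<epsilon>")
  case True
  then have "sqrt t \<le> \<epsilon>"
  proof
   assume "t < \<epsilon>\<^sup>2" then show ?thesis using \<epsilon> by (simp add: real_le_lsqrt)
  next
   assume "1 \<le> \<epsilon>"
   moreover have "sqrt t \<le> 1" using t by simp
   ultimately show ?thesis by linarith
  qed
  from trivial_bound[OF h t this, of e]
  show ?thesis using nn e2 by (simp add: abs_le_iff)
 next
  case False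
  then have \<epsilon>1: "\<epsilon> < 1" and t\<epsilon>: "\<epsilon>\<^sup>2 \<le> t" by auto
  obtain N where N: "\<And>t. 0 \<le> t ==> t \<le> 1 ==> lipb N C (\<lambda>e. u (t, e))" using u_slice by blast
  have uN: "\<bar>u q\<bar> \<le> N" if "q \<in> strip" for q
   using lipbD(1)[OF N, of "fst q" "snd q"] that by (cases q) auto
  have ul: "lipb N C (\<lambda>e. clamp_time u (t, e))" for t unfolding clamp_time_def case_prod_conv by (rule N) auto
  define k where "k = rescaled \<rho> \<epsilon>"
  have k: "averaging \<epsilon> k" unfolding k_def by (rule rescaled_averaging[OF \<rho> \<epsilon>])
  have cb: "bounded_borel N (clamp_time u)" by (rule clamp_bounded_borel[OF u(1) uN])
  define U where "U = conv (clamp_time u) k"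
  have Ul: "lipb N C (\<lambda>e. U (s, e))" for s unfolding U_def by (rule conv_slice_lipb[OF k cb ul])
  have mol: "mollify \<rho> \<epsilon> u (s, e) = U (s, e)" if "0 \<le> s" for s e
   unfolding U_def k_def by (rule mollify_eq_conv[OF \<rho> \<epsilon> cb that])
  have vl: "lipb M C (\<lambda>e. v (t, e))" for t unfolding v_def by (rule sch_lipb[OF \<phi>])
  have clamp: "clamp_time u (s + \<sigma>, a) = u (s + \<sigma>, a)" if "0 \<le> s" "s + \<epsilon>\<^sup>2 \<le> 1" "0 \<le> \<sigma>" "\<sigma> \<le> \<epsilon>\<^sup>2" for s \<sigma> a
   using that by (simp add: clamp_time_def)
  have step: "T h (\<lambda>e. U (s - h, e)) e \<le> U (s, e) + h * e2" if s: "h \<le> s" "s + \<epsilon>\<^sup>2 \<le> 1" for s e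
  proof -
   have s1: "0 < s" "s \<le> 1" "0 \<le> s - h" "0 \<le> s" using s h zero_le_power2[of \<epsilon>] by linarith+
   have "Gop \<Theta> (\<lambda>e. U (s, e)) e \<le> partial_deriv UNIV dt U (s, e)"
    unfolding U_def k_def
   proof (rule mollified_super[OF \<rho> u(1,2,4) _ _ \<epsilon> s1(1) s(2)])
    show "\<bar>u (t, e) - u (t, e')\<bar> \<le> 2 * C * norm (e - e')" if "0 \<le> t" "t \<le> 1" for t e e'
     by (rule lipb_norm[OF N[OF that]])
   qed (use C in simp)
   then have "0 \<le> pide_op \<Theta> (mollify \<rho> \<epsilon> u) (s, e)"
    unfolding pide_op_mollify[OF \<rho> \<epsilon> cb s1(1,2)] U_def k_def by simp
   then have "- e2 \<le> 1 / h * (U (s, e) - T h (\<lambda>e. U (s - h, e)) e)"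
    using C3[OF \<epsilon>1 s(1) s1(2), of e] unfolding mol[OF s1(4)] mol[OF s1(3)] by simp
   then have "h * - e2 \<le> h * (1 / h * (U (s, e) - T h (\<lambda>e. U (s - h, e)) e))"
    using h by (intro mult_left_mono) auto
   then show ?thesis using h by simp
  qed
  define D where "D = 2 * (C0 * sqrt h) + 4 * (C0 * \<epsilon>)"
  have claim: "v (s + \<epsilon>\<^sup>2, e) \<le> U (s, e) + D + real n * (h * e2)"
   if "nat \<lfloor>s / h\<rfloor> = n" "0 \<le> s" "s + \<epsilon>\<^sup>2 \<le> 1" for n s e
   using that
  proof (induction n arbitrary: s e)
   case 0
   then have "\<lfloor>s / h\<rfloor> < 1" by linarith
   then have "s / h < 1" by (simp only: floor_less_one)
   then have "s < h" using h by simp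
   have sq: "C0 * sqrt (s + \<sigma>) \<le> C0 * sqrt h + C0 * \<epsilon>" if "0 \<le> \<sigma>" "\<sigma> \<le> \<epsilon>\<^sup>2" for \<sigma>
   proof -
    have "sqrt (s + \<sigma>) \<le> sqrt s + \<epsilon>" by (rule sqrt_add_square_le) (use that 0 \<epsilon> in auto)
    also have "sqrt s \<le> sqrt h" using \<open>s < h\<close> by simp
    finally show ?thesis using mult_left_mono[OF _ C0_nonneg] by (simp flip: distrib_left)
   qed
   have "\<bar>v (s + \<epsilon>\<^sup>2, e) - \<phi> e\<bar> \<le> C0 * sqrt (s + \<epsilon>\<^sup>2)"
    unfolding v_def by (rule sch_initial[OF h]) (use 0 in auto)
   then have 1: "v (s + \<epsilon>\<^sup>2, e) \<le> \<phi> e + C0 * sqrt h + C0 * \<epsilon>" using sq[of "\<epsilon>\<^sup>2"] by simp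
   have "\<phi> e - C0 * sqrt h - 3 * (C0 * \<epsilon>) \<le> U (s, e)"
    unfolding U_def
   proof (rule conv_ge_avg[OF k cb])
    fix \<sigma> :: real and e' :: "'n space" assume \<sigma>: "0 \<le> \<sigma>" "\<sigma> \<le> \<epsilon>\<^sup>2" "norm e' < \<epsilon>"
    have s\<sigma>: "0 \<le> s + \<sigma>" "s + \<sigma> \<le> 1" using 0 \<sigma> by auto
    have "\<phi> e - C0 * sqrt h - 3 * (C0 * \<epsilon>) \<le> u (s + \<sigma>, e + e')"
     using u_initial[OF s\<sigma>, of e] sq[OF \<sigma>(1,2)] near_space[OF \<sigma>(3) N[OF s\<sigma>], of e] by linarith
    then show "\<phi> e - C0 * sqrt h - 3 * (C0 * \<epsilon>) \<le> clamp_time u (s + \<sigma>, e + e')"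
     using clamp[OF 0(2,3) \<sigma>(1,2)] by simp
   qed
   then show ?case using 1 by (simp add: D_def)
  next
   case (Suc n)
   have f1: "1 \<le> \<lfloor>s / h\<rfloor>" using Suc.prems(1) by linarith
   then have hs: "h \<le> s" using h by (simp add: le_floor_iff)
   have "(s - h) / h = s / h - 1" using h by (simp add: diff_divide_distrib)
   then have "\<lfloor>(s - h) / h\<rfloor> = \<lfloor>s / h\<rfloor> - 1" by simp
   then have n: "nat \<lfloor>(s - h) / h\<rfloor> = n" using Suc.prems(1) f1 by linarith
   define c where "c = D + real n * (h * e2)"
   have IH: "v (s - h + \<epsilon>\<^sup>2, e) \<le> U (s - h, e) + c" for e
    using Suc.IH[OF n, of e] hs h Suc.prems by (simp add: c_def)
   have e: "s + \<epsilon>\<^sup>2 - h = s - h + \<epsilon>\<^sup>2" by simp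
   have "h \<le> s + \<epsilon>\<^sup>2" using hs zero_le_power2[of \<epsilon>] by linarith
   from sch_rec[OF h this, of \<phi> e]
   have "v (s + \<epsilon>\<^sup>2, e) = T h (\<lambda>e. v (s - h + \<epsilon>\<^sup>2, e)) e" unfolding v_def[symmetric] e .
   also have "\<dots> \<le> T h (\<lambda>e. U (s - h, e) + c) e" by (rule T_mono[OF vl lipb_add[OF Ul lipb_const] IH])
   also have "\<dots> \<le> T h (\<lambda>e. U (s - h, e)) e + T h (\<lambda>_. c) e" by (rule T_add_le[OF Ul lipb_const])
   also have "T h (\<lambda>_. c) e = c" by (simp add: T_def const)
   also have "T h (\<lambda>e. U (s - h, e)) e \<le> U (s, e) + h * e2" by (rule step[OF hs Suc.prems(3)])
   finally show ?case by (simp add: c_def algebra_simps)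
  qed
  define s where "s = t - \<epsilon>\<^sup>2"
  define n where "n = nat \<lfloor>s / h\<rfloor>"
  have s: "0 \<le> s" "s + \<epsilon>\<^sup>2 \<le> 1" "s + \<epsilon>\<^sup>2 = t" using t t\<epsilon> by (auto simp: s_def)
  have "real n * h \<le> s" unfolding n_def by (rule sch_steps[OF h s(1)])
  then have "real n * h \<le> 1" using s zero_le_power2[of \<epsilon>] by linarith
  then have "real n * h * e2 \<le> 1 * e2" using e2 by (rule mult_right_mono)
  moreover have "v (t, e) \<le> U (s, e) + D + real n * (h * e2)" using claim[OF n_def[symmetric] s(1,2), of e] s(3) by simp
  moreover have "U (s, e) \<le> u (t, e) + 3 * (C0 * \<epsilon>)"
   unfolding U_def
  proof (rule conv_le_avg[OF k cb])
   fix \<sigma> :: real and e' :: "'n space" assume \<sigma>: "0 \<le> \<sigma>" "\<sigma> \<le> \<epsilon>\<^sup>2" "norm e' < \<epsilon>"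
   have s\<sigma>: "0 \<le> s + \<sigma>" "s + \<sigma> \<le> t" "s + \<sigma> \<le> 1" using s \<sigma> t by auto
   have "C0 * sqrt (t - (s + \<sigma>)) \<le> C0 * \<epsilon>"
    by (rule mult_left_mono[OF _ C0_nonneg]) (use \<sigma> \<epsilon> in \<open>simp add: s_def real_le_lsqrt\<close>)
   then have "u (s + \<sigma>, e + e') \<le> u (t, e) + 3 * (C0 * \<epsilon>)"
    using u_time[OF s\<sigma>(1,2) t(2), of e] near_space[OF \<sigma>(3) N[OF s\<sigma>(1,3)], of e] by linarith
   then show "clamp_time u (s + \<sigma>, e + e') \<le> u (t, e) + 3 * (C0 * \<epsilon>)"
    using clamp[OF s(1,2) \<sigma>(1,2)] by simp
  qed
  ultimately show ?thesis using nn unfolding v_def[symmetric] by (simp add: D_def algebra_simps)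
 qed
qed

end

lemma K_const_nonneg: "0 \<le> K_const (\<rho> :: real \<times> 'n::finite space => real)"
proof -
 let ?A = "{vs :: (real \<times> 'n space) list. set vs \<subseteq> Basis \<and> length vs \<le> 3}"
 let ?I = "\<lambda>vs. LINT \<tau>:{-1..0}|lborel. LINT e:ball 0 1|lborel. \<bar>iter_partial UNIV vs \<rho> (\<tau>, e)\<bar>"
 have "0 \<le> ?I []" unfolding set_lebesgue_integral_def
  by (intro Bochner_Integration.integral_nonneg scaleR_nonneg_nonneg) auto
 also have "?I [] \<le> Max (?I ` ?A)"
  by (intro Max_ge finite_imageI finite_lists_length_le imageI) auto
 finally show ?thesis unfolding K_const_def .
qed

theorem theorem2p8:
  fixes H :: "('w \<Rightarrow> real) set" and E :: "('w \<Rightarrow> real) \<Rightarrow> real"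
    and X Y Z :: "nat \<Rightarrow> 'w \<Rightarrow> real^'n"
    and X' Y' Z' :: "'w \<Rightarrow> real^'n"
    and \<alpha> \<Lambda>1 \<Lambda>2 C\<phi> C0 :: real
    and L :: "(real^'n) measure set"
    and \<Theta> :: "'n levy_triplet set"
    and \<phi> :: "'n space \<Rightarrow> real"
    and u \<rho> :: "real \<times> 'n space \<Rightarrow> real"
    and E1 E2 :: "real \<Rightarrow> real \<Rightarrow> real \<Rightarrow> real \<Rightarrow> real \<Rightarrow> real"
  assumes expectation: "sublinear_expectation H E"
    and alpha: "1 < \<alpha>" "\<alpha> < 2"
    and Lambda: "0 < \<Lambda>1" "\<Lambda>1 < \<Lambda>2"
    and levy: "admissible_levy_set \<alpha> \<Lambda>1 \<Lambda>2 L"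
    and theta: "uncertainty_set L \<Theta>"
    and iid: "iid H E (\<lambda>i \<omega>. (X i \<omega>, Y i \<omega>, Z i \<omega>))"
    and A1: "assumption_A1 H E (X 1) (Y 1)"
    and A2: "assumption_A2 H E \<alpha> Z"
    and A3: "assumption_A3 H E \<alpha> \<Theta> (X 1) (Y 1) (Z 1)"
    and phi: "\<phi> \<in> Cb_Lip"
    and C_phi: "\<And>x y z x' y' z'. \<bar>\<phi> (x, y, z) - \<phi> (x', y', z')\<bar>
                  \<le> C\<phi> * (norm (x - x') + norm (y - y') + norm (z - z'))"
    and C0: "C0 = max (C\<phi> * (sqrt (moment E (X 1) 2) + moment E (Y 1) 1 + M_star E \<alpha> Z)) C\<phi>"
    and u: "viscosity_solution \<Theta> \<phi> u"
    and copy_in: "random_vector H (\<lambda>\<omega>. (X' \<omega>, Y' \<omega>, Z' \<omega>))"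
    and copy: "eq_distr E (\<lambda>\<omega>. (X' \<omega>, Y' \<omega>, Z' \<omega>)) E (\<lambda>\<omega>. (X 1 \<omega>, Y 1 \<omega>, Z 1 \<omega>))"
    and rho: "mollifier \<rho>"
    and E_nonneg: "nonneg5 E1" "nonneg5 E2"
    and C2: "upper_consistency E \<alpha> X' Y' Z' \<Theta> \<rho> (scheme E \<alpha> X' Y' Z' \<phi>)
               (\<lambda>\<epsilon> h. E1 \<epsilon> h (sup_norm \<phi>) C0 (K_const \<rho>))"
    and C3: "lower_consistency E \<alpha> X' Y' Z' \<Theta> \<rho> (\<lambda>_. u)
               (\<lambda>\<epsilon> h. E2 \<epsilon> h (sup_norm \<phi>) C0 (K_const \<rho>))"
  shows "\<forall>\<^sub>F h in at_right 0. \<forall>t\<in>{0..1}. \<forall>x y z.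
     u (t, x, y, z) - scheme E \<alpha> X' Y' Z' \<phi> h (t, x, y, z)
       \<le> 4 * C0 * sqrt h +
         (INF \<epsilon>\<in>{0<..}. 8 * C0 * \<epsilon> + E1 \<epsilon> h (sup_norm \<phi>) C0 (K_const \<rho>)) \<and>
     scheme E \<alpha> X' Y' Z' \<phi> h (t, x, y, z) - u (t, x, y, z)
       \<le> 2 * C0 * sqrt h +
         (INF \<epsilon>\<in>{0<..}. 8 * C0 * \<epsilon> + E2 \<epsilon> h (sup_norm \<phi>) C0 (K_const \<rho>))"
proof -
 note err = E_nonneg
 have "L \<subseteq> levy_family \<alpha> \<Lambda>1 \<Lambda>2" using levy by (simp add: admissible_levy_set_def)
 from uncertainty_set_triplets[OF this theta] obtain C\<Theta> where "triplets \<Theta> C\<Theta>" by blast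
 then interpret triplets \<Theta> C\<Theta> .
 interpret sublinear_expectation H E by (rule expectation)
 interpret driven H E \<Theta> C\<Theta> X Y Z X' Y' Z' \<alpha>
  by unfold_locales (fact alpha iid A1 A2 A3 copy_in copy)+
 have Cp: "0 \<le> C\<phi>"
  using C_phi[of "axis undefined 1" 0 0 0 0 0] abs_ge_zero order_trans by (fastforce simp: norm_axis_1)
 obtain M where M: "\<And>p. \<bar>\<phi> p\<bar> \<le> M" using phi unfolding Cb_Lip_def bounded_iff by auto
 have lip: "lipb M C\<phi> \<phi>"
  unfolding lipb_def
 proof (intro conjI allI Cp M)
  show "\<bar>\<phi> p - \<phi> q\<bar> \<le> C\<phi> * snorm (p - q)" for p q
   using C_phi[of "fst p" "fst (snd p)" "snd (snd p)" "fst q" "fst (snd q)" "snd (snd q)"]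
   by (simp add: snorm_def add.assoc)
 qed
 note vd = u[unfolded viscosity_solution_def viscosity_subsolution_def viscosity_supersolution_def]
 interpret scheme_error H E \<Theta> C\<Theta> X Y Z X' Y' Z' \<alpha> u \<rho> \<phi> M C\<phi> C0
 proof unfold_locales
  show "sub_test \<Theta> u" "super_test \<Theta> u" using vd unfolding sub_test_def super_test_def by blast+
  show "u (0, e) = \<phi> e" for e using vd by (meson antisym)
  show "C\<phi> \<le> C0" "C\<phi> * (sqrt MX + MY + MZ) \<le> C0" unfolding C0 MX_def MY_def MZ_def by simp_all
 qed (use rho vd lip in blast)+
 have arg: "0 \<le> sup_norm \<phi>" "0 \<le> K_const \<rho>" by (rule sup_norm_nonneg[OF M], rule K_const_nonneg)
 have nonneg: "0 \<le> E1 \<epsilon> h (sup_norm \<phi>) C0 (K_const \<rho>)" "0 \<le> E2 \<epsilon> h (sup_norm \<phi>) C0 (K_const \<rho>)"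
  if "0 < \<epsilon>" "0 < h" for \<epsilon> h
  using err that arg C0_nonneg unfolding nonneg5_def by simp_all
 have "\<forall>\<^sub>F h in at_right (0 :: real). 0 < h \<and> h < 1"
  using eventually_at_right_field zero_less_one by blast
 then show ?thesis
 proof eventually_elim
  case (elim h)
  then have h: "0 < h" "h \<in> {0<..<1}" by auto
  note sc = scheme_eq_sch[OF h(1), of \<phi>]
  show ?case
  proof (intro ballI allI conjI)
   fix t x y z assume "t \<in> {0..1 :: real}"
   then have t: "0 \<le> t" "t \<le> 1" by auto
   have "u (t, x, y, z) - sch h \<phi> (t, x, y, z) - 4 * C0 * sqrt h \<le>
     (INF \<epsilon>\<in>{0<..}. 8 * C0 * \<epsilon> + E1 \<epsilon> h (sup_norm \<phi>) C0 (K_const \<rho>))"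
   proof (rule cINF_greatest)
    fix \<epsilon> :: real assume "\<epsilon> \<in> {0<..}"
    then have \<epsilon>: "0 < \<epsilon>" by simp
    have "u (t, x, y, z) - sch h \<phi> (t, x, y, z) \<le>
      4 * C0 * sqrt h + (8 * C0 * \<epsilon> + E1 \<epsilon> h (sup_norm \<phi>) C0 (K_const \<rho>))"
    proof (rule lower_bound[OF h(1) \<epsilon> t nonneg(1)[OF \<epsilon> h(1)]])
     fix s :: real and e :: "'n space" assume s: "\<epsilon> < 1" "h \<le> s" "s \<le> 1"
     obtain a b c where e: "e = (a, b, c)" by (cases e)
     have "\<epsilon> \<in> {0<..<1}" "s \<in> {h..1}" using \<epsilon> s by auto
     with C2 h(2) show "1 / h * (mollify \<rho> \<epsilon> (sch h \<phi>) (s, e) - T h (\<lambda>e. mollify \<rho> \<epsilon> (sch h \<phi>) (s - h, e)) e)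
       \<le> pide_op \<Theta> (mollify \<rho> \<epsilon> (sch h \<phi>)) (s, e) + E1 \<epsilon> h (sup_norm \<phi>) C0 (K_const \<rho>)"
      unfolding upper_consistency_def Let_def S_op_eq e sc[symmetric] by blast
    qed
    then show "u (t, x, y, z) - sch h \<phi> (t, x, y, z) - 4 * C0 * sqrt h \<le>
      8 * C0 * \<epsilon> + E1 \<epsilon> h (sup_norm \<phi>) C0 (K_const \<rho>)" by simp
   qed simp
   then show "u (t, x, y, z) - scheme E \<alpha> X' Y' Z' \<phi> h (t, x, y, z) \<le>
     4 * C0 * sqrt h + (INF \<epsilon>\<in>{0<..}. 8 * C0 * \<epsilon> + E1 \<epsilon> h (sup_norm \<phi>) C0 (K_const \<rho>))"
    unfolding sc by simp
   have "sch h \<phi> (t, x, y, z) - u (t, x, y, z) - 2 * C0 * sqrt h \<le>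
     (INF \<epsilon>\<in>{0<..}. 8 * C0 * \<epsilon> + E2 \<epsilon> h (sup_norm \<phi>) C0 (K_const \<rho>))"
   proof (rule cINF_greatest)
    fix \<epsilon> :: real assume "\<epsilon> \<in> {0<..}"
    then have \<epsilon>: "0 < \<epsilon>" by simp
    have "sch h \<phi> (t, x, y, z) - u (t, x, y, z) \<le>
      2 * C0 * sqrt h + (8 * C0 * \<epsilon> + E2 \<epsilon> h (sup_norm \<phi>) C0 (K_const \<rho>))"
    proof (rule upper_bound[OF h(1) \<epsilon> t nonneg(2)[OF \<epsilon> h(1)]])
     fix s :: real and e :: "'n space" assume s: "\<epsilon> < 1" "h \<le> s" "s \<le> 1"
     obtain a b c where e: "e = (a, b, c)" by (cases e)
     have "\<epsilon> \<in> {0<..<1}" "s \<in> {h..1}" using \<epsilon> s by auto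
     with C3 h(2) show "pide_op \<Theta> (mollify \<rho> \<epsilon> u) (s, e) - E2 \<epsilon> h (sup_norm \<phi>) C0 (K_const \<rho>)
       \<le> 1 / h * (mollify \<rho> \<epsilon> u (s, e) - T h (\<lambda>e. mollify \<rho> \<epsilon> u (s - h, e)) e)"
      unfolding lower_consistency_def Let_def S_op_eq e by blast
    qed
    then show "sch h \<phi> (t, x, y, z) - u (t, x, y, z) - 2 * C0 * sqrt h \<le>
      8 * C0 * \<epsilon> + E2 \<epsilon> h (sup_norm \<phi>) C0 (K_const \<rho>)" by simp
   qed simp
   then show "scheme E \<alpha> X' Y' Z' \<phi> h (t, x, y, z) - u (t, x, y, z) \<le>
     2 * C0 * sqrt h + (INF \<epsilon>\<in>{0<..}. 8 * C0 * \<epsilon> + E2 \<epsilon> h (sup_norm \<phi>) C0 (K_const \<rho>))"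
    unfolding sc by simp
  qed
 qed
qed

end
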